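(* Let $A$ be a triangular string algebra over an algebraically closed field $k$ and let $n,m>0$. Then $\mathrm{HH}^n(A)\cup \mathrm{HH}^m(A)=0$, i.e. $x\cup y=0$ in $\mathrm{HH}^{n+m}(A)$ for all $x\in\mathrm{HH}^n(A)$ and $y\in\mathrm{HH}^m(A)$.
   Context: $\mathrm{HH}^i(A)=\mathrm{Ext}^i_{A-A}(A,A)$ (Ext of $A$-bimodules) is the Hochschild cohomology of $A$, and $\cup$ is the cup product on $\bigoplus_{i\ge0}\mathrm{HH}^i(A)$, which coincides with the Yoneda product on $\bigoplus_i \mathrm{Ext}^i_{A-A}(A,A)$. $Q$ is a finite quiver; paths are written left to right ($\alpha\beta$ is a path if the target of $\alpha$ is the source of $\beta$). An ideal $I$ of the path algebra $kQ$ is admissible if $F^m\subseteq I\subseteq F^2$ for some $m\ge 2$, where $F$ is the ideal generated by the arrows. A string algebra is an algebra Morita equivalent to $kQ/I$ with $I$ admissible and generated by paths, such that: (S1) each vertex of $Q$ is the source of at most two arrows and the target of at most two arrows; (S2) for each arrow $\alpha$ there is at most one arrow $\beta$ such that $\alpha\beta$ is a path not in $I$, and at most one arrow $\gamma$ such that $\gamma\alpha$ is a path not in $I$. By Morita invariance of Hochschild cohomology one assumes $A=kQ/I$. $A$ is triangular if $Q$ has no oriented cycles. *)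

theory Defs
  imports
    "HOL-Algebra.Ideal_Product"
    "HOL-Algebra.QuotRing"
    "HOL-Algebra.Module"
    "HOL-Computational_Algebra.Polynomial"
    "Graph_Theory.Arc_Walk"
begin

section \<open>Path algebras and string algebras\<close>

text \<open>
  A quiver is a \<^typ>\<open>('v,'e) pre_digraph\<close> satisfying \<^locale>\<open>fin_digraph\<close>, which permits loops and
  parallel arrows. A path is a triple (source, list of arrows, target), read left to right; the
  endpoints are recorded so that the trivial paths at different vertices are different.
\<close>

type_synonym ('v,'e) qpath = "'v \<times> 'e list \<times> 'v"

definition qpaths :: "('v,'e) pre_digraph \<Rightarrow> ('v,'e) qpath set" where
  "qpaths Q = {(u, p, v). pre_digraph.awalk Q u p v}"

text \<open>\<open>composes a b c\<close>: the path \<open>b\<close> starts where \<open>a\<close> ends, and \<open>ab = c\<close>.\<close>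

definition composes :: "('v,'e) qpath \<Rightarrow> ('v,'e) qpath \<Rightarrow> ('v,'e) qpath \<Rightarrow> bool" where
  "composes = (\<lambda>(u, p, v) (u', q, w) c. v = u' \<and> c = (u, p @ q, w))"

text \<open>The element of the path algebra given by a single path.\<close>

definition path_elem :: "('v,'e) qpath \<Rightarrow> ('v,'e) qpath \<Rightarrow> 'k::field" where
  "path_elem c = (\<lambda>d. if d = c then 1 else 0)"

definition path_algebra :: "('v,'e) pre_digraph \<Rightarrow> ('k::field, ('v,'e) qpath \<Rightarrow> 'k) module" where
  "path_algebra Q =
    \<lparr>carrier = {x. finite {c. x c \<noteq> 0} \<and> {c. x c \<noteq> 0} \<subseteq> qpaths Q},
     monoid.mult = (\<lambda>x y c. \<Sum>(a, b) | a \<in> qpaths Q \<and> b \<in> qpaths Q \<and> composes a b c. x a * y b),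
     one = (\<lambda>c. if c \<in> {(v, [], v) | v. v \<in> verts Q} then 1 else 0),
     zero = (\<lambda>c. 0),
     add = (\<lambda>x y c. x c + y c),
     module.smult = (\<lambda>r x c. r * x c)\<rparr>"

definition arrow_ideal :: "('v,'e) pre_digraph \<Rightarrow> (('v,'e) qpath \<Rightarrow> 'k::field) set" where
  "arrow_ideal Q = Idl\<^bsub>path_algebra Q\<^esub> {path_elem (tail Q e, [e], head Q e) | e. e \<in> arcs Q}"

definition ideal_power :: "('a, 'b) ring_scheme \<Rightarrow> 'a set \<Rightarrow> nat \<Rightarrow> 'a set" where
  "ideal_power R J m = (ideal_prod R J ^^ m) (carrier R)"

definition admissible_ideal ::
    "('v,'e) pre_digraph \<Rightarrow> (('v,'e) qpath \<Rightarrow> 'k::field) set \<Rightarrow> bool" where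
  "admissible_ideal Q I \<longleftrightarrow> ideal I (path_algebra Q) \<and>
     (\<exists>m\<ge>2. ideal_power (path_algebra Q) (arrow_ideal Q) m \<subseteq> I) \<and>
     I \<subseteq> ideal_power (path_algebra Q) (arrow_ideal Q) 2"

definition generated_by_paths ::
    "('v,'e) pre_digraph \<Rightarrow> (('v,'e) qpath \<Rightarrow> 'k::field) set \<Rightarrow> bool" where
  "generated_by_paths Q I \<longleftrightarrow> (\<exists>S \<subseteq> qpaths Q. I = Idl\<^bsub>path_algebra Q\<^esub> (path_elem ` S))"

definition nonzero_pair ::
    "('v,'e) pre_digraph \<Rightarrow> (('v,'e) qpath \<Rightarrow> 'k::field) set \<Rightarrow> 'e \<Rightarrow> 'e \<Rightarrow> bool" where
  "nonzero_pair Q I \<alpha> \<beta> \<longleftrightarrow> (tail Q \<alpha>, [\<alpha>, \<beta>], head Q \<beta>) \<in> qpaths Q \<and>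
     path_elem (tail Q \<alpha>, [\<alpha>, \<beta>], head Q \<beta>) \<notin> I"

definition string_presentation ::
    "('v,'e) pre_digraph \<Rightarrow> (('v,'e) qpath \<Rightarrow> 'k::field) set \<Rightarrow> bool" where
  "string_presentation Q I \<longleftrightarrow> fin_digraph Q \<and> admissible_ideal Q I \<and> generated_by_paths Q I \<and>
     (\<forall>v \<in> verts Q. card (out_arcs Q v) \<le> 2 \<and> card (in_arcs Q v) \<le> 2) \<and>
     (\<forall>\<alpha> \<in> arcs Q. (\<exists>\<^sub>\<le>\<^sub>1\<beta>. nonzero_pair Q I \<alpha> \<beta>) \<and> (\<exists>\<^sub>\<le>\<^sub>1\<gamma>. nonzero_pair Q I \<gamma> \<alpha>))"

definition triangular :: "('v,'e) pre_digraph \<Rightarrow> bool" where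
  "triangular Q \<longleftrightarrow> (\<nexists>u p. pre_digraph.awalk Q u p u \<and> p \<noteq> [])"

definition quotient_algebra :: "('k, 'a) module \<Rightarrow> 'a set \<Rightarrow> ('k, 'a set) module" where
  "quotient_algebra R I =
    \<lparr>carrier = carrier (R Quot I), monoid.mult = monoid.mult (R Quot I), one = one (R Quot I),
     zero = zero (R Quot I), add = add (R Quot I),
     module.smult = (\<lambda>c X. \<Union>x\<in>X. I +>\<^bsub>R\<^esub> (c \<odot>\<^bsub>R\<^esub> x))\<rparr>"

abbreviation quiver_algebra ::
    "('v,'e) pre_digraph \<Rightarrow> (('v,'e) qpath \<Rightarrow> 'k::field) set
      \<Rightarrow> ('k, (('v,'e) qpath \<Rightarrow> 'k) set) module" where
  "quiver_algebra Q I \<equiv> quotient_algebra (path_algebra Q) I"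


section \<open>Bimodules\<close>

text \<open>
  As for the record \<^typ>\<open>('a,'m) module\<close>, the fields \<open>mult\<close> and \<open>one\<close> inherited from rings play no
  role in a bimodule. The field \<open>smult\<close> is the left action.
\<close>

record ('a, 'm) bimod = "('a, 'm) module" +
  rsmult :: "['m, 'a] \<Rightarrow> 'm" (infixl \<open>\<diamondop>\<index>\<close> 70)

text \<open>
  \<open>A\<close> is an algebra over \<open>'k\<close>, so \<open>c \<odot>\<^bsub>A\<^esub> \<one>\<^bsub>A\<^esub>\<close> is the image of the scalar \<open>c\<close> in \<open>A\<close>. The last
  assumption says that the two induced actions of \<open>'k\<close> agree, i.e. that \<open>M\<close> is a module over
  the enveloping algebra (tensor product over \<open>'k\<close>) and not just over the tensor product over the
  integers.
\<close>

locale bimodule = M?: abelian_group M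
  for A :: "('k, 'a) module" and M :: "('a, 'm) bimod" (structure) +
  assumes l_closed: "\<lbrakk>a \<in> carrier A; x \<in> carrier M\<rbrakk> \<Longrightarrow> a \<odot> x \<in> carrier M"
    and r_closed: "\<lbrakk>a \<in> carrier A; x \<in> carrier M\<rbrakk> \<Longrightarrow> x \<diamondop> a \<in> carrier M"
    and l_distr_ring: "\<lbrakk>a \<in> carrier A; b \<in> carrier A; x \<in> carrier M\<rbrakk>
          \<Longrightarrow> (a \<oplus>\<^bsub>A\<^esub> b) \<odot> x = a \<odot> x \<oplus> b \<odot> x"
    and r_distr_ring: "\<lbrakk>a \<in> carrier A; b \<in> carrier A; x \<in> carrier M\<rbrakk>
          \<Longrightarrow> x \<diamondop> (a \<oplus>\<^bsub>A\<^esub> b) = x \<diamondop> a \<oplus> x \<diamondop> b"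
    and l_distr_mod: "\<lbrakk>a \<in> carrier A; x \<in> carrier M; y \<in> carrier M\<rbrakk>
          \<Longrightarrow> a \<odot> (x \<oplus> y) = a \<odot> x \<oplus> a \<odot> y"
    and r_distr_mod: "\<lbrakk>a \<in> carrier A; x \<in> carrier M; y \<in> carrier M\<rbrakk>
          \<Longrightarrow> (x \<oplus> y) \<diamondop> a = x \<diamondop> a \<oplus> y \<diamondop> a"
    and l_assoc: "\<lbrakk>a \<in> carrier A; b \<in> carrier A; x \<in> carrier M\<rbrakk>
          \<Longrightarrow> (a \<otimes>\<^bsub>A\<^esub> b) \<odot> x = a \<odot> (b \<odot> x)"
    and r_assoc: "\<lbrakk>a \<in> carrier A; b \<in> carrier A; x \<in> carrier M\<rbrakk>
          \<Longrightarrow> x \<diamondop> (a \<otimes>\<^bsub>A\<^esub> b) = (x \<diamondop> a) \<diamondop> b"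
    and lr_assoc: "\<lbrakk>a \<in> carrier A; b \<in> carrier A; x \<in> carrier M\<rbrakk>
          \<Longrightarrow> (a \<odot> x) \<diamondop> b = a \<odot> (x \<diamondop> b)"
    and l_unit: "x \<in> carrier M \<Longrightarrow> \<one>\<^bsub>A\<^esub> \<odot> x = x"
    and r_unit: "x \<in> carrier M \<Longrightarrow> x \<diamondop> \<one>\<^bsub>A\<^esub> = x"
    and scalars_central: "x \<in> carrier M \<Longrightarrow> (c \<odot>\<^bsub>A\<^esub> \<one>\<^bsub>A\<^esub>) \<odot> x = x \<diamondop> (c \<odot>\<^bsub>A\<^esub> \<one>\<^bsub>A\<^esub>)"

definition regular_bimodule :: "('k, 'a) module \<Rightarrow> ('a, 'a) bimod" where
  "regular_bimodule A =
    \<lparr>carrier = carrier A, monoid.mult = monoid.mult A, one = one A, zero = zero A, add = add A,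
     module.smult = monoid.mult A, rsmult = monoid.mult A\<rparr>"

definition bimodule_hom ::
    "('k, 'a) module \<Rightarrow> ('a, 'm) bimod \<Rightarrow> ('a, 'n) bimod \<Rightarrow> ('m \<Rightarrow> 'n) set" where
  "bimodule_hom A M N = {f \<in> carrier M \<rightarrow>\<^sub>E carrier N.
     (\<forall>x\<in>carrier M. \<forall>y\<in>carrier M. f (x \<oplus>\<^bsub>M\<^esub> y) = f x \<oplus>\<^bsub>N\<^esub> f y) \<and>
     (\<forall>a\<in>carrier A. \<forall>x\<in>carrier M.
        f (a \<odot>\<^bsub>M\<^esub> x) = a \<odot>\<^bsub>N\<^esub> f x \<and> f (x \<diamondop>\<^bsub>M\<^esub> a) = f x \<diamondop>\<^bsub>N\<^esub> a)}"

text \<open>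
  The lifting property is tested on bimodules whose elements lie in the same type \<open>'m\<close> as those of
  \<open>P\<close>, since a definition cannot quantify over types. This is the usual notion for every \<open>P\<close> in a
  resolution (all terms in the type \<open>'m\<close>) of a nonzero algebra \<open>A\<close> over an infinite field: the
  degree 0 term surjects onto \<open>A\<close>, so \<open>'m\<close> is infinite and at least as large as \<open>A\<close>, hence the free
  bimodule on the set \<open>carrier P\<close> has a copy inside \<open>'m\<close>; the lifting property then exhibits \<open>P\<close> as a
  direct summand of that free bimodule. If \<open>A = 0\<close>, all bimodules vanish.
\<close>

definition projective_bimodule :: "('k, 'a) module \<Rightarrow> ('a, 'm) bimod \<Rightarrow> bool" where
  "projective_bimodule A P \<longleftrightarrow> bimodule A P \<and>
     (\<forall>(M :: ('a, 'm) bimod) (N :: ('a, 'm) bimod) g f.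
        bimodule A M \<longrightarrow> bimodule A N \<longrightarrow> g \<in> bimodule_hom A M N \<longrightarrow> g ` carrier M = carrier N \<longrightarrow>
        f \<in> bimodule_hom A P N \<longrightarrow> (\<exists>h \<in> bimodule_hom A P M. compose (carrier P) g h = f))"


section \<open>Ext and the Yoneda product\<close>

text \<open>A projective resolution \<open>\<dots> \<rightarrow> P 2 \<rightarrow> P 1 \<rightarrow> P 0 \<rightarrow> X \<rightarrow> 0\<close> with \<open>d n : P (n + 1) \<rightarrow> P n\<close>.\<close>

definition projective_resolution ::
    "('k, 'a) module \<Rightarrow> ('a, 'x) bimod \<Rightarrow> (nat \<Rightarrow> ('a, 'p) bimod) \<Rightarrow> (nat \<Rightarrow> 'p \<Rightarrow> 'p)
      \<Rightarrow> ('p \<Rightarrow> 'x) \<Rightarrow> bool" where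
  "projective_resolution A X P d \<epsilon> \<longleftrightarrow>
     (\<forall>n. projective_bimodule A (P n)) \<and>
     (\<forall>n. d n \<in> bimodule_hom A (P (Suc n)) (P n)) \<and>
     \<epsilon> \<in> bimodule_hom A (P 0) X \<and>
     \<epsilon> ` carrier (P 0) = carrier X \<and>
     d 0 ` carrier (P 1) = {x \<in> carrier (P 0). \<epsilon> x = \<zero>\<^bsub>X\<^esub>} \<and>
     (\<forall>n. d (Suc n) ` carrier (P (Suc (Suc n))) = {x \<in> carrier (P (Suc n)). d n x = \<zero>\<^bsub>P n\<^esub>})"

text \<open>
  Hom groups are written multiplicatively, as the library's quotient groups are: the product of two
  homomorphisms is their pointwise sum and \<open>\<one>\<close> is the zero homomorphism.
\<close>

definition hom_group ::
    "('k, 'a) module \<Rightarrow> ('a, 'm) bimod \<Rightarrow> ('a, 'n) bimod \<Rightarrow> ('m \<Rightarrow> 'n) monoid" where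
  "hom_group A M N =
    \<lparr>carrier = bimodule_hom A M N,
     monoid.mult = (\<lambda>f g. \<lambda>x\<in>carrier M. f x \<oplus>\<^bsub>N\<^esub> g x),
     one = (\<lambda>x\<in>carrier M. \<zero>\<^bsub>N\<^esub>)\<rparr>"

definition cocycles ::
    "('k, 'a) module \<Rightarrow> (nat \<Rightarrow> ('a, 'p) bimod) \<Rightarrow> (nat \<Rightarrow> 'p \<Rightarrow> 'p) \<Rightarrow> ('a, 'y) bimod \<Rightarrow> nat
      \<Rightarrow> ('p \<Rightarrow> 'y) set" where
  "cocycles A P d Y n = {f \<in> bimodule_hom A (P n) Y.
     compose (carrier (P (Suc n))) f (d n) = \<one>\<^bsub>hom_group A (P (Suc n)) Y\<^esub>}"

fun coboundaries ::
    "('k, 'a) module \<Rightarrow> (nat \<Rightarrow> ('a, 'p) bimod) \<Rightarrow> (nat \<Rightarrow> 'p \<Rightarrow> 'p) \<Rightarrow> ('a, 'y) bimod \<Rightarrow> nat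
      \<Rightarrow> ('p \<Rightarrow> 'y) set" where
  "coboundaries A P d Y 0 = {\<one>\<^bsub>hom_group A (P 0) Y\<^esub>}"
| "coboundaries A P d Y (Suc n) =
     (\<lambda>f. compose (carrier (P (Suc n))) f (d n)) ` bimodule_hom A (P n) Y"

text \<open>
  The group \<open>Ext\<^sup>n(X, Y)\<close> in the category of \<open>A\<close>-\<open>A\<close>-bimodules, computed from a projective resolution
  \<open>(P, d)\<close> of \<open>X\<close>.
\<close>

definition Ext_group ::
    "('k, 'a) module \<Rightarrow> (nat \<Rightarrow> ('a, 'p) bimod) \<Rightarrow> (nat \<Rightarrow> 'p \<Rightarrow> 'p) \<Rightarrow> ('a, 'y) bimod \<Rightarrow> nat
      \<Rightarrow> ('p \<Rightarrow> 'y) set monoid" where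
  "Ext_group A P d Y n =
     ((hom_group A (P n) Y)\<lparr>carrier := cocycles A P d Y n\<rparr>) Mod coboundaries A P d Y n"

abbreviation HH ::
    "('k, 'a) module \<Rightarrow> (nat \<Rightarrow> ('a, 'p) bimod) \<Rightarrow> (nat \<Rightarrow> 'p \<Rightarrow> 'p) \<Rightarrow> nat \<Rightarrow> ('p \<Rightarrow> 'a) set monoid"
  where "HH A P d n \<equiv> Ext_group A P d (regular_bimodule A) n"

text \<open>
  \<open>\<phi> i : P (m + i) \<rightarrow> P i\<close> is a chain map lifting the cocycle \<open>g : P m \<rightarrow> X\<close> along the augmentation
  \<open>\<epsilon>\<close>.
\<close>

definition chain_lift ::
    "('k, 'a) module \<Rightarrow> (nat \<Rightarrow> ('a, 'p) bimod) \<Rightarrow> (nat \<Rightarrow> 'p \<Rightarrow> 'p) \<Rightarrow> ('p \<Rightarrow> 'x) \<Rightarrow> nat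
      \<Rightarrow> ('p \<Rightarrow> 'x) \<Rightarrow> (nat \<Rightarrow> 'p \<Rightarrow> 'p) \<Rightarrow> bool" where
  "chain_lift A P d \<epsilon> m g \<phi> \<longleftrightarrow>
     (\<forall>i. \<phi> i \<in> bimodule_hom A (P (m + i)) (P i)) \<and>
     compose (carrier (P m)) \<epsilon> (\<phi> 0) = g \<and>
     (\<forall>i. compose (carrier (P (m + Suc i))) (d i) (\<phi> (Suc i)) =
          compose (carrier (P (m + Suc i))) (\<phi> i) (d (m + i)))"

text \<open>
  The cup product \<open>HH\<^sup>n(A) \<times> HH\<^sup>m(A) \<rightarrow> HH\<^sup>n\<^sup>+\<^sup>m(A)\<close>, as the Yoneda product on Ext: for representing
  cocycles \<open>f\<close> of \<open>x\<close> and \<open>g\<close> of \<open>y\<close> and a lift \<open>\<phi>\<close> of \<open>g\<close>, the class of \<open>f \<circ> \<phi> n\<close>. As for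
  \<^const>\<open>rcoset_mult\<close>, no choice is made: the union runs over all representatives and all lifts, which
  all give the same class. Other sign conventions differ from this one at most by a factor \<open>(-1)\<^sup>n\<^sup>m\<close>.
\<close>

definition cup ::
    "('k, 'a) module \<Rightarrow> (nat \<Rightarrow> ('a, 'p) bimod) \<Rightarrow> (nat \<Rightarrow> 'p \<Rightarrow> 'p) \<Rightarrow> ('p \<Rightarrow> 'a) \<Rightarrow> nat \<Rightarrow> nat
      \<Rightarrow> ('p \<Rightarrow> 'a) set \<Rightarrow> ('p \<Rightarrow> 'a) set \<Rightarrow> ('p \<Rightarrow> 'a) set" where
  "cup A P d \<epsilon> n m x y =
     (\<Union>f\<in>x. \<Union>g\<in>y. \<Union>\<phi>\<in>{\<phi>. chain_lift A P d \<epsilon> m g \<phi>}.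
        coboundaries A P d (regular_bimodule A) (n + m)
          #>\<^bsub>hom_group A (P (n + m)) (regular_bimodule A)\<^esub> compose (carrier (P (n + m))) f (\<phi> n))"

end

theory Submission
  imports Defs
begin

text \<open>
  Let \<open>X\<close> be the set of paths not in \<open>I\<close>; it is a basis of \<open>A\<close>. In the bar resolution relative to the
  span of the vertices, a cochain of degree \<open>n\<close> is a family of scalars \<open>f [p\<^sub>1, \<dots>, p\<^sub>n] \<gamma>\<close> for composable
  nontrivial \<open>p\<^sub>i\<close> in \<open>X\<close> and \<open>\<gamma>\<close> in \<open>X\<close> parallel to \<open>p\<^sub>1 \<dots> p\<^sub>n\<close>, and the Yoneda product of \<open>f\<close> and \<open>g\<close> is
  represented by multiplying the values of \<open>f\<close> and \<open>g\<close> on consecutive subtuples.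

  A cocycle of degree \<open>n \<ge> 2\<close> is cohomologous to one that vanishes on \<open>[\<dots>, p, c]\<close> whenever \<open>c\<close> is an
  arrow and \<open>p c \<in> X\<close>. Since at most one arrow prolongs a given nontrivial path within \<open>X\<close>, the values
  outside the right socle of \<open>A\<close> can then be removed by a further coboundary. As \<open>Q\<close> has no oriented
  cycles, the values of a second cocycle of positive degree lie in the radical, so the product vanishes.
  If only the second degree is at least 2, a derivation may be moved past the other factor up to a
  coboundary. If both degrees are 1, every derivation is the sum of a diagonal one, which scales each
  path, and one with values in the right socle. This reduces the claim to two diagonal derivations,
  and the product of these is a coboundary.
\<close>

section \<open>Tuples of composable paths\<close>

text \<open>The resolution in the statement is arbitrary. Comparison maps in both directions carry
  the cocycles to the bar resolution, and two null-homotopies carry the bounding cochain back.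
  Lifting out of a given projective term is available only against bimodules that fit into the type
  \<open>'p\<close>. A bar term consists of coefficient functions on a finite set, and these embed
  into \<open>'p\<close> because an infinite field is as large as its finite powers. Algebraic
  closedness is used to make the field infinite.

  Uniqueness of arrows enters from both sides. A unique next arrow makes the division of a value by
  that arrow well defined. A unique previous arrow makes two paths with a common continuation
  comparable, one being a suffix of the other. The terms that would spoil the comparison of
  coboundaries are excluded by this comparability together with the absence of oriented cycles.

  Degree 1 stands apart: the last argument has no neighbour in the tuple against which it could be
  stripped, and the factor by which a derivation scales a path survives the cocycle argument that
  kills its other values outside the right socle.\<close>

declare split_paired_All [simp del] split_paired_Ex [simp del]

abbreviation psrc :: "('v,'e) qpath \<Rightarrow> 'v" where "psrc a \<equiv> fst a"
abbreviation parcs :: "('v,'e) qpath \<Rightarrow> 'e list" where "parcs a \<equiv> fst (snd a)"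
abbreviation ptgt :: "('v,'e) qpath \<Rightarrow> 'v" where "ptgt a \<equiv> snd (snd a)"
abbreviation pid :: "'v \<Rightarrow> ('v,'e) qpath" where "pid v \<equiv> (v, [], v)"

text \<open>Total on purpose: composability is demanded separately as
  \<open>ptgt a = psrc b\<close>, so that associativity holds without side conditions.\<close>

definition pmul :: "('v,'e) qpath \<Rightarrow> ('v,'e) qpath \<Rightarrow> ('v,'e) qpath" where
  "pmul a b = (psrc a, parcs a @ parcs b, ptgt b)"

lemma pmul_simps [simp]:
  "psrc (pmul a b) = psrc a" "ptgt (pmul a b) = ptgt b" "parcs (pmul a b) = parcs a @ parcs b"
  by (simp_all add: pmul_def)

lemma pmul_assoc: "pmul (pmul a b) c = pmul a (pmul b c)"
  by (simp add: pmul_def)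

lemma qpath_eqI: "psrc a = psrc b \<Longrightarrow> parcs a = parcs b \<Longrightarrow> ptgt a = ptgt b \<Longrightarrow> a = b"
  by (simp add: prod_eq_iff)

text \<open>\<open>pmul\<close> forgets the middle vertex, so the factor is recovered only together
  with its inner endpoint.\<close>

lemma pmul_cancel_left: "pmul x a = pmul x b \<Longrightarrow> psrc a = psrc b \<Longrightarrow> a = b"
  by (rule qpath_eqI) (auto simp: pmul_def)

lemma pmul_cancel_right: "pmul a x = pmul b x \<Longrightarrow> ptgt a = ptgt b \<Longrightarrow> a = b"
  by (rule qpath_eqI) (auto simp: pmul_def)

text \<open>
  \<open>merges f [p\<^sub>1, \<dots>, p\<^sub>n]\<close> is the sum of \<open>(-1)\<^sup>i f [p\<^sub>1, \<dots>, p\<^sub>i p\<^sub>i\<^sub>+\<^sub>1, \<dots>, p\<^sub>n]\<close>, the inner part of the bar differential.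
\<close>

fun merges :: "(('v,'e) qpath list \<Rightarrow> 'k::ab_group_add) \<Rightarrow> ('v,'e) qpath list \<Rightarrow> 'k" where
  "merges f [] = 0"
| "merges f [x] = 0"
| "merges f (x # y # r) = - f (pmul x y # r) - merges (\<lambda>t. f (x # t)) (y # r)"

text \<open>Each merge of neighbours takes place within \<open>s @ [y]\<close> or within
  \<open>y # r\<close>. The entry \<open>y\<close> occurs in both parts because it has a neighbour
  on each side.\<close>

lemma merges_append:
  "merges f (s @ y # r) =
     merges (\<lambda>u. f (u @ r)) (s @ [y]) + (-1) ^ length s * merges (\<lambda>u. f (s @ u)) (y # r)"
  for f :: "('v,'e) qpath list \<Rightarrow> 'k::ring_1"
proof (induction s arbitrary: f)
  case Nil
  show ?case by simp
next
  case (Cons x s)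
  have IH: "merges (\<lambda>t. f (x # t)) (s @ y # r) =
     merges (\<lambda>u. f (x # u @ r)) (s @ [y]) + (-1) ^ length s * merges (\<lambda>u. f (x # s @ u)) (y # r)"
    using Cons.IH[of "\<lambda>t. f (x # t)"] by simp
  show ?case
  proof (cases s)
    case Nil
    then show ?thesis by simp
  next
    case (Cons z s')
    then show ?thesis using IH by simp
  qed
qed

lemma merges_cong:
  "(\<And>u. Suc (length u) = length t \<Longrightarrow> f u = g u) \<Longrightarrow> merges f t = merges g t"
proof (induction f t arbitrary: g rule: merges.induct)
  case (3 f x y r)
  have "merges (\<lambda>t. f (x # t)) (y # r) = merges (\<lambda>t. g (x # t)) (y # r)"
    by (rule 3(1)) (use 3(2) in auto)
  then show ?case using 3(2)[of "pmul x y # r"] by simp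
qed simp_all

lemma merges_linear:
  fixes \<Lambda> :: "'k::ab_group_add \<Rightarrow> 'l::ab_group_add"
  assumes "\<And>a b. \<Lambda> (a - b) = \<Lambda> a - \<Lambda> b"
  shows "\<Lambda> (merges f t) = merges (\<lambda>u. \<Lambda> (f u)) t"
proof -
  have 0: "\<Lambda> 0 = 0" using assms[of 0 0] by simp
  have n: "\<Lambda> (- a) = - \<Lambda> a" for a using assms[of 0 a] 0 by simp
  show ?thesis
    by (induction f t rule: merges.induct) (simp_all add: 0 n assms)
qed

lemma merges_zero [simp]: "merges (\<lambda>_. 0) t = 0"
  using merges_linear[of "\<lambda>_. 0" "\<lambda>_. 0" t] by simp

text \<open>The set of nonzero paths of a quotient by an ideal generated by paths, abstracted: it is
  closed under factors.\<close>

locale path_basis = wf_digraph Q for Q :: "('v,'e) pre_digraph" +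
  fixes X :: "('v,'e) qpath set"
  assumes X_subset: "X \<subseteq> qpaths Q"
    and finite_X: "finite X"
    and factor: "\<lbrakk>a \<in> qpaths Q; b \<in> qpaths Q; ptgt a = psrc b; pmul a b \<in> X\<rbrakk> \<Longrightarrow> a \<in> X \<and> b \<in> X"
begin

declare split_paired_All [simp del] split_paired_Ex [simp del]

lemma qpaths_pmul: "a \<in> qpaths Q \<Longrightarrow> b \<in> qpaths Q \<Longrightarrow> ptgt a = psrc b \<Longrightarrow> pmul a b \<in> qpaths Q"
  by (cases a; cases b) (auto simp: qpaths_def pmul_def)

lemma pid_in_qpaths: "a \<in> qpaths Q \<Longrightarrow> pid (psrc a) \<in> qpaths Q \<and> pid (ptgt a) \<in> qpaths Q"
  by (cases a) (auto simp: qpaths_def awalk_Nil_iff)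

lemma pmul_pid [simp]:
  "psrc a = v \<Longrightarrow> pmul (pid v) a = a" "ptgt a = v \<Longrightarrow> pmul a (pid v) = a"
  by (cases a; simp add: pmul_def)+

lemma pid_in_X: "a \<in> X \<Longrightarrow> pid (psrc a) \<in> X \<and> pid (ptgt a) \<in> X"
proof -
  assume a: "a \<in> X"
  then have q: "a \<in> qpaths Q" using X_subset by auto
  show ?thesis
    using factor[of "pid (psrc a)" a] factor[of a "pid (ptgt a)"] pid_in_qpaths[OF q] a q by simp
qed

lemma trivial_qpath: "a \<in> qpaths Q \<Longrightarrow> parcs a = [] \<Longrightarrow> a = pid (psrc a) \<and> ptgt a = psrc a"
  by (cases a) (auto simp: qpaths_def awalk_Nil_iff)

lemma split_qpath:
  assumes "a \<in> qpaths Q" "parcs a = p @ q"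
  shows "\<exists>v. (psrc a, p, v) \<in> qpaths Q \<and> (v, q, ptgt a) \<in> qpaths Q
    \<and> a = pmul (psrc a, p, v) (v, q, ptgt a)"
  using assms by (cases a) (auto simp: qpaths_def pmul_def)

lemma split_X:
  assumes "a \<in> X" "parcs a = p @ q"
  shows "\<exists>v. (psrc a, p, v) \<in> X \<and> (v, q, ptgt a) \<in> X \<and> a = pmul (psrc a, p, v) (v, q, ptgt a)"
proof -
  obtain v where v: "(psrc a, p, v) \<in> qpaths Q" "(v, q, ptgt a) \<in> qpaths Q"
    "a = pmul (psrc a, p, v) (v, q, ptgt a)"
    using split_qpath[of a p q] assms X_subset by blast
  then have "(psrc a, p, v) \<in> X \<and> (v, q, ptgt a) \<in> X"
    using factor[of "(psrc a, p, v)" "(v, q, ptgt a)"] assms(1) by simp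
  then show ?thesis using v(3) by blast
qed

section \<open>Cochains and their coboundary\<close>

definition parallel :: "('v,'e) qpath list \<Rightarrow> ('v,'e) qpath \<Rightarrow> bool" where
  "parallel t \<gamma> \<longleftrightarrow> psrc \<gamma> = psrc (hd t) \<and> ptgt \<gamma> = ptgt (last t)"

definition tuples :: "nat \<Rightarrow> ('v,'e) qpath list set" where
  "tuples n = {t. length t = n \<and> set t \<subseteq> X \<and> successively (\<lambda>a b. ptgt a = psrc b) t
     \<and> (\<forall>x\<in>set t. parcs x \<noteq> [])}"

text \<open>Total functions vanishing off the admissible arguments. A merge whose product leaves
  \<open>X\<close> then contributes 0 to the coboundary, as it should, that product being zero in
  the algebra. On the empty tuple \<open>parallel\<close> depends on the unspecified
  \<open>hd []\<close>, so cochains are used in positive degree only.\<close>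

definition cochain :: "nat \<Rightarrow> (('v,'e) qpath list \<Rightarrow> ('v,'e) qpath \<Rightarrow> 'k::field) \<Rightarrow> bool" where
  "cochain n f \<longleftrightarrow> (\<forall>t \<gamma>. f t \<gamma> \<noteq> 0 \<longrightarrow> t \<in> tuples n \<and> \<gamma> \<in> X \<and> parallel t \<gamma>)"

text \<open>The coefficient at \<gamma> of the product of the path \<open>x\<close> with the element
  \<phi>. By cancellation the sum has at most one term. The value has this meaning for \<gamma> in
  \<open>X\<close> only.\<close>

definition lact :: "('v,'e) qpath \<Rightarrow> (('v,'e) qpath \<Rightarrow> 'k::field) \<Rightarrow> ('v,'e) qpath \<Rightarrow> 'k" where
  "lact x \<phi> \<gamma> = (\<Sum>b | b \<in> X \<and> ptgt x = psrc b \<and> pmul x b = \<gamma>. \<phi> b)"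

definition ract :: "('v,'e) qpath \<Rightarrow> (('v,'e) qpath \<Rightarrow> 'k::field) \<Rightarrow> ('v,'e) qpath \<Rightarrow> 'k" where
  "ract x \<phi> \<gamma> = (\<Sum>b | b \<in> X \<and> ptgt b = psrc x \<and> pmul b x = \<gamma>. \<phi> b)"

definition cobd :: "(('v,'e) qpath list \<Rightarrow> ('v,'e) qpath \<Rightarrow> 'k::field)
    \<Rightarrow> ('v,'e) qpath list \<Rightarrow> ('v,'e) qpath \<Rightarrow> 'k" where
  "cobd f t \<gamma> = lact (hd t) (f (tl t)) \<gamma> + merges (\<lambda>u. f u \<gamma>) t
     + (-1) ^ length t * ract (last t) (f (butlast t)) \<gamma>"

lemma lact_pmul: "b \<in> X \<Longrightarrow> ptgt x = psrc b \<Longrightarrow> lact x \<phi> (pmul x b) = \<phi> b"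
proof -
  assume "b \<in> X" "ptgt x = psrc b"
  then have "{b'. b' \<in> X \<and> ptgt x = psrc b' \<and> pmul x b' = pmul x b} = {b}"
    by (auto dest: pmul_cancel_left)
  then show ?thesis by (simp add: lact_def)
qed

lemma ract_pmul: "b \<in> X \<Longrightarrow> ptgt b = psrc x \<Longrightarrow> ract x \<phi> (pmul b x) = \<phi> b"
proof -
  assume "b \<in> X" "ptgt b = psrc x"
  then have "{b'. b' \<in> X \<and> ptgt b' = psrc x \<and> pmul b' x = pmul b x} = {b}"
    by (auto dest: pmul_cancel_right)
  then show ?thesis by (simp add: ract_def)
qed

lemma lact_cases:
  "(\<exists>b\<in>X. ptgt x = psrc b \<and> \<gamma> = pmul x b \<and> lact x \<phi> \<gamma> = \<phi> b) \<or>
   (\<not> (\<exists>b\<in>X. ptgt x = psrc b \<and> \<gamma> = pmul x b) \<and> lact x \<phi> \<gamma> = 0)"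
proof (cases "\<exists>b\<in>X. ptgt x = psrc b \<and> \<gamma> = pmul x b")
  case True
  then show ?thesis using lact_pmul by blast
next
  case False
  then have "{b. b \<in> X \<and> ptgt x = psrc b \<and> pmul x b = \<gamma>} = {}" by auto
  then have "lact x \<phi> \<gamma> = 0" unfolding lact_def by (simp only: sum.empty)
  then show ?thesis using False by simp
qed

lemma ract_cases:
  "(\<exists>b\<in>X. ptgt b = psrc x \<and> \<gamma> = pmul b x \<and> ract x \<phi> \<gamma> = \<phi> b) \<or>
   (\<not> (\<exists>b\<in>X. ptgt b = psrc x \<and> \<gamma> = pmul b x) \<and> ract x \<phi> \<gamma> = 0)"
proof (cases "\<exists>b\<in>X. ptgt b = psrc x \<and> \<gamma> = pmul b x")
  case True
  then show ?thesis using ract_pmul by blast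
next
  case False
  then have "{b. b \<in> X \<and> ptgt b = psrc x \<and> pmul b x = \<gamma>} = {}" by auto
  then have "ract x \<phi> \<gamma> = 0" unfolding ract_def by (simp only: sum.empty)
  then show ?thesis using False by simp
qed

lemma cochain_zero:
  "cochain n f \<Longrightarrow> t \<notin> tuples n \<or> \<gamma> \<notin> X \<or> \<not> parallel t \<gamma> \<Longrightarrow> f t \<gamma> = 0"
  by (auto simp: cochain_def)

lemma tuples_append:
  "s @ r \<in> tuples n \<longleftrightarrow> s \<in> tuples (length s) \<and> r \<in> tuples (length r) \<and> length s + length r = n
     \<and> (s \<noteq> [] \<longrightarrow> r \<noteq> [] \<longrightarrow> ptgt (last s) = psrc (hd r))"
  by (auto simp: tuples_def successively_append_iff)

lemma tuples_Cons:
  "x # r \<in> tuples n \<longleftrightarrow> x \<in> X \<and> parcs x \<noteq> [] \<and> r \<in> tuples (length r) \<and> Suc (length r) = n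
     \<and> (r \<noteq> [] \<longrightarrow> ptgt x = psrc (hd r))"
  by (cases r) (auto simp: tuples_def)

lemma tuples_length: "t \<in> tuples n \<Longrightarrow> length t = n"
  by (simp add: tuples_def)

lemma Nil_tuples [simp]: "[] \<in> tuples n \<longleftrightarrow> n = 0"
  by (auto simp: tuples_def)

lemma finite_tuples: "finite (tuples n)"
  by (rule finite_subset[OF _ finite_lists_length_eq[OF finite_X, of n]]) (auto simp: tuples_def)

text \<open>The concatenation need not lie in \<open>X\<close>; it is used only to exhibit oriented
  cycles.\<close>

lemma tuple_path:
  assumes "t \<in> tuples n" "t \<noteq> []"
  shows "(psrc (hd t), concat (map parcs t), ptgt (last t)) \<in> qpaths Q"
  using assms
proof (induction t arbitrary: n)
  case (Cons x r)
  show ?case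
  proof (cases "r = []")
    case True
    then show ?thesis using Cons.prems X_subset by (auto simp: tuples_Cons)
  next
    case False
    from Cons.prems have x: "x \<in> X" "r \<in> tuples (length r)" "ptgt x = psrc (hd r)"
      using False by (auto simp: tuples_Cons)
    have "pmul x (psrc (hd r), concat (map parcs r), ptgt (last r)) \<in> qpaths Q"
      using qpaths_pmul[OF _ Cons.IH[OF x(2) False], of x] x X_subset by (simp add: subset_iff)
    then show ?thesis using False by (simp add: pmul_def)
  qed
qed simp

abbreviation arrow :: "('v,'e) qpath \<Rightarrow> bool" where
  "arrow v \<equiv> v \<in> X \<and> length (parcs v) = 1"

text \<open>The paths \<open>\<gamma>\<close> without any \<open>v\<close> as below span the right socle.\<close>

definition extends :: "('v,'e) qpath \<Rightarrow> ('v,'e) qpath \<Rightarrow> bool" where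
  "extends \<gamma> v \<longleftrightarrow> arrow v \<and> ptgt \<gamma> = psrc v \<and> pmul \<gamma> v \<in> X"

lemma split_last:
  assumes "q \<in> X" "parcs q \<noteq> []"
  shows "\<exists>p c. p \<in> X \<and> arrow c \<and> ptgt p = psrc c \<and> q = pmul p c \<and> parcs p = butlast (parcs q)"
proof -
  have "parcs q = butlast (parcs q) @ [last (parcs q)]" using assms by simp
  from split_X[OF assms(1) this] show ?thesis by fastforce
qed

lemma split_first:
  assumes "q \<in> X" "parcs q \<noteq> []"
  shows "\<exists>c p. p \<in> X \<and> arrow c \<and> ptgt c = psrc p \<and> q = pmul c p"
proof -
  have "parcs q = [hd (parcs q)] @ tl (parcs q)" using assms by simp
  from split_X[OF assms(1) this] show ?thesis by fastforce
qed

lemma factor_X: "\<lbrakk>a \<in> X; b \<in> X; c \<in> X; ptgt a = psrc b; ptgt b = psrc c; pmul a (pmul b c) \<in> X\<rbrakk>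
   \<Longrightarrow> pmul a b \<in> X \<and> pmul b c \<in> X"
  using factor[of a "pmul b c"] factor[of "pmul a b" c] qpaths_pmul[of b c] qpaths_pmul[of a b] X_subset
  by (auto simp: pmul_assoc)

end

section \<open>Acyclicity and unique continuation of paths\<close>

locale string_basis = path_basis Q X for Q :: "('v,'e) pre_digraph" and X +
  assumes acyclic: "(u, p, u) \<in> qpaths Q \<Longrightarrow> p = []"
    and next_unique: "(u, [a, b], w) \<in> X \<Longrightarrow> (u', [a, b'], w') \<in> X \<Longrightarrow> b = b'"
    and prev_unique: "(u, [b, a], w) \<in> X \<Longrightarrow> (u', [b', a], w') \<in> X \<Longrightarrow> b = b'"
begin

declare split_paired_All [simp del] split_paired_Ex [simp del]

lemma closed_trivial: "a \<in> qpaths Q \<Longrightarrow> psrc a = ptgt a \<Longrightarrow> parcs a = []"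
  using acyclic[of "psrc a" "parcs a"] by (cases a) simp

lemma tuple_not_closed: "t \<in> tuples n \<Longrightarrow> t \<noteq> [] \<Longrightarrow> psrc (hd t) \<noteq> ptgt (last t)"
  using tuple_path[of t n] closed_trivial[of "(psrc (hd t), concat (map parcs t), ptgt (last t))"]
  by (cases t) (auto simp: tuples_Cons)

text \<open>This is what puts the values of cochains into the radical: a trivial path parallel to a
  tuple would close the tuple up to an oriented cycle.\<close>

lemma parallel_nontrivial:
  assumes "t \<in> tuples n" "t \<noteq> []" "\<gamma> \<in> X" "parallel t \<gamma>" shows "parcs \<gamma> \<noteq> []"
  using tuple_not_closed[OF assms(1,2)] trivial_qpath[of \<gamma>] assms(3,4) X_subset
  by (auto simp: parallel_def)

text \<open>Reading backwards from the common arrow \<open>a\<close>, each arrow determines the one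
  before it, until one of the two lists is exhausted.\<close>

lemma suffix_comparable_arcs:
  assumes "(u, xs @ [a], w) \<in> X" "(u', ys @ [a], w') \<in> X"
  shows "(\<exists>zs. xs = zs @ ys) \<or> (\<exists>zs. ys = zs @ xs)"
  using assms
proof (induction xs arbitrary: ys a w w' rule: rev_induct)
  case (snoc c xs)
  show ?case
  proof (cases ys rule: rev_cases)
    case (snoc ys' d)
    have 1: "(u, (xs @ [c]) @ [a], w) \<in> X" "(u', (ys' @ [d]) @ [a], w') \<in> X"
      using snoc.prems snoc by auto
    obtain v where "(u, xs @ [c], v) \<in> X" using split_X[OF 1(1), of "xs @ [c]" "[a]"] by auto
    moreover obtain v' where "(u', ys' @ [d], v') \<in> X"
      using split_X[OF 1(2), of "ys' @ [d]" "[a]"] by auto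
    moreover have "\<exists>x. (x, [c, a], w) \<in> X" using split_X[OF 1(1), of xs "[c, a]"] by auto
    moreover have "\<exists>x. (x, [d, a], w') \<in> X" using split_X[OF 1(2), of ys' "[d, a]"] by auto
    ultimately have "c = d" using prev_unique by blast
    then show ?thesis
      using snoc.IH[of c v ys' v'] \<open>(u, xs @ [c], v) \<in> X\<close> \<open>(u', ys' @ [d], v') \<in> X\<close> snoc by auto
  qed simp
qed simp

text \<open>Both \<open>x\<close> and \<open>y\<close> can be followed within \<open>X\<close> by
  the first arrow of \<open>v\<close>, and backward uniqueness starts from that arrow. The rest of
  the proof passes from lists of arrows to paths with endpoints.\<close>

lemma suffix_comparable:
  assumes "x \<in> X" "y \<in> X" "v \<in> X" "parcs v \<noteq> []" "ptgt x = psrc v" "ptgt y = psrc v"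
    and "pmul x v \<in> X" "pmul y v \<in> X"
  obtains z where "z \<in> X" "ptgt z = psrc y" "x = pmul z y"
  | z where "z \<in> X" "ptgt z = psrc x" "y = pmul z x"
proof -
  have ends: "\<exists>z\<in>X. ptgt z = psrc y \<and> x = pmul z y"
    if xy: "x \<in> X" "y \<in> X" "parcs x = zs @ parcs y" "ptgt x = ptgt y" for x y zs
  proof -
    obtain u where u: "(psrc x, zs, u) \<in> X" "(u, parcs y, ptgt y) \<in> X"
      "x = pmul (psrc x, zs, u) (u, parcs y, ptgt y)"
      using split_X[OF xy(1,3)] xy(4) by auto
    have "u = psrc y"
    proof -
      have "(u, parcs y, ptgt y) \<in> qpaths Q" "(psrc y, parcs y, ptgt y) \<in> qpaths Q"
        using u(2) xy(2) X_subset by auto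
      then show ?thesis by (cases "parcs y") (auto simp: qpaths_def awalk_simps)
    qed
    then show ?thesis using u xy(4) by (intro bexI[of _ "(psrc x, zs, u)"]) auto
  qed
  obtain a p where v: "parcs v = a # p" using assms(4) by (cases "parcs v") auto
  have "\<exists>w. (psrc x, parcs x @ [a], w) \<in> X" using split_X[OF assms(7), of "parcs x @ [a]" p] v by auto
  moreover have "\<exists>w. (psrc y, parcs y @ [a], w) \<in> X"
    using split_X[OF assms(8), of "parcs y @ [a]" p] v by auto
  ultimately have "(\<exists>zs. parcs x = zs @ parcs y) \<or> (\<exists>zs. parcs y = zs @ parcs x)"
    using suffix_comparable_arcs by blast
  then show thesis
  proof
    assume "\<exists>zs. parcs x = zs @ parcs y"
    then show thesis using ends[of x y] assms(1,2,5,6) that(1) by auto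
  next
    assume "\<exists>zs. parcs y = zs @ parcs x"
    then show thesis using ends[of y x] assms(1,2,5,6) that(2) by auto
  qed
qed

text \<open>The last arrow of \<gamma> determines the arrow after it. A trivial \<gamma> has no last
  arrow, and two arrows may start at its vertex.\<close>

lemma extends_unique:
  assumes "extends \<gamma> v" "extends \<gamma> v'" "\<gamma> \<in> X" "parcs \<gamma> \<noteq> []"
  shows "v = v'"
proof -
  obtain a b p where a: "parcs v = [a]" "parcs v' = [b]" "parcs \<gamma> = butlast (parcs \<gamma>) @ [last (parcs \<gamma>)]"
    using assms by (auto simp: extends_def length_Suc_conv)
  let ?l = "last (parcs \<gamma>)"
  have "\<exists>x. (x, [?l, a], ptgt v) \<in> X"
    using split_X[of "pmul \<gamma> v" "butlast (parcs \<gamma>)" "[?l, a]"] assms a by (auto simp: extends_def)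
  moreover have "\<exists>x. (x, [?l, b], ptgt v') \<in> X"
    using split_X[of "pmul \<gamma> v'" "butlast (parcs \<gamma>)" "[?l, b]"] assms a by (auto simp: extends_def)
  ultimately have "a = b" using next_unique by blast
  moreover have "v \<in> qpaths Q" "v' \<in> qpaths Q" using assms X_subset by (auto simp: extends_def)
  ultimately show ?thesis
    using assms(1,2) a by (intro qpath_eqI) (auto simp: extends_def qpaths_def awalk_simps)
qed

end

section \<open>Normalization of cocycles\<close>

context path_basis
begin

definition plast :: "('v,'e) qpath \<Rightarrow> ('v,'e) qpath" where
  "plast q = (tail Q (last (parcs q)), [last (parcs q)], ptgt q)"

definition pinit :: "('v,'e) qpath \<Rightarrow> ('v,'e) qpath" where
  "pinit q = (psrc q, butlast (parcs q), tail Q (last (parcs q)))"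

lemma plast_pinit:
  assumes "arrow c" "ptgt p = psrc c"
  shows "plast (pmul p c) = c" "pinit (pmul p c) = p"
proof -
  obtain a where a: "parcs c = [a]" using assms by (auto simp: length_Suc_conv)
  have "c \<in> qpaths Q" using assms X_subset by auto
  then have "psrc c = tail Q a" using a by (cases c) (auto simp: qpaths_def awalk_simps)
  then show "plast (pmul p c) = c" "pinit (pmul p c) = p"
    using a assms(2) by (auto simp: plast_def pinit_def intro!: qpath_eqI)
qed

text \<open>Solves the recursion h [s, p c] = f [s, p, c] + h [s, p] c along the arrows
  \<open>c\<close> of the last argument, starting from h = 0 on a single arrow. The counter is the
  number of arrows beyond the first.\<close>

primrec peel :: "(('v,'e) qpath list \<Rightarrow> ('v,'e) qpath \<Rightarrow> 'k::field) \<Rightarrow> nat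
    \<Rightarrow> ('v,'e) qpath list \<Rightarrow> ('v,'e) qpath \<Rightarrow> ('v,'e) qpath \<Rightarrow> 'k" where
  "peel f 0 s q \<gamma> = 0"
| "peel f (Suc k) s q \<gamma> = f (s @ [pinit q, plast q]) \<gamma> + ract (plast q) (peel f k s (pinit q)) \<gamma>"

lemma cochain_restrict:
  "cochain n (\<lambda>t \<gamma>. if t \<in> tuples n \<and> \<gamma> \<in> X \<and> parallel t \<gamma> then f t \<gamma> else 0)"
  by (auto simp: cochain_def)

text \<open>The bounding cochain strips the last argument of its arrows, one at a time.\<close>

lemma normalize_last_argument:
  fixes f :: "('v,'e) qpath list \<Rightarrow> ('v,'e) qpath \<Rightarrow> 'k::field"
  assumes f: "cochain (Suc m) f" and m: "m > 0"
  shows "\<exists>h. cochain m h \<and> (\<forall>s p c \<gamma>. s @ [p, c] \<in> tuples (Suc m) \<longrightarrow> arrow c \<longrightarrow> pmul p c \<in> X \<longrightarrow>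
    \<gamma> \<in> X \<longrightarrow> parallel (s @ [p, c]) \<gamma> \<longrightarrow> cobd h (s @ [p, c]) \<gamma> = f (s @ [p, c]) \<gamma>)"
proof -
  \<comment> \<open>Since \<open>s\<close> has length m - 1, the merge of \<open>p\<close> with
    \<open>c\<close> and the right action of \<open>c\<close> enter the coboundary with signs (-1)^m
    and (-1)^(m+1). The factor in \<open>g\<close> absorbs them.\<close>
  define g where "g = (\<lambda>t \<gamma>. (-1) ^ m * f t \<gamma>)"
  define h where "h = (\<lambda>t \<gamma>. if t \<in> tuples m \<and> \<gamma> \<in> X \<and> parallel t \<gamma>
    then peel g (length (parcs (last t)) - 1) (butlast t) (last t) \<gamma> else 0)"
  have h: "cochain m h" unfolding h_def by (rule cochain_restrict)
  have h_arrow: "h (s @ [c]) \<gamma> = 0" if "arrow c" for s c \<gamma>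
    using that by (simp add: h_def)
  have "cobd h (s @ [p, c]) \<gamma> = f (s @ [p, c]) \<gamma>"
    if t: "s @ [p, c] \<in> tuples (Suc m)" and c: "arrow c" and pc: "pmul p c \<in> X"
      and \<gamma>: "\<gamma> \<in> X" and par: "parallel (s @ [p, c]) \<gamma>" for s p c \<gamma>
  proof -
    have len: "length s + 2 = Suc m" using tuples_length[OF t] by simp
    have ptc: "ptgt p = psrc c" and p: "p \<in> X" "parcs p \<noteq> []" using t by (auto simp: tuples_append tuples_Cons)
    have sp: "s @ [p] \<in> tuples m" using t by (auto simp: tuples_append tuples_Cons)
    have spc: "s @ [pmul p c] \<in> tuples m" using t pc by (auto simp: tuples_append tuples_Cons)
    have par': "parallel (s @ [pmul p c]) \<gamma>" using par by (cases s) (auto simp: parallel_def)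
    have lc: "length (parcs c) = 1" using c by simp
    have "ract c (h (s @ [p])) \<gamma> = ract c (peel g (length (parcs p) - 1) s p) \<gamma>"
    proof -
      consider b where "b \<in> X" "ptgt b = psrc c" "\<gamma> = pmul b c"
        | "ract c (h (s @ [p])) \<gamma> = 0" "ract c (peel g (length (parcs p) - 1) s p) \<gamma> = 0"
        using ract_cases[of c \<gamma> "h (s @ [p])"] ract_cases[of c \<gamma> "peel g (length (parcs p) - 1) s p"]
        by blast
      then show ?thesis
      proof cases
        case 1
        then have "parallel (s @ [p]) b" using par ptc by (cases s) (auto simp: parallel_def)
        then show ?thesis using 1 sp by (simp add: ract_pmul h_def)
      qed simp
    qed
    moreover have "h (s @ [pmul p c]) \<gamma>
      = g (s @ [p, c]) \<gamma> + ract c (peel g (length (parcs p) - 1) s p) \<gamma>"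
    proof -
      obtain k where k: "length (parcs p) = Suc k" using p by (cases "parcs p") auto
      have "h (s @ [pmul p c]) \<gamma> = peel g (Suc k) s (pmul p c) \<gamma>"
        using spc \<gamma> par' k lc by (simp add: h_def)
      then show ?thesis using plast_pinit[OF c ptc] k by simp
    qed
    ultimately have rec: "h (s @ [pmul p c]) \<gamma> = g (s @ [p, c]) \<gamma> + ract c (h (s @ [p])) \<gamma>" by simp
    \<comment> \<open>All other terms of the coboundary still end in the single arrow
      \<open>c\<close>, where \<open>h\<close> vanishes.\<close>
    have z: "h (s' @ [p, c]) = (\<lambda>_. 0)" for s' using h_arrow[OF c, of "s' @ [p]"] by auto
    have z1: "h [c] = (\<lambda>_. 0)" using h_arrow[OF c, of "[]"] by auto
    have "h (tl (s @ [p, c])) = (\<lambda>_. 0)" using z z1 by (cases s) auto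
    then have 1: "lact (hd (s @ [p, c])) (h (tl (s @ [p, c]))) \<gamma> = 0" by (simp add: lact_def)
    have 2: "merges (\<lambda>u. h u \<gamma>) (s @ [p, c]) = - ((-1) ^ length s * h (s @ [pmul p c]) \<gamma>)"
      using merges_append[of "\<lambda>u. h u \<gamma>" s p "[c]"] h_arrow[OF c] by simp
    have "(-1::'k) ^ length s * (-1) ^ m = -1" using len m
      by (metis add_2_eq_Suc' diff_Suc_1 left_minus_one_mult_self mult.commute mult_minus1 nat.inject power_Suc)
    then have "(-1::'k) ^ length s * (-1) ^ m * z = - z" for z by (simp only: mult_minus1)
    then have sgn: "(-1::'k) ^ m * ((-1) ^ length s * z) = - z" for z by (simp only: mult_ac)
    show ?thesis unfolding cobd_def 1 2 rec
      by (simp add: g_def butlast_append algebra_simps sgn)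
  qed
  then show ?thesis using h by blast
qed

text \<open>Comparison of last arrows: either \<open>b\<close> is trivial and x = \<gamma> v, or
  \<open>b\<close> ends in the arrow of \<open>v\<close>, which can be cancelled.\<close>

lemma pmul_arrow_cancel:
  assumes \<gamma>: "\<gamma> \<in> X" and x: "x \<in> X" "parcs x \<noteq> []" and v: "arrow v" "ptgt \<gamma> = psrc v"
    and eq: "pmul \<gamma> v = pmul x b" and b: "b \<in> X" "ptgt x = psrc b"
  shows "parcs b = [] \<or> (\<exists>b'\<in>X. ptgt x = psrc b' \<and> \<gamma> = pmul x b')"
proof (cases "parcs b" rule: rev_cases)
  case (snoc b' a')
  obtain a where "parcs v = [a]" using v by (auto simp: length_Suc_conv)
  then have e: "parcs \<gamma> = parcs x @ b'" and s: "psrc \<gamma> = psrc x"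
    using arg_cong[OF eq, of parcs] arg_cong[OF eq, of psrc] snoc by auto
  obtain w where w: "(psrc \<gamma>, parcs x, w) \<in> X" "(w, b', ptgt \<gamma>) \<in> X"
    "\<gamma> = pmul (psrc \<gamma>, parcs x, w) (w, b', ptgt \<gamma>)"
    using split_X[OF \<gamma> e] by blast
  have "(psrc x, parcs x, w) \<in> qpaths Q" "(psrc x, parcs x, ptgt x) \<in> qpaths Q"
    using w x s X_subset by auto
  then have "w = ptgt x" using awalk_ends[of "psrc x" "parcs x" w "psrc x" "ptgt x"] x(2)
    by (auto simp: qpaths_def)
  then have "\<gamma> = pmul x (w, b', ptgt \<gamma>)" using w s by (auto simp: pmul_def prod_eq_iff)
  then show ?thesis using w \<open>w = ptgt x\<close> by auto
qed simp

end

section \<open>Removing the values outside the right socle\<close>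

context string_basis
begin

text \<open>In the cocycle identity at \<open>s @ [p, c]\<close>, read at the path \<gamma> p c,
  everything ending in the separate entry \<open>c\<close> vanishes. What is left is the merge of
  \<open>p\<close> with \<open>c\<close> and the right action of \<open>c\<close>, with opposite
  signs.\<close>

lemma normalized_constant:
  fixes f :: "('v,'e) qpath list \<Rightarrow> ('v,'e) qpath \<Rightarrow> 'k::field"
  assumes f: "cochain (Suc m) f"
    and cocyc: "\<And>t \<gamma>. t \<in> tuples (Suc (Suc m)) \<Longrightarrow> \<gamma> \<in> X \<Longrightarrow> parallel t \<gamma> \<Longrightarrow> cobd f t \<gamma> = 0"
    and norm: "\<And>s p c \<gamma>. s @ [p, c] \<in> tuples (Suc m) \<Longrightarrow> arrow c \<Longrightarrow> pmul p c \<in> X \<Longrightarrow>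
        \<gamma> \<in> X \<Longrightarrow> parallel (s @ [p, c]) \<gamma> \<Longrightarrow> f (s @ [p, c]) \<gamma> = 0"
    and s: "s @ [p] \<in> tuples (Suc m)" "s \<noteq> []" and c: "arrow c" "ptgt p = psrc c"
    and \<gamma>: "\<gamma> \<in> X" "ptgt \<gamma> = psrc p" "psrc \<gamma> = psrc (hd s)" and x: "pmul \<gamma> (pmul p c) \<in> X"
  shows "f (s @ [pmul p c]) (pmul \<gamma> (pmul p c)) = f (s @ [p]) (pmul \<gamma> p)"
proof -
  let ?\<gamma> = "pmul \<gamma> (pmul p c)"
  \<comment> \<open>For \<open>p'\<close> outside \<open>X\<close> the tuple is not admissible and
    the support condition applies, so normalization is needed only for \<open>p'\<close> in
    \<open>X\<close>.\<close>
  have norm0: "f (s' @ [p', c]) \<gamma>' = 0" if "p' \<in> X \<longrightarrow> pmul p' c \<in> X" for s' p' \<gamma>'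
    using norm[of s' p' c \<gamma>'] cochain_zero[OF f, of "s' @ [p', c]" \<gamma>'] c that
    by (cases "p' \<in> X") (auto simp: tuples_append tuples_Cons)
  have p: "p \<in> X" "parcs p \<noteq> []" using s by (auto simp: tuples_append tuples_Cons)
  have pc: "pmul p c \<in> X" "pmul \<gamma> p \<in> X" using factor_X[of \<gamma> p c] \<gamma> p c x by auto
  have len: "length s = m" using tuples_length[OF s(1)] by simp
  have t: "s @ [p, c] \<in> tuples (Suc (Suc m))" using s c by (auto simp: tuples_append tuples_Cons)
  have par: "parallel (s @ [p, c]) ?\<gamma>" using \<gamma> s by (auto simp: parallel_def)
  have 1: "lact (hd (s @ [p, c])) (f (tl (s @ [p, c]))) ?\<gamma> = 0"
  proof -
    have "f (tl (s @ [p, c])) = (\<lambda>_. 0)"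
      using norm0[of p "tl s"] pc s(2) by auto
    then show ?thesis by (simp add: lact_def)
  qed
  obtain s0 y where y: "s = s0 @ [y]" using s(2) by (cases s rule: rev_cases) auto
  \<comment> \<open>The one merge that normalization may miss: y p lies in \<open>X\<close> but y p
    c does not. Since \<gamma> and \<open>y\<close> can both be followed by \<open>p\<close>, one is
    a suffix of the other, and either case puts y p c into \<open>X\<close>.\<close>
  have "f (s0 @ [pmul y p, c]) ?\<gamma> = 0"
  proof (cases "pmul y p \<in> X \<and> pmul (pmul y p) c \<notin> X")
    case True
    have yX: "y \<in> X" "ptgt y = psrc p" "s0 @ [y] \<in> tuples m"
      using s y by (auto simp: tuples_append tuples_Cons)
    from suffix_comparable[OF yX(1) \<gamma>(1) p yX(2) \<gamma>(2)] True pc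
    consider z where "z \<in> X" "ptgt z = psrc \<gamma>" "y = pmul z \<gamma>"
      | z where "z \<in> X" "ptgt z = psrc y" "\<gamma> = pmul z y" by blast
    then show ?thesis
    proof cases
      case 1
      have "psrc \<gamma> = psrc (hd (s0 @ [y]))" using \<gamma>(3) y by simp
      \<comment> \<open>The path \<gamma> starts where the tuple starts, so \<open>z\<close>
        together with the entries before \<open>y\<close> is a closed path.\<close>
      have "parcs z = []"
      proof (cases s0)
        case Nil
        then show ?thesis using 1 y \<gamma>(3) closed_trivial[of z] X_subset by auto
      next
        case (Cons a s1)
        have "(psrc a, concat (map parcs s0), ptgt (last s0)) \<in> qpaths Q"
          using tuple_path[of s0 "length s0"] yX(3) unfolding tuples_append Cons by simp
        moreover have "ptgt (last s0) = psrc z" using 1 yX(3) Cons unfolding tuples_append by simp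
        moreover have "ptgt z = psrc a" using 1 \<gamma>(3) y Cons by simp
        ultimately have "pmul (psrc a, concat (map parcs s0), ptgt (last s0)) z \<in> qpaths Q"
          by (intro qpaths_pmul) (use 1 X_subset in auto)
        from closed_trivial[OF this] \<open>ptgt z = psrc a\<close> show ?thesis by simp
      qed
      then have "y = \<gamma>" using 1 trivial_qpath[of z] X_subset by (auto simp: pmul_def prod_eq_iff)
      then show ?thesis using True x by (simp add: pmul_assoc)
    next
      case 2
      have "pmul y (pmul p c) \<in> X"
        using factor_X[of z y "pmul p c"] 2 yX pc x by (auto simp: pmul_assoc)
      then show ?thesis using True by (simp add: pmul_assoc)
    qed
  next
    case False
    then show ?thesis using norm0[of "pmul y p" s0] by blast
  qed
  moreover have mm: "m = Suc (length s0)" using len y by simp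
  ultimately have 2: "merges (\<lambda>u. f u ?\<gamma>) (s @ [p, c]) = - ((-1) ^ m * f (s @ [pmul p c]) ?\<gamma>)"
    using merges_append[of "\<lambda>u. f u ?\<gamma>" s p "[c]"]
      merges_append[of "\<lambda>u. f (u @ [c]) ?\<gamma>" s0 y "[p]"] norm0[of p] pc mm y
    by simp
  have 3: "ract c (f (s @ [p])) ?\<gamma> = f (s @ [p]) (pmul \<gamma> p)"
    using ract_pmul[of "pmul \<gamma> p" c] pc c by (simp add: pmul_assoc)
  have "0 = cobd f (s @ [p, c]) ?\<gamma>" using cocyc[OF t x par] by simp
  also have "\<dots> = - ((-1) ^ m * f (s @ [pmul p c]) ?\<gamma>) + (-1) ^ m * f (s @ [p]) (pmul \<gamma> p)"
    unfolding cobd_def 1 2 using len 3 by (simp add: butlast_append)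
  finally show ?thesis by simp
qed

text \<open>\<open>normalized_constant\<close> removes one arrow from the end of the last argument.
  Repetition leaves only its initial factor \<open>a\<close>.\<close>

lemma normalized_first_arrow:
  fixes f :: "('v,'e) qpath list \<Rightarrow> ('v,'e) qpath \<Rightarrow> 'k::field"
  assumes f: "cochain (Suc m) f"
    and cocyc: "\<And>t \<gamma>. t \<in> tuples (Suc (Suc m)) \<Longrightarrow> \<gamma> \<in> X \<Longrightarrow> parallel t \<gamma> \<Longrightarrow> cobd f t \<gamma> = 0"
    and norm: "\<And>s p c \<gamma>. s @ [p, c] \<in> tuples (Suc m) \<Longrightarrow> arrow c \<Longrightarrow> pmul p c \<in> X \<Longrightarrow>
        \<gamma> \<in> X \<Longrightarrow> parallel (s @ [p, c]) \<gamma> \<Longrightarrow> f (s @ [p, c]) \<gamma> = 0"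
    and s: "s @ [a] \<in> tuples (Suc m)" "s \<noteq> []"
    and q: "q \<in> X" "ptgt a = psrc q"
    and \<gamma>: "\<gamma> \<in> X" "ptgt \<gamma> = psrc a" "psrc \<gamma> = psrc (hd s)" and x: "pmul \<gamma> (pmul a q) \<in> X"
  shows "f (s @ [pmul a q]) (pmul \<gamma> (pmul a q)) = f (s @ [a]) (pmul \<gamma> a)"
  using q x
proof (induction "length (parcs q)" arbitrary: q)
  case 0
  then have "pmul a q = a" using trivial_qpath[of q] X_subset by (auto simp: pmul_def prod_eq_iff)
  then show ?case by simp
next
  case (Suc k)
  then have "parcs q \<noteq> []" by auto
  with Suc.prems(1) obtain p c where p: "p \<in> X" "arrow c" "ptgt p = psrc c" "q = pmul p c"
    using split_last by blast
  have a: "a \<in> X" "parcs a \<noteq> []" using s by (auto simp: tuples_append tuples_Cons)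
  have ap: "ptgt a = psrc p" using Suc.prems p by simp
  have qX: "pmul a q \<in> X" using factor_X[of \<gamma> a q] \<gamma> a Suc.prems by auto
  have apX: "pmul a p \<in> X" using factor_X[of a p c] p a ap qX by auto
  have gX: "pmul \<gamma> (pmul a p) \<in> X"
    using factor_X[of \<gamma> "pmul a p" c] p a ap apX \<gamma> Suc.prems by (auto simp: pmul_assoc)
  have "s @ [pmul a p] \<in> tuples (Suc m)" using s apX by (auto simp: tuples_append tuples_Cons)
  from normalized_constant[OF f cocyc norm this s(2) p(2) _ \<gamma>(1)] p(3,4) \<gamma> Suc.prems
  have "f (s @ [pmul a q]) (pmul \<gamma> (pmul a q)) = f (s @ [pmul a p]) (pmul \<gamma> (pmul a p))"
    by (auto simp: pmul_assoc)
  also have "\<dots> = f (s @ [a]) (pmul \<gamma> a)"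
    using Suc.hyps(1)[of p] Suc.hyps(2) p ap gX by simp
  finally show ?case .
qed

text \<open>
  Dividing the values of a normalized cocycle by the only arrow \<open>v\<close> that can follow them yields a
  cochain whose coboundary accounts for all values outside the right socle.
\<close>

lemma cocycle_right_socle:
  fixes f :: "('v,'e) qpath list \<Rightarrow> ('v,'e) qpath \<Rightarrow> 'k::field"
  assumes f: "cochain (Suc m) f" and m: "m > 0"
    and cocyc: "\<And>t \<gamma>. t \<in> tuples (Suc (Suc m)) \<Longrightarrow> \<gamma> \<in> X \<Longrightarrow> parallel t \<gamma> \<Longrightarrow> cobd f t \<gamma> = 0"
    and norm: "\<And>s p c \<gamma>. s @ [p, c] \<in> tuples (Suc m) \<Longrightarrow> arrow c \<Longrightarrow> pmul p c \<in> X \<Longrightarrow>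
        \<gamma> \<in> X \<Longrightarrow> parallel (s @ [p, c]) \<gamma> \<Longrightarrow> f (s @ [p, c]) \<gamma> = 0"
  shows "\<exists>h. cochain m h \<and> (\<forall>t \<gamma> v. t \<in> tuples (Suc m) \<longrightarrow> \<gamma> \<in> X \<longrightarrow> parallel t \<gamma> \<longrightarrow>
    extends \<gamma> v \<longrightarrow> cobd h t \<gamma> = f t \<gamma>)"
proof -
  \<comment> \<open>By \<open>extends_unique\<close> the choice of \<open>v\<close> is no choice for
    nontrivial \<gamma>. Paths of the right socle get the value 0.\<close>
  define g where "g = (\<lambda>t \<gamma>. if \<exists>v. extends \<gamma> v
    then let v = SOME v. extends \<gamma> v in f (t @ [v]) (pmul \<gamma> v) else 0)"
  define h where "h = (\<lambda>t \<gamma>. if t \<in> tuples m \<and> \<gamma> \<in> X \<and> parallel t \<gamma> then g t \<gamma> else 0)"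
  have coh: "cochain m h" unfolding h_def by (rule cochain_restrict)
  have h: "h t \<gamma> = f (t @ [v]) (pmul \<gamma> v)" if "\<gamma> \<in> X" "parcs \<gamma> \<noteq> []" "extends \<gamma> v" "t \<noteq> []" for t \<gamma> v
  proof (cases "t \<in> tuples m \<and> parallel t \<gamma>")
    case True
    have "(SOME v. extends \<gamma> v) = v"
      using that extends_unique[of \<gamma>] by (metis someI)
    then show ?thesis using that True by (auto simp: h_def g_def)
  next
    case False
    have "t @ [v] \<notin> tuples (Suc m) \<or> \<not> parallel (t @ [v]) (pmul \<gamma> v)"
      using False that(3,4) by (auto simp: tuples_append tuples_Cons parallel_def extends_def)
    then have "f (t @ [v]) (pmul \<gamma> v) = 0" using cochain_zero[OF f] by blast
    then show ?thesis using False by (auto simp: h_def)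
  qed
  \<comment> \<open>The coboundary of \<open>h\<close> agrees with \<open>f\<close> only up to this
    sign, coming from the right action of \<open>v\<close> in the cocycle identity at
    \<open>t @ [v]\<close>. Its square is 1, so \<open>e\<close> times \<open>h\<close> is the
    required cochain.\<close>
  define e where "e = (-1 :: 'k) ^ Suc m"
  have "cobd h t \<gamma> = e * f t \<gamma>"
    if t: "t \<in> tuples (Suc m)" and \<gamma>: "\<gamma> \<in> X" and par: "parallel t \<gamma>" and v: "extends \<gamma> v" for t \<gamma> v
  proof -
    have nt: "parcs \<gamma> \<noteq> []" using parallel_nontrivial[OF t _ \<gamma> par] t by (cases t) auto
    have v': "arrow v" "ptgt \<gamma> = psrc v" "pmul \<gamma> v \<in> X" using v by (auto simp: extends_def)
    obtain x1 r where x1: "t = x1 # r" using t by (cases t) auto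
    obtain s xn where xn: "t = s @ [xn]" using t by (cases t rule: rev_cases) auto
    have len: "length t = Suc m" using tuples_length[OF t] .
    have rne: "r \<noteq> []" and sne: "s \<noteq> []" using len m x1 xn by auto
    have x1X: "x1 \<in> X" "parcs x1 \<noteq> []" "r \<in> tuples m" "ptgt x1 = psrc (hd r)"
      using t x1 rne by (auto simp: tuples_Cons)
    have xnX: "xn \<in> X" "parcs xn \<noteq> []" "s \<in> tuples m" "ptgt (last s) = psrc xn"
      using t xn sne len by (auto simp: tuples_append tuples_Cons)
    have ends: "psrc \<gamma> = psrc x1" "ptgt \<gamma> = ptgt xn" "psrc \<gamma> = psrc (hd s)" "ptgt \<gamma> = ptgt (last r)"
    proof -
      have "hd t = hd s" "last t = xn" using xn sne by simp_all
      moreover have "hd t = x1" "last t = last r" using x1 rne by simp_all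
      ultimately
      show "psrc \<gamma> = psrc x1" "ptgt \<gamma> = ptgt xn" "psrc \<gamma> = psrc (hd s)" "ptgt \<gamma> = ptgt (last r)"
        using par unfolding parallel_def by simp_all
    qed
    have tv: "t @ [v] \<in> tuples (Suc (Suc m))"
      using t v' len ends(2) xn by (auto simp: tuples_append tuples_Cons)
    have par_v: "parallel (t @ [v]) (pmul \<gamma> v)" using par x1 by (auto simp: parallel_def)
    \<comment> \<open>The terms of the coboundary of \<open>h\<close> at \<open>t\<close> are
      matched with those of the cocycle identity at \<open>t @ [v]\<close>, read at \<gamma> v. On
      the left, division by \<open>v\<close> could fail to commute with \<open>x1\<close> only if x1
      = \<gamma> v; then \<open>r\<close> followed by \<open>v\<close> would be an oriented
      cycle.\<close>
    have 1: "lact x1 (h r) \<gamma> = lact x1 (f (r @ [v])) (pmul \<gamma> v)"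
    proof (cases "\<exists>b\<in>X. ptgt x1 = psrc b \<and> \<gamma> = pmul x1 b")
      case True
      then obtain b where b: "b \<in> X" "ptgt x1 = psrc b" "\<gamma> = pmul x1 b" by blast
      have bv: "pmul b v \<in> X" using factor_X[of x1 b v] b v' x1X by (auto simp: pmul_assoc)
      have "extends b v" using v' bv b by (auto simp: extends_def)
      moreover have "parcs b \<noteq> []"
        using parallel_nontrivial[OF x1X(3) rne b(1)] b x1X(4) ends(4) by (auto simp: parallel_def)
      moreover have "lact x1 (f (r @ [v])) (pmul \<gamma> v) = f (r @ [v]) (pmul b v)"
        using lact_pmul[of "pmul b v" x1] bv b by (simp add: pmul_assoc)
      ultimately show ?thesis using b h[of b v r] rne by (simp add: lact_pmul)
    next
      case False
      have "\<not> (\<exists>b\<in>X. ptgt x1 = psrc b \<and> pmul \<gamma> v = pmul x1 b)"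
      proof
        assume "\<exists>b\<in>X. ptgt x1 = psrc b \<and> pmul \<gamma> v = pmul x1 b"
        then obtain b where b: "b \<in> X" "ptgt x1 = psrc b" "pmul \<gamma> v = pmul x1 b" by blast
        obtain a where a: "parcs v = [a]" using v' by (auto simp: length_Suc_conv)
        have "parcs b = []" using pmul_arrow_cancel[OF \<gamma> x1X(1,2) v'(1,2) b(3,1,2)] False by blast
        then have "b = pid (ptgt x1)" using trivial_qpath[of b] b X_subset by auto
        then have "ptgt v = ptgt x1" using arg_cong[OF b(3), of ptgt] by simp
        have "(ptgt x1, concat (map parcs r), ptgt (last r)) \<in> qpaths Q"
          using tuple_path[OF x1X(3) rne] x1X(4) by simp
        then have "pmul (ptgt x1, concat (map parcs r), ptgt (last r)) v \<in> qpaths Q"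
          using qpaths_pmul[of _ v] v' ends X_subset by auto
        from closed_trivial[OF this] \<open>ptgt v = ptgt x1\<close> a show False by simp
      qed
      then show ?thesis
        using False lact_cases[of x1 \<gamma> "h r"] lact_cases[of x1 "pmul \<gamma> v" "f (r @ [v])"] by metis
    qed
    have 2: "merges (\<lambda>u. h u \<gamma>) t = merges (\<lambda>u. f (u @ [v]) (pmul \<gamma> v)) t"
      by (rule merges_cong) (use h[OF \<gamma> nt v] len m in auto)
    \<comment> \<open>The right action of \<open>xn\<close> on \<open>h\<close> has to match the
      merge of \<open>xn\<close> with \<open>v\<close>. If \<gamma> = b xn, division at
      \<open>b\<close> is by the first arrow \<open>a\<close> of \<open>xn\<close>, and
      \<open>normalized_first_arrow\<close> compares the last argument \<open>a\<close> with xn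
      v.\<close>
    have 3: "ract xn (h s) \<gamma> = f (s @ [pmul xn v]) (pmul \<gamma> v)"
    proof (cases "\<exists>b\<in>X. ptgt b = psrc xn \<and> \<gamma> = pmul b xn")
      case True
      then obtain b where b: "b \<in> X" "ptgt b = psrc xn" "\<gamma> = pmul b xn" by blast
      obtain a q where a: "q \<in> X" "arrow a" "ptgt a = psrc q" "xn = pmul a q"
        using split_first[OF xnX(1,2)] by blast
      have ba: "pmul b a \<in> X" using factor_X[of b a q] a b \<gamma> by auto
      have bne: "parcs b \<noteq> []"
        using parallel_nontrivial[OF xnX(3) sne b(1)] b xnX(4) ends(3) by (auto simp: parallel_def)
      have "extends b a" using a b ba by (auto simp: extends_def)
      then have *: "ract xn (h s) \<gamma> = f (s @ [a]) (pmul b a)"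
        using b bne h[of b a s] sne by (simp add: ract_pmul)
      have qv: "pmul q v \<in> X"
        using factor_X[of "pmul b a" q v] ba a b v' xn ends by (auto simp: pmul_assoc)
      have sa: "s @ [a] \<in> tuples (Suc m)"
        using t xn a sne by (auto simp: tuples_append tuples_Cons)
      have "f (s @ [pmul a (pmul q v)]) (pmul b (pmul a (pmul q v))) = f (s @ [a]) (pmul b a)"
        using normalized_first_arrow[OF f cocyc norm sa sne qv _ b(1)] a b v' ends
        by (auto simp: pmul_assoc)
      then show ?thesis using * a b by (simp add: pmul_assoc)
    next
      case False
      \<comment> \<open>Otherwise \<gamma> and \<open>xn\<close> are comparable. Either \<gamma>
        ends in \<open>xn\<close>, which is excluded here, or \<open>xn\<close> ends in \<gamma> and
        the entries of \<open>s\<close> lie on a closed path.\<close>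
      have "pmul xn v \<notin> X"
      proof
        assume xv: "pmul xn v \<in> X"
        have v0: "v \<in> X" "parcs v \<noteq> []" using v' by auto
        from suffix_comparable[OF \<gamma> xnX(1) v0 v'(2) _ v'(3) xv] ends v'
        consider z where "z \<in> X" "ptgt z = psrc xn" "\<gamma> = pmul z xn"
          | z where "z \<in> X" "ptgt z = psrc \<gamma>" "xn = pmul z \<gamma>" by metis
        then show False
        proof cases
          case 1
          then show False using False by blast
        next
          case 2
          have "(psrc (hd s), concat (map parcs s), ptgt (last s)) \<in> qpaths Q"
            using tuple_path[OF xnX(3) sne] .
          then have "pmul (psrc (hd s), concat (map parcs s), ptgt (last s)) z \<in> qpaths Q"
            using qpaths_pmul[of _ z] 2 xnX X_subset by auto
          from closed_trivial[OF this] 2 ends have "concat (map parcs s) = []" by simp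
          moreover have "hd s \<in> set s" using sne by simp
          ultimately show False using xnX(3) by (auto simp: tuples_def)
        qed
      qed
      then have "f (s @ [pmul xn v]) (pmul \<gamma> v) = 0"
        using cochain_zero[OF f, of "s @ [pmul xn v]"] by (auto simp: tuples_append tuples_Cons)
      then show ?thesis using False ract_cases[of xn \<gamma> "h s"] by auto
    qed
    have hdtl: "hd (t @ [v]) = x1" "tl (t @ [v]) = r @ [v]" using x1 by simp_all
    have "0 = cobd f (t @ [v]) (pmul \<gamma> v)" using cocyc[OF tv v'(3) par_v] by simp
    also have "\<dots> = lact x1 (f (r @ [v])) (pmul \<gamma> v) + merges (\<lambda>u. f (u @ [v]) (pmul \<gamma> v)) t
        - (-1) ^ length s * f (s @ [pmul xn v]) (pmul \<gamma> v)
        + (-1) ^ Suc (Suc m) * f t \<gamma>"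
      using merges_append[of "\<lambda>u. f u (pmul \<gamma> v)" s xn "[v]"] xn len \<gamma> v'
      unfolding cobd_def hdtl by (simp add: butlast_append ract_pmul)
    also have "\<dots> = cobd h t \<gamma> + (-1) ^ Suc (Suc m) * f t \<gamma>"
    proof -
      have "hd t = x1" "tl t = r" using x1 by simp_all
      moreover have "last t = xn" "butlast t = s" "length s = m" using xn len by simp_all
      ultimately show ?thesis
        unfolding cobd_def 1[symmetric] 2[symmetric] 3[symmetric] by (simp add: len)
    qed
    finally show ?thesis by (simp add: e_def eq_neg_iff_add_eq_0)
  qed
  moreover have "cobd (\<lambda>t \<gamma>. e * h t \<gamma>) t \<gamma> = e * cobd h t \<gamma>" for t \<gamma>
    using merges_linear[of "(*) e" "\<lambda>u. h u \<gamma>" t]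
    by (simp add: cobd_def lact_def ract_def sum_distrib_left algebra_simps)
  moreover have "e * e = 1" by (simp add: e_def flip: power_mult_distrib)
  ultimately have "cobd (\<lambda>t \<gamma>. e * h t \<gamma>) t \<gamma> = f t \<gamma>"
    if "t \<in> tuples (Suc m)" "\<gamma> \<in> X" "parallel t \<gamma>" "extends \<gamma> v" for t \<gamma> v
    using that by (simp flip: mult.assoc)
  moreover have "cochain m (\<lambda>t \<gamma>. e * h t \<gamma>)" using coh by (auto simp: cochain_def)
  ultimately show ?thesis by blast
qed

section \<open>Derivations and the right socle\<close>

lemma closed_pmul:
  assumes "z \<in> X" "psrc z = ptgt z"
  shows "ptgt z = psrc x \<Longrightarrow> pmul z x = x" "psrc z = ptgt x \<Longrightarrow> pmul x z = x"
  using assms closed_trivial[of z] trivial_qpath[of z] X_subset by (auto simp: pmul_def prod_eq_iff)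

text \<open>In the cocycle identity at [p, v], read at \<gamma> v, the merge and the left action
  vanish: either of them would make one of the parallel paths \<gamma> and \<open>p\<close> a factor
  of the other, hence equal to it, or make \<open>v\<close> closed. Only the right action of
  \<open>v\<close> remains. The diagonal value \<gamma> = p escapes this argument.\<close>

lemma derivation_right_socle:
  fixes f :: "('v,'e) qpath list \<Rightarrow> ('v,'e) qpath \<Rightarrow> 'k::field"
  assumes f: "cochain 1 f"
    and cocyc: "\<And>t \<gamma>. t \<in> tuples 2 \<Longrightarrow> \<gamma> \<in> X \<Longrightarrow> parallel t \<gamma> \<Longrightarrow> cobd f t \<gamma> = 0"
    and p: "[p] \<in> tuples 1" and \<gamma>: "\<gamma> \<in> X" "parallel [p] \<gamma>" "\<gamma> \<noteq> p" and v: "extends \<gamma> v"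
  shows "f [p] \<gamma> = 0"
proof -
  have v': "arrow v" "ptgt \<gamma> = psrc v" "pmul \<gamma> v \<in> X" using v by (auto simp: extends_def)
  have pX: "p \<in> X" "parcs p \<noteq> []" using p by (auto simp: tuples_Cons)
  have ends: "psrc \<gamma> = psrc p" "ptgt \<gamma> = ptgt p" using \<gamma> by (auto simp: parallel_def)
  have pv: "pmul p v \<notin> X"
  proof
    assume xv: "pmul p v \<in> X"
    have v0: "v \<in> X" "parcs v \<noteq> []" using v' by auto
    from suffix_comparable[OF \<gamma>(1) pX(1) v0 v'(2) _ v'(3) xv] ends v'
    consider z where "z \<in> X" "ptgt z = psrc p" "\<gamma> = pmul z p"
      | z where "z \<in> X" "ptgt z = psrc \<gamma>" "p = pmul z \<gamma>" by metis
    then show False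
    proof cases
      case 1
      then have "psrc z = ptgt z" using ends by simp
      then have "pmul z p = p" by (intro closed_pmul(1)) (use 1 in auto)
      then show False using 1(3) \<gamma>(3) by simp
    next
      case 2
      then have "psrc z = ptgt z" using ends by simp
      then have "pmul z \<gamma> = \<gamma>" by (intro closed_pmul(1)) (use 2 in auto)
      then show False using 2(3) \<gamma>(3) by simp
    qed
  qed
  have "f [pmul p v] (pmul \<gamma> v) = 0"
    using pv cochain_zero[OF f, of "[pmul p v]"] by (auto simp: tuples_Cons)
  moreover have "lact p (f [v]) (pmul \<gamma> v) = 0"
  proof -
    have "\<not> (\<exists>b\<in>X. ptgt p = psrc b \<and> pmul \<gamma> v = pmul p b)"
    proof
      assume "\<exists>b\<in>X. ptgt p = psrc b \<and> pmul \<gamma> v = pmul p b"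
      then obtain b where b: "b \<in> X" "ptgt p = psrc b" "pmul \<gamma> v = pmul p b" by blast
      from pmul_arrow_cancel[OF \<gamma>(1) pX v'(1,2) b(3,1,2)]
      consider "parcs b = []" | b' where "b' \<in> X" "ptgt p = psrc b'" "\<gamma> = pmul p b'" by blast
      then show False
      proof cases
        case 1
        then have "b = pid (ptgt p)" using trivial_qpath[of b] b X_subset by auto
        then have "ptgt v = psrc v" using arg_cong[OF b(3), of ptgt] v' ends by simp
        then show False using closed_trivial[of v] v' X_subset by auto
      next
        case 2
        have "ptgt \<gamma> = ptgt b'" using 2(3) by simp
        then have "psrc b' = ptgt b'" using 2(2) ends by simp
        then have "pmul p b' = p" by (intro closed_pmul(2)) (use 2(1,2) in auto)
        then show False using 2(3) \<gamma>(3) by simp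
      qed
    qed
    then show ?thesis using lact_cases by metis
  qed
  moreover have "cobd f [p, v] (pmul \<gamma> v) = 0"
    using cocyc[of "[p, v]" "pmul \<gamma> v"] p v' ends by (cases "parcs v") (auto simp: tuples_Cons parallel_def)
  moreover have "ract v (f [p]) (pmul \<gamma> v) = f [p] \<gamma>" using ract_pmul[of \<gamma> v] \<gamma> v' by simp
  ultimately show ?thesis by (simp add: cobd_def)
qed

text \<open>Used in contrapositive form: a path of the right socle is annihilated by every
  nontrivial path, because the first arrow of a path that does not annihilate it would extend
  it.\<close>

lemma right_socle_mult:
  assumes "a \<in> X" "b \<in> X" "parcs b \<noteq> []" "ptgt a = psrc b" "pmul a b \<in> X"
  shows "\<exists>v. extends a v"
proof -
  obtain c p where c: "p \<in> X" "arrow c" "ptgt c = psrc p" "b = pmul c p"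
    using split_first[OF assms(2,3)] by blast
  have ac: "ptgt a = psrc c" using assms(4) c(4) by simp
  have "pmul a c \<in> X" using factor_X[OF assms(1) _ c(1) ac c(3)] c(2) assms(5) c(4) by simp
  then show ?thesis using ac c(2) unfolding extends_def by blast
qed

end

section \<open>Bimodules over an algebra with a basis of paths\<close>

lemma sum_rotate3:
  "(\<Sum>b\<in>B. \<Sum>c\<in>C. \<Sum>d\<in>D. f b c d) = (\<Sum>d\<in>D. \<Sum>b\<in>B. \<Sum>c\<in>C. f b c d)"
proof -
  have "(\<Sum>b\<in>B. \<Sum>c\<in>C. \<Sum>d\<in>D. f b c d) = (\<Sum>b\<in>B. \<Sum>d\<in>D. \<Sum>c\<in>C. f b c d)"
    by (rule sum.cong[OF refl], rule sum.swap)
  also have "\<dots> = (\<Sum>d\<in>D. \<Sum>b\<in>B. \<Sum>c\<in>C. f b c d)" by (rule sum.swap)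
  finally show ?thesis .
qed

lemma sum_rotate4:
  "(\<Sum>a\<in>A. \<Sum>b\<in>B. \<Sum>c\<in>C. \<Sum>d\<in>D. f a b c d) = (\<Sum>b\<in>B. \<Sum>c\<in>C. \<Sum>d\<in>D. \<Sum>a\<in>A. f a b c d)"
proof -
  have "(\<Sum>a\<in>A. \<Sum>b\<in>B. \<Sum>c\<in>C. \<Sum>d\<in>D. f a b c d) = (\<Sum>b\<in>B. \<Sum>a\<in>A. \<Sum>c\<in>C. \<Sum>d\<in>D. f a b c d)"
    by (rule sum.swap)
  also have "\<dots> = (\<Sum>b\<in>B. \<Sum>c\<in>C. \<Sum>a\<in>A. \<Sum>d\<in>D. f a b c d)"
    by (rule sum.cong[OF refl], rule sum.swap)
  also have "\<dots> = (\<Sum>b\<in>B. \<Sum>c\<in>C. \<Sum>d\<in>D. \<Sum>a\<in>A. f a b c d)"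
    by (rule sum.cong[OF refl], rule sum.cong[OF refl], rule sum.swap)
  finally show ?thesis .
qed

context path_basis
begin

section \<open>Coefficient functions and their convolution\<close>

definition unit_at :: "'z \<Rightarrow> 'z \<Rightarrow> 'k::field" where
  "unit_at z = (\<lambda>w. if w = z then 1 else 0)"

text \<open>The multiplication of the algebra in coordinates; products of paths that leave
  \<open>X\<close> are discarded.\<close>

definition conv :: "(('v,'e) qpath \<Rightarrow> 'k::field) \<Rightarrow> (('v,'e) qpath \<Rightarrow> 'k) \<Rightarrow> ('v,'e) qpath \<Rightarrow> 'k" where
  "conv \<phi> \<chi> \<gamma> = (if \<gamma> \<in> X then \<Sum>a\<in>X. \<Sum>b\<in>X.
     if ptgt a = psrc b \<and> pmul a b = \<gamma> then \<phi> a * \<chi> b else 0 else 0)"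

lemma conv_outside: "\<gamma> \<notin> X \<Longrightarrow> conv \<phi> \<chi> \<gamma> = 0"
  by (simp add: conv_def)

lemma conv_nonzero:
  assumes "conv \<phi> \<chi> \<gamma> \<noteq> 0"
  shows "\<gamma> \<in> X \<and> (\<exists>a\<in>X. \<exists>b\<in>X. ptgt a = psrc b \<and> pmul a b = \<gamma> \<and> \<phi> a \<noteq> 0 \<and> \<chi> b \<noteq> 0)"
proof -
  have X: "\<gamma> \<in> X" using assms by (auto simp: conv_def split: if_splits)
  then have *: "(\<Sum>a\<in>X. \<Sum>b\<in>X. if ptgt a = psrc b \<and> pmul a b = \<gamma> then \<phi> a * \<chi> b else 0) \<noteq> 0"
    using assms by (simp add: conv_def)
  obtain a where a: "a \<in> X" "(\<Sum>b\<in>X. if ptgt a = psrc b \<and> pmul a b = \<gamma> then \<phi> a * \<chi> b else 0) \<noteq> 0"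
    using sum.not_neutral_contains_not_neutral[OF *] by blast
  obtain b where b: "b \<in> X" "(if ptgt a = psrc b \<and> pmul a b = \<gamma> then \<phi> a * \<chi> b else 0) \<noteq> 0"
    using sum.not_neutral_contains_not_neutral[OF a(2)] by blast
  then show ?thesis using X a by (auto split: if_splits)
qed

lemma conv_add:
  "conv (\<lambda>p. \<phi> p + \<phi>' p) \<chi> \<gamma> = conv \<phi> \<chi> \<gamma> + conv \<phi>' \<chi> \<gamma>"
  "conv \<phi> (\<lambda>p. \<chi> p + \<chi>' p) \<gamma> = conv \<phi> \<chi> \<gamma> + conv \<phi> \<chi>' \<gamma>"
  unfolding conv_def by (auto simp: algebra_simps intro!: sum.cong simp flip: sum.distrib)

lemma conv_scale:
  "conv (\<lambda>p. k * \<phi> p) \<chi> \<gamma> = k * conv \<phi> \<chi> \<gamma>"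
  "conv \<phi> (\<lambda>p. k * \<chi> p) \<gamma> = k * conv \<phi> \<chi> \<gamma>"
  unfolding conv_def by (auto simp: sum_distrib_left algebra_simps intro!: sum.cong)

lemma conv_zero [simp]: "conv (\<lambda>_. 0) \<chi> \<gamma> = 0" "conv \<phi> (\<lambda>_. 0) \<gamma> = 0"
  by (simp_all add: conv_def cong: if_cong)

lemma conv_diff:
  "conv (\<lambda>p. \<phi> p - \<phi>' p) \<chi> \<gamma> = conv \<phi> \<chi> \<gamma> - conv \<phi>' \<chi> \<gamma>"
  "conv \<phi> (\<lambda>p. \<chi> p - \<chi>' p) \<gamma> = conv \<phi> \<chi> \<gamma> - conv \<phi> \<chi>' \<gamma>"
  using conv_add(1)[of "\<lambda>p. \<phi> p - \<phi>' p" \<phi>' \<chi> \<gamma>] conv_add(2)[of \<phi> "\<lambda>p. \<chi> p - \<chi>' p" \<chi>' \<gamma>]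
  by (simp_all add: algebra_simps)

lemma conv_unit_left:
  assumes "x \<in> X" "\<gamma> \<in> X"
  shows "conv (unit_at x) \<chi> \<gamma> = lact x \<chi> \<gamma>"
proof -
  have "conv (unit_at x) \<chi> \<gamma> = (\<Sum>a\<in>X. if a = x then
      (\<Sum>b\<in>X. if ptgt x = psrc b \<and> pmul x b = \<gamma> then \<chi> b else 0) else 0)"
    unfolding conv_def if_P[OF assms(2)]
    by (rule sum.cong[OF refl]) (simp add: unit_at_def cong: if_cong)
  also have "\<dots> = (\<Sum>b\<in>X. if ptgt x = psrc b \<and> pmul x b = \<gamma> then \<chi> b else 0)"
    using assms finite_X by (simp add: sum.delta')
  finally show ?thesis
    using finite_X by (simp add: lact_def sum.inter_filter flip: sum.If_cases)
qed

lemma conv_unit_right: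
  assumes "x \<in> X" "\<gamma> \<in> X"
  shows "conv \<chi> (unit_at x) \<gamma> = ract x \<chi> \<gamma>"
proof -
  have "conv \<chi> (unit_at x) \<gamma> = (\<Sum>a\<in>X. \<Sum>b\<in>X. if b = x then
      (if ptgt a = psrc x \<and> pmul a x = \<gamma> then \<chi> a else 0) else 0)"
    unfolding conv_def if_P[OF assms(2)]
    by (rule sum.cong[OF refl], rule sum.cong[OF refl]) (simp add: unit_at_def cong: if_cong)
  also have "\<dots> = (\<Sum>a\<in>X. if ptgt a = psrc x \<and> pmul a x = \<gamma> then \<chi> a else 0)"
    using assms finite_X by (simp add: sum.delta')
  finally show ?thesis
    using finite_X by (simp add: ract_def sum.inter_filter)
qed

text \<open>Both sides are the sum over composable triples with product \<gamma>. Discarding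
  intermediate products outside \<open>X\<close> loses nothing, as factors of a path in
  \<open>X\<close> lie in \<open>X\<close>.\<close>

lemma conv_assoc: "conv (conv \<phi> \<chi>) \<omega> \<gamma> = conv \<phi> (conv \<chi> \<omega>) \<gamma>"
proof (cases "\<gamma> \<in> X")
  case True
  let ?T = "\<lambda>a b c. if ptgt a = psrc b \<and> ptgt b = psrc c \<and> pmul a (pmul b c) = \<gamma> then \<phi> a * \<chi> b * \<omega> c else 0"
  have "conv (conv \<phi> \<chi>) \<omega> \<gamma> = (\<Sum>d\<in>X. \<Sum>c\<in>X. \<Sum>a\<in>X. \<Sum>b\<in>X.
      if ptgt d = psrc c \<and> pmul d c = \<gamma> \<and> ptgt a = psrc b \<and> pmul a b = d then \<phi> a * \<chi> b * \<omega> c else 0)"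
    using True by (auto simp: conv_def sum_distrib_right intro!: sum.cong cong: if_cong conj_cong)
  also have "\<dots> = (\<Sum>c\<in>X. \<Sum>a\<in>X. \<Sum>b\<in>X. \<Sum>d\<in>X.
      if ptgt d = psrc c \<and> pmul d c = \<gamma> \<and> ptgt a = psrc b \<and> pmul a b = d then \<phi> a * \<chi> b * \<omega> c else 0)"
    by (rule sum_rotate4)
  also have "\<dots> = (\<Sum>c\<in>X. \<Sum>a\<in>X. \<Sum>b\<in>X. ?T a b c)"
  proof (intro sum.cong refl)
    fix a b c assume abc: "c \<in> X" "a \<in> X" "b \<in> X"
    have "(\<Sum>d\<in>X. if ptgt d = psrc c \<and> pmul d c = \<gamma> \<and> ptgt a = psrc b \<and> pmul a b = d
        then \<phi> a * \<chi> b * \<omega> c else 0) = (\<Sum>d\<in>X. if d = pmul a b then ?T a b c else 0)"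
      by (intro sum.cong refl) (auto simp: pmul_assoc)
    also have "\<dots> = (if pmul a b \<in> X then ?T a b c else 0)"
      using finite_X by (simp add: sum.delta)
    also have "\<dots> = ?T a b c" using factor_X[of a b c] abc True by auto
    finally show "(\<Sum>d\<in>X. if ptgt d = psrc c \<and> pmul d c = \<gamma> \<and> ptgt a = psrc b \<and> pmul a b = d
        then \<phi> a * \<chi> b * \<omega> c else 0) = ?T a b c" .
  qed
  also have "\<dots> = (\<Sum>a\<in>X. \<Sum>b\<in>X. \<Sum>c\<in>X. ?T a b c)"
  proof -
    have "(\<Sum>c\<in>X. \<Sum>a\<in>X. \<Sum>b\<in>X. ?T a b c) = (\<Sum>a\<in>X. \<Sum>c\<in>X. \<Sum>b\<in>X. ?T a b c)" by (rule sum.swap)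
    also have "\<dots> = (\<Sum>a\<in>X. \<Sum>b\<in>X. \<Sum>c\<in>X. ?T a b c)" by (rule sum.cong[OF refl], rule sum.swap)
    finally show ?thesis .
  qed
  also have "\<dots> = (\<Sum>a\<in>X. \<Sum>b\<in>X. \<Sum>c\<in>X. \<Sum>d\<in>X.
      if ptgt a = psrc d \<and> pmul a d = \<gamma> \<and> ptgt b = psrc c \<and> pmul b c = d then \<phi> a * \<chi> b * \<omega> c else 0)"
  proof (intro sum.cong refl)
    fix a b c assume abc: "a \<in> X" "b \<in> X" "c \<in> X"
    have "(\<Sum>d\<in>X. if ptgt a = psrc d \<and> pmul a d = \<gamma> \<and> ptgt b = psrc c \<and> pmul b c = d
        then \<phi> a * \<chi> b * \<omega> c else 0) = (\<Sum>d\<in>X. if d = pmul b c then ?T a b c else 0)"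
      by (intro sum.cong refl) (auto simp: pmul_assoc)
    also have "\<dots> = (if pmul b c \<in> X then ?T a b c else 0)"
      using finite_X by (simp add: sum.delta)
    also have "\<dots> = ?T a b c" using factor_X[of a b c] abc True by auto
    finally show "?T a b c = (\<Sum>d\<in>X. if ptgt a = psrc d \<and> pmul a d = \<gamma> \<and> ptgt b = psrc c \<and> pmul b c = d
        then \<phi> a * \<chi> b * \<omega> c else 0)" by simp
  qed
  also have "\<dots> = (\<Sum>a\<in>X. \<Sum>d\<in>X. \<Sum>b\<in>X. \<Sum>c\<in>X.
      if ptgt a = psrc d \<and> pmul a d = \<gamma> \<and> ptgt b = psrc c \<and> pmul b c = d then \<phi> a * \<chi> b * \<omega> c else 0)"
    by (rule sum.cong[OF refl]) (rule sum_rotate3)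
  also have "\<dots> = conv \<phi> (conv \<chi> \<omega>) \<gamma>"
    using True by (auto simp: conv_def sum_distrib_left mult.assoc intro!: sum.cong cong: if_cong conj_cong)
  finally show ?thesis .
qed (simp add: conv_outside)

text \<open>The left action convolves in the first coordinate and the right action in the last, so
  they commute. This is \<open>lr_assoc\<close> for the bar bimodules.\<close>

lemma conv_swap:
  "conv (\<lambda>q'. conv \<phi> (\<lambda>p'. c p' q') p) \<chi> q = conv \<phi> (\<lambda>p'. conv (c p') \<chi> q) p"
proof (cases "p \<in> X \<and> q \<in> X")
  case True
  let ?P = "\<lambda>a b \<gamma>. ptgt a = psrc b \<and> pmul a b = \<gamma>"
  have "conv (\<lambda>q'. conv \<phi> (\<lambda>p'. c p' q') p) \<chi> q = (\<Sum>a\<in>X. \<Sum>b\<in>X. \<Sum>a'\<in>X. \<Sum>b'\<in>X.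
      if ?P a b q \<and> ?P a' b' p then \<phi> a' * c b' a * \<chi> b else 0)"
    using True by (auto simp: conv_def sum_distrib_right intro!: sum.cong cong: if_cong conj_cong)
  also have "\<dots> = (\<Sum>a'\<in>X. \<Sum>b'\<in>X. \<Sum>a\<in>X. \<Sum>b\<in>X.
      if ?P a b q \<and> ?P a' b' p then \<phi> a' * c b' a * \<chi> b else 0)"
    by (subst sum_rotate4, rule sum_rotate4)
  also have "\<dots> = conv \<phi> (\<lambda>p'. conv (c p') \<chi> q) p"
    using True by (auto simp: conv_def sum_distrib_left mult.assoc intro!: sum.cong cong: if_cong conj_cong)
  finally show ?thesis .
qed (auto simp: conv_outside)

definition unit_coef :: "('v,'e) qpath \<Rightarrow> 'k::field" where
  "unit_coef p = (if p \<in> X \<and> parcs p = [] then 1 else 0)"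

lemma conv_one_left:
  assumes "\<And>p. \<phi> p \<noteq> 0 \<Longrightarrow> p \<in> X"
  shows "conv unit_coef \<phi> \<gamma> = \<phi> \<gamma>"
proof (cases "\<gamma> \<in> X")
  case True
  have "conv unit_coef \<phi> \<gamma> = (\<Sum>a\<in>X. \<Sum>b\<in>X. if a = pid (psrc \<gamma>) \<and> b = \<gamma> then \<phi> \<gamma> else 0)"
  proof -
    have "(if ptgt a = psrc b \<and> pmul a b = \<gamma> then unit_coef a * \<phi> b else 0)
      = (if a = pid (psrc \<gamma>) \<and> b = \<gamma> then \<phi> \<gamma> else 0)" if "a \<in> X" "b \<in> X" for a b
    proof (cases "parcs a = []")
      case True
      then have "a = pid (psrc a)" using trivial_qpath[of a] that X_subset by auto
      then have "ptgt a = psrc b \<Longrightarrow> pmul a b = b" "a = pid (psrc b) \<longleftrightarrow> ptgt a = psrc b"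
        by (metis pmul_pid(1) snd_conv, metis snd_conv)
      then show ?thesis using that True by (auto simp: unit_coef_def)
    next
      case False
      then have "a \<noteq> pid (psrc \<gamma>)" by (metis fst_conv snd_conv)
      then show ?thesis using False by (simp add: unit_coef_def)
    qed
    then show ?thesis using \<open>\<gamma> \<in> X\<close> by (auto simp: conv_def intro!: sum.cong)
  qed
  also have "\<dots> = (\<Sum>a\<in>X. if a = pid (psrc \<gamma>) then \<phi> \<gamma> else 0)"
    using finite_X True by (intro sum.cong refl) (auto simp: sum.delta)
  also have "\<dots> = \<phi> \<gamma>" using finite_X True pid_in_X[of \<gamma>] by (simp add: sum.delta)
  finally show ?thesis .
next
  case False
  then have "\<phi> \<gamma> = 0" using assms by blast
  then show ?thesis using False by (simp add: conv_outside)
qed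

lemma conv_one_right:
  assumes "\<And>p. \<phi> p \<noteq> 0 \<Longrightarrow> p \<in> X"
  shows "conv \<phi> unit_coef \<gamma> = \<phi> \<gamma>"
proof (cases "\<gamma> \<in> X")
  case True
  have "conv \<phi> unit_coef \<gamma> = (\<Sum>a\<in>X. \<Sum>b\<in>X. if b = pid (ptgt \<gamma>) \<and> a = \<gamma> then \<phi> \<gamma> else 0)"
  proof -
    have "(if ptgt a = psrc b \<and> pmul a b = \<gamma> then \<phi> a * unit_coef b else 0)
      = (if b = pid (ptgt \<gamma>) \<and> a = \<gamma> then \<phi> \<gamma> else 0)" if "a \<in> X" "b \<in> X" for a b
    proof (cases "parcs b = []")
      case True
      then have "b = pid (ptgt b)" using trivial_qpath[of b] that X_subset by auto
      then have "ptgt a = psrc b \<Longrightarrow> pmul a b = a" "b = pid (ptgt a) \<longleftrightarrow> ptgt a = psrc b"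
        by (metis pmul_pid(2) fst_conv, metis fst_conv)
      then show ?thesis using that True by (auto simp: unit_coef_def)
    next
      case False
      then have "b \<noteq> pid (ptgt \<gamma>)" by (metis fst_conv snd_conv)
      then show ?thesis using False by (simp add: unit_coef_def)
    qed
    then show ?thesis using \<open>\<gamma> \<in> X\<close> by (auto simp: conv_def intro!: sum.cong)
  qed
  also have "\<dots> = (\<Sum>a\<in>X. if a = \<gamma> then \<phi> \<gamma> else 0)"
    using finite_X True pid_in_X[of \<gamma>] by (intro sum.cong refl) (auto simp: sum.delta)
  also have "\<dots> = \<phi> \<gamma>" using finite_X True by (simp add: sum.delta)
  finally show ?thesis .
next
  case False
  then have "\<phi> \<gamma> = 0" using assms by blast
  then show ?thesis using False by (simp add: conv_outside)
qed

end

text \<open>The algebra enters only through its coordinates. Its ring laws are not assumed but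
  recovered from those of \<open>conv\<close> by injectivity of \<open>coef\<close>.\<close>

locale coord_algebra = path_basis Q X for Q :: "('v,'e) pre_digraph" and X +
  fixes A :: "('k::field, 'a) module" and coef :: "'a \<Rightarrow> ('v,'e) qpath \<Rightarrow> 'k"
  assumes coef_inj: "inj_on coef (carrier A)"
    and coef_image: "coef ` carrier A = {\<phi>. \<forall>p. \<phi> p \<noteq> 0 \<longrightarrow> p \<in> X}"
    and A_closed: "\<lbrakk>a \<in> carrier A; b \<in> carrier A\<rbrakk> \<Longrightarrow> a \<otimes>\<^bsub>A\<^esub> b \<in> carrier A"
      "\<lbrakk>a \<in> carrier A; b \<in> carrier A\<rbrakk> \<Longrightarrow> a \<oplus>\<^bsub>A\<^esub> b \<in> carrier A"
      "a \<in> carrier A \<Longrightarrow> k \<odot>\<^bsub>A\<^esub> a \<in> carrier A" "\<one>\<^bsub>A\<^esub> \<in> carrier A" "\<zero>\<^bsub>A\<^esub> \<in> carrier A"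
    and coef_ops: "\<lbrakk>a \<in> carrier A; b \<in> carrier A\<rbrakk> \<Longrightarrow> coef (a \<otimes>\<^bsub>A\<^esub> b) = conv (coef a) (coef b)"
      "\<lbrakk>a \<in> carrier A; b \<in> carrier A\<rbrakk> \<Longrightarrow> coef (a \<oplus>\<^bsub>A\<^esub> b) = (\<lambda>p. coef a p + coef b p)"
      "a \<in> carrier A \<Longrightarrow> coef (k \<odot>\<^bsub>A\<^esub> a) = (\<lambda>p. k * coef a p)"
      "coef \<one>\<^bsub>A\<^esub> = unit_coef" "coef \<zero>\<^bsub>A\<^esub> = (\<lambda>_. 0)"
begin

lemma coef_outside: "a \<in> carrier A \<Longrightarrow> coef a p \<noteq> 0 \<Longrightarrow> p \<in> X"
  using coef_image by blast

lemma coef_eqI: "a \<in> carrier A \<Longrightarrow> b \<in> carrier A \<Longrightarrow> (\<And>p. coef a p = coef b p) \<Longrightarrow> a = b"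
  using coef_inj by (meson ext inj_onD)

definition emb :: "(('v,'e) qpath \<Rightarrow> 'k) \<Rightarrow> 'a" where
  "emb \<phi> = inv_into (carrier A) coef \<phi>"

lemma emb:
  assumes "\<And>p. \<phi> p \<noteq> 0 \<Longrightarrow> p \<in> X"
  shows "emb \<phi> \<in> carrier A" "coef (emb \<phi>) = \<phi>"
proof -
  have "\<phi> \<in> coef ` carrier A" using assms coef_image by auto
  then show "emb \<phi> \<in> carrier A" "coef (emb \<phi>) = \<phi>"
    unfolding emb_def by (auto intro: inv_into_into f_inv_into_f)
qed

definition bas :: "('v,'e) qpath \<Rightarrow> 'a" where "bas p = emb (unit_at p)"

lemma bas: "p \<in> X \<Longrightarrow> bas p \<in> carrier A" "p \<in> X \<Longrightarrow> coef (bas p) = unit_at p"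
  unfolding bas_def by (rule emb; auto simp: unit_at_def split: if_splits)+

lemma bimodule_regular: "bimodule A (regular_bimodule A)"
proof (intro bimodule.intro bimodule_axioms.intro)
  show "abelian_group (regular_bimodule A)"
  proof (rule abelian_groupI)
    fix a assume a: "a \<in> carrier (regular_bimodule A)"
    let ?b = "(- 1) \<odot>\<^bsub>A\<^esub> a"
    have "?b \<oplus>\<^bsub>A\<^esub> a = \<zero>\<^bsub>A\<^esub>" using a
      by (intro coef_eqI) (auto simp: regular_bimodule_def A_closed coef_ops)
    then show "\<exists>b\<in>carrier (regular_bimodule A). b \<oplus>\<^bsub>regular_bimodule A\<^esub> a = \<zero>\<^bsub>regular_bimodule A\<^esub>"
      using a A_closed(3) by (auto simp: regular_bimodule_def)
  qed (auto simp: regular_bimodule_def A_closed coef_ops intro!: coef_eqI A_closed)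
qed (auto simp: regular_bimodule_def A_closed coef_ops conv_add conv_assoc conv_one_left conv_one_right
    conv_scale coef_outside intro!: coef_eqI A_closed)

lemma alg_induct [consumes 1, case_names zero add basis]:
  assumes "a \<in> carrier A" and "P \<zero>\<^bsub>A\<^esub>"
    and add: "\<And>a b. \<lbrakk>a \<in> carrier A; b \<in> carrier A; P a; P b\<rbrakk> \<Longrightarrow> P (a \<oplus>\<^bsub>A\<^esub> b)"
    and basis: "\<And>k p. p \<in> X \<Longrightarrow> P (k \<odot>\<^bsub>A\<^esub> bas p)"
  shows "P a"
proof -
  have "finite S \<Longrightarrow> S \<subseteq> X \<Longrightarrow> \<forall>a\<in>carrier A. (\<forall>p. coef a p \<noteq> 0 \<longrightarrow> p \<in> S) \<longrightarrow> P a" for S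
  proof (induction S rule: finite_induct)
    case empty
    have "a = \<zero>\<^bsub>A\<^esub>" if "a \<in> carrier A" "\<forall>p. coef a p \<noteq> 0 \<longrightarrow> p \<in> {}" for a
      using that by (intro coef_eqI) (auto simp: A_closed coef_ops)
    then show ?case using assms(2) by auto
  next
    case (insert x S)
    show ?case
    proof (intro ballI impI)
      fix a assume a: "a \<in> carrier A" "\<forall>p. coef a p \<noteq> 0 \<longrightarrow> p \<in> insert x S"
      define b where "b = emb ((coef a)(x := 0))"
      have b: "b \<in> carrier A" "coef b = (coef a)(x := 0)"
        unfolding b_def by (rule emb; use a coef_outside in \<open>auto split: if_splits\<close>)+
      have "x \<in> X" using insert by auto
      then have "a = (coef a x \<odot>\<^bsub>A\<^esub> bas x) \<oplus>\<^bsub>A\<^esub> b"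
        using a b by (intro coef_eqI) (auto simp: A_closed coef_ops bas unit_at_def)
      moreover have "\<forall>p. coef b p \<noteq> 0 \<longrightarrow> p \<in> S" using a b by auto
      then have "P b" using insert b(1) by blast
      ultimately show "P a" using add[of "coef a x \<odot>\<^bsub>A\<^esub> bas x" b] basis \<open>x \<in> X\<close> b(1) A_closed bas by metis
    qed
  qed
  from this[OF finite_X] show ?thesis using assms(1) coef_outside by auto
qed

lemma bas_mult:
  assumes "p \<in> X" "q \<in> X"
  shows "bas p \<otimes>\<^bsub>A\<^esub> bas q = (if ptgt p = psrc q \<and> pmul p q \<in> X then bas (pmul p q) else \<zero>\<^bsub>A\<^esub>)"
proof (rule coef_eqI)
  fix \<gamma>
  show "coef (bas p \<otimes>\<^bsub>A\<^esub> bas q) \<gamma> = coef (if ptgt p = psrc q \<and> pmul p q \<in> X then bas (pmul p q) else \<zero>\<^bsub>A\<^esub>) \<gamma>"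
  proof (cases "\<gamma> \<in> X")
    case True
    have 1: "coef (bas p \<otimes>\<^bsub>A\<^esub> bas q) \<gamma> = lact p (unit_at q) \<gamma>"
      using assms True by (simp add: coef_ops bas conv_unit_left)
    from lact_cases[of p \<gamma> "unit_at q :: _ \<Rightarrow> 'k"]
    consider b where "b \<in> X" "ptgt p = psrc b" "\<gamma> = pmul p b" "lact p (unit_at q :: _ \<Rightarrow> 'k) \<gamma> = unit_at q b"
      | "\<not> (\<exists>b\<in>X. ptgt p = psrc b \<and> \<gamma> = pmul p b)" "lact p (unit_at q :: _ \<Rightarrow> 'k) \<gamma> = 0" by blast
    then show ?thesis
    proof cases
      case 1
      have "b = q \<longleftrightarrow> ptgt p = psrc q \<and> pmul p b = pmul p q"
        using pmul_cancel_left[of p b q] 1 by auto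
      then show ?thesis
        using 1 \<open>coef (bas p \<otimes>\<^bsub>A\<^esub> bas q) \<gamma> = lact p (unit_at q) \<gamma>\<close> True
        by (auto simp: bas coef_ops unit_at_def)
    next
      case 2
      then have "\<not> (ptgt p = psrc q \<and> \<gamma> = pmul p q)" using assms by blast
      then show ?thesis using 1 2 by (auto simp: bas coef_ops unit_at_def)
    qed
  qed (auto simp: coef_ops bas assms conv_outside unit_at_def)
qed (use assms in \<open>auto simp: A_closed bas\<close>)

text \<open>The bimodule record has no scalar multiplication of its own for the field, so scalars
  act through their images in the algebra.\<close>

definition sm :: "('a, 'm) bimod \<Rightarrow> 'k \<Rightarrow> 'm \<Rightarrow> 'm" where
  "sm M k x = (k \<odot>\<^bsub>A\<^esub> \<one>\<^bsub>A\<^esub>) \<odot>\<^bsub>M\<^esub> x"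

lemma scalar_central: "a \<in> carrier A \<Longrightarrow> (k \<odot>\<^bsub>A\<^esub> \<one>\<^bsub>A\<^esub>) \<otimes>\<^bsub>A\<^esub> a = k \<odot>\<^bsub>A\<^esub> a"
  "a \<in> carrier A \<Longrightarrow> a \<otimes>\<^bsub>A\<^esub> (k \<odot>\<^bsub>A\<^esub> \<one>\<^bsub>A\<^esub>) = k \<odot>\<^bsub>A\<^esub> a"
  by (rule coef_eqI; simp add: A_closed coef_ops conv_scale conv_one_left conv_one_right coef_outside)+

section \<open>Scalars and zero in a bimodule\<close>

context
  fixes M :: "('a, 'm) bimod"
  assumes M: "bimodule A M"
begin

interpretation bimodule A M by (rule M)

lemma sm_closed: "x \<in> carrier M \<Longrightarrow> sm M k x \<in> carrier M"
  by (simp add: sm_def l_closed A_closed)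

lemma sm_add: "\<lbrakk>x \<in> carrier M; y \<in> carrier M\<rbrakk> \<Longrightarrow> sm M k (x \<oplus>\<^bsub>M\<^esub> y) = sm M k x \<oplus>\<^bsub>M\<^esub> sm M k y"
  by (simp add: sm_def l_distr_mod A_closed)

lemma sm_add_scalar: "x \<in> carrier M \<Longrightarrow> sm M (k + l) x = sm M k x \<oplus>\<^bsub>M\<^esub> sm M l x"
proof -
  assume x: "x \<in> carrier M"
  have "(k + l) \<odot>\<^bsub>A\<^esub> \<one>\<^bsub>A\<^esub> = (k \<odot>\<^bsub>A\<^esub> \<one>\<^bsub>A\<^esub>) \<oplus>\<^bsub>A\<^esub> (l \<odot>\<^bsub>A\<^esub> \<one>\<^bsub>A\<^esub>)"
    by (rule coef_eqI) (auto simp: A_closed coef_ops algebra_simps)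
  then show ?thesis using x by (simp add: sm_def l_distr_ring A_closed)
qed

lemma sm_sm: "x \<in> carrier M \<Longrightarrow> sm M k (sm M l x) = sm M (k * l) x"
proof -
  assume x: "x \<in> carrier M"
  have "(k * l) \<odot>\<^bsub>A\<^esub> \<one>\<^bsub>A\<^esub> = (k \<odot>\<^bsub>A\<^esub> \<one>\<^bsub>A\<^esub>) \<otimes>\<^bsub>A\<^esub> (l \<odot>\<^bsub>A\<^esub> \<one>\<^bsub>A\<^esub>)"
    by (rule coef_eqI) (auto simp: A_closed coef_ops scalar_central)
  then show ?thesis using x by (simp add: sm_def l_assoc A_closed)
qed

lemma sm_one: "x \<in> carrier M \<Longrightarrow> sm M 1 x = x"
proof -
  assume x: "x \<in> carrier M"
  have "1 \<odot>\<^bsub>A\<^esub> \<one>\<^bsub>A\<^esub> = \<one>\<^bsub>A\<^esub>" by (rule coef_eqI) (auto simp: A_closed coef_ops)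
  then show ?thesis using x by (simp add: sm_def l_unit)
qed

lemma smult_zero: "a \<in> carrier A \<Longrightarrow> a \<odot>\<^bsub>M\<^esub> \<zero>\<^bsub>M\<^esub> = \<zero>\<^bsub>M\<^esub>"
  using l_distr_mod[of a "\<zero>\<^bsub>M\<^esub>" "\<zero>\<^bsub>M\<^esub>"] l_closed[of a "\<zero>\<^bsub>M\<^esub>"] by simp

lemma rsmult_zero: "a \<in> carrier A \<Longrightarrow> \<zero>\<^bsub>M\<^esub> \<diamondop>\<^bsub>M\<^esub> a = \<zero>\<^bsub>M\<^esub>"
  using r_distr_mod[of a "\<zero>\<^bsub>M\<^esub>" "\<zero>\<^bsub>M\<^esub>"] r_closed[of a "\<zero>\<^bsub>M\<^esub>"] by simp

lemma zero_smult: "x \<in> carrier M \<Longrightarrow> \<zero>\<^bsub>A\<^esub> \<odot>\<^bsub>M\<^esub> x = \<zero>\<^bsub>M\<^esub>"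
proof -
  assume x: "x \<in> carrier M"
  have "\<zero>\<^bsub>A\<^esub> \<oplus>\<^bsub>A\<^esub> \<zero>\<^bsub>A\<^esub> = \<zero>\<^bsub>A\<^esub>" by (rule coef_eqI) (auto simp: A_closed coef_ops)
  then show ?thesis
    using l_distr_ring[of "\<zero>\<^bsub>A\<^esub>" "\<zero>\<^bsub>A\<^esub>" x] l_closed[of "\<zero>\<^bsub>A\<^esub>" x] x A_closed by simp
qed

lemma zero_rsmult: "x \<in> carrier M \<Longrightarrow> x \<diamondop>\<^bsub>M\<^esub> \<zero>\<^bsub>A\<^esub> = \<zero>\<^bsub>M\<^esub>"
proof -
  assume x: "x \<in> carrier M"
  have "\<zero>\<^bsub>A\<^esub> \<oplus>\<^bsub>A\<^esub> \<zero>\<^bsub>A\<^esub> = \<zero>\<^bsub>A\<^esub>" by (rule coef_eqI) (auto simp: A_closed coef_ops)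
  then show ?thesis
    using r_distr_ring[of "\<zero>\<^bsub>A\<^esub>" "\<zero>\<^bsub>A\<^esub>" x] r_closed[of "\<zero>\<^bsub>A\<^esub>" x] x A_closed by simp
qed

lemma sm_zero: "sm M k \<zero>\<^bsub>M\<^esub> = \<zero>\<^bsub>M\<^esub>"
  by (simp add: sm_def smult_zero A_closed)

lemma sm_zero_scalar: "x \<in> carrier M \<Longrightarrow> sm M 0 x = \<zero>\<^bsub>M\<^esub>"
proof -
  assume x: "x \<in> carrier M"
  have "0 \<odot>\<^bsub>A\<^esub> \<one>\<^bsub>A\<^esub> = \<zero>\<^bsub>A\<^esub>" by (rule coef_eqI) (auto simp: A_closed coef_ops)
  then show ?thesis using x by (simp add: sm_def zero_smult)
qed

lemma sm_minus: "x \<in> carrier M \<Longrightarrow> sm M (- 1) x = \<ominus>\<^bsub>M\<^esub> x"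
  using sm_add_scalar[of x "-1" 1] sm_zero_scalar[of x] sm_one[of x] sm_closed[of x "-1"]
  by (simp add: M.minus_equality)

lemma smult_sm: "\<lbrakk>a \<in> carrier A; x \<in> carrier M\<rbrakk> \<Longrightarrow> a \<odot>\<^bsub>M\<^esub> sm M k x = sm M k (a \<odot>\<^bsub>M\<^esub> x)"
  by (simp add: sm_def A_closed scalar_central flip: l_assoc)

lemma rsmult_sm: "\<lbrakk>a \<in> carrier A; x \<in> carrier M\<rbrakk> \<Longrightarrow> sm M k x \<diamondop>\<^bsub>M\<^esub> a = sm M k (x \<diamondop>\<^bsub>M\<^esub> a)"
  by (simp add: sm_def A_closed lr_assoc)

lemma scaled_smult: "\<lbrakk>a \<in> carrier A; x \<in> carrier M\<rbrakk> \<Longrightarrow> (k \<odot>\<^bsub>A\<^esub> a) \<odot>\<^bsub>M\<^esub> x = sm M k (a \<odot>\<^bsub>M\<^esub> x)"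
  by (simp add: sm_def A_closed scalar_central flip: l_assoc)

lemma scaled_rsmult: "\<lbrakk>a \<in> carrier A; x \<in> carrier M\<rbrakk> \<Longrightarrow> x \<diamondop>\<^bsub>M\<^esub> (k \<odot>\<^bsub>A\<^esub> a) = sm M k (x \<diamondop>\<^bsub>M\<^esub> a)"
  unfolding sm_def using scalar_central(2)[of a k] r_assoc[of a "k \<odot>\<^bsub>A\<^esub> \<one>\<^bsub>A\<^esub>" x]
    scalars_central[of "x \<diamondop>\<^bsub>M\<^esub> a" k] by (simp add: A_closed r_closed)

end

end

section \<open>The relative bar resolution\<close>

text \<open>\<Lambda> is linear on \<open>C\<close> only, so membership in \<open>C\<close> has to
  be carried through the induction together with linearity.\<close>

lemma merges_fun_linear:
  fixes \<Lambda> :: "('z \<Rightarrow> 'k::ab_group_add) \<Rightarrow> 'l::ab_group_add"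
  assumes g: "\<And>u. g u \<in> C"
    and C: "\<And>a b. a \<in> C \<Longrightarrow> b \<in> C \<Longrightarrow> (\<lambda>w. a w - b w) \<in> C"
    and \<Lambda>: "\<And>a b. a \<in> C \<Longrightarrow> b \<in> C \<Longrightarrow> \<Lambda> (\<lambda>w. a w - b w) = \<Lambda> a - \<Lambda> b"
  shows "(\<lambda>w. merges (\<lambda>u. g u w) t) \<in> C \<and>
    \<Lambda> (\<lambda>w. merges (\<lambda>u. g u w) t) = merges (\<lambda>u. \<Lambda> (g u)) t"
proof -
  have z: "(\<lambda>_. 0) \<in> C" "\<Lambda> (\<lambda>_. 0) = 0" using C[OF g[of t] g[of t]] \<Lambda>[OF g[of t] g[of t]] by simp_all
  have n: "(\<lambda>w. - a w) \<in> C" "\<Lambda> (\<lambda>w. - a w) = - \<Lambda> a" if "a \<in> C" for a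
    using C[OF z(1) that] \<Lambda>[OF z(1) that] z(2) by simp_all
  show ?thesis
    using g
  proof (induction "\<lambda>u. \<Lambda> (g u)" t arbitrary: g rule: merges.induct)
    case (3 x y r)
    have 1: "(\<lambda>w. merges (\<lambda>u. g (x # u) w) (y # r)) \<in> C \<and>
      \<Lambda> (\<lambda>w. merges (\<lambda>u. g (x # u) w) (y # r)) = merges (\<lambda>u. \<Lambda> (g (x # u))) (y # r)"
      using 3(1)[of "\<lambda>u. g (x # u)"] 3(2) by simp
    show ?case using 1 n[OF 3(2)[of "pmul x y # r"]] C[OF n(1)[OF 3(2)[of "pmul x y # r"]], of "\<lambda>w. merges (\<lambda>u. g (x # u) w) (y # r)"]
      \<Lambda>[OF n(1)[OF 3(2)[of "pmul x y # r"]], of "\<lambda>w. merges (\<lambda>u. g (x # u) w) (y # r)"]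
      by simp
  qed (simp_all add: z)
qed

context coord_algebra
begin

text \<open>\<open>bimodule_hom\<close> without extensionality: composites and sums given by plain
  lambda terms are members without being restricted.\<close>

definition hm :: "('a, 'm) bimod \<Rightarrow> ('a, 'n) bimod \<Rightarrow> ('m \<Rightarrow> 'n) set" where
  "hm M N = {f. (\<forall>x\<in>carrier M. f x \<in> carrier N) \<and>
     (\<forall>x\<in>carrier M. \<forall>y\<in>carrier M. f (x \<oplus>\<^bsub>M\<^esub> y) = f x \<oplus>\<^bsub>N\<^esub> f y) \<and>
     (\<forall>a\<in>carrier A. \<forall>x\<in>carrier M.
        f (a \<odot>\<^bsub>M\<^esub> x) = a \<odot>\<^bsub>N\<^esub> f x \<and> f (x \<diamondop>\<^bsub>M\<^esub> a) = f x \<diamondop>\<^bsub>N\<^esub> a)}"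

lemma hmD:
  assumes "f \<in> hm M N"
  shows "x \<in> carrier M \<Longrightarrow> f x \<in> carrier N"
    "x \<in> carrier M \<Longrightarrow> y \<in> carrier M \<Longrightarrow> f (x \<oplus>\<^bsub>M\<^esub> y) = f x \<oplus>\<^bsub>N\<^esub> f y"
    "a \<in> carrier A \<Longrightarrow> x \<in> carrier M \<Longrightarrow> f (a \<odot>\<^bsub>M\<^esub> x) = a \<odot>\<^bsub>N\<^esub> f x"
    "a \<in> carrier A \<Longrightarrow> x \<in> carrier M \<Longrightarrow> f (x \<diamondop>\<^bsub>M\<^esub> a) = f x \<diamondop>\<^bsub>N\<^esub> a"
    "x \<in> carrier M \<Longrightarrow> f (sm M k x) = sm N k (f x)"
  using assms by (auto simp: hm_def sm_def A_closed)

lemma hm_zero: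
  assumes "f \<in> hm M N" "bimodule A M" "bimodule A N" shows "f \<zero>\<^bsub>M\<^esub> = \<zero>\<^bsub>N\<^esub>"
proof -
  interpret M: bimodule A M by fact
  interpret N: bimodule A N by fact
  show ?thesis using hmD(2)[OF assms(1), of "\<zero>\<^bsub>M\<^esub>" "\<zero>\<^bsub>M\<^esub>"] hmD(1)[OF assms(1), of "\<zero>\<^bsub>M\<^esub>"] by simp
qed

lemma hm_comp: "f \<in> hm M N \<Longrightarrow> g \<in> hm N L \<Longrightarrow> (\<lambda>x. g (f x)) \<in> hm M L"
  by (auto simp: hm_def)

lemma hm_add_scaled:
  assumes "f \<in> hm M N" "g \<in> hm M N" "bimodule A N"
  shows "(\<lambda>x. f x \<oplus>\<^bsub>N\<^esub> sm N k (g x)) \<in> hm M N"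
proof -
  interpret N: bimodule A N by fact
  note sm = sm_closed[OF assms(3)] sm_add[OF assms(3)] smult_sm[OF assms(3)] rsmult_sm[OF assms(3)]
  show ?thesis
    unfolding hm_def
    by (simp add: hmD[OF assms(1)] hmD[OF assms(2)] sm N.l_distr_mod N.r_distr_mod N.a_ac)
qed

text \<open>Linear forms reduce identities between boundaries to identities of scalars, one term at
  a time.\<close>

definition functional :: "('a, 'm) bimod \<Rightarrow> ('m \<Rightarrow> 'k) \<Rightarrow> bool" where
  "functional M \<Lambda> \<longleftrightarrow> (\<forall>x\<in>carrier M. \<forall>y\<in>carrier M. \<Lambda> (x \<oplus>\<^bsub>M\<^esub> y) = \<Lambda> x + \<Lambda> y)
     \<and> (\<forall>x\<in>carrier M. \<forall>k. \<Lambda> (sm M k x) = k * \<Lambda> x)"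

text \<open>The triple \<open>(p, [t\<^sub>1, \<dots>, t\<^sub>n], q)\<close> stands for \<open>p \<otimes> t\<^sub>1 \<otimes> \<dots> \<otimes> t\<^sub>n \<otimes> q\<close> in the term of degree \<open>n\<close> of the
  normalized bar resolution, with tensor products over the span of the vertices.\<close>

definition bar_basis :: "nat \<Rightarrow> (('v,'e) qpath \<times> ('v,'e) qpath list \<times> ('v,'e) qpath) set" where
  "bar_basis n = {(p, t, q). p \<in> X \<and> q \<in> X \<and> t \<in> tuples n \<and>
     (if t = [] then ptgt p = psrc q else ptgt p = psrc (hd t) \<and> ptgt (last t) = psrc q)}"

definition bar :: "nat \<Rightarrow> ('a, ('v,'e) qpath \<times> ('v,'e) qpath list \<times> ('v,'e) qpath \<Rightarrow> 'k) bimod" where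
  "bar n = \<lparr>carrier = {c. \<forall>z. c z \<noteq> 0 \<longrightarrow> z \<in> bar_basis n}, monoid.mult = (\<lambda>_ _ _. 0), one = (\<lambda>_. 0),
     zero = (\<lambda>_. 0), add = (\<lambda>c c' z. c z + c' z),
     module.smult = (\<lambda>a c (p, t, q). conv (coef a) (\<lambda>p'. c (p', t, q)) p),
     rsmult = (\<lambda>c a (p, t, q). conv (\<lambda>q'. c (p, t, q')) (coef a) q)\<rparr>"

lemma bar_simps [simp]:
  "c \<in> carrier (bar n) \<longleftrightarrow> (\<forall>z. c z \<noteq> 0 \<longrightarrow> z \<in> bar_basis n)"
  "\<zero>\<^bsub>bar n\<^esub> = (\<lambda>_. 0)"
  "c \<oplus>\<^bsub>bar n\<^esub> c' = (\<lambda>z. c z + c' z)"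
  "a \<odot>\<^bsub>bar n\<^esub> c = (\<lambda>(p, t, q). conv (coef a) (\<lambda>p'. c (p', t, q)) p)"
  "c \<diamondop>\<^bsub>bar n\<^esub> a = (\<lambda>(p, t, q). conv (\<lambda>q'. c (p, t, q')) (coef a) q)"
  by (simp_all add: bar_def)

lemma bar_basis_X: "(p, t, q) \<in> bar_basis n \<Longrightarrow> p \<in> X \<and> q \<in> X \<and> t \<in> tuples n"
  by (auto simp: bar_basis_def)

lemma finite_bar_basis: "finite (bar_basis n)"
  by (rule finite_subset[of _ "X \<times> tuples n \<times> X"]) (auto simp: bar_basis_def finite_X finite_tuples)

lemma bimodule_bar: "bimodule A (bar n)"
proof (intro bimodule.intro bimodule_axioms.intro)
  show "abelian_group (bar n)"
  proof (rule abelian_groupI)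
    fix c assume "c \<in> carrier (bar n)"
    then show "\<exists>b\<in>carrier (bar n). b \<oplus>\<^bsub>bar n\<^esub> c = \<zero>\<^bsub>bar n\<^esub>"
      by (intro bexI[of _ "\<lambda>z. - c z"]) auto
  next
    fix x y assume "x \<in> carrier (bar n)" "y \<in> carrier (bar n)"
    then show "x \<oplus>\<^bsub>bar n\<^esub> y \<in> carrier (bar n)" by (auto) (metis add.right_neutral)
  qed (auto simp: algebra_simps)
next
  fix a x assume "a \<in> carrier A" and x: "x \<in> carrier (bar n)"
  show "a \<odot>\<^bsub>bar n\<^esub> x \<in> carrier (bar n)"
  proof (clarsimp)
    fix p u q assume "conv (coef a) (\<lambda>p'. x (p', u, q)) p \<noteq> 0"
    then obtain c b where "p \<in> X" "ptgt c = psrc b" "pmul c b = p" "x (b, u, q) \<noteq> 0"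
      using conv_nonzero by blast
    moreover from this have "(b, u, q) \<in> bar_basis n" using x by auto
    ultimately show "(p, u, q) \<in> bar_basis n" by (auto simp: bar_basis_def)
  qed
  show "x \<diamondop>\<^bsub>bar n\<^esub> a \<in> carrier (bar n)"
  proof (clarsimp)
    fix p u q assume "conv (\<lambda>q'. x (p, u, q')) (coef a) q \<noteq> 0"
    then obtain c b where "q \<in> X" "ptgt c = psrc b" "pmul c b = q" "x (p, u, c) \<noteq> 0"
      using conv_nonzero by blast
    moreover from this have "(p, u, c) \<in> bar_basis n" using x by auto
    ultimately show "(p, u, q) \<in> bar_basis n" by (auto simp: bar_basis_def)
  qed
next
  fix x assume x: "x \<in> carrier (bar n)"
  have *: "\<And>t q p. x (p, t, q) \<noteq> 0 \<Longrightarrow> p \<in> X" "\<And>t q p. x (p, t, q) \<noteq> 0 \<Longrightarrow> q \<in> X"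
    using x bar_basis_X by auto
  show "\<one>\<^bsub>A\<^esub> \<odot>\<^bsub>bar n\<^esub> x = x" "x \<diamondop>\<^bsub>bar n\<^esub> \<one>\<^bsub>A\<^esub> = x"
    by (auto simp: coef_ops conv_one_left conv_one_right *)
  fix k
  show "(k \<odot>\<^bsub>A\<^esub> \<one>\<^bsub>A\<^esub>) \<odot>\<^bsub>bar n\<^esub> x = x \<diamondop>\<^bsub>bar n\<^esub> (k \<odot>\<^bsub>A\<^esub> \<one>\<^bsub>A\<^esub>)"
    by (auto simp: coef_ops A_closed conv_scale conv_one_left conv_one_right *)
qed (auto simp: coef_ops conv_add conv_assoc conv_swap)

lemma sm_bar: "c \<in> carrier (bar n) \<Longrightarrow> sm (bar n) k c = (\<lambda>z. k * c z)"
proof -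
  assume c: "c \<in> carrier (bar n)"
  have *: "\<And>t q p. c (p, t, q) \<noteq> 0 \<Longrightarrow> p \<in> X" using c bar_basis_X by auto
  show ?thesis
    by (auto simp: sm_def coef_ops A_closed conv_scale conv_one_left *)
qed

lemma bar_scale: "c \<in> carrier (bar n) \<Longrightarrow> (\<lambda>z. k * c z) \<in> carrier (bar n)"
  by auto

lemma bar_diff: "c \<in> carrier (bar n) \<Longrightarrow> c' \<in> carrier (bar n) \<Longrightarrow> (\<lambda>z. c z - c' z) \<in> carrier (bar n)"
  by (auto) (metis diff_zero)

section \<open>Basis elements and generators of the bar bimodules\<close>

definition ind :: "nat \<Rightarrow> ('v,'e) qpath \<times> ('v,'e) qpath list \<times> ('v,'e) qpath
    \<Rightarrow> ('v,'e) qpath \<times> ('v,'e) qpath list \<times> ('v,'e) qpath \<Rightarrow> 'k" where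
  "ind n z = (\<lambda>w. if w = z \<and> z \<in> bar_basis n then 1 else 0)"

lemma ind_carrier [simp]: "ind n z \<in> carrier (bar n)"
  by (auto simp: ind_def)

lemma bar_induct [consumes 1, case_names zero add basis]:
  assumes "c \<in> carrier (bar n)" and "P (\<lambda>_. 0)"
    and add: "\<And>a b. \<lbrakk>a \<in> carrier (bar n); b \<in> carrier (bar n); P a; P b\<rbrakk> \<Longrightarrow> P (\<lambda>z. a z + b z)"
    and basis: "\<And>k z. z \<in> bar_basis n \<Longrightarrow> P (\<lambda>w. k * ind n z w)"
  shows "P c"
proof -
  have "finite S \<Longrightarrow> S \<subseteq> bar_basis n \<Longrightarrow> \<forall>c\<in>carrier (bar n). (\<forall>p. c p \<noteq> 0 \<longrightarrow> p \<in> S) \<longrightarrow> P c" for S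
  proof (induction S rule: finite_induct)
    case empty
    have "c = (\<lambda>_. 0)" if "\<forall>p. c p \<noteq> 0 \<longrightarrow> p \<in> {}" for c :: "_ \<Rightarrow> 'k" using that by auto
    then show ?case using assms(2) by blast
  next
    case (insert x S)
    show ?case
    proof (intro ballI impI)
      fix c assume c: "c \<in> carrier (bar n)" "\<forall>p. c p \<noteq> 0 \<longrightarrow> p \<in> insert x S"
      define b where "b = c(x := 0)"
      have b: "b \<in> carrier (bar n)" "\<forall>p. b p \<noteq> 0 \<longrightarrow> p \<in> S" using c by (auto simp: b_def)
      have x: "x \<in> bar_basis n" using insert by auto
      have e: "c = (\<lambda>z. c x * ind n x z + b z)" using x by (auto simp: ind_def b_def)
      have "P b" using insert b by blast
      then show "P c"
        using add[of "\<lambda>z. c x * ind n x z" b] basis[OF x] b(1) bar_scale[OF ind_carrier] e by metis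
    qed
  qed
  from this[OF finite_bar_basis[of n]] show ?thesis using assms(1) by auto
qed

text \<open>The element 1 \<otimes> t \<otimes> 1. For a nonempty tuple this is a single basis
  element. For the empty one in degree 0 it is the sum of e \<otimes> e over all vertices e with
  trivial path in \<open>X\<close>. It is 0 if \<open>t\<close> is not an n-tuple.\<close>

definition gen :: "nat \<Rightarrow> ('v,'e) qpath list \<Rightarrow> ('v,'e) qpath \<times> ('v,'e) qpath list \<times> ('v,'e) qpath \<Rightarrow> 'k" where
  "gen n t = (\<lambda>(p, u, q). if u = t \<and> parcs p = [] \<and> parcs q = [] \<and> (p, u, q) \<in> bar_basis n then 1 else 0)"

lemma gen_carrier [simp]: "gen n t \<in> carrier (bar n)"
  by (auto simp: gen_def split: if_splits prod.splits)

lemma lact_trivial: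
  assumes "x \<in> X" "\<And>b. b \<in> X \<Longrightarrow> parcs b \<noteq> [] \<Longrightarrow> \<phi> b = 0"
  shows "lact x \<phi> p = (if p = x then \<phi> (pid (ptgt x)) else 0)"
proof -
  have e: "pmul x (pid (ptgt x)) = x" by simp
  have "p = x \<Longrightarrow> lact x \<phi> p = \<phi> (pid (ptgt x))"
    using lact_pmul[of "pid (ptgt x)" x \<phi>] pid_in_X[OF assms(1)] e by simp
  moreover have "lact x \<phi> p = 0" if "p \<noteq> x"
  proof -
    from lact_cases[of x p \<phi>] consider "lact x \<phi> p = 0"
      | b where "b \<in> X" "ptgt x = psrc b" "p = pmul x b" "lact x \<phi> p = \<phi> b" by blast
    then show ?thesis
    proof cases
      case 2
      have "parcs b \<noteq> []"
      proof
        assume "parcs b = []"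
        then have "b = pid (ptgt x)" using trivial_qpath[of b] 2 X_subset by auto
        then show False using 2(3) that e by simp
      qed
      then show ?thesis using assms(2) 2 by simp
    qed
  qed
  ultimately show ?thesis by auto
qed

lemma ract_trivial:
  assumes "x \<in> X" "\<And>b. b \<in> X \<Longrightarrow> parcs b \<noteq> [] \<Longrightarrow> \<phi> b = 0"
  shows "ract x \<phi> p = (if p = x then \<phi> (pid (psrc x)) else 0)"
proof -
  have e: "pmul (pid (psrc x)) x = x" by simp
  have "p = x \<Longrightarrow> ract x \<phi> p = \<phi> (pid (psrc x))"
    using ract_pmul[of "pid (psrc x)" x \<phi>] pid_in_X[OF assms(1)] e by simp
  moreover have "ract x \<phi> p = 0" if "p \<noteq> x"
  proof -
    from ract_cases[of x p \<phi>] consider "ract x \<phi> p = 0"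
      | b where "b \<in> X" "ptgt b = psrc x" "p = pmul b x" "ract x \<phi> p = \<phi> b" by blast
    then show ?thesis
    proof cases
      case 2
      have "parcs b \<noteq> []"
      proof
        assume "parcs b = []"
        then have "b = pid (psrc x)" using trivial_qpath[of b] 2 X_subset by auto
        then show False using 2(3) that e by simp
      qed
      then show ?thesis using assms(2) 2 by simp
    qed
  qed
  ultimately show ?thesis by auto
qed

lemma bas_gen:
  assumes "x \<in> X"
  shows "bas x \<odot>\<^bsub>bar n\<^esub> gen n t = (\<lambda>(p, u, q). if p = x \<and> u = t \<and> parcs q = [] \<and> (x, t, q) \<in> bar_basis n then 1 else 0)"
proof (intro ext)
  fix w :: "('v,'e) qpath \<times> ('v,'e) qpath list \<times> ('v,'e) qpath"
  obtain p u q where w: "w = (p, u, q)" by (cases w)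
  have "conv (unit_at x) (\<lambda>p'. gen n t (p', u, q)) p =
      (if p = x \<and> u = t \<and> parcs q = [] \<and> (x, t, q) \<in> bar_basis n then 1 else 0)"
  proof (cases "p \<in> X")
    case True
    have "(pid (ptgt x), t, q) \<in> bar_basis n \<longleftrightarrow> (x, t, q) \<in> bar_basis n"
      using assms pid_in_X[OF assms] by (auto simp: bar_basis_def)
    moreover have "lact x (\<lambda>p'. gen n t (p', u, q)) p
      = (if p = x then gen n t (pid (ptgt x), u, q) else 0)"
      by (rule lact_trivial[OF assms]) (simp add: gen_def)
    ultimately show ?thesis using True assms by (auto simp: conv_unit_left gen_def)
  next
    case False
    then show ?thesis using assms by (auto simp: conv_outside)
  qed
  then show "(bas x \<odot>\<^bsub>bar n\<^esub> gen n t) w = (\<lambda>(p, u, q). if p = x \<and> u = t \<and> parcs q = [] \<and> (x, t, q) \<in> bar_basis n then 1 else 0) w"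
    using assms by (simp add: w bas)
qed

lemma gen_bas:
  assumes "x \<in> X"
  shows "gen n t \<diamondop>\<^bsub>bar n\<^esub> bas x = (\<lambda>(p, u, q). if q = x \<and> u = t \<and> parcs p = [] \<and> (p, t, x) \<in> bar_basis n then 1 else 0)"
proof (intro ext)
  fix w :: "('v,'e) qpath \<times> ('v,'e) qpath list \<times> ('v,'e) qpath"
  obtain p u q where w: "w = (p, u, q)" by (cases w)
  have "conv (\<lambda>q'. gen n t (p, u, q')) (unit_at x) q =
      (if q = x \<and> u = t \<and> parcs p = [] \<and> (p, t, x) \<in> bar_basis n then 1 else 0)"
  proof (cases "q \<in> X")
    case True
    have "(p, t, pid (psrc x)) \<in> bar_basis n \<longleftrightarrow> (p, t, x) \<in> bar_basis n"
      using assms pid_in_X[OF assms] by (auto simp: bar_basis_def)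
    moreover have "ract x (\<lambda>q'. gen n t (p, u, q')) q
      = (if q = x then gen n t (p, u, pid (psrc x)) else 0)"
      by (rule ract_trivial[OF assms]) (simp add: gen_def)
    ultimately show ?thesis using True assms by (auto simp: conv_unit_right gen_def)
  next
    case False
    then show ?thesis using assms by (auto simp: conv_outside)
  qed
  then show "(gen n t \<diamondop>\<^bsub>bar n\<^esub> bas x) w = (\<lambda>(p, u, q). if q = x \<and> u = t \<and> parcs p = [] \<and> (p, t, x) \<in> bar_basis n then 1 else 0) w"
    using assms by (simp add: w bas)
qed

text \<open>Hence the elements \<open>gen n t\<close> generate the bimodule. No composability is
  assumed, because \<open>ind\<close> is 0 off \<open>bar_basis\<close>.\<close>

lemma bas_gen_bas:
  assumes "x \<in> X" "y \<in> X"
  shows "(bas x \<odot>\<^bsub>bar n\<^esub> gen n t) \<diamondop>\<^bsub>bar n\<^esub> bas y = ind n (x, t, y)"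
proof (intro ext)
  fix w :: "('v,'e) qpath \<times> ('v,'e) qpath list \<times> ('v,'e) qpath"
  obtain p u q where w: "w = (p, u, q)" by (cases w)
  define c where "c = bas x \<odot>\<^bsub>bar n\<^esub> gen n t"
  have c: "c (p, u, q') = (if p = x \<and> u = t \<and> parcs q' = [] \<and> (x, t, q') \<in> bar_basis n then 1 else 0)" for p u q'
    unfolding c_def by (subst bas_gen[OF assms(1)]) simp
  have "(c \<diamondop>\<^bsub>bar n\<^esub> bas y) w = ind n (x, t, y) w"
  proof (cases "q \<in> X")
    case True
    have "(x, t, pid (psrc y)) \<in> bar_basis n \<longleftrightarrow> (x, t, y) \<in> bar_basis n"
      using assms pid_in_X[OF assms(2)] by (auto simp: bar_basis_def)
    moreover have "ract y (\<lambda>q'. c (p, u, q')) q = (if q = y then c (p, u, pid (psrc y)) else 0)"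
      by (rule ract_trivial[OF assms(2)]) (simp add: c)
    ultimately have "ract y (\<lambda>q'. c (p, u, q')) q = ind n (x, t, y) w"
      by (auto simp: c w ind_def)
    then show ?thesis using True assms by (simp add: conv_unit_right w bas)
  next
    case False
    then show ?thesis using assms by (auto simp: conv_outside w ind_def)
  qed
  then show "((bas x \<odot>\<^bsub>bar n\<^esub> gen n t) \<diamondop>\<^bsub>bar n\<^esub> bas y) w = ind n (x, t, y) w" by (simp add: c_def)
qed

section \<open>Homomorphisms out of the bar bimodules\<close>

definition term_at :: "('a, 'm) bimod \<Rightarrow> (('v,'e) qpath list \<Rightarrow> 'm)
    \<Rightarrow> ('v,'e) qpath \<times> ('v,'e) qpath list \<times> ('v,'e) qpath \<Rightarrow> 'm" where
  "term_at M x = (\<lambda>(p, t, q). (bas p \<odot>\<^bsub>M\<^esub> x t) \<diamondop>\<^bsub>M\<^esub> bas q)"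

text \<open>The homomorphism prescribed by values on the generators. Only the part of
  \<open>x t\<close> between the end vertices of \<open>t\<close> enters, so this is a homomorphism
  for every \<open>x\<close>, whereas it takes the value \<open>x t\<close> at
  \<open>gen n t\<close> only under the condition \<open>corner\<close>.\<close>

definition extend :: "('a, 'm) bimod \<Rightarrow> nat \<Rightarrow> (('v,'e) qpath list \<Rightarrow> 'm)
    \<Rightarrow> (('v,'e) qpath \<times> ('v,'e) qpath list \<times> ('v,'e) qpath \<Rightarrow> 'k) \<Rightarrow> 'm" where
  "extend M n x c = finsum M (\<lambda>z. sm M (c z) (term_at M x z)) (bar_basis n)"

lemma bas_ind:
  assumes "u \<in> X" "(p, t, q) \<in> bar_basis n"
  shows "bas u \<odot>\<^bsub>bar n\<^esub> ind n (p, t, q) =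
    (if ptgt u = psrc p \<and> pmul u p \<in> X then ind n (pmul u p, t, q) else (\<lambda>_. 0))"
proof -
  interpret B: bimodule A "bar n" by (rule bimodule_bar)
  have X: "p \<in> X" "q \<in> X" using assms bar_basis_X by auto
  note c = bas(1)[OF X(1)] bas(1)[OF X(2)] bas(1)[OF assms(1)] gen_carrier[of n t]
  have "bas u \<odot>\<^bsub>bar n\<^esub> ind n (p, t, q) = ((bas u \<otimes>\<^bsub>A\<^esub> bas p) \<odot>\<^bsub>bar n\<^esub> gen n t) \<diamondop>\<^bsub>bar n\<^esub> bas q"
    unfolding bas_gen_bas[OF X, symmetric] using c
    by (simp only: B.l_closed B.lr_assoc B.l_assoc)
  also have "\<dots> = (if ptgt u = psrc p \<and> pmul u p \<in> X then ind n (pmul u p, t, q) else (\<lambda>_. 0))"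
    using bas_gen_bas[of "pmul u p" q n t] X
      zero_smult[OF bimodule_bar gen_carrier[of n t]] rsmult_zero[OF bimodule_bar[of n] c(2)]
    by (simp del: bar_simps(4,5) add: bas_mult[OF assms(1) X(1)])
  finally show ?thesis .
qed

lemma ind_bas:
  assumes "u \<in> X" "(p, t, q) \<in> bar_basis n"
  shows "ind n (p, t, q) \<diamondop>\<^bsub>bar n\<^esub> bas u =
    (if ptgt q = psrc u \<and> pmul q u \<in> X then ind n (p, t, pmul q u) else (\<lambda>_. 0))"
proof -
  interpret B: bimodule A "bar n" by (rule bimodule_bar)
  have X: "p \<in> X" "q \<in> X" using assms bar_basis_X by auto
  note c = bas(1)[OF X(1)] bas(1)[OF X(2)] bas(1)[OF assms(1)] gen_carrier[of n t]
  have "ind n (p, t, q) \<diamondop>\<^bsub>bar n\<^esub> bas u = (bas p \<odot>\<^bsub>bar n\<^esub> gen n t) \<diamondop>\<^bsub>bar n\<^esub> (bas q \<otimes>\<^bsub>A\<^esub> bas u)"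
    unfolding bas_gen_bas[OF X, symmetric] using c
    by (simp only: B.l_closed B.r_assoc)
  also have "\<dots> = (if ptgt q = psrc u \<and> pmul q u \<in> X then ind n (p, t, pmul q u) else (\<lambda>_. 0))"
    using bas_gen_bas[of p "pmul q u" n t] X
      zero_rsmult[OF bimodule_bar B.l_closed[OF c(1,4)]]
    by (simp del: bar_simps(4,5) add: bas_mult[OF X(2) assms(1)])
  finally show ?thesis .
qed

lemma hm_from_basis:
  assumes N: "bimodule A N"
    and cl: "\<And>c. c \<in> carrier (bar n) \<Longrightarrow> f c \<in> carrier N"
    and ad: "\<And>c c'. c \<in> carrier (bar n) \<Longrightarrow> c' \<in> carrier (bar n) \<Longrightarrow> f (\<lambda>z. c z + c' z) = f c \<oplus>\<^bsub>N\<^esub> f c'"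
    and sc: "\<And>c k. c \<in> carrier (bar n) \<Longrightarrow> f (\<lambda>z. k * c z) = sm N k (f c)"
    and l: "\<And>u z. u \<in> X \<Longrightarrow> z \<in> bar_basis n \<Longrightarrow> f (bas u \<odot>\<^bsub>bar n\<^esub> ind n z) = bas u \<odot>\<^bsub>N\<^esub> f (ind n z)"
    and r: "\<And>u z. u \<in> X \<Longrightarrow> z \<in> bar_basis n \<Longrightarrow> f (ind n z \<diamondop>\<^bsub>bar n\<^esub> bas u) = f (ind n z) \<diamondop>\<^bsub>N\<^esub> bas u"
  shows "f \<in> hm (bar n) N"
proof -
  interpret N: bimodule A N by fact
  interpret B: bimodule A "bar n" by (rule bimodule_bar)
  note nb = sm_closed[OF N] sm_zero[OF N] smult_zero[OF N] rsmult_zero[OF N] zero_smult[OF N] zero_rsmult[OF N]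
    smult_sm[OF N] rsmult_sm[OF N] scaled_smult[OF N] scaled_rsmult[OF N]
  have f0: "f (\<lambda>_. 0) = \<zero>\<^bsub>N\<^esub>"
    using sc[of "\<lambda>_. 0" 0] cl[of "\<lambda>_. 0"] sm_zero_scalar[OF N] by simp
  have scale: "(\<lambda>z. k * c z) = sm (bar n) k c" if "c \<in> carrier (bar n)" for k c
    using sm_bar[OF that] by simp
  have B0: "a \<odot>\<^bsub>bar n\<^esub> (\<lambda>_. 0) = (\<lambda>_. 0)" "(\<lambda>_. 0) \<diamondop>\<^bsub>bar n\<^esub> a = (\<lambda>_. 0)" for a by auto
  have Badd: "(\<lambda>z. c z + c' z) = c \<oplus>\<^bsub>bar n\<^esub> c'" for c c' by simp
  have main: "f (bas u \<odot>\<^bsub>bar n\<^esub> c) = bas u \<odot>\<^bsub>N\<^esub> f c \<and> f (c \<diamondop>\<^bsub>bar n\<^esub> bas u) = f c \<diamondop>\<^bsub>N\<^esub> bas u"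
    if "c \<in> carrier (bar n)" "u \<in> X" for u c
    using that
  proof (induction c rule: bar_induct)
    case zero
    then show ?case by (simp only: B0 f0 nb bas)
  next
    case (add a b)
    note u = bas(1)[OF add.prems]
    have "f (bas u \<odot>\<^bsub>bar n\<^esub> (a \<oplus>\<^bsub>bar n\<^esub> b)) = bas u \<odot>\<^bsub>N\<^esub> f (a \<oplus>\<^bsub>bar n\<^esub> b)"
      using add.IH add.prems u ad[of "bas u \<odot>\<^bsub>bar n\<^esub> a" "bas u \<odot>\<^bsub>bar n\<^esub> b"] ad[OF add.hyps] cl[OF add.hyps(1)] cl[OF add.hyps(2)]
        B.l_closed[OF u] add.hyps
      by (simp only: Badd B.l_distr_mod N.l_distr_mod simp_thms)
    moreover have "f ((a \<oplus>\<^bsub>bar n\<^esub> b) \<diamondop>\<^bsub>bar n\<^esub> bas u) = f (a \<oplus>\<^bsub>bar n\<^esub> b) \<diamondop>\<^bsub>N\<^esub> bas u"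
      using add.IH add.prems u ad[of "a \<diamondop>\<^bsub>bar n\<^esub> bas u" "b \<diamondop>\<^bsub>bar n\<^esub> bas u"] ad[OF add.hyps] cl[OF add.hyps(1)] cl[OF add.hyps(2)]
        B.r_closed[OF u] add.hyps
      by (simp only: Badd B.r_distr_mod N.r_distr_mod simp_thms)
    ultimately show ?case by (simp only: Badd)
  next
    case (basis k z)
    note u = bas(1)[OF basis.prems]
    have "f (bas u \<odot>\<^bsub>bar n\<^esub> sm (bar n) k (ind n z)) = bas u \<odot>\<^bsub>N\<^esub> f (sm (bar n) k (ind n z))"
      using l[OF basis.prems basis.hyps] sc[OF B.l_closed[OF u ind_carrier]] sc[OF ind_carrier] cl[OF ind_carrier] u
      by (simp only: smult_sm[OF bimodule_bar] scale[OF ind_carrier] scale[OF B.l_closed[OF u ind_carrier]] nb ind_carrier)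
    moreover have "f (sm (bar n) k (ind n z) \<diamondop>\<^bsub>bar n\<^esub> bas u) = f (sm (bar n) k (ind n z)) \<diamondop>\<^bsub>N\<^esub> bas u"
      using r[OF basis.prems basis.hyps] sc[OF B.r_closed[OF u ind_carrier]] sc[OF ind_carrier] cl[OF ind_carrier] u
      by (simp only: rsmult_sm[OF bimodule_bar] scale[OF ind_carrier] scale[OF B.r_closed[OF u ind_carrier]] nb ind_carrier)
    ultimately show ?case by (simp only: scale[OF ind_carrier])
  qed
  have "f (a \<odot>\<^bsub>bar n\<^esub> c) = a \<odot>\<^bsub>N\<^esub> f c \<and> f (c \<diamondop>\<^bsub>bar n\<^esub> a) = f c \<diamondop>\<^bsub>N\<^esub> a"
    if "a \<in> carrier A" "c \<in> carrier (bar n)" for a c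
    using that
  proof (induction a rule: alg_induct)
    case zero
    then show ?case
      using zero_smult[OF bimodule_bar zero] zero_rsmult[OF bimodule_bar zero] f0 cl[OF zero]
      by (simp only: nb bar_simps(2) simp_thms)
  next
    case (add a b)
    then show ?case
      using ad[OF B.l_closed[OF add.hyps(1) add.prems] B.l_closed[OF add.hyps(2) add.prems]]
        ad[OF B.r_closed[OF add.hyps(1) add.prems] B.r_closed[OF add.hyps(2) add.prems]] cl[OF add.prems]
      by (simp only: B.l_distr_ring B.r_distr_ring N.l_distr_ring N.r_distr_ring Badd simp_thms)
  next
    case (basis k u)
    note u = bas(1)[OF basis.hyps]
    show ?case
      using main[OF basis.prems basis.hyps] sc[OF B.l_closed[OF u basis.prems]] sc[OF B.r_closed[OF u basis.prems]]
        cl[OF basis.prems] u basis.prems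
      by (simp only: scaled_smult[OF bimodule_bar] scaled_rsmult[OF bimodule_bar] nb
        scale[OF B.l_closed[OF u basis.prems]] scale[OF B.r_closed[OF u basis.prems]] simp_thms)
  qed
  then show ?thesis unfolding hm_def using cl ad by (simp del: bar_simps(1,4,5))
qed

lemma sm_finsum:
  assumes M: "bimodule A M" and "finite S" "f \<in> S \<rightarrow> carrier M"
  shows "sm M k (finsum M f S) = finsum M (\<lambda>z. sm M k (f z)) S"
proof -
  interpret M: bimodule A M by fact
  show ?thesis
    using assms(2,3)
  proof (induction S rule: finite_induct)
    case (insert x F)
    then have "f x \<in> carrier M" "f \<in> F \<rightarrow> carrier M" by auto
    then show ?case using insert
      by (simp add: M.finsum_insert M.finsum_closed sm_add[OF M] sm_closed[OF M] Pi_def)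
  qed (simp add: sm_zero[OF M])
qed

context
  fixes M :: "('a, 'm) bimod" and n :: nat and x :: "('v,'e) qpath list \<Rightarrow> 'm"
  assumes M: "bimodule A M" and x: "\<And>t. t \<in> tuples n \<Longrightarrow> x t \<in> carrier M"
begin

interpretation M: bimodule A M by (rule M)

lemma term_at_closed: "z \<in> bar_basis n \<Longrightarrow> term_at M x z \<in> carrier M"
  using bar_basis_X x bas(1) by (cases z) (auto simp: term_at_def intro!: M.l_closed M.r_closed)

lemma extend_closed: "extend M n x c \<in> carrier M"
  unfolding extend_def using term_at_closed sm_closed[OF M] by (auto intro!: M.finsum_closed)

lemma extend_add: "extend M n x (\<lambda>z. c z + c' z) = extend M n x c \<oplus>\<^bsub>M\<^esub> extend M n x c'"
proof -
  have "extend M n x (\<lambda>z. c z + c' z)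
    = finsum M (\<lambda>z. sm M (c z) (term_at M x z) \<oplus>\<^bsub>M\<^esub> sm M (c' z) (term_at M x z)) (bar_basis n)"
    unfolding extend_def using term_at_closed sm_closed[OF M] sm_add_scalar[OF M]
    by (intro M.finsum_cong') auto
  then show ?thesis
    unfolding extend_def using term_at_closed sm_closed[OF M] by (simp add: M.finsum_addf Pi_def)
qed

lemma extend_scale: "extend M n x (\<lambda>z. k * c z) = sm M k (extend M n x c)"
proof -
  have "extend M n x (\<lambda>z. k * c z)
    = finsum M (\<lambda>z. sm M k (sm M (c z) (term_at M x z))) (bar_basis n)"
    unfolding extend_def using term_at_closed sm_closed[OF M] sm_sm[OF M]
    by (intro M.finsum_cong') auto
  then show ?thesis
    unfolding extend_def using term_at_closed sm_closed[OF M]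
    by (subst sm_finsum[OF M finite_bar_basis]) auto
qed

lemma extend_ind: "z \<in> bar_basis n \<Longrightarrow> extend M n x (ind n z) = term_at M x z"
proof -
  assume z: "z \<in> bar_basis n"
  have "extend M n x (ind n z) = finsum M (\<lambda>w. if z = w then term_at M x w else \<zero>\<^bsub>M\<^esub>) (bar_basis n)"
    unfolding extend_def using term_at_closed z sm_one[OF M] sm_zero_scalar[OF M] sm_closed[OF M]
    by (intro M.finsum_cong') (auto simp: ind_def)
  also have "\<dots> = term_at M x z"
    using M.finsum_singleton[OF z finite_bar_basis, of "term_at M x"] term_at_closed by auto
  finally show ?thesis .
qed

lemma extend_zero: "extend M n x (\<lambda>_. 0) = \<zero>\<^bsub>M\<^esub>"
  using extend_scale[of 0 "\<lambda>_. 0"] sm_zero_scalar[OF M extend_closed] by simp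

lemma extend_hm: "extend M n x \<in> hm (bar n) M"
proof (rule hm_from_basis[OF M extend_closed extend_add extend_scale])
  fix u :: "('v,'e) qpath" and z :: "('v,'e) qpath \<times> ('v,'e) qpath list \<times> ('v,'e) qpath"
  assume u: "u \<in> X" and z: "z \<in> bar_basis n"
  obtain p t q where z': "z = (p, t, q)" by (cases z)
  have X: "p \<in> X" "q \<in> X" "t \<in> tuples n" using z z' bar_basis_X by auto
  note c = bas(1)[OF X(1)] bas(1)[OF X(2)] bas(1)[OF u] x[OF X(3)]
  have l: "bas u \<odot>\<^bsub>M\<^esub> term_at M x z = ((bas u \<otimes>\<^bsub>A\<^esub> bas p) \<odot>\<^bsub>M\<^esub> x t) \<diamondop>\<^bsub>M\<^esub> bas q"
    unfolding z' term_at_def using c by (simp add: M.l_closed M.lr_assoc M.l_assoc)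
  have r: "term_at M x z \<diamondop>\<^bsub>M\<^esub> bas u = (bas p \<odot>\<^bsub>M\<^esub> x t) \<diamondop>\<^bsub>M\<^esub> (bas q \<otimes>\<^bsub>A\<^esub> bas u)"
    unfolding z' term_at_def using c by (simp add: M.l_closed M.r_assoc)
  have "(pmul u p, t, q) \<in> bar_basis n" if "pmul u p \<in> X"
    using z z' that by (auto simp: bar_basis_def)
  then show "extend M n x (bas u \<odot>\<^bsub>bar n\<^esub> ind n z) = bas u \<odot>\<^bsub>M\<^esub> extend M n x (ind n z)"
    unfolding extend_ind[OF z] l bas_mult[OF u X(1)] unfolding z' bas_ind[OF u z[unfolded z']]
    by (simp add: extend_ind extend_zero zero_smult[OF M c(4)] rsmult_zero[OF M c(2)] term_at_def)
  have "(p, t, pmul q u) \<in> bar_basis n" if "pmul q u \<in> X"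
    using z z' that by (auto simp: bar_basis_def)
  then show "extend M n x (ind n z \<diamondop>\<^bsub>bar n\<^esub> bas u) = extend M n x (ind n z) \<diamondop>\<^bsub>M\<^esub> bas u"
    unfolding extend_ind[OF z] r bas_mult[OF X(2) u] unfolding z' ind_bas[OF u z[unfolded z']]
    by (simp add: extend_ind extend_zero zero_rsmult[OF M M.l_closed[OF c(1,4)]] term_at_def)
qed

end

text \<open>Every basis element is a generator multiplied by paths on both sides, so a homomorphism
  is determined by its values on the generators.\<close>

lemma hm_eq_extend:
  assumes M: "bimodule A M" and f: "f \<in> hm (bar n) M" and c: "c \<in> carrier (bar n)"
  shows "f c = extend M n (\<lambda>t. f (gen n t)) c"
proof -
  have cl: "\<And>t. t \<in> tuples n \<Longrightarrow> f (gen n t) \<in> carrier M" using hmD(1)[OF f] gen_carrier by blast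
  note e = extend_zero[where x = "\<lambda>t. f (gen n t)", OF M cl] extend_add[where x = "\<lambda>t. f (gen n t)", OF M cl]
    extend_scale[where x = "\<lambda>t. f (gen n t)", OF M cl] extend_ind[where x = "\<lambda>t. f (gen n t)", OF M cl]
  show ?thesis
    using c
  proof (induction c rule: bar_induct)
    case zero
    have "f (\<lambda>_. 0) = \<zero>\<^bsub>M\<^esub>" using hm_zero[OF f bimodule_bar M] by simp
    then show ?case using e(1) by simp
  next
    case (add a b)
    have "f (\<lambda>z. a z + b z) = f a \<oplus>\<^bsub>M\<^esub> f b" using hmD(2)[OF f add.hyps] by simp
    then show ?case using e(2) add.IH by simp
  next
    case (basis k z)
    obtain p t q where z: "z = (p, t, q)" by (cases z)
    have X: "p \<in> X" "q \<in> X" using basis z bar_basis_X by auto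
    interpret B: bimodule A "bar n" by (rule bimodule_bar)
    have "f (ind n z) = term_at M (\<lambda>t. f (gen n t)) z"
      unfolding z bas_gen_bas[OF X, symmetric] term_at_def
      by (simp only: hmD[OF f] B.l_closed bas X gen_carrier case_prod_conv)
    moreover have "f (\<lambda>w. k * ind n z w) = sm M k (f (ind n z))"
      using hmD(5)[OF f ind_carrier[of n z], where k = k] sm_bar[OF ind_carrier[of n z], of k] by simp
    ultimately show ?case using e(3,4) basis by simp
  qed
qed

lemma extend_cong: 
  assumes M: "bimodule A M" and "\<And>t. t \<in> tuples n \<Longrightarrow> x t = y t" "\<And>t. t \<in> tuples n \<Longrightarrow> y t \<in> carrier M"
  shows "extend M n x c = extend M n y c"
proof -
  interpret M: bimodule A M by fact
  have "term_at M x z = term_at M y z" if "z \<in> bar_basis n" for z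
    using that assms(2) bar_basis_X by (cases z) (auto simp: term_at_def)
  then show ?thesis
    unfolding extend_def using term_at_closed[where x = y, OF M assms(3)] sm_closed[OF M]
    by (intro M.finsum_cong') auto
qed

lemma hm_bar_eqI:
  assumes M: "bimodule A M" and f: "f \<in> hm (bar n) M" and g: "g \<in> hm (bar n) M"
    and "\<And>t. t \<in> tuples n \<Longrightarrow> f (gen n t) = g (gen n t)" and c: "c \<in> carrier (bar n)"
  shows "f c = g c"
  unfolding hm_eq_extend[OF M f c] hm_eq_extend[OF M g c]
  by (rule extend_cong[OF M], erule assms(4), rule hmD(1)[OF g gen_carrier])

end

text \<open>Merging keeps the outer endpoints of a tuple, so agreement is needed only on tuples with
  these ends. This allows all merges of a tuple to be written with the same outer vertices.\<close>

lemma merges_cong_ends: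
  assumes "\<And>u. Suc (length u) = length t \<Longrightarrow> u \<noteq> [] \<Longrightarrow> psrc (hd u) = psrc (hd t) \<Longrightarrow>
      ptgt (last u) = ptgt (last t) \<Longrightarrow> f u = g u"
  shows "merges f t = merges g t"
  using assms
proof (induction f t arbitrary: g rule: merges.induct)
  case (3 f x y r)
  have "f (pmul x y # r) = g (pmul x y # r)" by (rule 3(2)) auto
  moreover have "merges (\<lambda>t. f (x # t)) (y # r) = merges (\<lambda>t. g (x # t)) (y # r)"
    by (rule 3(1)) (auto intro!: 3(2))
  ultimately show ?case by simp
qed simp_all

context coord_algebra
begin

lemma ind_outside: "p \<notin> X \<or> q \<notin> X \<Longrightarrow> ind n (p, t, q) = (\<lambda>_. 0)"
  by (auto simp: ind_def bar_basis_def)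

lemma gen_ind:
  assumes "t \<in> tuples n" "t \<noteq> []"
  shows "gen n t = ind n (pid (psrc (hd t)), t, pid (ptgt (last t)))"
proof -
  have "hd t \<in> X" "last t \<in> X" using assms by (auto simp: tuples_def)
  then have X: "pid (psrc (hd t)) \<in> X" "pid (ptgt (last t)) \<in> X" using pid_in_X by auto
  show ?thesis
    unfolding gen_def ind_def
  proof (intro ext, clarify)
    fix p1 p3 q1 q3 :: 'v and p2 q2 :: "'e list" and u
    let ?p = "(p1, p2, p3)" and ?q = "(q1, q2, q3)"
    have "(u = t \<and> parcs ?p = [] \<and> parcs ?q = [] \<and> (?p, u, ?q) \<in> bar_basis n) \<longleftrightarrow>
      ((?p, u, ?q) = (pid (psrc (hd t)), t, pid (ptgt (last t)))
        \<and> (pid (psrc (hd t)), t, pid (ptgt (last t))) \<in> bar_basis n)"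
      using trivial_qpath[of ?p] trivial_qpath[of ?q] X_subset assms X by (auto simp: bar_basis_def)
    then show "(if u = t \<and> parcs ?p = [] \<and> parcs ?q = [] \<and> (?p, u, ?q) \<in> bar_basis n then 1 else 0) =
      (if (?p, u, ?q) = (pid (psrc (hd t)), t, pid (ptgt (last t)))
        \<and> (pid (psrc (hd t)), t, pid (ptgt (last t))) \<in> bar_basis n then 1 else (0::'k))"
      by (rule if_cong[OF _ refl refl])
  qed
qed

text \<open>The empty tuple stands for all vertices at once; its values have to commute with the vertices.\<close>

definition corner :: "('a, 'm) bimod \<Rightarrow> ('v,'e) qpath list \<Rightarrow> 'm \<Rightarrow> bool" where
  "corner M t x \<longleftrightarrow> (if t = [] then \<forall>v. pid v \<in> X \<longrightarrow> bas (pid v) \<odot>\<^bsub>M\<^esub> x = x \<diamondop>\<^bsub>M\<^esub> bas (pid v)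
     else (bas (pid (psrc (hd t))) \<odot>\<^bsub>M\<^esub> x) \<diamondop>\<^bsub>M\<^esub> bas (pid (ptgt (last t))) = x)"

lemma bas_pid: "p \<in> X \<Longrightarrow> bas (pid (psrc p)) \<otimes>\<^bsub>A\<^esub> bas p = bas p"
  "p \<in> X \<Longrightarrow> bas p \<otimes>\<^bsub>A\<^esub> bas (pid (ptgt p)) = bas p"
  using bas_mult pid_in_X by auto

lemma extend_gen:
  assumes M: "bimodule A M" and x: "\<And>t. t \<in> tuples n \<Longrightarrow> x t \<in> carrier M"
    and t: "t \<in> tuples n" and cor: "corner M t (x t)"
  shows "extend M n x (gen n t) = x t"
proof (cases "t = []")
  case False
  then have "hd t \<in> X" "last t \<in> X" using t by (auto simp: tuples_def)
  then have "(pid (psrc (hd t)), t, pid (ptgt (last t))) \<in> bar_basis n"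
    using pid_in_X t False by (auto simp: bar_basis_def)
  then show ?thesis
    using gen_ind[OF t False] extend_ind[where x = x, OF M x] cor False by (simp add: term_at_def corner_def)
next
  case True
  then have n: "n = 0" using t by simp
  interpret M: bimodule A M by fact
  interpret B: bimodule A "bar n" by (rule bimodule_bar)
  have xt: "x [] \<in> carrier M" using x t True by auto
  note f = extend_hm[where x = x, OF M x]
  \<comment> \<open>The generator of the empty tuple is a sum over vertices. Multiplying it by a
    path \<open>p\<close> isolates one summand, and the claim for a = 1 follows by
    linearity.\<close>
  have "extend M n x (a \<odot>\<^bsub>bar n\<^esub> gen n []) = a \<odot>\<^bsub>M\<^esub> x []" if "a \<in> carrier A" for a
    using that
  proof (induction a rule: alg_induct)
    case zero
    then show ?case
      using hm_zero[OF f bimodule_bar M] zero_smult[OF bimodule_bar gen_carrier] zero_smult[OF M xt] by metis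
  next
    case (add a b)
    then show ?case
      using B.l_distr_ring[OF add.hyps gen_carrier] M.l_distr_ring[OF add.hyps xt]
        hmD(2)[OF f B.l_closed[OF add.hyps(1) gen_carrier] B.l_closed[OF add.hyps(2) gen_carrier]] by metis
  next
    case (basis k p)
    have e: "pid (ptgt p) \<in> X" using pid_in_X[OF basis] by simp
    note c = bas(1)[OF basis] bas(1)[OF e]
    have pb: "(p, [], pid (ptgt p)) \<in> bar_basis n" using basis e n by (auto simp: bar_basis_def)
    have "bas p \<odot>\<^bsub>bar n\<^esub> gen n [] = ind n (p, [], pid (ptgt p))"
      unfolding bas_gen[OF basis] ind_def
    proof (intro ext, clarify)
      fix a1 a2 a3 u q1 q2 q3
      have "((a1, a2, a3) = p \<and> u = [] \<and> parcs (q1, q2, q3) = [] \<and> (p, [], (q1, q2, q3)) \<in> bar_basis n) \<longleftrightarrow>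
        (((a1, a2, a3), u, (q1, q2, q3)) = (p, [], pid (ptgt p)) \<and> (p, [], pid (ptgt p)) \<in> bar_basis n)"
        using trivial_qpath[of "(q1, q2, q3)"] X_subset pb by (auto simp: bar_basis_def)
      then show "(if (a1, a2, a3) = p \<and> u = [] \<and> parcs (q1, q2, q3) = [] \<and> (p, [], (q1, q2, q3)) \<in> bar_basis n
          then 1 else 0) = (if ((a1, a2, a3), u, (q1, q2, q3)) = (p, [], pid (ptgt p))
            \<and> (p, [], pid (ptgt p)) \<in> bar_basis n then 1 else (0::'k))" by (rule if_cong[OF _ refl refl])
    qed
    then have "extend M n x (bas p \<odot>\<^bsub>bar n\<^esub> gen n []) = (bas p \<odot>\<^bsub>M\<^esub> x []) \<diamondop>\<^bsub>M\<^esub> bas (pid (ptgt p))"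
      using extend_ind[where x = x, OF M x pb] by (simp add: term_at_def)
    also have "\<dots> = bas p \<odot>\<^bsub>M\<^esub> (bas (pid (ptgt p)) \<odot>\<^bsub>M\<^esub> x [])"
      using cor True e c xt by (simp add: corner_def M.lr_assoc)
    also have "\<dots> = bas p \<odot>\<^bsub>M\<^esub> x []"
      using M.l_assoc[OF c xt] bas_pid(2)[OF basis] by simp
    finally show ?case
      using scaled_smult[OF bimodule_bar c(1) gen_carrier[of n "[]"], where k = k] scaled_smult[OF M c(1) xt, where k = k]
        hmD(5)[OF f B.l_closed[OF c(1) gen_carrier[of n "[]"]], where k = k] by metis
  qed
  from this[OF A_closed(4)] show ?thesis
    using B.l_unit[OF gen_carrier] M.l_unit[OF xt] True by metis
qed

lemma hm_bar_ind_eqI: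
  assumes M: "bimodule A M" and f: "f \<in> hm (bar n) M" and g: "g \<in> hm (bar n) M"
    and fg: "\<And>z. z \<in> bar_basis n \<Longrightarrow> f (ind n z) = g (ind n z)" and c: "c \<in> carrier (bar n)"
  shows "f c = g c"
  using c
proof (induction c rule: bar_induct)
  case zero
  then show ?case using hm_zero[OF f bimodule_bar M] hm_zero[OF g bimodule_bar M] by simp
next
  case (add a b)
  then show ?case using hmD(2)[OF f add.hyps] hmD(2)[OF g add.hyps] by simp
next
  case (basis k z)
  then show ?case
    using hmD(5)[OF f ind_carrier[of n z], where k = k] hmD(5)[OF g ind_carrier[of n z], where k = k]
      sm_bar[OF ind_carrier[of n z], of k] fg by simp
qed

lemma hm_zero_map: "bimodule A N \<Longrightarrow> (\<lambda>_. \<zero>\<^bsub>N\<^esub>) \<in> hm M N"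
proof -
  assume N: "bimodule A N"
  interpret N: bimodule A N by fact
  show ?thesis by (auto simp: hm_def smult_zero[OF N] rsmult_zero[OF N])
qed

section \<open>The bar differential and the augmentation\<close>

lemma functional_comp: "f \<in> hm M N \<Longrightarrow> functional N \<Lambda> \<Longrightarrow> functional M (\<lambda>x. \<Lambda> (f x))"
  by (auto simp: functional_def hmD)

lemma functional_coef: "functional (regular_bimodule A) (\<lambda>a. coef a \<gamma>)"
  by (auto simp: functional_def regular_bimodule_def sm_def coef_ops A_closed scalar_central)

lemma functional_point: "functional (bar n) (\<lambda>c. c w)"
  unfolding functional_def using sm_bar by auto

text \<open>The bar boundary of 1 \<otimes> t \<otimes> 1 for a tuple of length n + 1, which
  explains the exponent in the last sign.\<close>

definition bd :: "nat \<Rightarrow> ('v,'e) qpath list \<Rightarrow> ('v,'e) qpath \<times> ('v,'e) qpath list \<times> ('v,'e) qpath \<Rightarrow> 'k" where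
  "bd n t = (\<lambda>w. (bas (hd t) \<odot>\<^bsub>bar n\<^esub> gen n (tl t)) w + merges (\<lambda>u. gen n u w) t
     + (-1) ^ Suc n * (gen n (butlast t) \<diamondop>\<^bsub>bar n\<^esub> bas (last t)) w)"

lemma tuples_hd_last:
  assumes "t \<in> tuples (Suc n)"
  shows "hd t \<in> X" "last t \<in> X" "tl t \<in> tuples n" "butlast t \<in> tuples n" "t \<noteq> []"
proof -
  show ne: "t \<noteq> []" using assms by auto
  have "hd t \<in> set t" "last t \<in> set t" using ne by auto
  then show "hd t \<in> X" "last t \<in> X" using assms by (auto simp: tuples_def)
  show "tl t \<in> tuples n" using assms ne by (cases t) (auto simp: tuples_Cons)
  show "butlast t \<in> tuples n" using assms ne by (cases t rule: rev_cases) (auto simp: tuples_append)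
qed

lemma functional_bd:
  assumes \<Lambda>: "functional (bar n) \<Lambda>" and t: "t \<in> tuples (Suc n)"
  shows "bd n t \<in> carrier (bar n)"
    "\<Lambda> (bd n t) = \<Lambda> (bas (hd t) \<odot>\<^bsub>bar n\<^esub> gen n (tl t)) + merges (\<lambda>u. \<Lambda> (gen n u)) t
       + (-1) ^ Suc n * \<Lambda> (gen n (butlast t) \<diamondop>\<^bsub>bar n\<^esub> bas (last t))"
proof -
  interpret B: bimodule A "bar n" by (rule bimodule_bar)
  have ad: "\<Lambda> (\<lambda>z. a z + b z) = \<Lambda> a + \<Lambda> b" "(\<lambda>z. a z + b z) \<in> carrier (bar n)"
    if "a \<in> carrier (bar n)" "b \<in> carrier (bar n)" for a b
    using \<Lambda> that B.a_closed[OF that] by (auto simp: functional_def simp del: bar_simps(1)) 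
  have sc: "\<Lambda> (\<lambda>z. k * a z) = k * \<Lambda> a" if "a \<in> carrier (bar n)" for a k
    using \<Lambda> that sm_bar[OF that] by (auto simp: functional_def simp del: bar_simps(1)) 
  have df: "\<Lambda> (\<lambda>z. a z - b z) = \<Lambda> a - \<Lambda> b" if "a \<in> carrier (bar n)" "b \<in> carrier (bar n)" for a b
    using ad(1)[OF that(1) bar_scale[OF that(2)], of "-1"] sc[OF that(2), of "-1"] by simp
  let ?L = "bas (hd t) \<odot>\<^bsub>bar n\<^esub> gen n (tl t)" and ?R = "gen n (butlast t) \<diamondop>\<^bsub>bar n\<^esub> bas (last t)"
  have L: "?L \<in> carrier (bar n)" and R: "?R \<in> carrier (bar n)"
    using B.l_closed[OF bas(1)[OF tuples_hd_last(1)[OF t]] gen_carrier]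
      B.r_closed[OF bas(1)[OF tuples_hd_last(2)[OF t]] gen_carrier] by blast+
  have m: "(\<lambda>w. merges (\<lambda>u. gen n u w) t) \<in> carrier (bar n)"
      "\<Lambda> (\<lambda>w. merges (\<lambda>u. gen n u w) t) = merges (\<lambda>u. \<Lambda> (gen n u)) t"
    using merges_fun_linear[of "gen n" "carrier (bar n)" \<Lambda> t, OF gen_carrier bar_diff df] by blast+
  show "bd n t \<in> carrier (bar n)"
    unfolding bd_def by (rule ad(2)[OF ad(2)[OF L m(1)] bar_scale[OF R]])
  show "\<Lambda> (bd n t) = \<Lambda> ?L + merges (\<lambda>u. \<Lambda> (gen n u)) t + (-1) ^ Suc n * \<Lambda> ?R"
    unfolding bd_def ad(1)[OF ad(2)[OF L m(1)] bar_scale[OF R]] ad(1)[OF L m(1)] sc[OF R] m(2) ..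
qed

lemma bd_carrier: "t \<in> tuples (Suc n) \<Longrightarrow> bd n t \<in> carrier (bar n)"
  by (rule functional_bd(1)[OF functional_point])

definition dB :: "nat \<Rightarrow> (('v,'e) qpath \<times> ('v,'e) qpath list \<times> ('v,'e) qpath \<Rightarrow> 'k)
    \<Rightarrow> ('v,'e) qpath \<times> ('v,'e) qpath list \<times> ('v,'e) qpath \<Rightarrow> 'k" where
  "dB n = extend (bar n) (Suc n) (bd n)"

lemma dB_hm: "dB n \<in> hm (bar (Suc n)) (bar n)"
  unfolding dB_def by (rule extend_hm[OF bimodule_bar bd_carrier])

definition aug :: "(('v,'e) qpath \<times> ('v,'e) qpath list \<times> ('v,'e) qpath \<Rightarrow> 'k) \<Rightarrow> 'a" where
  "aug = extend (regular_bimodule A) 0 (\<lambda>_. \<one>\<^bsub>A\<^esub>)"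

lemma regular_simps [simp]:
  "carrier (regular_bimodule A) = carrier A" "\<zero>\<^bsub>regular_bimodule A\<^esub> = \<zero>\<^bsub>A\<^esub>"
  "a \<oplus>\<^bsub>regular_bimodule A\<^esub> b = a \<oplus>\<^bsub>A\<^esub> b" "a \<odot>\<^bsub>regular_bimodule A\<^esub> b = a \<otimes>\<^bsub>A\<^esub> b"
  "a \<diamondop>\<^bsub>regular_bimodule A\<^esub> b = a \<otimes>\<^bsub>A\<^esub> b"
  by (simp_all add: regular_bimodule_def)

lemma aug_hm: "aug \<in> hm (bar 0) (regular_bimodule A)"
  unfolding aug_def by (rule extend_hm[OF bimodule_regular]) (simp add: A_closed)

lemma functional_sandwich:
  assumes M: "bimodule A M" and "functional M \<Lambda>" "a \<in> carrier A" "b \<in> carrier A"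
  shows "functional M (\<lambda>x. \<Lambda> ((a \<odot>\<^bsub>M\<^esub> x) \<diamondop>\<^bsub>M\<^esub> b))"
proof -
  interpret M: bimodule A M by fact
  show ?thesis using assms
    by (auto simp: functional_def M.l_distr_mod M.r_distr_mod M.l_closed M.r_closed smult_sm[OF M] rsmult_sm[OF M])
qed

text \<open>The outer products need no case distinction: if one leaves \<open>X\<close>, the
  corresponding \<open>ind\<close> is 0.\<close>

lemma dB_ind:
  assumes z: "(p, t, q) \<in> bar_basis (Suc n)"
  shows "dB n (ind (Suc n) (p, t, q)) w = ind n (pmul p (hd t), tl t, q) w
     + merges (\<lambda>u. ind n (p, u, q) w) t + (-1) ^ Suc n * ind n (p, butlast t, pmul (last t) q) w"
proof -
  interpret B: bimodule A "bar n" by (rule bimodule_bar)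
  have X: "p \<in> X" "q \<in> X" "t \<in> tuples (Suc n)" using z bar_basis_X by auto
  note t = tuples_hd_last[OF X(3)]
  note c = bas(1)[OF X(1)] bas(1)[OF X(2)] bas(1)[OF t(1)] bas(1)[OF t(2)]
  have ends: "ptgt p = psrc (hd t)" "ptgt (last t) = psrc q" using z t(5) by (auto simp: bar_basis_def)
  have h: "(hd t, tl t, q) \<in> bar_basis n"
    using X t ends by (cases t) (auto simp: bar_basis_def tuples_Cons)
  have l: "(p, butlast t, last t) \<in> bar_basis n"
    using X t ends by (cases t rule: rev_cases) (auto simp: bar_basis_def tuples_append hd_append split: if_splits)
  have "dB n (ind (Suc n) (p, t, q)) w = ((bas p \<odot>\<^bsub>bar n\<^esub> bd n t) \<diamondop>\<^bsub>bar n\<^esub> bas q) w"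
    unfolding dB_def by (subst extend_ind[OF bimodule_bar bd_carrier z]) (simp_all add: term_at_def del: bar_simps)
  also have "\<dots> = ((bas p \<odot>\<^bsub>bar n\<^esub> (bas (hd t) \<odot>\<^bsub>bar n\<^esub> gen n (tl t))) \<diamondop>\<^bsub>bar n\<^esub> bas q) w
     + merges (\<lambda>u. ((bas p \<odot>\<^bsub>bar n\<^esub> gen n u) \<diamondop>\<^bsub>bar n\<^esub> bas q) w) t
     + (-1) ^ Suc n * ((bas p \<odot>\<^bsub>bar n\<^esub> (gen n (butlast t) \<diamondop>\<^bsub>bar n\<^esub> bas (last t))) \<diamondop>\<^bsub>bar n\<^esub> bas q) w"
    by (rule functional_bd(2)[OF functional_sandwich[OF bimodule_bar functional_point c(1,2)] X(3)])
  also have "(bas p \<odot>\<^bsub>bar n\<^esub> (bas (hd t) \<odot>\<^bsub>bar n\<^esub> gen n (tl t))) \<diamondop>\<^bsub>bar n\<^esub> bas q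
      = bas p \<odot>\<^bsub>bar n\<^esub> ind n (hd t, tl t, q)"
    unfolding bas_gen_bas[OF t(1) X(2), symmetric] using c by (simp only: B.lr_assoc B.l_closed gen_carrier)
  also have "\<dots> = ind n (pmul p (hd t), tl t, q)"
    using bas_ind[OF X(1) h] ends by (simp add: ind_outside del: bar_simps)
  also have "(bas p \<odot>\<^bsub>bar n\<^esub> (gen n (butlast t) \<diamondop>\<^bsub>bar n\<^esub> bas (last t))) \<diamondop>\<^bsub>bar n\<^esub> bas q
      = ind n (p, butlast t, last t) \<diamondop>\<^bsub>bar n\<^esub> bas q"
    unfolding bas_gen_bas[OF X(1) t(2), symmetric] using c by (simp only: B.lr_assoc B.r_closed gen_carrier)
  also have "\<dots> = ind n (p, butlast t, pmul (last t) q)"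
    using ind_bas[OF X(2) l] ends by (simp add: ind_outside del: bar_simps)
  finally show ?thesis by (simp only: bas_gen_bas[OF X(1,2)])
qed

section \<open>The contracting homotopy\<close>

definition contr :: "nat \<Rightarrow> (('v,'e) qpath \<times> ('v,'e) qpath list \<times> ('v,'e) qpath \<Rightarrow> 'k)
    \<Rightarrow> ('v,'e) qpath \<times> ('v,'e) qpath list \<times> ('v,'e) qpath \<Rightarrow> 'k" where
  "contr n c = (\<lambda>(p, u, q). if parcs p = [] \<and> (p, u, q) \<in> bar_basis (Suc n) then c (hd u, tl u, q) else 0)"

lemma contr_carrier: "contr n c \<in> carrier (bar (Suc n))"
  by (auto simp: contr_def split: if_splits)

lemma bar_basis_Cons:
  "(p, y # u, q) \<in> bar_basis (Suc n) \<longleftrightarrow> p \<in> X \<and> ptgt p = psrc y \<and> parcs y \<noteq> [] \<and> (y, u, q) \<in> bar_basis n"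
  by (auto simp: bar_basis_def tuples_Cons tuples_length dest: tuples_length)

text \<open>The usual form of the homotopy, p \<otimes> t \<otimes> q going to 1 \<otimes> p
  \<otimes> t \<otimes> q; the definition of \<open>contr\<close> reads this backwards on
  coefficients. A trivial first factor gives 0 because entries of tuples are nontrivial.\<close>

lemma contr_ind:
  assumes "y \<in> X"
  shows "contr n (ind n (y, u, q)) =
    (if parcs y = [] then (\<lambda>_. 0) else ind (Suc n) (pid (psrc y), y # u, q))"
proof (intro ext)
  fix w :: "('v,'e) qpath \<times> ('v,'e) qpath list \<times> ('v,'e) qpath"
  obtain p v r where w: "w = (p, v, r)" by (cases w)
  show "contr n (ind n (y, u, q)) w =
    (if parcs y = [] then (\<lambda>_. 0) else ind (Suc n) (pid (psrc y), y # u, q)) w"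
  proof (cases "parcs p = [] \<and> w \<in> bar_basis (Suc n)")
    case True
    then have "v \<in> tuples (Suc n)" using w bar_basis_X[of p v r "Suc n"] by simp
    then obtain y' v' where v: "v = y' # v'" by (cases v) auto
    have "p \<in> X" "ptgt p = psrc y'" "parcs y' \<noteq> []" using True w v bar_basis_Cons by auto
    then have "p = pid (psrc y')" using trivial_qpath[of p] True X_subset by auto
    then show ?thesis using True w v bar_basis_Cons[of p y' v' r n]
      by (auto simp: contr_def ind_def)
  next
    case False
    then show ?thesis by (auto simp: contr_def ind_def w)
  qed
qed

lemma contr_diff: "contr n (\<lambda>z. a z - b z) w = contr n a w - contr n b w"
  by (cases w) (auto simp: contr_def)

lemma contr_lin:
  "contr n (\<lambda>z. a z + b z) w = contr n a w + contr n b w"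
  "contr n (\<lambda>z. k * a z) w = k * contr n a w" "contr n (\<lambda>_. 0) w = 0"
  by (cases w; auto simp: contr_def)+

lemma dB_lin:
  "c \<in> carrier (bar (Suc n)) \<Longrightarrow> c' \<in> carrier (bar (Suc n)) \<Longrightarrow> dB n (\<lambda>z. c z + c' z) w = dB n c w + dB n c' w"
  "c \<in> carrier (bar (Suc n)) \<Longrightarrow> dB n (\<lambda>z. k * c z) w = k * dB n c w"
  "dB n (\<lambda>_. 0) w = 0"
proof -
  show "c \<in> carrier (bar (Suc n)) \<Longrightarrow> c' \<in> carrier (bar (Suc n)) \<Longrightarrow> dB n (\<lambda>z. c z + c' z) w = dB n c w + dB n c' w"
    using hmD(2)[OF dB_hm, of c n c'] by (simp del: bar_simps(1) add: bar_simps(3))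
  show *: "c \<in> carrier (bar (Suc n)) \<Longrightarrow> dB n (\<lambda>z. k * c z) w = k * dB n c w" for c k
    using hmD(5)[OF dB_hm, of c n k] sm_bar[of c "Suc n"] sm_bar[OF hmD(1)[OF dB_hm], of c n]
    by (simp del: bar_simps(1))
  show "dB n (\<lambda>_. 0) w = 0" using *[of "\<lambda>_. 0" 0] by simp
qed

text \<open>For nontrivial \<open>p\<close>, the boundary of 1 \<otimes> p \<otimes> t \<otimes> q
  is p \<otimes> t \<otimes> q minus the image of its boundary under the homotopy. For trivial
  \<open>p\<close> the homotopy kills the element, and the first term of its boundary gives it
  back.\<close>

lemma contraction:
  assumes "c \<in> carrier (bar (Suc n))"
  shows "dB (Suc n) (contr (Suc n) c) w + contr n (dB n c) w = c w"
  using assms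
proof (induction c arbitrary: w rule: bar_induct)
  case zero
  show ?case using dB_lin(3)[of n] dB_lin(3)[of "Suc n"] contr_lin(3) by (simp add: contr_def)
next
  case (add a b)
  have "contr (Suc n) (\<lambda>z. a z + b z) = (\<lambda>z. contr (Suc n) a z + contr (Suc n) b z)"
    "dB n (\<lambda>z. a z + b z) = (\<lambda>z. dB n a z + dB n b z)"
    using contr_lin(1) dB_lin(1)[OF add.hyps] by auto
  then show ?case
    using dB_lin(1)[OF contr_carrier contr_carrier, of "Suc n" a b w] contr_lin(1)[of n "dB n a" "dB n b" w]
      add.IH[of w] by (simp only:) (simp add: algebra_simps)
next
  case (basis k z)
  obtain p t q where z: "z = (p, t, q)" by (cases z)
  have zb: "(p, t, q) \<in> bar_basis (Suc n)" using basis z by simp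
  have X: "p \<in> X" "t \<in> tuples (Suc n)" using zb bar_basis_X by auto
  obtain x r where t: "t = x # r" using X by (cases t) auto
  have x: "x \<in> X" "parcs x \<noteq> []" using X t by (auto simp: tuples_Cons)
  have px: "ptgt p = psrc x" "(x, r, q) \<in> bar_basis n" using zb t bar_basis_Cons by auto
  let ?e = "pid (psrc p)"
  have "dB (Suc n) (contr (Suc n) (ind (Suc n) z)) w + contr n (dB n (ind (Suc n) z)) w = ind (Suc n) z w"
  proof -
    have e: "contr n (dB n (ind (Suc n) z)) = contr n (\<lambda>w. ind n (pmul p x, r, q) w
       + merges (\<lambda>u. ind n (p, u, q) w) t + (-1) ^ Suc n * ind n (p, butlast t, pmul (last t) q) w)"
      unfolding z by (rule arg_cong[where f = "contr n"]) (use dB_ind[OF zb] t in auto)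
    have 1: "contr n (dB n (ind (Suc n) z)) w = contr n (ind n (pmul p x, r, q)) w + merges (\<lambda>u. contr n (ind n (p, u, q)) w) t
       + (-1) ^ Suc n * contr n (ind n (p, butlast t, pmul (last t) q)) w"
      using merges_fun_linear[of "\<lambda>u. ind n (p, u, q)" UNIV "\<lambda>c. contr n c w" t] contr_diff
      unfolding e contr_lin by simp
    show ?thesis
    proof (cases "parcs p = []")
      case True
      then have "p = pid (psrc x)" using trivial_qpath[of p] X px X_subset by auto
      then have "pmul p x = x" "p = pid (psrc x)" by auto
      then have "contr n (ind n (pmul p x, r, q)) w = ind (Suc n) z w"
        using contr_ind[OF x(1)] x t z by simp
      moreover have "contr n (ind n (p, u, q')) w = 0" for u q'
        using contr_ind[OF X(1)] True by simp
      moreover have "dB (Suc n) (contr (Suc n) (ind (Suc n) z)) w = 0"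
        using contr_ind[OF X(1)] True z dB_lin(3) by simp
      ultimately show ?thesis using 1 by simp
    next
      case False
      have zb': "(?e, p # t, q) \<in> bar_basis (Suc (Suc n))"
        using zb False X pid_in_X by (simp add: bar_basis_Cons)
      have c1: "contr n (ind n (pmul p x, r, q)) w = ind (Suc n) (?e, pmul p x # r, q) w"
      proof (cases "pmul p x \<in> X")
        case True
        then show ?thesis using contr_ind[OF True] x by simp
      next
        case False
        then show ?thesis
          by (cases w) (auto simp: contr_def ind_def bar_basis_Cons dest: bar_basis_X)
      qed
      have c2: "contr n (ind n (p, u, q')) w = ind (Suc n) (?e, p # u, q') w" for u q'
        using contr_ind[OF X(1)] False by simp
      have "dB (Suc n) (contr (Suc n) (ind (Suc n) z)) w = ind (Suc n) (pmul ?e p, t, q) w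
        + merges (\<lambda>u. ind (Suc n) (?e, u, q) w) (p # t)
        + (-1) ^ Suc (Suc n) * ind (Suc n) (?e, butlast (p # t), pmul (last (p # t)) q) w"
        using dB_ind[OF zb'] contr_ind[OF X(1)] False z by simp
      then show ?thesis unfolding 1 c1 c2 using t z by simp
    qed
  qed
  moreover have "dB n (\<lambda>w. k * ind (Suc n) z w) = (\<lambda>w. k * dB n (ind (Suc n) z) w)"
    by (rule ext) (rule dB_lin(2)[OF ind_carrier])
  moreover have "contr (Suc n) (\<lambda>w. k * ind (Suc n) z w) = (\<lambda>w. k * contr (Suc n) (ind (Suc n) z) w)"
    by (rule ext) (rule contr_lin(2))
  ultimately show ?case
    using dB_lin(2)[OF contr_carrier, of "Suc n" k "ind (Suc n) z" w] contr_lin(2)[of n k "dB n (ind (Suc n) z)" w]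
    by (simp only:) (simp flip: distrib_left)
qed

text \<open>The lowest piece of the homotopy, a going to 1 \<otimes> a.\<close>

definition contr_aug :: "'a \<Rightarrow> ('v,'e) qpath \<times> ('v,'e) qpath list \<times> ('v,'e) qpath \<Rightarrow> 'k" where
  "contr_aug a = (\<lambda>(p, u, q). if parcs p = [] \<and> (p, u, q) \<in> bar_basis 0 then coef a q else 0)"

lemma aug_ind: "(p, [], q) \<in> bar_basis 0 \<Longrightarrow> aug (ind 0 (p, [], q)) = bas p \<otimes>\<^bsub>A\<^esub> bas q"
proof -
  assume z: "(p, [], q) \<in> bar_basis 0"
  have X: "p \<in> X" "q \<in> X" using z bar_basis_X by auto
  have "aug (ind 0 (p, [], q)) = (bas p \<otimes>\<^bsub>A\<^esub> \<one>\<^bsub>A\<^esub>) \<otimes>\<^bsub>A\<^esub> bas q"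
    unfolding aug_def
    by (subst extend_ind[OF bimodule_regular _ z]) (simp_all add: A_closed term_at_def)
  moreover have "bas p \<otimes>\<^bsub>A\<^esub> \<one>\<^bsub>A\<^esub> = bas p"
    using bimodule.r_unit[OF bimodule_regular, of "bas p"] bas X by simp
  ultimately show ?thesis by simp
qed

lemma aug_gen: "aug (gen 0 []) = \<one>\<^bsub>A\<^esub>"
  unfolding aug_def
  by (rule extend_gen[OF bimodule_regular])
    (simp_all add: A_closed corner_def bas bimodule.l_unit[OF bimodule_regular, simplified]
      bimodule.r_unit[OF bimodule_regular, simplified])

lemma aug_bd: "t \<in> tuples (Suc 0) \<Longrightarrow> aug (bd 0 t) = \<zero>\<^bsub>A\<^esub>"
proof -
  assume t: "t \<in> tuples (Suc 0)"
  then obtain x where x: "t = [x]" by (auto simp: tuples_def length_Suc_conv)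
  have X: "x \<in> X" using t x by (auto simp: tuples_Cons)
  interpret B: bimodule A "bar 0" by (rule bimodule_bar)
  note g = aug_gen
  have ux: "\<And>p. (unit_at x p :: 'k) \<noteq> 0 \<Longrightarrow> p \<in> X" using X by (auto simp: unit_at_def split: if_splits)
  show ?thesis
  proof (rule coef_eqI)
    fix \<gamma>
    have "coef (aug (bd 0 t)) \<gamma> = coef (aug (bas x \<odot>\<^bsub>bar 0\<^esub> gen 0 [])) \<gamma> - coef (aug (gen 0 [] \<diamondop>\<^bsub>bar 0\<^esub> bas x)) \<gamma>"
      using functional_bd(2)[OF functional_comp[OF aug_hm functional_coef] t, of \<gamma>] x by simp
    then show "coef (aug (bd 0 t)) \<gamma> = coef \<zero>\<^bsub>A\<^esub> \<gamma>"
      unfolding hmD(3)[OF aug_hm bas(1)[OF X] gen_carrier] hmD(4)[OF aug_hm bas(1)[OF X] gen_carrier] g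
      using bas(1)[OF X] bas(2)[OF X] X by (simp add: coef_ops A_closed conv_one_left[OF ux] conv_one_right[OF ux])
  qed (use hmD(1)[OF aug_hm bd_carrier[OF t]] A_closed in auto)
qed

lemma contraction_aug:
  assumes "c \<in> carrier (bar 0)"
  shows "dB 0 (contr 0 c) w + contr_aug (aug c) w = c w"
  using assms
proof (induction c arbitrary: w rule: bar_induct)
  case zero
  have "aug (\<lambda>_. 0) = \<zero>\<^bsub>A\<^esub>" using hm_zero[OF aug_hm bimodule_bar bimodule_regular] by simp
  moreover have "contr 0 (\<lambda>_. 0) = (\<lambda>_. 0)" using contr_lin(3) by blast
  ultimately show ?case using dB_lin(3)[of 0] by (cases w) (simp add: contr_aug_def coef_ops)
next
  case (add a b)
  have "contr 0 (\<lambda>z. a z + b z) = (\<lambda>z. contr 0 a z + contr 0 b z)" using contr_lin(1) by blast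
  moreover have "contr_aug (aug (\<lambda>z. a z + b z)) w = contr_aug (aug a) w + contr_aug (aug b) w"
    using hmD(2)[OF aug_hm add.hyps] hmD(1)[OF aug_hm add.hyps(1)] hmD(1)[OF aug_hm add.hyps(2)]
    by (cases w) (simp add: contr_aug_def coef_ops)
  ultimately show ?case
    using dB_lin(1)[OF contr_carrier contr_carrier, of 0 a b w] add.IH[of w]
    by (simp only:) (simp add: algebra_simps)
next
  case (basis k z)
  obtain p t q where z: "z = (p, t, q)" by (cases z)
  have t: "t = []" using basis z bar_basis_X[of p t q 0] by (auto simp: tuples_def)
  have zb: "(p, [], q) \<in> bar_basis 0" using basis z t by simp
  have X: "p \<in> X" "q \<in> X" "ptgt p = psrc q" using zb by (auto simp: bar_basis_def)
  have 1: "contr_aug (aug (ind 0 z)) w = ind 0 (pid (psrc p), [], pmul p q) w"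
  proof -
    obtain p' u q' where w: "w = (p', u, q')" by (cases w)
    have "coef (aug (ind 0 z)) q' = (if q' = pmul p q \<and> pmul p q \<in> X then 1 else 0)"
      using X by (auto simp: aug_ind[OF zb] z t bas_mult bas coef_ops unit_at_def)
    moreover have "parcs p' = [] \<and> (p', u, pmul p q) \<in> bar_basis 0 \<longleftrightarrow>
      p' = pid (psrc p) \<and> u = [] \<and> (p', u, pmul p q) \<in> bar_basis 0"
      using trivial_qpath[of p'] X_subset by (auto simp: bar_basis_def tuples_def)
    moreover have "(p', u, pmul p q) \<in> bar_basis 0 \<Longrightarrow> pmul p q \<in> X" by (auto simp: bar_basis_def)
    ultimately show ?thesis by (auto simp: contr_aug_def w ind_def)
  qed
  have "dB 0 (contr 0 (ind 0 z)) w + contr_aug (aug (ind 0 z)) w = ind 0 z w"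
  proof (cases "parcs p = []")
    case True
    then have "p = pid (psrc q)" using trivial_qpath[of p] X X_subset by auto
    then have "pmul p q = q" "pid (psrc p) = p" by auto
    then show ?thesis using 1 contr_ind[OF X(1)] True z t dB_lin(3)[of 0] by simp
  next
    case False
    have "(pid (psrc p), [p], q) \<in> bar_basis (Suc 0)"
      using zb False X pid_in_X by (simp add: bar_basis_Cons)
    from dB_ind[OF this, of w] show ?thesis using 1 contr_ind[OF X(1)] False z t by simp
  qed
  moreover have "contr_aug (aug (\<lambda>w. k * ind 0 z w)) w = k * contr_aug (aug (ind 0 z)) w"
    using hmD(5)[OF aug_hm ind_carrier[of 0 z], where k = k] sm_bar[OF ind_carrier[of 0 z], of k]
      functional_coef hmD(1)[OF aug_hm ind_carrier[of 0 z]]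
    by (cases w) (simp add: contr_aug_def functional_def)
  moreover have "contr 0 (\<lambda>w. k * ind 0 z w) = (\<lambda>w. k * contr 0 (ind 0 z) w)"
    using contr_lin(2) by blast
  ultimately show ?case
    using dB_lin(2)[OF contr_carrier, of 0 k "ind 0 z" w] by (simp only:) (simp flip: distrib_left)
qed

lemma aug_dB:
  assumes "c \<in> carrier (bar (Suc 0))" shows "aug (dB 0 c) = \<zero>\<^bsub>A\<^esub>"
proof -
  have "aug (dB 0 c) = \<zero>\<^bsub>regular_bimodule A\<^esub>"
  proof (rule hm_bar_ind_eqI[OF bimodule_regular hm_comp[OF dB_hm aug_hm] hm_zero_map[OF bimodule_regular] _ assms])
    fix z assume z: "z \<in> bar_basis (Suc 0)"
    obtain p t q where z': "z = (p, t, q)" by (cases z)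
    have X: "p \<in> X" "q \<in> X" "t \<in> tuples (Suc 0)" using z z' bar_basis_X by auto
    have "dB 0 (ind (Suc 0) z) = (bas p \<odot>\<^bsub>bar 0\<^esub> bd 0 t) \<diamondop>\<^bsub>bar 0\<^esub> bas q"
      unfolding dB_def by (subst extend_ind[OF bimodule_bar bd_carrier z]) (simp_all add: term_at_def z' del: bar_simps)
    then have "aug (dB 0 (ind (Suc 0) z)) = (bas p \<otimes>\<^bsub>A\<^esub> aug (bd 0 t)) \<otimes>\<^bsub>A\<^esub> bas q"
      using hmD(3)[OF aug_hm bas(1)[OF X(1)] bd_carrier[OF X(3)]]
        hmD(4)[OF aug_hm bas(1)[OF X(2)] bimodule.l_closed[OF bimodule_bar bas(1)[OF X(1)] bd_carrier[OF X(3)]]]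
      by simp
    then show "aug (dB 0 (ind (Suc 0) z)) = \<zero>\<^bsub>regular_bimodule A\<^esub>"
      using aug_bd[OF X(3)] smult_zero[OF bimodule_regular bas(1)[OF X(1)]]
        rsmult_zero[OF bimodule_regular bas(1)[OF X(2)]] by simp
  qed
  then show ?thesis by simp
qed

section \<open>The bar complex as a resolution\<close>

lemma dB_diff: "c \<in> carrier (bar (Suc n)) \<Longrightarrow> c' \<in> carrier (bar (Suc n)) \<Longrightarrow>
    dB n (\<lambda>z. c z - c' z) w = dB n c w - dB n c' w"
  using dB_lin(1)[of c n "\<lambda>z. (-1) * c' z" w] dB_lin(2)[of c' n "-1" w] bar_scale[of c' "Suc n" "-1"]
  by (simp del: bar_simps)

text \<open>Derived from the contraction instead of a double sum of merges. A generator has the form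
  contr d, its boundary is d - contr (dB d), and the boundary of that is 0 once dB (contr (dB d)) =
  dB d. The last equation is the contraction one degree lower, where the previous case of the
  induction, or \<open>aug_dB\<close> at the bottom, removes the other term.\<close>

lemma dB_dB: "c \<in> carrier (bar (Suc (Suc n))) \<Longrightarrow> dB n (dB (Suc n) c) = \<zero>\<^bsub>bar n\<^esub>"
proof (induction n arbitrary: c)
  have gens: "dB n (dB (Suc n) c) = \<zero>\<^bsub>bar n\<^esub>"
    if exact: "\<And>d. d \<in> carrier (bar (Suc n)) \<Longrightarrow> dB n (contr n (dB n d)) = dB n d"
      and c: "c \<in> carrier (bar (Suc (Suc n)))" for n c
  proof (rule hm_bar_eqI[OF bimodule_bar hm_comp[OF dB_hm dB_hm] hm_zero_map[OF bimodule_bar] _ c])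
    fix t assume t: "t \<in> tuples (Suc (Suc n))"
    then obtain y u where yu: "t = y # u" by (cases t) auto
    have y: "y \<in> X" "parcs y \<noteq> []" using t yu by (auto simp: tuples_Cons)
    define d where "d = ind (Suc n) (y, u, pid (ptgt (last t)))"
    have d: "d \<in> carrier (bar (Suc n))" unfolding d_def by (rule ind_carrier)
    have "gen (Suc (Suc n)) t = contr (Suc n) d"
      using gen_ind[OF t] contr_ind[OF y(1)] y(2) yu by (simp add: d_def)
    moreover have "dB (Suc n) (contr (Suc n) d) = (\<lambda>w. d w - contr n (dB n d) w)"
      using contraction[OF d] by (auto simp: algebra_simps)
    moreover have "dB n (\<lambda>w. d w - contr n (dB n d) w) = (\<lambda>_. 0)"
      using dB_diff[OF d contr_carrier] exact[OF d] by auto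
    ultimately show "dB n (dB (Suc n) (gen (Suc (Suc n)) t)) = \<zero>\<^bsub>bar n\<^esub>" by simp
  qed
  {
    case 0
    show ?case
    proof (rule gens[OF _ 0])
      fix d assume d: "d \<in> carrier (bar (Suc 0))"
      have "contr_aug (aug (dB 0 d)) = (\<lambda>_. 0)" by (auto simp: aug_dB[OF d] contr_aug_def coef_ops)
      then show "dB 0 (contr 0 (dB 0 d)) = dB 0 d" using contraction_aug[OF hmD(1)[OF dB_hm d]] by auto
    qed
  next
    case (Suc n)
    show ?case
    proof (rule gens[OF _ Suc.prems])
      fix d assume d: "d \<in> carrier (bar (Suc (Suc n)))"
      have "contr n (dB n (dB (Suc n) d)) = (\<lambda>_. 0)" using Suc.IH[OF d] contr_lin(3) by auto
      then show "dB (Suc n) (contr (Suc n) (dB (Suc n) d)) = dB (Suc n) d"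
        using contraction[OF hmD(1)[OF dB_hm d]] by auto
    qed
  }
qed

lemma bar_exact: "c \<in> carrier (bar (Suc n)) \<Longrightarrow> dB n c = \<zero>\<^bsub>bar n\<^esub> \<Longrightarrow> c \<in> dB (Suc n) ` carrier (bar (Suc (Suc n)))"
  using contraction[of c n] contr_carrier contr_lin(3)[of n]
  by (intro image_eqI[of _ _ "contr (Suc n) c"] ext) (simp_all del: bar_simps(1))

lemma bar_exact_aug: "c \<in> carrier (bar 0) \<Longrightarrow> aug c = \<zero>\<^bsub>A\<^esub> \<Longrightarrow> c \<in> dB 0 ` carrier (bar (Suc 0))"
proof -
  assume c: "c \<in> carrier (bar 0)" "aug c = \<zero>\<^bsub>A\<^esub>"
  have "contr_aug \<zero>\<^bsub>A\<^esub> = (\<lambda>_. 0)" by (auto simp: contr_aug_def coef_ops)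
  then have "dB 0 (contr 0 c) = c" using contraction_aug[OF c(1)] c(2) by auto
  then show ?thesis using contr_carrier[of 0 c] by (metis image_eqI)
qed

lemma aug_surj: "a \<in> carrier A \<Longrightarrow> a \<in> aug ` carrier (bar 0)"
proof (rule image_eqI)
  assume a: "a \<in> carrier A"
  show "a \<odot>\<^bsub>bar 0\<^esub> gen 0 [] \<in> carrier (bar 0)"
    by (rule bimodule.l_closed[OF bimodule_bar a gen_carrier])
  show "a = aug (a \<odot>\<^bsub>bar 0\<^esub> gen 0 [])"
    unfolding hmD(3)[OF aug_hm a gen_carrier] aug_gen
    using bimodule.r_unit[OF bimodule_regular, of a] a by simp
qed

lemma dB_gen: "t \<in> tuples (Suc n) \<Longrightarrow> dB n (gen (Suc n) t) = bd n t"
proof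
  fix w assume t: "t \<in> tuples (Suc n)"
  note h = tuples_hd_last[OF t]
  let ?e = "pid (psrc (hd t))" and ?e' = "pid (ptgt (last t))"
  have X: "?e \<in> X" "?e' \<in> X" using pid_in_X h by auto
  have zb: "(?e, t, ?e') \<in> bar_basis (Suc n)" using X t h by (auto simp: bar_basis_def)
  have "bas (hd t) \<odot>\<^bsub>bar n\<^esub> gen n (tl t) = ind n (hd t, tl t, ?e')"
    unfolding bas_gen[OF h(1)] ind_def
  proof (intro ext, clarify)
    fix p1 p3 q1 q3 :: 'v and p2 q2 :: "'e list" and u
    have "(hd t, tl t, q) \<in> bar_basis n \<Longrightarrow> psrc q = ptgt (last t)" for q
      using h(5) by (cases t) (auto simp: bar_basis_def split: if_splits)
    then have "((p1, p2, p3) = hd t \<and> u = tl t \<and> parcs (q1, q2, q3) = [] \<and> (hd t, tl t, (q1, q2, q3)) \<in> bar_basis n) \<longleftrightarrow>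
      (((p1, p2, p3), u, (q1, q2, q3)) = (hd t, tl t, ?e') \<and> (hd t, tl t, ?e') \<in> bar_basis n)"
      using trivial_qpath[of "(q1, q2, q3)"] X_subset bar_basis_X[of "hd t" "tl t" "(q1, q2, q3)" n] by auto
    then show "(if (p1, p2, p3) = hd t \<and> u = tl t \<and> parcs (q1, q2, q3) = [] \<and> (hd t, tl t, (q1, q2, q3)) \<in> bar_basis n
        then 1 else 0) = (if ((p1, p2, p3), u, (q1, q2, q3)) = (hd t, tl t, ?e')
          \<and> (hd t, tl t, ?e') \<in> bar_basis n then 1 else (0::'k))" by (rule if_cong[OF _ refl refl])
  qed
  moreover have "gen n (butlast t) \<diamondop>\<^bsub>bar n\<^esub> bas (last t) = ind n (?e, butlast t, last t)"
    unfolding gen_bas[OF h(2)] ind_def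
  proof (intro ext, clarify)
    fix p1 p3 q1 q3 :: 'v and p2 q2 :: "'e list" and u
    have "(p, butlast t, last t) \<in> bar_basis n \<Longrightarrow> ptgt p = psrc (hd t)" for p
      using h(5) by (cases t rule: rev_cases) (auto simp: bar_basis_def hd_append split: if_splits)
    then have "((q1, q2, q3) = last t \<and> u = butlast t \<and> parcs (p1, p2, p3) = [] \<and> ((p1, p2, p3), butlast t, last t) \<in> bar_basis n) \<longleftrightarrow>
      (((p1, p2, p3), u, (q1, q2, q3)) = (?e, butlast t, last t) \<and> (?e, butlast t, last t) \<in> bar_basis n)"
      using trivial_qpath[of "(p1, p2, p3)"] X_subset bar_basis_X[of "(p1, p2, p3)" "butlast t" "last t" n] by auto
    then show "(if (q1, q2, q3) = last t \<and> u = butlast t \<and> parcs (p1, p2, p3) = [] \<and> ((p1, p2, p3), butlast t, last t) \<in> bar_basis n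
        then 1 else 0) = (if ((p1, p2, p3), u, (q1, q2, q3)) = (?e, butlast t, last t)
          \<and> (?e, butlast t, last t) \<in> bar_basis n then 1 else (0::'k))" by (rule if_cong[OF _ refl refl])
  qed
  moreover have "merges (\<lambda>u. ind n (?e, u, ?e') w) t = merges (\<lambda>u. gen n u w) t"
  proof (rule merges_cong_ends)
    fix u :: "('v,'e) qpath list" assume u: "Suc (length u) = length t" "u \<noteq> []" "psrc (hd u) = psrc (hd t)" "ptgt (last u) = ptgt (last t)"
    show "ind n (?e, u, ?e') w = gen n u w"
    proof (cases "u \<in> tuples n")
      case True
      then show ?thesis using gen_ind[OF True u(2)] u by simp
    next
      case False
      then show ?thesis by (cases w) (auto simp: gen_def ind_def bar_basis_def)
    qed
  qed
  ultimately show "dB n (gen (Suc n) t) w = bd n t w"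
    using dB_ind[OF zb, of w] gen_ind[OF t h(5)] by (simp add: bd_def del: bar_simps)
qed

end

section \<open>Lifting and comparison of resolutions\<close>

text \<open>An infinite set is equipotent with its square, so finitely many field elements can be
  packed into one.\<close>

lemma finite_functions_inj:
  fixes \<kappa> :: "'k::zero \<Rightarrow> 'p"
  assumes "finite S" and inf: "infinite (UNIV :: 'k set)" and \<kappa>: "inj \<kappa>"
  shows "\<exists>\<iota> :: ('z \<Rightarrow> 'k) \<Rightarrow> 'p. inj_on \<iota> {c. \<forall>z. c z \<noteq> 0 \<longrightarrow> z \<in> S}"
proof -
  obtain pr :: "'k \<times> 'k \<Rightarrow> 'k" where pr: "inj pr"
    using card_of_Times_same_infinite[OF inf] by (auto simp: bij_betw_def simp flip: card_of_ordIso)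
  have "\<exists>\<iota> :: ('z \<Rightarrow> 'k) \<Rightarrow> 'k. inj_on \<iota> {c. \<forall>z. c z \<noteq> 0 \<longrightarrow> z \<in> S}"
    using assms(1)
  proof (induction S rule: finite_induct)
    case empty
    have "{c. \<forall>z. c z \<noteq> 0 \<longrightarrow> z \<in> {}} = {\<lambda>_::'z. 0::'k}" by auto
    then show ?case by simp
  next
    case (insert x F)
    then obtain \<iota> :: "('z \<Rightarrow> 'k) \<Rightarrow> 'k" where \<iota>: "inj_on \<iota> {c. \<forall>z. c z \<noteq> 0 \<longrightarrow> z \<in> F}" by blast
    have "inj_on (\<lambda>c. pr (c x, \<iota> (c(x := 0)))) {c. \<forall>z. c z \<noteq> 0 \<longrightarrow> z \<in> insert x F}"
    proof (rule inj_onI)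
      fix c c' assume c: "c \<in> {c. \<forall>z. c z \<noteq> 0 \<longrightarrow> z \<in> insert x F}" "c' \<in> {c. \<forall>z. c z \<noteq> 0 \<longrightarrow> z \<in> insert x F}"
        and e: "pr (c x, \<iota> (c(x := 0))) = pr (c' x, \<iota> (c'(x := 0)))"
      then have e': "c x = c' x" "\<iota> (c(x := 0)) = \<iota> (c'(x := 0))" using pr by (auto dest: injD)
      have m: "c(x := 0) \<in> {c. \<forall>z. c z \<noteq> 0 \<longrightarrow> z \<in> F}" "c'(x := 0) \<in> {c. \<forall>z. c z \<noteq> 0 \<longrightarrow> z \<in> F}"
        using c by auto
      have "c(x := 0) = c'(x := 0)" using inj_on_eq_iff[OF \<iota> m] e'(2) by simp
      then show "c = c'" using e'(1) by (metis fun_upd_triv fun_upd_upd)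
    qed
    then show ?case by blast
  qed
  then obtain \<iota> :: "('z \<Rightarrow> 'k) \<Rightarrow> 'k" where "inj_on \<iota> {c. \<forall>z. c z \<noteq> 0 \<longrightarrow> z \<in> S}" by blast
  then have "inj_on (\<kappa> \<circ> \<iota>) {c. \<forall>z. c z \<noteq> 0 \<longrightarrow> z \<in> S}"
    using \<kappa> by (intro comp_inj_on) (auto intro: inj_on_subset)
  then show ?thesis by blast
qed

section \<open>Copying bimodules into another type\<close>

definition transport :: "('m \<Rightarrow> 'p) \<Rightarrow> ('a, 'm) bimod \<Rightarrow> ('a, 'p) bimod" where
  "transport \<iota> M = (let back = inv_into (carrier M) \<iota> in
    \<lparr>carrier = \<iota> ` carrier M, monoid.mult = (\<lambda>_ _. \<iota> \<zero>\<^bsub>M\<^esub>), one = \<iota> \<zero>\<^bsub>M\<^esub>, zero = \<iota> \<zero>\<^bsub>M\<^esub>,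
     add = (\<lambda>x y. \<iota> (back x \<oplus>\<^bsub>M\<^esub> back y)), module.smult = (\<lambda>a x. \<iota> (a \<odot>\<^bsub>M\<^esub> back x)),
     rsmult = (\<lambda>x a. \<iota> (back x \<diamondop>\<^bsub>M\<^esub> a))\<rparr>)"

lemma transport_simps [simp]:
  "carrier (transport \<iota> M) = \<iota> ` carrier M" "\<zero>\<^bsub>transport \<iota> M\<^esub> = \<iota> \<zero>\<^bsub>M\<^esub>"
  "x \<oplus>\<^bsub>transport \<iota> M\<^esub> y = \<iota> (inv_into (carrier M) \<iota> x \<oplus>\<^bsub>M\<^esub> inv_into (carrier M) \<iota> y)"
  "a \<odot>\<^bsub>transport \<iota> M\<^esub> x = \<iota> (a \<odot>\<^bsub>M\<^esub> inv_into (carrier M) \<iota> x)"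
  "x \<diamondop>\<^bsub>transport \<iota> M\<^esub> a = \<iota> (inv_into (carrier M) \<iota> x \<diamondop>\<^bsub>M\<^esub> a)"
  by (simp_all add: transport_def Let_def)

context coord_algebra
begin

lemma bimodule_transport:
  assumes M: "bimodule A M" and \<iota>: "inj_on \<iota> (carrier M)"
  shows "bimodule A (transport \<iota> M)"
proof -
  interpret M: bimodule A M by fact
  have [simp]: "x \<in> carrier M \<Longrightarrow> inv_into (carrier M) \<iota> (\<iota> x) = x" for x
    using \<iota> by simp
  have sc: "c \<odot>\<^bsub>A\<^esub> \<one>\<^bsub>A\<^esub> \<in> carrier A" for c using A_closed by simp
  show ?thesis
  proof (intro bimodule.intro bimodule_axioms.intro)
    show "abelian_group (transport \<iota> M)"
    proof (rule abelian_groupI)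
      fix x assume "x \<in> carrier (transport \<iota> M)"
      then obtain y where y: "y \<in> carrier M" "x = \<iota> y" by auto
      then show "\<exists>z\<in>carrier (transport \<iota> M). z \<oplus>\<^bsub>transport \<iota> M\<^esub> x = \<zero>\<^bsub>transport \<iota> M\<^esub>"
        using M.l_neg[OF y(1)] by (intro bexI[of _ "\<iota> (\<ominus>\<^bsub>M\<^esub> y)"]) auto
    qed (auto simp: M.a_ac)
  qed (auto simp: M.l_closed M.r_closed M.l_distr_ring M.r_distr_ring M.l_distr_mod M.r_distr_mod
      M.l_assoc M.r_assoc M.lr_assoc M.l_unit M.r_unit M.scalars_central A_closed sc)
qed

text \<open>Projectivity speaks of surjections only, so the target has to be cut down to the image
  of \<open>g\<close>.\<close>

lemma bimodule_image:
  assumes M: "bimodule A M" and N: "bimodule A N" and g: "g \<in> hm M N"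
  shows "bimodule A (N\<lparr>carrier := g ` carrier M\<rparr>)"
proof -
  interpret M: bimodule A M by fact
  interpret N: bimodule A N by fact
  note gs = hmD[OF g]
  have sub: "x \<in> carrier M \<Longrightarrow> g x \<in> carrier N" for x by (rule gs)
  have cl: "g x \<oplus>\<^bsub>N\<^esub> g y \<in> g ` carrier M" if "x \<in> carrier M" "y \<in> carrier M" for x y
    using gs(2)[OF that] that by (metis M.a_closed image_eqI)
  have ng: "\<exists>y\<in>carrier M. g y \<oplus>\<^bsub>N\<^esub> g x = \<zero>\<^bsub>N\<^esub>" if "x \<in> carrier M" for x
    using gs(2)[of "\<ominus>\<^bsub>M\<^esub> x" x] that M.l_neg[OF that] hm_zero[OF g M N]
    by (intro bexI[of _ "\<ominus>\<^bsub>M\<^esub> x"]) simp_all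
  have z: "\<zero>\<^bsub>N\<^esub> \<in> g ` carrier M" using hm_zero[OF g M N] M.zero_closed by (metis image_eqI)
  have l: "a \<odot>\<^bsub>N\<^esub> g x \<in> g ` carrier M" "g x \<diamondop>\<^bsub>N\<^esub> a \<in> g ` carrier M" if "a \<in> carrier A" "x \<in> carrier M" for a x
    using gs(3,4)[OF that] M.l_closed[OF that] M.r_closed[OF that] by (metis image_eqI)+
  show ?thesis
  proof (intro bimodule.intro bimodule_axioms.intro)
    show "abelian_group (N\<lparr>carrier := g ` carrier M\<rparr>)"
    proof (rule abelian_groupI)
      fix x assume "x \<in> carrier (N\<lparr>carrier := g ` carrier M\<rparr>)"
      then show "\<exists>y\<in>carrier (N\<lparr>carrier := g ` carrier M\<rparr>).
          y \<oplus>\<^bsub>N\<lparr>carrier := g ` carrier M\<rparr>\<^esub> x = \<zero>\<^bsub>N\<lparr>carrier := g ` carrier M\<rparr>\<^esub>"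
        using ng by auto
    qed (auto simp: cl z sub N.a_ac)
  qed (auto simp: l sub N.l_distr_ring N.r_distr_ring N.l_distr_mod N.r_distr_mod
      N.l_assoc N.r_assoc N.lr_assoc N.l_unit N.r_unit N.scalars_central)
qed

text \<open>Lifting against one map \<open>g\<close>. The image of \<open>f\<close> is required to
  lie in that of \<open>g\<close> instead of \<open>g\<close> being surjective, which is what
  exactness delivers, and the types of the three bimodules are independent.\<close>

definition lifts :: "('a, 'c) bimod \<Rightarrow> ('a, 'm) bimod \<Rightarrow> ('a, 'n) bimod \<Rightarrow> ('m \<Rightarrow> 'n) \<Rightarrow> bool" where
  "lifts C M N g \<longleftrightarrow> (\<forall>f\<in>hm C N. f ` carrier C \<subseteq> g ` carrier M \<longrightarrow>
     (\<exists>h\<in>hm C M. \<forall>x\<in>carrier C. g (h x) = f x))"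

text \<open>Preimages of the values at the generators can be chosen freely, without regard to
  vertices, because \<open>extend\<close> multiplies them by paths on both sides and
  \<open>g\<close> commutes with this.\<close>

lemma lifts_bar:
  assumes M: "bimodule A M" and N: "bimodule A N" and g: "g \<in> hm M N"
  shows "lifts (bar n) M N g"
  unfolding lifts_def
proof (intro ballI impI)
  fix f assume f: "f \<in> hm (bar n) N" and im: "f ` carrier (bar n) \<subseteq> g ` carrier M"
  interpret M: bimodule A M by fact
  have "\<forall>t. \<exists>y. y \<in> carrier M \<and> g y = f (gen n t)"
  proof
    fix t
    have "f (gen n t) \<in> g ` carrier M" using im gen_carrier by blast
    then show "\<exists>y. y \<in> carrier M \<and> g y = f (gen n t)" by auto
  qed
  then obtain y where y: "\<And>t. y t \<in> carrier M" "\<And>t. g (y t) = f (gen n t)" by metis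
  have yM: "\<And>t. t \<in> tuples n \<Longrightarrow> y t \<in> carrier M" using y(1) by simp
  have fN: "\<And>t. t \<in> tuples n \<Longrightarrow> f (gen n t) \<in> carrier N" using hmD(1)[OF f gen_carrier] by simp
  note h = extend_hm[where x = y and n = n, OF M yM]
  have "g (extend M n y c) = f c" if c: "c \<in> carrier (bar n)" for c
  proof (rule hm_bar_ind_eqI[OF N hm_comp[OF h g] f _ c])
    fix z assume z: "z \<in> bar_basis n"
    obtain p t q where z': "z = (p, t, q)" by (cases z)
    have X: "p \<in> X" "q \<in> X" using z z' bar_basis_X by auto
    have "g (extend M n y (ind n z)) = term_at N (\<lambda>t. f (gen n t)) z"
    proof -
      have "extend M n y (ind n z) = term_at M y z" by (rule extend_ind[OF M yM z])
      then show ?thesis by (simp add: z' term_at_def hmD[OF g] bas X y M.l_closed)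
    qed
    also have "\<dots> = f (ind n z)"
      using hm_eq_extend[OF N f ind_carrier] extend_ind[where x = "\<lambda>t. f (gen n t)", OF N fN z]
      by simp
    finally show "g (extend M n y (ind n z)) = f (ind n z)" .
  qed
  then show "\<exists>h\<in>hm (bar n) M. \<forall>x\<in>carrier (bar n). g (h x) = f x" using h by blast
qed

lemma bimodule_hom_hm: "f \<in> bimodule_hom A M N \<Longrightarrow> f \<in> hm M N"
  by (auto simp: bimodule_hom_def hm_def)

lemma hm_restrict: "bimodule A M \<Longrightarrow> f \<in> hm M N \<Longrightarrow> restrict f (carrier M) \<in> bimodule_hom A M N"
proof -
  assume M: "bimodule A M" and f: "f \<in> hm M N"
  interpret M: bimodule A M by fact
  show ?thesis using hmD[OF f] by (auto simp: bimodule_hom_def M.l_closed M.r_closed)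
qed

text \<open>
  The lifting property in \<^const>\<open>projective_bimodule\<close> is confined to one type; any surjection
  whose domain injects into that type can be copied there.
\<close>

lemma projective_lifts:
  fixes P :: "('a, 'p) bimod" and M :: "('a, 'm) bimod" and \<iota> :: "'m \<Rightarrow> 'p"
  assumes P: "projective_bimodule A P" and M: "bimodule A M" and N: "bimodule A N"
    and g: "g \<in> hm M N" and \<iota>: "inj_on \<iota> (carrier M)"
  shows "lifts P M N g"
  unfolding lifts_def
proof (intro ballI impI)
  fix f assume f: "f \<in> hm P N" and im: "f ` carrier P \<subseteq> g ` carrier M"
  let ?N = "N\<lparr>carrier := g ` carrier M\<rparr>"
  \<comment> \<open>The image of \<open>g\<close> is copied as well, each element being represented
    by a chosen preimage in \<open>M\<close>. Nothing is needed about the size of the type of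
    \<open>N\<close>.\<close>
  define \<nu> where "\<nu> = (\<lambda>y. \<iota> (inv_into (carrier M) g y))"
  have \<nu>: "inj_on \<nu> (carrier ?N)"
    by (rule inj_onI) (auto simp: \<nu>_def dest!: inj_onD[OF \<iota>] intro: inv_into_into inv_into_injective)
  have PB: "bimodule A P" using P by (simp add: projective_bimodule_def)
  note M' = bimodule_transport[OF M \<iota>] and N' = bimodule_transport[OF bimodule_image[OF M N g] \<nu>]
  have iM: "x \<in> carrier M \<Longrightarrow> inv_into (carrier M) \<iota> (\<iota> x) = x" for x using \<iota> by simp
  have iN: "y \<in> g ` carrier M \<Longrightarrow> inv_into (g ` carrier M) \<nu> (\<nu> y) = y" for y using \<nu> by simp
  interpret M: bimodule A M by fact
  interpret P: bimodule A P by fact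
  define g' where "g' = restrict (\<lambda>x. \<nu> (g (inv_into (carrier M) \<iota> x))) (carrier (transport \<iota> M))"
  have g': "g' \<in> bimodule_hom A (transport \<iota> M) (transport \<nu> ?N)"
    unfolding g'_def
    by (rule hm_restrict[OF M']) (auto simp: hm_def iM iN hmD[OF g] M.l_closed M.r_closed)
  have im': "g' ` carrier (transport \<iota> M) = carrier (transport \<nu> ?N)"
    by (force simp: g'_def iM)
  define f' where "f' = restrict (\<lambda>x. \<nu> (f x)) (carrier P)"
  have fi: "x \<in> carrier P \<Longrightarrow> f x \<in> g ` carrier M" for x using im by auto
  have f': "f' \<in> bimodule_hom A P (transport \<nu> ?N)"
    unfolding f'_def
    by (rule hm_restrict[OF PB]) (auto simp: hm_def iN fi hmD[OF f])
  obtain h where h: "h \<in> bimodule_hom A P (transport \<iota> M)" "compose (carrier P) g' h = f'"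
    using P M' N' g' im' f' unfolding projective_bimodule_def by blast
  note hh = hmD[OF bimodule_hom_hm[OF h(1)]]
  have hi: "x \<in> carrier P \<Longrightarrow> \<exists>y\<in>carrier M. h x = \<iota> y" for x using hh(1)[of x] by auto
  let ?h = "\<lambda>x. inv_into (carrier M) \<iota> (h x)"
  have hc: "x \<in> carrier P \<Longrightarrow> ?h x \<in> carrier M" for x using hi[of x] iM by auto
  have h1: "?h \<in> hm P M"
    unfolding hm_def using hc by (auto simp: hh iM M.l_closed M.r_closed)
  have h2: "g (?h x) = f x" if x: "x \<in> carrier P" for x
  proof -
    have "\<nu> (g (?h x)) = \<nu> (f x)"
      using fun_cong[OF h(2), of x] x hi[OF x] hh(1)[OF x] by (auto simp: compose_def g'_def f'_def iM)
    then show ?thesis using inj_onD[OF \<nu>] hc[OF x] fi[OF x] by simp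
  qed
  show "\<exists>h\<in>hm P M. \<forall>x\<in>carrier P. g (h x) = f x"
    by (rule bexI[OF _ h1], rule ballI, rule h2)
qed

section \<open>Comparison maps and null-homotopies\<close>

context
  fixes C :: "nat \<Rightarrow> ('a, 'c) bimod" and dC :: "nat \<Rightarrow> 'c \<Rightarrow> 'c"
    and D :: "nat \<Rightarrow> ('a, 'd) bimod" and dD :: "nat \<Rightarrow> 'd \<Rightarrow> 'd"
    and Y :: "('a, 'y) bimod" and e :: "'d \<Rightarrow> 'y"
  assumes C: "\<And>i. bimodule A (C i)" and D: "\<And>i. bimodule A (D i)" and Y: "bimodule A Y"
    and dC: "\<And>i. dC i \<in> hm (C (Suc i)) (C i)" and dD: "\<And>i. dD i \<in> hm (D (Suc i)) (D i)"
    and e: "e \<in> hm (D 0) Y"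
    and dC_dC: "\<And>i x. x \<in> carrier (C (Suc (Suc i))) \<Longrightarrow> dC i (dC (Suc i) x) = \<zero>\<^bsub>C i\<^esub>"
    and exact0: "\<And>x. x \<in> carrier (D 0) \<Longrightarrow> e x = \<zero>\<^bsub>Y\<^esub> \<Longrightarrow> x \<in> dD 0 ` carrier (D (Suc 0))"
    and exact: "\<And>i x. x \<in> carrier (D (Suc i)) \<Longrightarrow> dD i x = \<zero>\<^bsub>D i\<^esub> \<Longrightarrow> x \<in> dD (Suc i) ` carrier (D (Suc (Suc i)))"
begin

text \<open>The invariant \<open>R\<close> records that \<phi> composed with the differential lands
  in the image of the next differential. The next lift therefore depends on the last map alone, as
  dependent choice requires.\<close>

lemma comparison_map:
  assumes L0: "lifts (C 0) (D 0) Y e" and L: "\<And>i. lifts (C (Suc i)) (D (Suc i)) (D i) (dD i)"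
    and g: "g \<in> hm (C 0) Y" and im: "g ` carrier (C 0) \<subseteq> e ` carrier (D 0)"
    and gd: "\<And>x. x \<in> carrier (C (Suc 0)) \<Longrightarrow> g (dC 0 x) = \<zero>\<^bsub>Y\<^esub>"
  shows "\<exists>\<phi>. (\<forall>i. \<phi> i \<in> hm (C i) (D i)) \<and> (\<forall>x\<in>carrier (C 0). e (\<phi> 0 x) = g x) \<and>
    (\<forall>i. \<forall>x\<in>carrier (C (Suc i)). dD i (\<phi> (Suc i) x) = \<phi> i (dC i x))"
proof -
  define R where "R = (\<lambda>n \<phi>. \<phi> \<in> hm (C n) (D n) \<and> (n = 0 \<longrightarrow> (\<forall>x\<in>carrier (C 0). e (\<phi> x) = g x)) \<and>
    (\<forall>x\<in>carrier (C (Suc n)). \<phi> (dC n x) \<in> dD n ` carrier (D (Suc n))))"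
  have "\<exists>\<phi>. \<forall>n. R n (\<phi> n) \<and> (\<forall>x\<in>carrier (C (Suc n)). dD n (\<phi> (Suc n) x) = \<phi> n (dC n x))"
  proof (rule dependent_nat_choice)
    obtain \<phi> where \<phi>: "\<phi> \<in> hm (C 0) (D 0)" "\<And>x. x \<in> carrier (C 0) \<Longrightarrow> e (\<phi> x) = g x"
      using L0[unfolded lifts_def, rule_format, OF g im] by blast
    have "\<phi> (dC 0 x) \<in> dD 0 ` carrier (D (Suc 0))" if x: "x \<in> carrier (C (Suc 0))" for x
      using exact0[of "\<phi> (dC 0 x)"] \<phi> gd[OF x] hmD(1)[OF dC x] hmD(1)[OF \<phi>(1)] by simp
    then have "R 0 \<phi>" using \<phi> by (simp add: R_def)
    then show "\<exists>\<phi>. R 0 \<phi>" by (intro exI[of _ \<phi>])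
  next
    fix \<phi> n assume R: "R n \<phi>"
    then have \<phi>: "\<phi> \<in> hm (C n) (D n)" by (simp add: R_def)
    have "(\<lambda>x. \<phi> (dC n x)) \<in> hm (C (Suc n)) (D n)" by (rule hm_comp[OF dC \<phi>])
    moreover have "(\<lambda>x. \<phi> (dC n x)) ` carrier (C (Suc n)) \<subseteq> dD n ` carrier (D (Suc n))"
      using R by (auto simp: R_def)
    ultimately obtain \<psi> where \<psi>: "\<psi> \<in> hm (C (Suc n)) (D (Suc n))"
      "\<And>x. x \<in> carrier (C (Suc n)) \<Longrightarrow> dD n (\<psi> x) = \<phi> (dC n x)"
      using L[of n, unfolded lifts_def, rule_format, of "\<lambda>x. \<phi> (dC n x)"] by blast
    have "\<psi> (dC (Suc n) x) \<in> dD (Suc n) ` carrier (D (Suc (Suc n)))" if x: "x \<in> carrier (C (Suc (Suc n)))" for x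
    proof (rule exact)
      note y = hmD(1)[OF dC x]
      show "\<psi> (dC (Suc n) x) \<in> carrier (D (Suc n))" using hmD(1)[OF \<psi>(1) y] .
      show "dD n (\<psi> (dC (Suc n) x)) = \<zero>\<^bsub>D n\<^esub>"
        using \<psi>(2)[OF y] dC_dC[OF x] hm_zero[OF \<phi> C D] by simp
    qed
    then have "R (Suc n) \<psi>" using \<psi>(1) by (simp add: R_def)
    then show "\<exists>\<psi>. R (Suc n) \<psi> \<and> (\<forall>x\<in>carrier (C (Suc n)). dD n (\<psi> x) = \<phi> (dC n x))"
      using \<psi>(2) by blast
  qed
  then obtain \<phi> where \<phi>: "\<forall>n. R n (\<phi> n) \<and> (\<forall>x\<in>carrier (C (Suc n)). dD n (\<phi> (Suc n) x) = \<phi> n (dC n x))" ..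
  then have "R 0 (\<phi> 0)" "\<forall>n. \<phi> n \<in> hm (C n) (D n)" by (simp_all add: R_def)
  with \<phi> show ?thesis by (intro exI[of _ \<phi>]) (simp add: R_def)
qed

text \<open>In the invariant the equation d s = \<tau> is kept on boundaries only, where the other
  summand of the homotopy formula vanishes. This already makes \<tau> - s d a cycle in the next
  degree.\<close>

lemma null_homotopy:
  assumes L: "\<And>i. lifts (C i) (D (Suc i)) (D i) (dD i)"
    and \<tau>: "\<And>i. \<tau> i \<in> hm (C i) (D i)" and \<tau>0: "\<And>x. x \<in> carrier (C 0) \<Longrightarrow> e (\<tau> 0 x) = \<zero>\<^bsub>Y\<^esub>"
    and ch: "\<And>i x. x \<in> carrier (C (Suc i)) \<Longrightarrow> dD i (\<tau> (Suc i) x) = \<tau> i (dC i x)"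
  shows "\<exists>s. (\<forall>i. s i \<in> hm (C i) (D (Suc i))) \<and>
    (\<forall>i. \<forall>x\<in>carrier (C (Suc i)). \<tau> (Suc i) x = dD (Suc i) (s (Suc i) x) \<oplus>\<^bsub>D (Suc i)\<^esub> s i (dC i x))"
proof -
  define R where "R = (\<lambda>n s. s \<in> hm (C n) (D (Suc n)) \<and>
    (\<forall>x\<in>carrier (C (Suc n)). dD n (s (dC n x)) = \<tau> n (dC n x)))"
  have "\<exists>s. \<forall>n. R n (s n) \<and>
    (\<forall>x\<in>carrier (C (Suc n)). \<tau> (Suc n) x = dD (Suc n) (s (Suc n) x) \<oplus>\<^bsub>D (Suc n)\<^esub> s n (dC n x))"
  proof (rule dependent_nat_choice)
    have "\<tau> 0 ` carrier (C 0) \<subseteq> dD 0 ` carrier (D (Suc 0))"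
      using exact0 \<tau>0 hmD(1)[OF \<tau>] by blast
    then obtain s where s: "s \<in> hm (C 0) (D (Suc 0))" "\<forall>x\<in>carrier (C 0). dD 0 (s x) = \<tau> 0 x"
      using L[of 0, unfolded lifts_def, rule_format, OF \<tau>] by auto
    then have "R 0 s" using hmD(1)[OF dC] by (simp add: R_def)
    then show "\<exists>s. R 0 s" by (intro exI[of _ s])
  next
    fix s n assume R: "R n s"
    then have s: "s \<in> hm (C n) (D (Suc n))" by (simp add: R_def)
    interpret D1: bimodule A "D (Suc n)" by (rule D)
    interpret D0: bimodule A "D n" by (rule D)
    \<comment> \<open>The part of \<tau> not yet accounted for by the previous homotopy. It consists
      of cycles, hence of boundaries, so it can be lifted.\<close>
    define f where "f = (\<lambda>x. \<tau> (Suc n) x \<oplus>\<^bsub>D (Suc n)\<^esub> sm (D (Suc n)) (-1) (s (dC n x)))"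
    have f: "f \<in> hm (C (Suc n)) (D (Suc n))"
      unfolding f_def by (rule hm_add_scaled[OF \<tau> hm_comp[OF dC s] D])
    have "f x \<in> dD (Suc n) ` carrier (D (Suc (Suc n)))" if x: "x \<in> carrier (C (Suc n))" for x
    proof (rule exact[OF hmD(1)[OF f x]])
      note y = hmD(1)[OF dC x]
      note c = hmD(1)[OF \<tau> x] hmD(1)[OF s y]
      have "dD n (f x) = dD n (\<tau> (Suc n) x) \<oplus>\<^bsub>D n\<^esub> sm (D n) (-1) (dD n (s (dC n x)))"
        unfolding f_def using hmD(2)[OF dD c(1) sm_closed[OF D c(2)]] hmD(5)[OF dD c(2)] by simp
      also have "\<dots> = \<tau> n (dC n x) \<oplus>\<^bsub>D n\<^esub> \<ominus>\<^bsub>D n\<^esub> \<tau> n (dC n x)"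
        using ch[OF x] R x sm_minus[OF D hmD(1)[OF \<tau> y]] by (simp add: R_def)
      finally show "dD n (f x) = \<zero>\<^bsub>D n\<^esub>" using D0.r_neg[OF hmD(1)[OF \<tau> y]] by simp
    qed
    then obtain s' where s': "s' \<in> hm (C (Suc n)) (D (Suc (Suc n)))"
      "\<And>x. x \<in> carrier (C (Suc n)) \<Longrightarrow> dD (Suc n) (s' x) = f x"
      using L[of "Suc n"] f unfolding lifts_def by (metis image_subsetI)
    have q: "\<tau> (Suc n) x = dD (Suc n) (s' x) \<oplus>\<^bsub>D (Suc n)\<^esub> s (dC n x)" if x: "x \<in> carrier (C (Suc n))" for x
    proof -
      note c = hmD(1)[OF \<tau> x] hmD(1)[OF s hmD(1)[OF dC x]]
      show ?thesis using s'(2)[OF x] c sm_minus[OF D c(2)] D1.l_neg[OF c(2)] by (simp add: f_def D1.a_assoc)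
    qed
    have "dD (Suc n) (s' (dC (Suc n) x)) = \<tau> (Suc n) (dC (Suc n) x)" if x: "x \<in> carrier (C (Suc (Suc n)))" for x
    proof -
      note y = hmD(1)[OF dC x]
      have "s (dC n (dC (Suc n) x)) = \<zero>\<^bsub>D (Suc n)\<^esub>" using dC_dC[OF x] hm_zero[OF s C D] by simp
      then show ?thesis using q[OF y] hmD(1)[OF dD hmD(1)[OF s'(1) y]] by simp
    qed
    then have "R (Suc n) s'" using s' by (simp add: R_def)
    then show "\<exists>s'. R (Suc n) s' \<and>
      (\<forall>x\<in>carrier (C (Suc n)). \<tau> (Suc n) x = dD (Suc n) (s' x) \<oplus>\<^bsub>D (Suc n)\<^esub> s (dC n x))"
      using q by blast
  qed
  then obtain s where s: "\<forall>n. R n (s n) \<and>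
    (\<forall>x\<in>carrier (C (Suc n)). \<tau> (Suc n) x = dD (Suc n) (s (Suc n) x) \<oplus>\<^bsub>D (Suc n)\<^esub> s n (dC n x))" ..
  then have "\<forall>n. s n \<in> hm (C n) (D (Suc n))" by (simp add: R_def)
  with s show ?thesis by (intro exI[of _ s]) simp
qed

end

end

section \<open>The cup product on the bar resolution\<close>

context coord_algebra
begin

lemma gen_outside: "t \<notin> tuples n \<Longrightarrow> gen n t = (\<lambda>_. 0)"
  by (auto simp: gen_def bar_basis_def)

lemma gen_vertex:
  assumes "t \<in> tuples n" "t \<noteq> []"
  shows "bas (pid (psrc (hd t))) \<odot>\<^bsub>bar n\<^esub> gen n t = gen n t"
    "gen n t \<diamondop>\<^bsub>bar n\<^esub> bas (pid (ptgt (last t))) = gen n t"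
proof -
  have "hd t \<in> X" "last t \<in> X" using assms by (auto simp: tuples_def)
  then have X: "pid (psrc (hd t)) \<in> X" "pid (ptgt (last t)) \<in> X" using pid_in_X by auto
  then have b: "(pid (psrc (hd t)), t, pid (ptgt (last t))) \<in> bar_basis n"
    using assms by (auto simp: bar_basis_def)
  show "bas (pid (psrc (hd t))) \<odot>\<^bsub>bar n\<^esub> gen n t = gen n t"
    unfolding gen_ind[OF assms] bas_ind[OF X(1) b] using X by simp
  show "gen n t \<diamondop>\<^bsub>bar n\<^esub> bas (pid (ptgt (last t))) = gen n t"
    unfolding gen_ind[OF assms] ind_bas[OF X(2) b] using X by simp
qed

lemma gen_Nil_commutes:
  assumes "pid v \<in> X"
  shows "bas (pid v) \<odot>\<^bsub>bar 0\<^esub> gen 0 [] = gen 0 [] \<diamondop>\<^bsub>bar 0\<^esub> bas (pid v)"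
  unfolding bas_gen[OF assms] gen_bas[OF assms]
proof (intro ext, clarify)
  fix p1 p3 q1 q3 :: 'v and p2 q2 :: "'e list" and u :: "('v,'e) qpath list"
  let ?p = "(p1, p2, p3)" and ?q = "(q1, q2, q3)"
  have "(?p = pid v \<and> u = [] \<and> parcs ?q = [] \<and> (pid v, [], ?q) \<in> bar_basis 0) =
    (?q = pid v \<and> u = [] \<and> parcs ?p = [] \<and> (?p, [], pid v) \<in> bar_basis 0)"
    using trivial_qpath[of ?p] trivial_qpath[of ?q] X_subset assms by (auto simp: bar_basis_def)
  then show "(if ?p = pid v \<and> u = [] \<and> parcs ?q = [] \<and> (pid v, [], ?q) \<in> bar_basis 0 then 1 else (0::'k)) =
    (if ?q = pid v \<and> u = [] \<and> parcs ?p = [] \<and> (?p, [], pid v) \<in> bar_basis 0 then 1 else 0)"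
    by (rule if_cong[OF _ refl refl])
qed

lemma value_vertex:
  assumes f: "f \<in> hm (bar n) M" and t: "t \<in> tuples n" "t \<noteq> []"
  shows "bas (pid (psrc (hd t))) \<odot>\<^bsub>M\<^esub> f (gen n t) = f (gen n t)"
    "f (gen n t) \<diamondop>\<^bsub>M\<^esub> bas (pid (ptgt (last t))) = f (gen n t)"
proof -
  have "hd t \<in> X" "last t \<in> X" using t by (auto simp: tuples_def)
  then have X: "pid (psrc (hd t)) \<in> X" "pid (ptgt (last t)) \<in> X" using pid_in_X by auto
  show "bas (pid (psrc (hd t))) \<odot>\<^bsub>M\<^esub> f (gen n t) = f (gen n t)"
    "f (gen n t) \<diamondop>\<^bsub>M\<^esub> bas (pid (ptgt (last t))) = f (gen n t)"
    using hmD(3)[OF f bas(1)[OF X(1)] gen_carrier[of n t]] hmD(4)[OF f bas(1)[OF X(2)] gen_carrier[of n t]]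
    by (simp_all only: gen_vertex[OF t])
qed

text \<open>The standard lift of a cocycle: \<open>g\<close> takes the last m entries, and its value
  acts from the right on the generator of the first i.\<close>

definition cup_gen :: "nat \<Rightarrow> ((('v,'e) qpath \<times> ('v,'e) qpath list \<times> ('v,'e) qpath \<Rightarrow> 'k) \<Rightarrow> 'a) \<Rightarrow> nat
    \<Rightarrow> ('v,'e) qpath list \<Rightarrow> ('v,'e) qpath \<times> ('v,'e) qpath list \<times> ('v,'e) qpath \<Rightarrow> 'k" where
  "cup_gen m g i t = gen i (take i t) \<diamondop>\<^bsub>bar i\<^esub> g (gen m (drop i t))"

definition cup_map :: "nat \<Rightarrow> ((('v,'e) qpath \<times> ('v,'e) qpath list \<times> ('v,'e) qpath \<Rightarrow> 'k) \<Rightarrow> 'a) \<Rightarrow> nat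
    \<Rightarrow> (('v,'e) qpath \<times> ('v,'e) qpath list \<times> ('v,'e) qpath \<Rightarrow> 'k)
    \<Rightarrow> ('v,'e) qpath \<times> ('v,'e) qpath list \<times> ('v,'e) qpath \<Rightarrow> 'k" where
  "cup_map m g i = extend (bar i) (m + i) (cup_gen m g i)"

context
  fixes m :: nat and g :: "(('v,'e) qpath \<times> ('v,'e) qpath list \<times> ('v,'e) qpath \<Rightarrow> 'k) \<Rightarrow> 'a"
  assumes m: "m > 0" and g: "g \<in> hm (bar m) (regular_bimodule A)"
begin

lemma g_gen: "g (gen m r) \<in> carrier A"
  using hmD(1)[OF g gen_carrier] by simp

lemma cup_gen_closed: "cup_gen m g i t \<in> carrier (bar i)"
  unfolding cup_gen_def by (rule bimodule.r_closed[OF bimodule_bar g_gen gen_carrier])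

lemma cup_map_hm: "cup_map m g i \<in> hm (bar (m + i)) (bar i)"
  unfolding cup_map_def by (rule extend_hm[OF bimodule_bar cup_gen_closed])

lemma cup_map_gen:
  assumes t: "t \<in> tuples (m + i)"
  shows "cup_map m g i (gen (m + i) t) = cup_gen m g i t"
  unfolding cup_map_def
proof (rule extend_gen[OF bimodule_bar cup_gen_closed t])
  interpret B: bimodule A "bar i" by (rule bimodule_bar)
  define s r where "s = take i t" and "r = drop i t"
  have tsr: "t = s @ r" by (simp add: s_def r_def)
  have len: "length t = m + i" by (rule tuples_length[OF t])
  have rne: "r \<noteq> []" using len m by (simp add: r_def)
  have ls: "length s = i" "length r = m" using len by (simp_all add: s_def r_def)
  have s: "s \<in> tuples i" and r: "r \<in> tuples m" using t tsr ls by (auto simp: tuples_append)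
  have tne: "t \<noteq> []" using tsr rne by simp
  have "hd t \<in> X" "last t \<in> X" using t tne by (auto simp: tuples_def)
  then have X: "pid (psrc (hd t)) \<in> X" "pid (ptgt (last t)) \<in> X" using pid_in_X by auto
  let ?e = "bas (pid (psrc (hd t)))" and ?e' = "bas (pid (ptgt (last t)))" and ?a = "g (gen m r)"
  note c = bas(1)[OF X(1)] bas(1)[OF X(2)] g_gen[of r] gen_carrier[of i s]
  have ae: "?a \<otimes>\<^bsub>A\<^esub> ?e' = ?a" using value_vertex(2)[OF g r rne] tsr rne by simp
  have ea: "?e \<odot>\<^bsub>bar i\<^esub> (gen i s \<diamondop>\<^bsub>bar i\<^esub> ?a) = gen i s \<diamondop>\<^bsub>bar i\<^esub> ?a"
  proof (cases "s = []")
    case True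
    then have i: "i = 0" using ls by simp
    \<comment> \<open>With no entries left for the generator, the vertex passes through
      \<open>gen 0 []\<close> and is absorbed by the value of \<open>g\<close>.\<close>
    have "?e \<otimes>\<^bsub>A\<^esub> ?a = ?a" using value_vertex(1)[OF g r rne] tsr True by simp
    then have "gen i s \<diamondop>\<^bsub>bar i\<^esub> ?a = (gen i s \<diamondop>\<^bsub>bar i\<^esub> ?e) \<diamondop>\<^bsub>bar i\<^esub> ?a"
      using B.r_assoc[OF c(1,3,4)] by (simp only:)
    also have "gen i s \<diamondop>\<^bsub>bar i\<^esub> ?e = ?e \<odot>\<^bsub>bar i\<^esub> gen i s"
      using gen_Nil_commutes[OF X(1)] True i by (simp only:)
    also have "(?e \<odot>\<^bsub>bar i\<^esub> gen i s) \<diamondop>\<^bsub>bar i\<^esub> ?a = ?e \<odot>\<^bsub>bar i\<^esub> (gen i s \<diamondop>\<^bsub>bar i\<^esub> ?a)"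
      by (rule B.lr_assoc[OF c(1,3,4)])
    finally show ?thesis by (rule sym)
  next
    case False
    have "?e \<odot>\<^bsub>bar i\<^esub> gen i s = gen i s" using gen_vertex(1)[OF s False] tsr False by (simp del: bar_simps)
    then show ?thesis using B.lr_assoc[OF c(1,3,4)] by (simp only:)
  qed
  have "(?e \<odot>\<^bsub>bar i\<^esub> cup_gen m g i t) \<diamondop>\<^bsub>bar i\<^esub> ?e' = cup_gen m g i t"
    unfolding cup_gen_def s_def[symmetric] r_def[symmetric] ea B.r_assoc[OF c(3,2,4), symmetric] ae ..
  then show "corner (bar i) t (cup_gen m g i t)" using tne by (simp add: corner_def)
qed

text \<open>Stated also for lists that are not tuples, since merging may lead out of
  \<open>X\<close>; both sides are then 0.\<close>

lemma cup_map_append: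
  assumes "length u = i" "length r = m" "u \<noteq> [] \<Longrightarrow> r \<noteq> [] \<Longrightarrow> ptgt (last u) = psrc (hd r)"
  shows "cup_map m g i (gen (m + i) (u @ r)) = gen i u \<diamondop>\<^bsub>bar i\<^esub> g (gen m r)"
proof (cases "u \<in> tuples i \<and> r \<in> tuples m")
  case True
  then have "u @ r \<in> tuples (m + i)" using assms by (auto simp: tuples_append)
  then show ?thesis using cup_map_gen[of "u @ r" i] assms(1) by (simp add: cup_gen_def)
next
  case False
  then have "u @ r \<notin> tuples (m + i)" using assms(1,2) by (auto simp: tuples_append)
  then have "cup_map m g i (gen (m + i) (u @ r)) = (\<lambda>_. 0)"
    using gen_outside hm_zero[OF cup_map_hm bimodule_bar bimodule_bar] by simp
  moreover have "gen i u \<diamondop>\<^bsub>bar i\<^esub> g (gen m r) = (\<lambda>_. 0)"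
  proof (cases "u \<in> tuples i")
    case True
    then have "gen m r = (\<lambda>_. 0)" using False gen_outside by blast
    then have "g (gen m r) = \<zero>\<^bsub>A\<^esub>" using hm_zero[OF g bimodule_bar bimodule_regular] by simp
    then show ?thesis using zero_rsmult[OF bimodule_bar gen_carrier, of i u] by simp
  next
    case False
    then show ?thesis using gen_outside rsmult_zero[OF bimodule_bar g_gen, of i r] by simp
  qed
  ultimately show ?thesis by simp
qed

text \<open>The cocycle condition on \<open>g\<close> cancels all the terms of the boundary beyond position \<open>i\<close>.\<close>

lemma cup_map_chain:
  assumes gd: "\<And>c. c \<in> carrier (bar (Suc m)) \<Longrightarrow> g (dB m c) = \<zero>\<^bsub>A\<^esub>"
    and c: "c \<in> carrier (bar (Suc (m + i)))"
  shows "dB i (cup_map m g (Suc i) c) = cup_map m g i (dB (m + i) c)"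
proof -
  interpret B: bimodule A "bar i" by (rule bimodule_bar)
  have h: "cup_map m g (Suc i) \<in> hm (bar (Suc (m + i))) (bar (Suc i))" using cup_map_hm[of "Suc i"] by simp
  show ?thesis
  proof (rule hm_bar_eqI[OF bimodule_bar hm_comp[OF h dB_hm] hm_comp[OF dB_hm cup_map_hm] _ c], rule ext)
    fix t w assume t: "t \<in> tuples (Suc (m + i))"
    have len: "length t = Suc (m + i)" by (rule tuples_length[OF t])
    \<comment> \<open>The boundary of \<open>t\<close> is split at the entry \<open>y\<close> in
      position i. Merges within \<open>s @ [y]\<close> belong to the boundary of the generator,
      those within \<open>y # r\<close> to the coboundary of \<open>g\<close>.\<close>
    define s y r where "s = take i t" and "y = t ! i" and "r = drop (Suc i) t"
    have tsr: "t = s @ y # r" using len by (simp add: s_def y_def r_def id_take_nth_drop[symmetric])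
    have ls: "length s = i" "length r = m" using len by (simp_all add: s_def r_def)
    have rne: "r \<noteq> []" using ls m by auto
    have tne: "t \<noteq> []" using tsr by simp
    have sy: "s @ [y] \<in> tuples (Suc i)" and yr: "y # r \<in> tuples (Suc m)" and r: "r \<in> tuples m" and s: "s \<in> tuples i"
      and yX: "y \<in> X" and con: "ptgt y = psrc (hd r)" "s \<noteq> [] \<Longrightarrow> ptgt (last s) = psrc y"
      using t tsr ls rne by (auto simp: tuples_append tuples_Cons)
    note X = tuples_hd_last(1,2)[OF t]
    let ?a = "g (gen m r)"
    let ?L = "\<lambda>u v. (gen i u \<diamondop>\<^bsub>bar i\<^esub> g (gen m v))"
    have hdt: "hd t = hd (s @ [y])" "tl t = tl (s @ [y]) @ r" "last t = last (y # r)" "butlast t = s @ butlast (y # r)"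
      using tsr rne by (cases s; simp add: butlast_append)+
    have "dB i (cup_map m g (Suc i) (gen (Suc (m + i)) t)) = dB i (gen (Suc i) (s @ [y]) \<diamondop>\<^bsub>bar (Suc i)\<^esub> ?a)"
      using cup_map_append[of "s @ [y]" "Suc i" r] ls con tsr by (simp del: bar_simps)
    also have "\<dots> = bd i (s @ [y]) \<diamondop>\<^bsub>bar i\<^esub> ?a"
      using hmD(4)[OF dB_hm g_gen gen_carrier] dB_gen[OF sy] by (simp del: bar_simps)
    finally have l1: "dB i (cup_map m g (Suc i) (gen (Suc (m + i)) t)) = bd i (s @ [y]) \<diamondop>\<^bsub>bar i\<^esub> ?a" .
    have "(bd i (s @ [y]) \<diamondop>\<^bsub>bar i\<^esub> ?a) w = ((bas (hd (s @ [y])) \<odot>\<^bsub>bar i\<^esub> gen i (tl (s @ [y]))) \<diamondop>\<^bsub>bar i\<^esub> ?a) w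
        + merges (\<lambda>u. ?L u r w) (s @ [y])
        + (-1) ^ Suc i * ((gen i (butlast (s @ [y])) \<diamondop>\<^bsub>bar i\<^esub> bas (last (s @ [y]))) \<diamondop>\<^bsub>bar i\<^esub> ?a) w"
    proof (rule functional_bd(2)[OF _ sy])
      show "functional (bar i) (\<lambda>c. (c \<diamondop>\<^bsub>bar i\<^esub> ?a) w)"
        unfolding functional_def using B.r_distr_mod[OF g_gen] rsmult_sm[OF bimodule_bar g_gen]
          sm_bar[OF B.r_closed[OF g_gen]] by (simp del: bar_simps(1,4,5))
    qed
    also have "(bas (hd (s @ [y])) \<odot>\<^bsub>bar i\<^esub> gen i (tl (s @ [y]))) \<diamondop>\<^bsub>bar i\<^esub> ?a = bas (hd t) \<odot>\<^bsub>bar i\<^esub> ?L (tl (s @ [y])) r"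
      using B.lr_assoc[OF bas(1)[OF X(1)] g_gen gen_carrier] hdt(1) by (simp del: bar_simps)
    finally have lhs: "dB i (cup_map m g (Suc i) (gen (Suc (m + i)) t)) w
      = (bas (hd t) \<odot>\<^bsub>bar i\<^esub> ?L (tl (s @ [y])) r) w + merges (\<lambda>u. ?L u r w) (s @ [y])
        + (-1) ^ Suc i * ((gen i s \<diamondop>\<^bsub>bar i\<^esub> bas y) \<diamondop>\<^bsub>bar i\<^esub> ?a) w"
      unfolding l1 by (simp del: bar_simps)
    have "cup_map m g i (dB (m + i) (gen (Suc (m + i)) t)) w
      = cup_map m g i (bas (hd t) \<odot>\<^bsub>bar (m + i)\<^esub> gen (m + i) (tl t)) w
        + merges (\<lambda>u. cup_map m g i (gen (m + i) u) w) t
        + (-1) ^ Suc (m + i) * cup_map m g i (gen (m + i) (butlast t) \<diamondop>\<^bsub>bar (m + i)\<^esub> bas (last t)) w"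
      unfolding dB_gen[OF t] by (rule functional_bd(2)[OF functional_comp[OF cup_map_hm functional_point] t])
    also have "cup_map m g i (bas (hd t) \<odot>\<^bsub>bar (m + i)\<^esub> gen (m + i) (tl t)) = bas (hd t) \<odot>\<^bsub>bar i\<^esub> ?L (tl (s @ [y])) r"
    proof -
      have "length (tl (s @ [y])) = i" "tl (s @ [y]) \<noteq> [] \<Longrightarrow> last (tl (s @ [y])) = y"
        using ls by (cases s; simp)+
      then show ?thesis
        using hmD(3)[OF cup_map_hm bas(1)[OF X(1)] gen_carrier] cup_map_append[of "tl (s @ [y])" i r] ls con
        unfolding hdt by (simp del: bar_simps)
    qed
    also have "cup_map m g i (gen (m + i) (butlast t) \<diamondop>\<^bsub>bar (m + i)\<^esub> bas (last t))
      = ?L s (butlast (y # r)) \<diamondop>\<^bsub>bar i\<^esub> bas (last t)"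
    proof -
      have "length (butlast (y # r)) = m" using ls m by auto
      moreover have "hd (butlast (y # r)) = y" using rne by simp
      ultimately show ?thesis
        using hmD(4)[OF cup_map_hm bas(1)[OF X(2)] gen_carrier] cup_map_append[of s i "butlast (y # r)"] ls con
        unfolding hdt by (simp del: bar_simps butlast.simps)
    qed
    also have "merges (\<lambda>u. cup_map m g i (gen (m + i) u) w) t
      = merges (\<lambda>u. ?L u r w) (s @ [y]) + (-1) ^ i * merges (\<lambda>u. ?L s u w) (y # r)"
    proof -
      have "merges (\<lambda>u. cup_map m g i (gen (m + i) (u @ r)) w) (s @ [y]) = merges (\<lambda>u. ?L u r w) (s @ [y])"
        by (rule merges_cong_ends, subst cup_map_append) (use ls con in auto)
      moreover have "merges (\<lambda>u. cup_map m g i (gen (m + i) (s @ u)) w) (y # r) = merges (\<lambda>u. ?L s u w) (y # r)"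
        by (rule merges_cong_ends, subst cup_map_append) (use ls con in auto)
      ultimately show ?thesis
        using merges_append[of "\<lambda>u. cup_map m g i (gen (m + i) u) w" s y r] tsr ls by simp
    qed
    finally have rhs: "cup_map m g i (dB (m + i) (gen (Suc (m + i)) t)) w = (bas (hd t) \<odot>\<^bsub>bar i\<^esub> ?L (tl (s @ [y])) r) w
      + (merges (\<lambda>u. ?L u r w) (s @ [y]) + (-1) ^ i * merges (\<lambda>u. ?L s u w) (y # r))
      + (-1) ^ Suc (m + i) * (?L s (butlast (y # r)) \<diamondop>\<^bsub>bar i\<^esub> bas (last t)) w" .
    \<comment> \<open>The cocycle condition at \<open>y # r\<close>, multiplied by the generator of
      \<open>s\<close>, expresses the merges within \<open>y # r\<close> by the two outer terms.
      These are exactly the terms in which the two sides differ.\<close>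
    have "(gen i s \<diamondop>\<^bsub>bar i\<^esub> g (bd m (y # r))) w = (gen i s \<diamondop>\<^bsub>bar i\<^esub> g (bas (hd (y # r)) \<odot>\<^bsub>bar m\<^esub> gen m (tl (y # r)))) w
        + merges (\<lambda>u. ?L s u w) (y # r)
        + (-1) ^ Suc m * (gen i s \<diamondop>\<^bsub>bar i\<^esub> g (gen m (butlast (y # r)) \<diamondop>\<^bsub>bar m\<^esub> bas (last (y # r)))) w"
    proof (rule functional_bd(2)[OF _ yr])
      have gc: "x \<in> carrier (bar m) \<Longrightarrow> g x \<in> carrier A" for x using hmD(1)[OF g] by simp
      show "functional (bar m) (\<lambda>c. (gen i s \<diamondop>\<^bsub>bar i\<^esub> g c) w)"
        unfolding functional_def
      proof (intro conjI ballI allI)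
        fix x z assume xz: "x \<in> carrier (bar m)" "z \<in> carrier (bar m)"
        show "(gen i s \<diamondop>\<^bsub>bar i\<^esub> g (x \<oplus>\<^bsub>bar m\<^esub> z)) w = (gen i s \<diamondop>\<^bsub>bar i\<^esub> g x) w + (gen i s \<diamondop>\<^bsub>bar i\<^esub> g z) w"
          using hmD(2)[OF g xz] B.r_distr_ring[OF gc[OF xz(1)] gc[OF xz(2)] gen_carrier] by (simp del: bar_simps(1,4,5))
      next
        fix x k assume x: "x \<in> carrier (bar m)"
        have "g (sm (bar m) k x) = k \<odot>\<^bsub>A\<^esub> g x"
          using hmD(5)[OF g x] scalar_central(1)[OF gc[OF x]] by (simp add: sm_def)
        then show "(gen i s \<diamondop>\<^bsub>bar i\<^esub> g (sm (bar m) k x)) w = k * (gen i s \<diamondop>\<^bsub>bar i\<^esub> g x) w"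
          using scaled_rsmult[OF bimodule_bar gc[OF x] gen_carrier] sm_bar[OF B.r_closed[OF gc[OF x] gen_carrier]]
          by (simp del: bar_simps)
      qed
    qed
    moreover have "g (bd m (y # r)) = \<zero>\<^bsub>A\<^esub>" using gd[OF gen_carrier, of "y # r"] dB_gen[OF yr] by (simp del: bar_simps)
    moreover have "gen i s \<diamondop>\<^bsub>bar i\<^esub> \<zero>\<^bsub>A\<^esub> = (\<lambda>_. 0)" using zero_rsmult[OF bimodule_bar gen_carrier, of i s] by simp
    moreover have "gen i s \<diamondop>\<^bsub>bar i\<^esub> g (bas (hd (y # r)) \<odot>\<^bsub>bar m\<^esub> gen m (tl (y # r)))
        = (gen i s \<diamondop>\<^bsub>bar i\<^esub> bas y) \<diamondop>\<^bsub>bar i\<^esub> ?a"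
      using hmD(3)[OF g bas(1)[OF yX] gen_carrier] B.r_assoc[OF bas(1)[OF yX] g_gen gen_carrier] by (simp del: bar_simps)
    moreover have "gen i s \<diamondop>\<^bsub>bar i\<^esub> g (gen m (butlast (y # r)) \<diamondop>\<^bsub>bar m\<^esub> bas (last (y # r)))
        = ?L s (butlast (y # r)) \<diamondop>\<^bsub>bar i\<^esub> bas (last t)"
    proof -
      have "last (y # r) = last t" using hdt by simp
      then show ?thesis
        using hmD(4)[OF g bas(1)[OF X(2)] gen_carrier] B.r_assoc[OF g_gen bas(1)[OF X(2)] gen_carrier] by (simp del: bar_simps)
    qed
    ultimately have "0 = ((gen i s \<diamondop>\<^bsub>bar i\<^esub> bas y) \<diamondop>\<^bsub>bar i\<^esub> ?a) w + merges (\<lambda>u. ?L s u w) (y # r)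
        + (-1) ^ Suc m * (?L s (butlast (y # r)) \<diamondop>\<^bsub>bar i\<^esub> bas (last t)) w" by (simp only:)
    then have "merges (\<lambda>u. ?L s u w) (y # r) = - ((gen i s \<diamondop>\<^bsub>bar i\<^esub> bas y) \<diamondop>\<^bsub>bar i\<^esub> ?a) w
        - (-1) ^ Suc m * (?L s (butlast (y # r)) \<diamondop>\<^bsub>bar i\<^esub> bas (last t)) w"
      by (simp only: eq_neg_iff_add_eq_0 eq_diff_eq) (simp only: ac_simps)
    then show "dB i (cup_map m g (Suc i) (gen (Suc (m + i)) t)) w = cup_map m g i (dB (m + i) (gen (Suc (m + i)) t)) w"
      unfolding lhs rhs by (simp only: power_add power_Suc right_diff_distrib) (simp del: bar_simps add: algebra_simps)
  qed
qed

end

end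

section \<open>Products of cocycles on the bar resolution\<close>

lemma merges_add: "merges (\<lambda>u. f u + g u) t = merges f t + merges g t"
  for f g :: "('v,'e) qpath list \<Rightarrow> 'k::ab_group_add"
proof (induction f t arbitrary: g rule: merges.induct)
  case (3 f x y r)
  then show ?case using "3"(1)[of "\<lambda>t. g (x # t)"] by simp
qed simp_all

lemma (in path_basis) cobd_add:
  "cobd (\<lambda>t \<gamma>. h t \<gamma> + k t \<gamma>) t \<gamma> = cobd h t \<gamma> + cobd k t \<gamma>"
  by (simp add: cobd_def merges_add lact_def ract_def sum.distrib algebra_simps)

lemma (in path_basis) cobd_scale: "cobd (\<lambda>t \<gamma>. s * h t \<gamma>) t \<gamma> = s * cobd h t \<gamma>"
  using merges_linear[of "(*) s" "\<lambda>u. h u \<gamma>" t]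
  by (simp add: cobd_def lact_def ract_def sum_distrib_left algebra_simps)

context path_basis
begin

lemma linear_expand:
  fixes B :: "(('v,'e) qpath \<Rightarrow> 'k::field) \<Rightarrow> 'k"
  assumes ad: "\<And>\<phi> \<psi>. B (\<lambda>p. \<phi> p + \<psi> p) = B \<phi> + B \<psi>" and sc: "\<And>k \<phi>. B (\<lambda>p. k * \<phi> p) = k * B \<phi>"
    and \<phi>: "\<And>p. \<phi> p \<noteq> 0 \<Longrightarrow> p \<in> X"
  shows "B \<phi> = (\<Sum>p\<in>X. \<phi> p * B (unit_at p))"
proof -
  have "finite S \<Longrightarrow> B (\<lambda>q. if q \<in> S then \<phi> q else 0) = (\<Sum>p\<in>S. \<phi> p * B (unit_at p))" for S
  proof (induction S rule: finite_induct)
    case empty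
    show ?case using sc[of 0 \<phi>] by simp
  next
    case (insert x F)
    have "(\<lambda>q. if q \<in> insert x F then \<phi> q else 0) = (\<lambda>q. \<phi> x * unit_at x q + (if q \<in> F then \<phi> q else 0))"
      using insert by (auto simp: unit_at_def)
    then show ?case using insert ad[of "\<lambda>q. \<phi> x * unit_at x q"] sc[of "\<phi> x" "unit_at x"] by simp
  qed
  from this[OF finite_X] have "B (\<lambda>q. if q \<in> X then \<phi> q else 0) = (\<Sum>p\<in>X. \<phi> p * B (unit_at p))" .
  moreover have "(\<lambda>q. if q \<in> X then \<phi> q else 0) = \<phi>"
  proof
    fix q
    show "(if q \<in> X then \<phi> q else 0) = \<phi> q" using \<phi>[of q] by (cases "q \<in> X") auto
  qed
  ultimately show ?thesis by simp
qed

lemma linear_eqI: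
  fixes B C :: "(('v,'e) qpath \<Rightarrow> 'k::field) \<Rightarrow> 'k"
  assumes "\<And>\<phi> \<psi>. B (\<lambda>p. \<phi> p + \<psi> p) = B \<phi> + B \<psi>" "\<And>k \<phi>. B (\<lambda>p. k * \<phi> p) = k * B \<phi>"
    and "\<And>\<phi> \<psi>. C (\<lambda>p. \<phi> p + \<psi> p) = C \<phi> + C \<psi>" "\<And>k \<phi>. C (\<lambda>p. k * \<phi> p) = k * C \<phi>"
    and "\<And>p. p \<in> X \<Longrightarrow> B (unit_at p) = C (unit_at p)" and \<phi>: "\<And>p. \<phi> p \<noteq> 0 \<Longrightarrow> p \<in> X"
  shows "B \<phi> = C \<phi>"
  using linear_expand[of B \<phi>] linear_expand[of C \<phi>] assms by simp

lemma conv_vertex_left: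
  assumes "\<And>p. \<phi> p \<noteq> 0 \<Longrightarrow> p \<in> X \<and> psrc p = v" "pid v \<in> X"
  shows "conv (unit_at (pid v)) \<phi> \<gamma> = \<phi> \<gamma>"
proof (cases "\<gamma> \<in> X")
  case True
  have "lact (pid v) \<phi> \<gamma> = \<phi> \<gamma>"
  proof (cases "psrc \<gamma> = v")
    case v: True
    show ?thesis using lact_pmul[OF True, of "pid v" \<phi>] v unfolding pmul_pid(1)[OF v] by simp
  next
    case False
    then have "\<phi> \<gamma> = 0" using assms(1)[of \<gamma>] by blast
    moreover have "psrc \<gamma> = v" if "\<gamma> = pmul (pid v) b" for b using that by simp
    ultimately show ?thesis using lact_cases[of "pid v" \<gamma> \<phi>] False by metis
  qed
  then show ?thesis using True assms(2) by (simp add: conv_unit_left)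
next
  case False
  then have "\<phi> \<gamma> = 0" using assms(1) by blast
  then show ?thesis using False by (simp add: conv_outside)
qed

lemma conv_vertex_right:
  assumes "\<And>p. \<phi> p \<noteq> 0 \<Longrightarrow> p \<in> X \<and> ptgt p = v" "pid v \<in> X"
  shows "conv \<phi> (unit_at (pid v)) \<gamma> = \<phi> \<gamma>"
proof (cases "\<gamma> \<in> X")
  case True
  have "ract (pid v) \<phi> \<gamma> = \<phi> \<gamma>"
  proof (cases "ptgt \<gamma> = v")
    case v: True
    show ?thesis using ract_pmul[OF True, of "pid v" \<phi>] v unfolding pmul_pid(2)[OF v] by simp
  next
    case False
    then have "\<phi> \<gamma> = 0" using assms(1)[of \<gamma>] by blast
    moreover have "ptgt \<gamma> = v" if "\<gamma> = pmul b (pid v)" for b using that by simp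
    ultimately show ?thesis using ract_cases[of "pid v" \<gamma> \<phi>] False by metis
  qed
  then show ?thesis using True assms(2) by (simp add: conv_unit_right)
next
  case False
  then have "\<phi> \<gamma> = 0" using assms(1) by blast
  then show ?thesis using False by (simp add: conv_outside)
qed

end

locale string_algebra = coord_algebra Q X A coef + string_basis Q X
  for Q :: "('v,'e) pre_digraph" and X and A :: "('k::field, 'a) module" and coef
begin

abbreviation reg :: "('a, 'a) bimod" where "reg \<equiv> regular_bimodule A"

section \<open>Bar cocycles in coordinates\<close>

definition cf :: "((('v,'e) qpath \<times> ('v,'e) qpath list \<times> ('v,'e) qpath \<Rightarrow> 'k) \<Rightarrow> 'a) \<Rightarrow> nat
    \<Rightarrow> ('v,'e) qpath list \<Rightarrow> ('v,'e) qpath \<Rightarrow> 'k" where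
  "cf f n t = coef (f (gen n t))"

text \<open>Being a coboundary of the bar complex, for plain functions and with equality on the
  carrier only.\<close>

definition bounding :: "nat \<Rightarrow> ((('v,'e) qpath \<times> ('v,'e) qpath list \<times> ('v,'e) qpath \<Rightarrow> 'k) \<Rightarrow> 'a) \<Rightarrow> bool" where
  "bounding m F \<longleftrightarrow> (\<exists>K\<in>hm (bar m) reg. \<forall>c\<in>carrier (bar (Suc m)). F c = K (dB m c))"

lemma gen_value: "f \<in> hm (bar n) reg \<Longrightarrow> f (gen n t) \<in> carrier A"
proof -
  assume "f \<in> hm (bar n) reg"
  from hmD(1)[OF this gen_carrier] show ?thesis by simp
qed

lemma cf_cochain:
  assumes f: "f \<in> hm (bar n) reg" and n: "n > 0"
  shows "cochain n (cf f n)"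
  unfolding cochain_def
proof (intro allI impI)
  fix t \<gamma> assume nz: "cf f n t \<gamma> \<noteq> 0"
  have "gen n t \<noteq> (\<lambda>_. 0)" using nz hm_zero[OF f bimodule_bar bimodule_regular] by (auto simp: cf_def coef_ops)
  then have t: "t \<in> tuples n" using gen_outside by blast
  have tne: "t \<noteq> []" using t n by auto
  note a = gen_value[OF f, of t]
  have \<gamma>: "\<gamma> \<in> X" using nz coef_outside[OF a] by (simp add: cf_def)
  have "hd t \<in> X" "last t \<in> X" using t tne by (auto simp: tuples_def)
  then have X: "pid (psrc (hd t)) \<in> X" "pid (ptgt (last t)) \<in> X" using pid_in_X by auto
  have "coef (bas (pid (psrc (hd t))) \<otimes>\<^bsub>A\<^esub> f (gen n t)) \<gamma> \<noteq> 0" "coef (f (gen n t) \<otimes>\<^bsub>A\<^esub> bas (pid (ptgt (last t)))) \<gamma> \<noteq> 0"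
    using value_vertex[OF f t tne] nz by (simp_all add: cf_def)
  then have l: "lact (pid (psrc (hd t))) (coef (f (gen n t))) \<gamma> \<noteq> 0" "ract (pid (ptgt (last t))) (coef (f (gen n t))) \<gamma> \<noteq> 0"
    using X a \<gamma> by (simp_all add: coef_ops bas conv_unit_left conv_unit_right)
  have "psrc \<gamma> = psrc (hd t)"
    using lact_cases[of "pid (psrc (hd t))" \<gamma> "coef (f (gen n t))"] l(1) by auto
  moreover have "ptgt \<gamma> = ptgt (last t)"
    using ract_cases[of "pid (ptgt (last t))" \<gamma> "coef (f (gen n t))"] l(2) by auto
  ultimately show "t \<in> tuples n \<and> \<gamma> \<in> X \<and> parallel t \<gamma>" using t \<gamma> by (simp add: parallel_def)
qed

lemma cobd_cf:
  assumes f: "f \<in> hm (bar n) reg" and t: "t \<in> tuples (Suc n)" and \<gamma>: "\<gamma> \<in> X"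
  shows "coef (f (dB n (gen (Suc n) t))) \<gamma> = cobd (cf f n) t \<gamma>"
proof -
  note X = tuples_hd_last(1,2)[OF t]
  have "coef (f (bas (hd t) \<odot>\<^bsub>bar n\<^esub> gen n (tl t))) \<gamma> = lact (hd t) (cf f n (tl t)) \<gamma>"
    using hmD(3)[OF f bas(1)[OF X(1)] gen_carrier] gen_value[OF f] X \<gamma>
    by (simp add: coef_ops bas conv_unit_left cf_def del: bar_simps)
  moreover have "coef (f (gen n (butlast t) \<diamondop>\<^bsub>bar n\<^esub> bas (last t))) \<gamma> = ract (last t) (cf f n (butlast t)) \<gamma>"
    using hmD(4)[OF f bas(1)[OF X(2)] gen_carrier] gen_value[OF f] X \<gamma>
    by (simp add: coef_ops bas conv_unit_right cf_def del: bar_simps)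
  ultimately show ?thesis
    unfolding dB_gen[OF t] functional_bd(2)[OF functional_comp[OF f functional_coef] t]
    using tuples_length[OF t] by (simp add: cobd_def cf_def del: bar_simps)
qed

text \<open>That values are parallel to their tuple is precisely the corner condition under which
  \<open>extend\<close> takes the prescribed values.\<close>

lemma extend_cochain:
  assumes h: "cochain n h" and n: "n > 0"
  shows "\<exists>K\<in>hm (bar n) reg. cf K n = h"
proof
  have emb_h: "emb (h t) \<in> carrier A" "coef (emb (h t)) = h t" for t
    by (rule emb; use h in \<open>auto simp: cochain_def\<close>)+
  let ?K = "extend reg n (\<lambda>t. emb (h t))"
  show K: "?K \<in> hm (bar n) reg" by (rule extend_hm[OF bimodule_regular]) (simp add: emb_h)
  show "cf ?K n = h"
  proof
    fix t
    show "cf ?K n t = h t"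
    proof (cases "t \<in> tuples n")
      case True
      have tne: "t \<noteq> []" using True n by auto
      have "hd t \<in> X" "last t \<in> X" using True tne by (auto simp: tuples_def)
      then have X: "pid (psrc (hd t)) \<in> X" "pid (ptgt (last t)) \<in> X" using pid_in_X by auto
      have 1: "bas (pid (psrc (hd t))) \<otimes>\<^bsub>A\<^esub> emb (h t) = emb (h t)"
        using h X by (intro coef_eqI, simp_all add: A_closed bas emb_h coef_ops)
          (rule conv_vertex_left, auto simp: cochain_def parallel_def)
      have 2: "emb (h t) \<otimes>\<^bsub>A\<^esub> bas (pid (ptgt (last t))) = emb (h t)"
        using h X by (intro coef_eqI, simp_all add: A_closed bas emb_h coef_ops)
          (rule conv_vertex_right, auto simp: cochain_def parallel_def)
      have "?K (gen n t) = emb (h t)"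
        by (rule extend_gen[OF bimodule_regular _ True]) (simp_all add: emb_h corner_def tne 1 2)
      then show ?thesis by (simp add: cf_def emb_h)
    next
      case False
      have "h t = (\<lambda>_. 0)" using cochain_zero[OF h] False by auto
      then show ?thesis
        using gen_outside[OF False] hm_zero[OF K bimodule_bar bimodule_regular] by (simp add: cf_def coef_ops)
    qed
  qed
qed

lemma hm_gen_coef_eqI:
  assumes F: "F \<in> hm (bar n) reg" and G: "G \<in> hm (bar n) reg"
    and e: "\<And>t \<gamma>. t \<in> tuples n \<Longrightarrow> \<gamma> \<in> X \<Longrightarrow> coef (F (gen n t)) \<gamma> = coef (G (gen n t)) \<gamma>"
    and c: "c \<in> carrier (bar n)"
  shows "F c = G c"
proof (rule hm_bar_eqI[OF bimodule_regular F G _ c], rule coef_eqI[OF gen_value[OF F] gen_value[OF G]])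
  fix t \<gamma> assume "t \<in> tuples n"
  then show "coef (F (gen n t)) \<gamma> = coef (G (gen n t)) \<gamma>"
    using e coef_outside[OF gen_value[OF F]] coef_outside[OF gen_value[OF G]] by metis
qed

text \<open>The summand with \<open>G\<close> serves the exchange of factors, where the product in
  the other order is already known to be a coboundary.\<close>

lemma bounding_cochain:
  assumes m: "m > 0" and F: "F \<in> hm (bar (Suc m)) reg" and G: "G \<in> hm (bar (Suc m)) reg"
    and bG: "bounding m G" and k: "cochain m k"
    and e: "\<And>t \<gamma>. t \<in> tuples (Suc m) \<Longrightarrow> \<gamma> \<in> X \<Longrightarrow>
      coef (F (gen (Suc m) t)) \<gamma> = cobd k t \<gamma> + s * coef (G (gen (Suc m) t)) \<gamma>"
  shows "bounding m F"
proof -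
  obtain K where K: "K \<in> hm (bar m) reg" "cf K m = k" using extend_cochain[OF k m] by blast
  obtain L where L: "L \<in> hm (bar m) reg" "\<And>c. c \<in> carrier (bar (Suc m)) \<Longrightarrow> G c = L (dB m c)"
    using bG unfolding bounding_def by blast
  let ?N = "\<lambda>c. K c \<oplus>\<^bsub>reg\<^esub> sm reg s (L c)"
  have N: "?N \<in> hm (bar m) reg" by (rule hm_add_scaled[OF K(1) L(1) bimodule_regular])
  have FN: "F c = ?N (dB m c)" if "c \<in> carrier (bar (Suc m))" for c
  proof (rule hm_gen_coef_eqI[OF F hm_comp[OF dB_hm N] _ that])
    fix t \<gamma> assume t: "t \<in> tuples (Suc m)" "\<gamma> \<in> X"
    have d: "dB m (gen (Suc m) t) \<in> carrier (bar m)" by (rule hmD(1)[OF dB_hm gen_carrier])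
    have c: "K (dB m (gen (Suc m) t)) \<in> carrier A" "L (dB m (gen (Suc m) t)) \<in> carrier A"
      using hmD(1)[OF K(1) d] hmD(1)[OF L(1) d] by simp_all
    have sc: "sm reg s (L (dB m (gen (Suc m) t))) = s \<odot>\<^bsub>A\<^esub> L (dB m (gen (Suc m) t))"
      using c scalar_central by (simp add: sm_def)
    have "coef (?N (dB m (gen (Suc m) t))) \<gamma> = coef (K (dB m (gen (Suc m) t))) \<gamma> + s * coef (L (dB m (gen (Suc m) t))) \<gamma>"
      unfolding sc using c by (simp add: coef_ops A_closed)
    then show "coef (F (gen (Suc m) t)) \<gamma> = coef (?N (dB m (gen (Suc m) t))) \<gamma>"
      using e[OF t] cobd_cf[OF K(1) t] K(2) L(2)[OF gen_carrier] by simp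
  qed
  show ?thesis unfolding bounding_def by (intro bexI[OF _ N] ballI FN)
qed

lemma bounding_zero: "bounding m (\<lambda>_. \<zero>\<^bsub>A\<^esub>)"
  unfolding bounding_def using hm_zero_map[OF bimodule_regular] by (intro bexI[of _ "\<lambda>_. \<zero>\<^bsub>A\<^esub>"]) simp_all

lemma cocycle_cobd:
  assumes f: "f \<in> hm (bar n) reg" and fd: "\<And>c. c \<in> carrier (bar (Suc n)) \<Longrightarrow> f (dB n c) = \<zero>\<^bsub>A\<^esub>"
    and t: "t \<in> tuples (Suc n)" "\<gamma> \<in> X"
  shows "cobd (cf f n) t \<gamma> = 0"
  using cobd_cf[OF f t] fd[OF gen_carrier] by (simp add: coef_ops)

lemma subtract_coboundary:
  assumes f: "f \<in> hm (bar (Suc p)) reg" and fd: "\<And>c. c \<in> carrier (bar (Suc (Suc p))) \<Longrightarrow> f (dB (Suc p) c) = \<zero>\<^bsub>A\<^esub>"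
    and h: "cochain p h" and p: "p > 0"
  shows "\<exists>f1\<in>hm (bar (Suc p)) reg. \<exists>K\<in>hm (bar p) reg.
    (\<forall>c\<in>carrier (bar (Suc p)). f c = f1 c \<oplus>\<^bsub>A\<^esub> K (dB p c)) \<and>
    (\<forall>c\<in>carrier (bar (Suc (Suc p))). f1 (dB (Suc p) c) = \<zero>\<^bsub>A\<^esub>) \<and>
    (\<forall>t\<in>tuples (Suc p). \<forall>\<gamma>\<in>X. cf f1 (Suc p) t \<gamma> = cf f (Suc p) t \<gamma> - cobd h t \<gamma>)"
proof -
  interpret R: bimodule A reg by (rule bimodule_regular)
  obtain K where K: "K \<in> hm (bar p) reg" "cf K p = h" using extend_cochain[OF h p] by blast
  let ?f1 = "\<lambda>c. f c \<oplus>\<^bsub>reg\<^esub> sm reg (-1) (K (dB p c))"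
  have f1: "?f1 \<in> hm (bar (Suc p)) reg" by (rule hm_add_scaled[OF f hm_comp[OF dB_hm K(1)] bimodule_regular])
  have Kc: "K (dB p c) \<in> carrier reg" if "c \<in> carrier (bar (Suc p))" for c
    using hmD(1)[OF K(1) hmD(1)[OF dB_hm that]] .
  have neg: "sm reg (-1) (K (dB p c)) = \<ominus>\<^bsub>reg\<^esub> K (dB p c)" if "c \<in> carrier (bar (Suc p))" for c
    by (rule sm_minus[OF bimodule_regular Kc[OF that]])
  have "f c = ?f1 c \<oplus>\<^bsub>reg\<^esub> K (dB p c)" if c: "c \<in> carrier (bar (Suc p))" for c
    unfolding neg[OF c] using hmD(1)[OF f c] Kc[OF c]
    by (simp only: R.a_assoc R.a_inv_closed R.l_neg R.r_zero)
  moreover have "?f1 (dB (Suc p) c) = \<zero>\<^bsub>reg\<^esub>" if c: "c \<in> carrier (bar (Suc (Suc p)))" for c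
  proof -
    have "K (dB p (dB (Suc p) c)) = \<zero>\<^bsub>reg\<^esub>"
      using dB_dB[OF c] hm_zero[OF K(1) bimodule_bar bimodule_regular] by simp
    moreover have "f (dB (Suc p) c) = \<zero>\<^bsub>reg\<^esub>" using fd[OF c] by simp
    ultimately show ?thesis
      using sm_zero[OF bimodule_regular, of "-1"] R.r_zero[OF R.zero_closed] by (simp only:)
  qed
  moreover have "cf ?f1 (Suc p) t \<gamma> = cf f (Suc p) t \<gamma> - cobd h t \<gamma>" if t: "t \<in> tuples (Suc p)" "\<gamma> \<in> X" for t \<gamma>
  proof -
    have c: "f (gen (Suc p) t) \<in> carrier A" "K (dB p (gen (Suc p) t)) \<in> carrier A"
      using gen_value[OF f] Kc[OF gen_carrier] by simp_all
    have sc: "sm reg (-1) (K (dB p (gen (Suc p) t))) = (-1) \<odot>\<^bsub>A\<^esub> K (dB p (gen (Suc p) t))"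
      using c scalar_central by (simp add: sm_def)
    show ?thesis using c cobd_cf[OF K(1) t] K(2) unfolding cf_def sc by (simp add: coef_ops A_closed)
  qed
  ultimately show ?thesis using f1 K(1) by (intro bexI[OF _ f1] bexI[OF _ K(1)]) simp_all
qed

lemma cup_value:
  assumes g: "g \<in> hm (bar m) reg" and m: "m > 0" and f: "f \<in> hm (bar n) reg" and t: "t \<in> tuples (m + n)"
  shows "coef (f (cup_map m g n (gen (m + n) t))) \<gamma> = conv (cf f n (take n t)) (cf g m (drop n t)) \<gamma>"
proof -
  have "f (cup_map m g n (gen (m + n) t)) = f (gen n (take n t)) \<otimes>\<^bsub>A\<^esub> g (gen m (drop n t))"
    unfolding cup_map_gen[OF m g t] cup_gen_def using hmD(4)[OF f gen_value[OF g] gen_carrier] by (simp del: bar_simps)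
  then show ?thesis using gen_value[OF f] gen_value[OF g] by (simp add: coef_ops cf_def)
qed

section \<open>First factor of degree at least two\<close>

lemma cochain_value_nontrivial:
  assumes "cochain n h" "n > 0" "h t b \<noteq> 0"
  shows "b \<in> X \<and> parcs b \<noteq> []"
proof -
  have t: "t \<in> tuples n" "b \<in> X" "parallel t b" using assms by (auto simp: cochain_def)
  have "t \<noteq> []" using t(1) assms(2) by auto
  from parallel_nontrivial[OF t(1) this t(2,3)] t(2) show ?thesis by simp
qed

text \<open>Two coboundaries, by K1 and K2, are subtracted from \<open>f\<close>; the remainder f2
  has values in the right socle, so its product with \<open>g\<close> is zero on the nose. The
  subtracted part contributes a coboundary because the lift of \<open>g\<close> is a chain
  map.\<close>

lemma cup_bounding_ge2:
  assumes p: "p > 0" and m: "m > 0"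
    and f: "f \<in> hm (bar (Suc p)) reg" and fd: "\<And>c. c \<in> carrier (bar (Suc (Suc p))) \<Longrightarrow> f (dB (Suc p) c) = \<zero>\<^bsub>A\<^esub>"
    and g: "g \<in> hm (bar m) reg" and gd: "\<And>c. c \<in> carrier (bar (Suc m)) \<Longrightarrow> g (dB m c) = \<zero>\<^bsub>A\<^esub>"
  shows "bounding (m + p) (\<lambda>c. f (cup_map m g (Suc p) c))"
proof -
  interpret R: bimodule A reg by (rule bimodule_regular)
  obtain h1 where h1: "cochain p h1" "\<forall>s q c \<gamma>. s @ [q, c] \<in> tuples (Suc p) \<longrightarrow> arrow c \<longrightarrow> pmul q c \<in> X \<longrightarrow>
    \<gamma> \<in> X \<longrightarrow> parallel (s @ [q, c]) \<gamma> \<longrightarrow> cobd h1 (s @ [q, c]) \<gamma> = cf f (Suc p) (s @ [q, c]) \<gamma>"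
    using normalize_last_argument[OF cf_cochain[OF f] p] by blast
  obtain f1 K1 where f1: "f1 \<in> hm (bar (Suc p)) reg" "K1 \<in> hm (bar p) reg"
    "\<forall>c\<in>carrier (bar (Suc p)). f c = f1 c \<oplus>\<^bsub>A\<^esub> K1 (dB p c)"
    "\<forall>c\<in>carrier (bar (Suc (Suc p))). f1 (dB (Suc p) c) = \<zero>\<^bsub>A\<^esub>"
    "\<forall>t\<in>tuples (Suc p). \<forall>\<gamma>\<in>X. cf f1 (Suc p) t \<gamma> = cf f (Suc p) t \<gamma> - cobd h1 t \<gamma>"
    using subtract_coboundary[OF f fd h1(1) p] by blast
  have cc1: "cobd (cf f1 (Suc p)) t \<gamma> = 0" if "t \<in> tuples (Suc (Suc p))" "\<gamma> \<in> X" for t \<gamma>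
    using cocycle_cobd[OF f1(1) _ that] f1(4) by blast
  have nm1: "cf f1 (Suc p) (s @ [q, c]) \<gamma> = 0" if "s @ [q, c] \<in> tuples (Suc p)" "arrow c" "pmul q c \<in> X" "\<gamma> \<in> X"
    "parallel (s @ [q, c]) \<gamma>" for s q c \<gamma>
    using f1(5) h1(2) that by simp
  obtain h2 where h2: "cochain p h2" "\<forall>t \<gamma> v. t \<in> tuples (Suc p) \<longrightarrow> \<gamma> \<in> X \<longrightarrow> parallel t \<gamma> \<longrightarrow>
    extends \<gamma> v \<longrightarrow> cobd h2 t \<gamma> = cf f1 (Suc p) t \<gamma>"
    using cocycle_right_socle[OF cf_cochain[OF f1(1)] p cc1 nm1] by blast
  have f1d: "\<And>c. c \<in> carrier (bar (Suc (Suc p))) \<Longrightarrow> f1 (dB (Suc p) c) = \<zero>\<^bsub>A\<^esub>" using f1(4) by blast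
  obtain f2 K2 where f2: "f2 \<in> hm (bar (Suc p)) reg" "K2 \<in> hm (bar p) reg"
    "\<forall>c\<in>carrier (bar (Suc p)). f1 c = f2 c \<oplus>\<^bsub>A\<^esub> K2 (dB p c)"
    "\<forall>t\<in>tuples (Suc p). \<forall>\<gamma>\<in>X. cf f2 (Suc p) t \<gamma> = cf f1 (Suc p) t \<gamma> - cobd h2 t \<gamma>"
    using subtract_coboundary[OF f1(1) f1d h2(1) p] by blast
  note coch2 = cf_cochain[OF f2(1)]
  have soc: "cf f2 (Suc p) t \<gamma> = 0" if "extends \<gamma> v" for t \<gamma> v
  proof (cases "t \<in> tuples (Suc p) \<and> \<gamma> \<in> X \<and> parallel t \<gamma>")
    case True
    then show ?thesis using f2(4) h2(2)[rule_format, of t \<gamma> v] that by simp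
  next
    case False
    then show ?thesis using cochain_zero[OF coch2] by blast
  qed
  have cm: "cup_map m g (Suc p) \<in> hm (bar (Suc (m + p))) (bar (Suc p))"
    using cup_map_hm[OF m g, of "Suc p"] by simp
  have z: "f2 (cup_map m g (Suc p) c) = \<zero>\<^bsub>reg\<^esub>" if "c \<in> carrier (bar (Suc (m + p)))" for c
  proof (rule hm_gen_coef_eqI[OF hm_comp[OF cm f2(1)] hm_zero_map[OF bimodule_regular] _ that])
    fix t \<gamma> assume t: "t \<in> tuples (Suc (m + p))"
    have "conv (cf f2 (Suc p) (take (Suc p) t)) (cf g m (drop (Suc p) t)) \<gamma> = 0"
    \<comment> \<open>In a nonzero term a path \<open>a\<close> outside the annihilator of the
      nontrivial path \<open>b\<close> would be extended by the first arrow of \<open>b\<close>, but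
      f2 has no such values.\<close>
    proof (rule ccontr)
      assume "conv (cf f2 (Suc p) (take (Suc p) t)) (cf g m (drop (Suc p) t)) \<gamma> \<noteq> 0"
      from conv_nonzero[OF this] obtain a b where ab: "a \<in> X" "b \<in> X" "ptgt a = psrc b" "pmul a b \<in> X"
        "cf f2 (Suc p) (take (Suc p) t) a \<noteq> 0" "cf g m (drop (Suc p) t) b \<noteq> 0" by blast
      have "parcs b \<noteq> []" using cochain_value_nontrivial[OF cf_cochain[OF g m] m ab(6)] by simp
      from right_socle_mult[OF ab(1,2) this ab(3,4)] soc ab(5) show False by blast
    qed
    then show "coef (f2 (cup_map m g (Suc p) (gen (Suc (m + p)) t))) \<gamma> = coef \<zero>\<^bsub>reg\<^esub> \<gamma>"
      using cup_value[OF g m f2(1), of t] t by (simp add: coef_ops)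
  qed
  let ?K = "\<lambda>c. K2 c \<oplus>\<^bsub>reg\<^esub> sm reg 1 (K1 c)"
  have K: "?K \<in> hm (bar p) reg" by (rule hm_add_scaled[OF f2(2) f1(2) bimodule_regular])
  show ?thesis
    unfolding bounding_def
  proof (intro bexI[OF _ hm_comp[OF cup_map_hm[OF m g] K]] ballI)
    fix c assume c: "c \<in> carrier (bar (Suc (m + p)))"
    let ?c = "cup_map m g (Suc p) c"
    have c': "?c \<in> carrier (bar (Suc p))" by (rule hmD(1)[OF cm c])
    have d: "dB p ?c \<in> carrier (bar p)" by (rule hmD(1)[OF dB_hm c'])
    have Kc: "K1 (dB p ?c) \<in> carrier reg" "K2 (dB p ?c) \<in> carrier reg"
      using hmD(1)[OF f1(2) d] hmD(1)[OF f2(2) d] .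
    have "f ?c = (f2 ?c \<oplus>\<^bsub>reg\<^esub> K2 (dB p ?c)) \<oplus>\<^bsub>reg\<^esub> K1 (dB p ?c)"
      using f1(3) f2(3) c' by simp
    also have "\<dots> = ?K (dB p ?c)"
      unfolding z[OF c] sm_one[OF bimodule_regular Kc(1)] using Kc by (simp only: R.l_zero)
    also have "dB p ?c = cup_map m g p (dB (m + p) c)" by (rule cup_map_chain[OF m g gd c])
    finally show "f ?c = ?K (cup_map m g p (dB (m + p) c))" .
  qed
qed

section \<open>Products with a derivation\<close>

definition act :: "(('v,'e) qpath list \<Rightarrow> ('v,'e) qpath \<Rightarrow> 'k) \<Rightarrow> (('v,'e) qpath \<Rightarrow> 'k) \<Rightarrow> ('v,'e) qpath \<Rightarrow> 'k" where
  "act F \<phi> \<gamma> = (\<Sum>p\<in>X. \<phi> p * F [p] \<gamma>)"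

lemma act_add: "act F (\<lambda>p. \<phi> p + \<psi> p) \<gamma> = act F \<phi> \<gamma> + act F \<psi> \<gamma>"
  by (simp add: act_def algebra_simps sum.distrib)

lemma act_scale: "act F (\<lambda>p. k * \<phi> p) \<gamma> = k * act F \<phi> \<gamma>"
  by (simp add: act_def algebra_simps sum_distrib_left)

lemma act_unit: "p \<in> X \<Longrightarrow> act F (unit_at p) \<gamma> = F [p] \<gamma>"
  using finite_X by (simp add: act_def unit_at_def if_distrib[where f = "\<lambda>z. z * _"] sum.delta cong: if_cong)

lemma conv_unit_unit:
  assumes "a \<in> X" "b \<in> X"
  shows "conv (unit_at a) (unit_at b) = (if ptgt a = psrc b \<and> pmul a b \<in> X then unit_at (pmul a b) else (\<lambda>_. 0 :: 'k))"
proof -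
  have "conv (unit_at a) (unit_at b) = coef (bas a \<otimes>\<^bsub>A\<^esub> bas b)" using assms by (simp add: coef_ops bas)
  then show ?thesis using assms by (simp add: bas_mult bas coef_ops)
qed

context
  fixes F :: "('v,'e) qpath list \<Rightarrow> ('v,'e) qpath \<Rightarrow> 'k"
  assumes F: "cochain 1 F" and cocyc: "\<And>t \<gamma>. t \<in> tuples 2 \<Longrightarrow> \<gamma> \<in> X \<Longrightarrow> cobd F t \<gamma> = 0"
begin

text \<open>The Leibniz rule on all basis paths. The cocycle condition gives it for composable
  nontrivial paths. For a trivial factor it holds because \<open>F\<close> vanishes on trivial paths
  and has values with the right endpoints, and for non-composable ones because every term is
  0.\<close>

lemma derivation_product:
  assumes a: "a \<in> X" and b: "b \<in> X" and \<gamma>: "\<gamma> \<in> X"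
  shows "lact a (F [b]) \<gamma> + ract b (F [a]) \<gamma> = (if ptgt a = psrc b \<and> pmul a b \<in> X then F [pmul a b] \<gamma> else 0)"
proof -
  have supp: "F [x] \<delta> \<noteq> 0 \<Longrightarrow> parcs x \<noteq> [] \<and> psrc \<delta> = psrc x \<and> ptgt \<delta> = ptgt x \<and> \<delta> \<in> X" for x \<delta>
  proof -
    assume "F [x] \<delta> \<noteq> 0"
    then have "[x] \<in> tuples 1" "\<delta> \<in> X" "parallel [x] \<delta>" using F unfolding cochain_def by blast+
    then show ?thesis by (simp add: tuples_Cons parallel_def)
  qed
  consider "ptgt a \<noteq> psrc b" | "ptgt a = psrc b" "parcs a = []" | "ptgt a = psrc b" "parcs a \<noteq> []" "parcs b = []"
    | "ptgt a = psrc b" "parcs a \<noteq> []" "parcs b \<noteq> []" by blast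
  then show ?thesis
  proof cases
    case 1
    have "lact a (F [b]) \<gamma> = 0"
    proof (rule ccontr)
      assume "lact a (F [b]) \<gamma> \<noteq> 0"
      with lact_cases[of a \<gamma> "F [b]"] obtain c where "ptgt a = psrc c" "F [b] c \<noteq> 0" by metis
      then show False using supp[of b c] 1 by simp
    qed
    moreover have "ract b (F [a]) \<gamma> = 0"
    proof (rule ccontr)
      assume "ract b (F [a]) \<gamma> \<noteq> 0"
      with ract_cases[of b \<gamma> "F [a]"] obtain c where "ptgt c = psrc b" "F [a] c \<noteq> 0" by metis
      then show False using supp[of a c] 1 by simp
    qed
    ultimately show ?thesis using 1 by simp
  next
    case 2
    then have e: "a = pid (psrc b)" using trivial_qpath[of a] a X_subset by auto
    have "lact a (F [b]) \<gamma> = F [b] \<gamma>"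
      using conv_vertex_left[of "F [b]" "psrc b" \<gamma>] supp a \<gamma> unfolding e by (simp add: conv_unit_left)
    moreover have "F [a] = (\<lambda>_. 0)" using supp[of a] 2 by blast
    moreover have "pmul a b = b" unfolding e by simp
    ultimately show ?thesis using 2 b by (simp add: ract_def)
  next
    case 3
    then have e: "b = pid (ptgt a)" using trivial_qpath[of b] b X_subset by auto
    have "ract b (F [a]) \<gamma> = F [a] \<gamma>"
      using conv_vertex_right[of "F [a]" "ptgt a" \<gamma>] supp b \<gamma> unfolding e by (simp add: conv_unit_right)
    moreover have "F [b] = (\<lambda>_. 0)" using supp[of b] 3 by blast
    moreover have "pmul a b = a" unfolding e by simp
    ultimately show ?thesis using 3 a by (simp add: lact_def)
  next
    case 4
    then have "cobd F [a, b] \<gamma> = 0" using cocyc[of "[a, b]" \<gamma>] a b \<gamma> by (simp add: tuples_Cons)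
    moreover have "cobd F [a, b] \<gamma> = lact a (F [b]) \<gamma> + ract b (F [a]) \<gamma> - F [pmul a b] \<gamma>"
      by (simp add: cobd_def algebra_simps)
    ultimately have "lact a (F [b]) \<gamma> + ract b (F [a]) \<gamma> = F [pmul a b] \<gamma>" by simp
    moreover have "pmul a b \<notin> X \<Longrightarrow> F [pmul a b] \<gamma> = 0"
      using cochain_zero[OF F, of "[pmul a b]"] by (simp add: tuples_Cons)
    ultimately show ?thesis using 4 by auto
  qed
qed

lemma act_conv:
  assumes \<phi>: "\<And>p. \<phi> p \<noteq> 0 \<Longrightarrow> p \<in> X" and \<chi>: "\<And>p. \<chi> p \<noteq> 0 \<Longrightarrow> p \<in> X" and \<gamma>: "\<gamma> \<in> X"
  shows "act F (conv \<phi> \<chi>) \<gamma> = conv (act F \<phi>) \<chi> \<gamma> + conv \<phi> (act F \<chi>) \<gamma>"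
proof -
  have cl: "conv (\<lambda>p. a p + b p) c = (\<lambda>\<gamma>. conv a c \<gamma> + conv b c \<gamma>)"
    "conv c (\<lambda>p. a p + b p) = (\<lambda>\<gamma>. conv c a \<gamma> + conv c b \<gamma>)"
    "conv (\<lambda>p. k * a p) c = (\<lambda>\<gamma>. k * conv a c \<gamma>)" "conv c (\<lambda>p. k * a p) = (\<lambda>\<gamma>. k * conv c a \<gamma>)"
    for a b c :: "_ \<Rightarrow> 'k" and k
    using conv_add conv_scale by blast+
  have al: "act F (\<lambda>p. a p + b p) = (\<lambda>\<gamma>. act F a \<gamma> + act F b \<gamma>)" "act F (\<lambda>p. k * a p) = (\<lambda>\<gamma>. k * act F a \<gamma>)" for a b k
    using act_add act_scale by blast+
  have u: "act F (unit_at p) = F [p]" if "p \<in> X" for p using act_unit[OF that] by blast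
  have step: "act F (conv (unit_at a) \<chi>) \<gamma> = conv (F [a]) \<chi> \<gamma> + conv (unit_at a) (act F \<chi>) \<gamma>" if a: "a \<in> X" for a
  proof (rule linear_eqI[where \<phi> = \<chi>])
    fix b assume b: "b \<in> X"
    have "act F (conv (unit_at a) (unit_at b)) \<gamma> = (if ptgt a = psrc b \<and> pmul a b \<in> X then F [pmul a b] \<gamma> else 0)"
      unfolding conv_unit_unit[OF a b] using act_unit[of "pmul a b" F \<gamma>] by (simp add: act_def)
    also have "\<dots> = lact a (F [b]) \<gamma> + ract b (F [a]) \<gamma>" using derivation_product[OF a b \<gamma>] by simp
    finally show "act F (conv (unit_at a) (unit_at b)) \<gamma>
        = conv (F [a]) (unit_at b) \<gamma> + conv (unit_at a) (act F (unit_at b)) \<gamma>"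
      by (simp add: conv_unit_left[OF a \<gamma>] conv_unit_right[OF b \<gamma>] u[OF b])
  qed (use \<chi> in \<open>simp_all add: cl al algebra_simps\<close>)
  show ?thesis
  proof (rule linear_eqI[where \<phi> = \<phi>])
    fix a assume a: "a \<in> X"
    show "act F (conv (unit_at a) \<chi>) \<gamma> = conv (act F (unit_at a)) \<chi> \<gamma> + conv (unit_at a) (act F \<chi>) \<gamma>"
      using step[OF a] u[OF a] by simp
  qed (use \<phi> in \<open>simp_all add: cl al algebra_simps\<close>)
qed

text \<open>Composition with a derivation is a homotopy between the two cup products with it.\<close>

lemma cup_derivation_commutes:
  assumes G: "cochain m G" and m: "m > 0" and Gc: "\<And>t \<gamma>. t \<in> tuples (Suc m) \<Longrightarrow> \<gamma> \<in> X \<Longrightarrow> cobd G t \<gamma> = 0"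
  shows "\<exists>k. cochain m k \<and> (\<forall>t\<in>tuples (Suc m). \<forall>\<gamma>\<in>X. conv (F [hd t]) (G (tl t)) \<gamma>
    = cobd k t \<gamma> + (-1) ^ m * conv (G (butlast t)) (F [last t]) \<gamma>)"
proof -
  \<comment> \<open>\<open>G\<close> followed by the derivation \<open>F\<close>.\<close>
  define k where "k = (\<lambda>t \<gamma>. act F (G t) \<gamma>)"
  have k: "cochain m k"
    unfolding cochain_def
  proof (intro allI impI)
    fix t \<gamma> assume "k t \<gamma> \<noteq> 0"
    then obtain p where p: "p \<in> X" "G t p * F [p] \<gamma> \<noteq> 0"
      unfolding k_def act_def by (meson sum.not_neutral_contains_not_neutral)
    then have "G t p \<noteq> 0" "F [p] \<gamma> \<noteq> 0" by auto
    then show "t \<in> tuples m \<and> \<gamma> \<in> X \<and> parallel t \<gamma>"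
      using G F by (auto simp: cochain_def parallel_def)
  qed
  have Gs: "\<And>t p. G t p \<noteq> 0 \<Longrightarrow> p \<in> X" using G by (auto simp: cochain_def)
  have "conv (F [hd t]) (G (tl t)) \<gamma> = cobd (\<lambda>t \<gamma>. (-1) * k t \<gamma>) t \<gamma> + (-1) ^ m * conv (G (butlast t)) (F [last t]) \<gamma>"
    if t: "t \<in> tuples (Suc m)" and \<gamma>: "\<gamma> \<in> X" for t \<gamma>
  proof -
    note X = tuples_hd_last(1,2)[OF t]
    have us: "\<And>p x. x \<in> X \<Longrightarrow> (unit_at x p :: 'k) \<noteq> 0 \<Longrightarrow> p \<in> X" by (auto simp: unit_at_def split: if_splits)
    have u: "act F (unit_at p) = F [p]" if "p \<in> X" for p using act_unit[OF that] by blast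
    have l: "act F (lact (hd t) (G (tl t))) \<gamma> = conv (F [hd t]) (G (tl t)) \<gamma> + lact (hd t) (k (tl t)) \<gamma>"
    proof -
      have "act F (lact (hd t) (G (tl t))) \<gamma> = act F (conv (unit_at (hd t)) (G (tl t))) \<gamma>"
        unfolding act_def by (intro sum.cong) (auto simp: conv_unit_left[OF X(1)])
      then show ?thesis
        using act_conv[OF us[OF X(1)] Gs[of "tl t"] \<gamma>] u[OF X(1)] conv_unit_left[OF X(1) \<gamma>, of "k (tl t)"]
        by (simp add: k_def)
    qed
    have r: "act F (ract (last t) (G (butlast t))) \<gamma> = ract (last t) (k (butlast t)) \<gamma> + conv (G (butlast t)) (F [last t]) \<gamma>"
    proof -
      have "act F (ract (last t) (G (butlast t))) \<gamma> = act F (conv (G (butlast t)) (unit_at (last t))) \<gamma>"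
        unfolding act_def by (intro sum.cong) (auto simp: conv_unit_right[OF X(2)])
      then show ?thesis
        using act_conv[OF Gs[of "butlast t"] us[OF X(2)] \<gamma>] u[OF X(2)] conv_unit_right[OF X(2) \<gamma>, of "k (butlast t)"]
        by (simp add: k_def)
    qed
    have diff: "act F (\<lambda>w. a w - b w) \<gamma> = act F a \<gamma> - act F b \<gamma>" for a b
      using act_add[of F a "\<lambda>w. (-1) * b w" \<gamma>] act_scale[of F "-1" b \<gamma>] by simp
    have mg: "act F (\<lambda>w. merges (\<lambda>u. G u w) t) \<gamma> = merges (\<lambda>u. k u \<gamma>) t"
      using merges_fun_linear[of G UNIV "\<lambda>\<psi>. act F \<psi> \<gamma>" t] diff by (simp add: k_def)
    \<comment> \<open>The derivation is applied to the vanishing coboundary of \<open>G\<close>. By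
      the Leibniz rule, the left and right actions produce the corresponding terms for
      \<open>k\<close> and, in addition, the two products.\<close>
    have "0 = act F (\<lambda>w. cobd G t w) \<gamma>" using Gc[OF t] by (simp add: act_def)
    also have "\<dots> = act F (lact (hd t) (G (tl t))) \<gamma> + act F (\<lambda>w. merges (\<lambda>u. G u w) t) \<gamma>
        + (-1) ^ length t * act F (ract (last t) (G (butlast t))) \<gamma>"
      unfolding cobd_def act_add act_scale ..
    also have "\<dots> = conv (F [hd t]) (G (tl t)) \<gamma> + cobd k t \<gamma> + (-1) ^ length t * conv (G (butlast t)) (F [last t]) \<gamma>"
      unfolding l r mg by (simp add: cobd_def algebra_simps)
    finally have e: "0 = conv (F [hd t]) (G (tl t)) \<gamma> + cobd k t \<gamma> + (-1) ^ length t * conv (G (butlast t)) (F [last t]) \<gamma>" .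
    then have "conv (F [hd t]) (G (tl t)) \<gamma> = (-1) * cobd k t \<gamma> + (-1) ^ m * conv (G (butlast t)) (F [last t]) \<gamma>"
      using tuples_length[OF t] by (simp add: algebra_simps eq_neg_iff_add_eq_0)
    then show ?thesis unfolding cobd_scale .
  qed
  moreover have "cochain m (\<lambda>t \<gamma>. (-1) * k t \<gamma>)" using k by (simp add: cochain_def)
  ultimately show ?thesis by blast
qed

end

lemma cup_bounding_one_ge2:
  assumes p: "p > 0"
    and f: "f \<in> hm (bar 1) reg" and fd: "\<And>c. c \<in> carrier (bar (Suc 1)) \<Longrightarrow> f (dB 1 c) = \<zero>\<^bsub>A\<^esub>"
    and g: "g \<in> hm (bar (Suc p)) reg" and gd: "\<And>c. c \<in> carrier (bar (Suc (Suc p))) \<Longrightarrow> g (dB (Suc p) c) = \<zero>\<^bsub>A\<^esub>"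
  shows "bounding (Suc p) (\<lambda>c. f (cup_map (Suc p) g 1 c))"
proof -
  have F: "cochain 1 (cf f 1)" using cf_cochain[OF f] by simp
  have Fc: "cobd (cf f 1) t \<gamma> = 0" if "t \<in> tuples 2" "\<gamma> \<in> X" for t \<gamma>
    using cocycle_cobd[OF f fd] that by (simp add: numeral_2_eq_2)
  have G: "cochain (Suc p) (cf g (Suc p))" using cf_cochain[OF g] by simp
  obtain k where k: "cochain (Suc p) k" "\<forall>t\<in>tuples (Suc (Suc p)). \<forall>\<gamma>\<in>X. conv (cf f 1 [hd t]) (cf g (Suc p) (tl t)) \<gamma>
    = cobd k t \<gamma> + (-1) ^ Suc p * conv (cf g (Suc p) (butlast t)) (cf f 1 [last t]) \<gamma>"
    using cup_derivation_commutes[OF F Fc G _ cocycle_cobd[OF g gd]] by blast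
  have c1: "cup_map (Suc p) g 1 \<in> hm (bar (Suc (Suc p))) (bar 1)" using cup_map_hm[OF _ g, of 1] by simp
  have c2: "cup_map 1 f (Suc p) \<in> hm (bar (Suc (Suc p))) (bar (Suc p))" using cup_map_hm[OF _ f, of "Suc p"] by simp
  \<comment> \<open>In the exchanged order the first factor has degree at least 2, and that case
    needs only positive degree of the second.\<close>
  have b: "bounding (Suc p) (\<lambda>c. g (cup_map 1 f (Suc p) c))"
    using cup_bounding_ge2[OF p _ g gd f fd] by simp
  show ?thesis
  proof (rule bounding_cochain[OF _ hm_comp[OF c1 f] hm_comp[OF c2 g] b k(1)])
    fix t \<gamma> assume t: "t \<in> tuples (Suc (Suc p))" "\<gamma> \<in> X"
    have len: "length t = Suc (Suc p)" by (rule tuples_length[OF t(1)])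
    have "take 1 t = [hd t]" "drop 1 t = tl t" "take (Suc p) t = butlast t"
      using len by (cases t; simp add: butlast_conv_take drop_Suc)+
    moreover have "drop (Suc p) t = [last t]"
      using len by (cases t rule: rev_cases) auto
    ultimately show "coef (f (cup_map (Suc p) g 1 (gen (Suc (Suc p)) t))) \<gamma>
      = cobd k t \<gamma> + (-1) ^ Suc p * coef (g (cup_map 1 f (Suc p) (gen (Suc (Suc p)) t))) \<gamma>"
      using cup_value[OF g _ f, of t \<gamma>] cup_value[OF f _ g, of t \<gamma>] t k(2) by simp
  qed simp
qed

section \<open>Two derivations\<close>

definition weight :: "(('v,'e) qpath list \<Rightarrow> ('v,'e) qpath \<Rightarrow> 'k) \<Rightarrow> ('v,'e) qpath \<Rightarrow> 'k" where
  "weight F x = F [x] x"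

definition diagonal :: "(('v,'e) qpath list \<Rightarrow> ('v,'e) qpath \<Rightarrow> 'k) \<Rightarrow> ('v,'e) qpath list \<Rightarrow> ('v,'e) qpath \<Rightarrow> 'k" where
  "diagonal F t \<gamma> = (if t = [\<gamma>] then F t \<gamma> else 0)"

lemma diagonal_unit: "diagonal F [x] = (\<lambda>\<gamma>. weight F x * unit_at x \<gamma>)"
  by (auto simp: diagonal_def weight_def unit_at_def)

lemma pairs: "t \<in> tuples 2 \<Longrightarrow> \<exists>x y. t = [x, y] \<and> x \<in> X \<and> y \<in> X \<and> parcs x \<noteq> [] \<and> parcs y \<noteq> [] \<and> ptgt x = psrc y"
  by (auto simp: tuples_def numeral_2_eq_2 length_Suc_conv)

lemma cobd_diagonal:
  assumes "x \<in> X" "y \<in> X" "\<gamma> \<in> X" "ptgt x = psrc y"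
  shows "cobd (\<lambda>t \<gamma>. if t = [\<gamma>] then w \<gamma> else 0) [x, y] \<gamma> = (if \<gamma> = pmul x y then w y - w \<gamma> + w x else 0)"
proof -
  have "lact x (\<lambda>\<gamma>'. if [y] = [\<gamma>'] then w \<gamma>' else 0) \<gamma> = (if \<gamma> = pmul x y then w y else 0)"
    using lact_cases[of x \<gamma> "\<lambda>\<gamma>'. if [y] = [\<gamma>'] then w \<gamma>' else 0"]
      lact_pmul[of y x "\<lambda>\<gamma>'. if [y] = [\<gamma>'] then w \<gamma>' else 0"] assms by auto
  moreover have "ract y (\<lambda>\<gamma>'. if [x] = [\<gamma>'] then w \<gamma>' else 0) \<gamma> = (if \<gamma> = pmul x y then w x else 0)"
    using ract_cases[of y \<gamma> "\<lambda>\<gamma>'. if [x] = [\<gamma>'] then w \<gamma>' else 0"]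
      ract_pmul[of x y "\<lambda>\<gamma>'. if [x] = [\<gamma>'] then w \<gamma>' else 0"] assms by auto
  ultimately show ?thesis by (auto simp: cobd_def)
qed

lemma weight_add:
  assumes F: "cochain 1 F" and Fc: "\<And>t \<gamma>. t \<in> tuples 2 \<Longrightarrow> \<gamma> \<in> X \<Longrightarrow> cobd F t \<gamma> = 0"
    and x: "x \<in> X" "parcs x \<noteq> []" and y: "y \<in> X" "parcs y \<noteq> []" and xy: "ptgt x = psrc y" "pmul x y \<in> X"
  shows "weight F (pmul x y) = weight F x + weight F y"
  using Fc[of "[x, y]" "pmul x y"] x y xy lact_pmul[of y x "F [y]"] ract_pmul[of x y "F [x]"]
  by (simp add: cobd_def tuples_Cons weight_def algebra_simps)

text \<open>By the cocycle condition weights add up under multiplication of paths, so they are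
  determined by the arrows.\<close>

lemma weight_sum:
  assumes F: "cochain 1 F" and Fc: "\<And>t \<gamma>. t \<in> tuples 2 \<Longrightarrow> \<gamma> \<in> X \<Longrightarrow> cobd F t \<gamma> = 0"
    and x: "x \<in> X" "parcs x \<noteq> []"
  shows "weight F x = (\<Sum>a\<leftarrow>parcs x. weight F (tail Q a, [a], head Q a))"
  using x
proof (induction "length (parcs x)" arbitrary: x)
  case (Suc n)
  obtain c p where c: "p \<in> X" "arrow c" "ptgt c = psrc p" "x = pmul c p"
    using split_first[OF Suc.prems] by blast
  obtain a where a: "parcs c = [a]" using c(2) by (auto simp: length_Suc_conv)
  have "c \<in> qpaths Q" using c(2) X_subset by auto
  then have ca: "c = (tail Q a, [a], head Q a)" using a by (cases c) (auto simp: qpaths_def awalk_simps)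
  show ?case
  proof (cases "parcs p = []")
    case True
    then have "p = pid (ptgt c)" using trivial_qpath[of p] c X_subset by auto
    then have "x = c" using c(4) by simp
    then show ?thesis using a ca by simp
  next
    case False
    have "weight F x = weight F c + weight F p"
      unfolding c(4) by (rule weight_add[OF F Fc]) (use c a False Suc.prems in auto)
    also have "weight F p = (\<Sum>a\<leftarrow>parcs p. weight F (tail Q a, [a], head Q a))"
      using Suc.hyps(1)[of p] Suc.hyps(2) c False by simp
    finally show ?thesis using c(4) a ca by simp
  qed
qed simp

text \<open>The sum of \<alpha> a \<beta> b over all pairs of positions with \<open>a\<close> before
  \<open>b\<close>. Its failure to be additive under concatenation is the product of the total
  \<alpha> of the first list and the total \<beta> of the second, so it bounds the product of two
  weights.\<close>

fun pair_sum :: "('e \<Rightarrow> 'k) \<Rightarrow> ('e \<Rightarrow> 'k) \<Rightarrow> 'e list \<Rightarrow> 'k" where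
  "pair_sum \<alpha> \<beta> [] = 0"
| "pair_sum \<alpha> \<beta> (a # l) = \<alpha> a * (\<Sum>b\<leftarrow>l. \<beta> b) + pair_sum \<alpha> \<beta> l"

lemma pair_sum_append:
  "pair_sum \<alpha> \<beta> (l @ l') = pair_sum \<alpha> \<beta> l + pair_sum \<alpha> \<beta> l' + (\<Sum>a\<leftarrow>l. \<alpha> a) * (\<Sum>b\<leftarrow>l'. \<beta> b)"
  by (induction l) (simp_all add: algebra_simps)

text \<open>The off-diagonal values of a derivation lie in the right socle and are killed by the
  nontrivial paths in the values of \<open>G\<close>.\<close>

lemma conv_diagonal_left:
  assumes F: "cochain 1 F" and Fc: "\<And>t \<gamma>. t \<in> tuples 2 \<Longrightarrow> \<gamma> \<in> X \<Longrightarrow> cobd F t \<gamma> = 0" and G: "cochain 1 G"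
    and x: "[x] \<in> tuples 1"
  shows "conv (F [x]) (G [y]) \<gamma> = conv (diagonal F [x]) (G [y]) \<gamma>"
proof -
  have "conv (\<lambda>a. F [x] a - diagonal F [x] a) (G [y]) \<gamma> = 0"
  proof (rule ccontr)
    assume "conv (\<lambda>a. F [x] a - diagonal F [x] a) (G [y]) \<gamma> \<noteq> 0"
    from conv_nonzero[OF this] obtain a b where ab: "a \<in> X" "b \<in> X" "ptgt a = psrc b" "pmul a b \<in> X"
      "F [x] a - diagonal F [x] a \<noteq> 0" "G [y] b \<noteq> 0" by blast
    have ax: "a \<noteq> x" "F [x] a \<noteq> 0" using ab(5) by (auto simp: diagonal_def split: if_splits)
    have "parcs b \<noteq> []" using cochain_value_nontrivial[OF G _ ab(6)] by simp
    from right_socle_mult[OF ab(1,2) this ab(3,4)] obtain v where v: "extends a v" by blast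
    have "parallel [x] a" using F ax by (auto simp: cochain_def)
    from derivation_right_socle[OF F Fc x ab(1) this ax(1) v] ax(2) show False by simp
  qed
  then show ?thesis unfolding conv_diff by simp
qed

text \<open>\<open>conv_diagonal_left\<close> replaces a left factor only. The factors are therefore
  exchanged between its two uses, at the price of a sign and the coboundary of \<open>k\<close>.
  What remains is the product of two weights.\<close>

lemma cup_bounding_one_one:
  assumes f: "f \<in> hm (bar 1) reg" and fd: "\<And>c. c \<in> carrier (bar (Suc 1)) \<Longrightarrow> f (dB 1 c) = \<zero>\<^bsub>A\<^esub>"
    and g: "g \<in> hm (bar 1) reg" and gd: "\<And>c. c \<in> carrier (bar (Suc 1)) \<Longrightarrow> g (dB 1 c) = \<zero>\<^bsub>A\<^esub>"
  shows "bounding 1 (\<lambda>c. f (cup_map 1 g 1 c))"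
proof -
  let ?F = "cf f 1" and ?G = "cf g 1"
  have F: "cochain 1 ?F" and G: "cochain 1 ?G" using cf_cochain[OF f] cf_cochain[OF g] by simp_all
  have Fc: "cobd ?F t \<gamma> = 0" if "t \<in> tuples 2" "\<gamma> \<in> X" for t \<gamma>
    using cocycle_cobd[OF f fd] that by (simp add: numeral_2_eq_2)
  have Gc: "cobd ?G t \<gamma> = 0" if "t \<in> tuples 2" "\<gamma> \<in> X" for t \<gamma>
    using cocycle_cobd[OF g gd] that by (simp add: numeral_2_eq_2)
  have Gc1: "cobd ?G t \<gamma> = 0" if "t \<in> tuples (Suc 1)" "\<gamma> \<in> X" for t \<gamma>
    by (rule cocycle_cobd[OF g gd that])
  let ?D = "diagonal ?F"
  have F0: "cochain 1 ?D" using F by (auto simp: cochain_def diagonal_def)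
  have F0d: "?D = (\<lambda>t \<gamma>. if t = [\<gamma>] then weight ?F \<gamma> else 0)" by (auto simp: diagonal_def weight_def fun_eq_iff)
  have F0c: "cobd ?D t \<gamma> = 0" if t: "t \<in> tuples 2" "\<gamma> \<in> X" for t \<gamma>
  proof -
    obtain x y where xy: "t = [x, y]" "x \<in> X" "y \<in> X" "parcs x \<noteq> []" "parcs y \<noteq> []" "ptgt x = psrc y"
      using pairs[OF t(1)] by (elim exE conjE) (rule that)
    have "weight ?F (pmul x y) = weight ?F x + weight ?F y" if "pmul x y \<in> X"
      by (rule weight_add[OF F Fc xy(2,4,3,5,6) that])
    then show ?thesis unfolding F0d xy(1) cobd_diagonal[OF xy(2,3) t(2) xy(6)]
      using t(2) by (cases "\<gamma> = pmul x y") simp_all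
  qed
  obtain k where k: "cochain 1 k" "\<forall>t\<in>tuples (Suc 1). \<forall>\<gamma>\<in>X. conv (?D [hd t]) (?G (tl t)) \<gamma>
    = cobd k t \<gamma> + (-1) ^ 1 * conv (?G (butlast t)) (?D [last t]) \<gamma>"
    using cup_derivation_commutes[OF F0 F0c G zero_less_one Gc1] by blast
  \<comment> \<open>After the exchange the left factor is the diagonal part of \<open>g\<close>,
    hence \<alpha> comes from \<open>g\<close> and \<beta> from \<open>f\<close>.\<close>
  define \<alpha> \<beta> where "\<alpha> = (\<lambda>a. weight ?G (tail Q a, [a], head Q a))" and "\<beta> = (\<lambda>a. weight ?F (tail Q a, [a], head Q a))"
  \<comment> \<open>Set to 0 outside the nontrivial paths of \<open>X\<close>, so that \<eta> is a
    cochain.\<close>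
  define w where "w = (\<lambda>\<gamma>. if \<gamma> \<in> X \<and> parcs \<gamma> \<noteq> [] then pair_sum \<alpha> \<beta> (parcs \<gamma>) else 0)"
  define \<eta> where "\<eta> = (\<lambda>t \<gamma>. if t = [\<gamma>] then w \<gamma> else 0)"
  have \<eta>: "cochain 1 \<eta>" by (auto simp: cochain_def \<eta>_def w_def tuples_Cons parallel_def split: if_splits)
  have k\<eta>: "cochain 1 (\<lambda>t \<gamma>. k t \<gamma> + \<eta> t \<gamma>)"
    using k(1) \<eta> unfolding cochain_def by (metis add.right_neutral)
  have c1: "cup_map 1 g 1 \<in> hm (bar (Suc 1)) (bar 1)" using cup_map_hm[OF _ g, of 1] by simp
  show ?thesis
  proof (rule bounding_cochain[OF _ hm_comp[OF c1 f] hm_zero_map[OF bimodule_regular] _ k\<eta>])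
    fix t \<gamma> assume t: "t \<in> tuples (Suc 1)" and \<gamma>: "\<gamma> \<in> X"
    have t2: "t \<in> tuples 2" using t by (simp add: numeral_2_eq_2)
    obtain x y where xy: "t = [x, y]" "x \<in> X" "y \<in> X" "parcs x \<noteq> []" "parcs y \<noteq> []" "ptgt x = psrc y"
      using pairs[OF t2] by (elim exE conjE) (rule that)
    have x1: "[x] \<in> tuples 1" using xy by (simp add: tuples_Cons)
    have "coef (f (cup_map 1 g 1 (gen (Suc 1) t))) \<gamma> = conv (?F [x]) (?G [y]) \<gamma>"
      using cup_value[OF g _ f, of t \<gamma>] t xy by simp
    also have "\<dots> = conv (?D [x]) (?G [y]) \<gamma>" by (rule conv_diagonal_left[OF F Fc G x1])
    also have "\<dots> = cobd k t \<gamma> - conv (?G [x]) (?D [y]) \<gamma>" 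
      using k(2)[rule_format, OF t \<gamma>] xy(1) by simp
    also have "conv (?G [x]) (?D [y]) \<gamma> = conv (diagonal ?G [x]) (?D [y]) \<gamma>"
      by (rule conv_diagonal_left[OF G Gc F0 x1])
    also have "\<dots> = weight ?G x * weight ?F y * conv (unit_at x) (unit_at y) \<gamma>"
      unfolding diagonal_unit conv_scale by simp
    also have "\<dots> = - cobd \<eta> t \<gamma>"
    proof -
      have "weight ?G x * weight ?F y = (\<Sum>a\<leftarrow>parcs x. \<alpha> a) * (\<Sum>b\<leftarrow>parcs y. \<beta> b)"
        using weight_sum[OF G Gc xy(2,4)] weight_sum[OF F Fc xy(3,5)] by (simp add: \<alpha>_def \<beta>_def)
      moreover have "cobd \<eta> t \<gamma> = (if \<gamma> = pmul x y then w y - w \<gamma> + w x else 0)"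
        unfolding \<eta>_def xy(1) by (rule cobd_diagonal[OF xy(2,3) \<gamma> xy(6)])
      ultimately show ?thesis
        unfolding conv_unit_unit[OF xy(2,3)] using xy \<gamma> by (auto simp: unit_at_def w_def pair_sum_append)
    qed
    finally show "coef (f (cup_map 1 g 1 (gen (Suc 1) t))) \<gamma>
      = cobd (\<lambda>t \<gamma>. k t \<gamma> + \<eta> t \<gamma>) t \<gamma> + 0 * coef \<zero>\<^bsub>reg\<^esub> \<gamma>"
      unfolding cobd_add by simp
  qed (use bounding_zero in simp_all)
qed

theorem cup_bounding:
  assumes n: "n > 0" and m: "m > 0"
    and f: "f \<in> hm (bar n) reg" and fd: "\<And>c. c \<in> carrier (bar (Suc n)) \<Longrightarrow> f (dB n c) = \<zero>\<^bsub>A\<^esub>"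
    and g: "g \<in> hm (bar m) reg" and gd: "\<And>c. c \<in> carrier (bar (Suc m)) \<Longrightarrow> g (dB m c) = \<zero>\<^bsub>A\<^esub>"
  shows "bounding (m + n - 1) (\<lambda>c. f (cup_map m g n c))"
proof -
  obtain p where p: "n = Suc p" using n by (cases n) auto
  obtain q where q: "m = Suc q" using m by (cases m) auto
  consider "p > 0" | "p = 0" "q > 0" | "p = 0" "q = 0" by blast
  then show ?thesis
  proof cases
    case 1
    then show ?thesis using cup_bounding_ge2[OF 1 m f[unfolded p] fd[unfolded p] g gd] p by simp
  next
    case 2
    then have "n = 1" using p by simp
    then show ?thesis
      using cup_bounding_one_ge2[OF 2(2) f[unfolded \<open>n = 1\<close>] fd[unfolded \<open>n = 1\<close>] g[unfolded q] gd[unfolded q]] q by simp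
  next
    case 3
    then have nm: "n = 1" "m = 1" using p q by simp_all
    then show ?thesis using cup_bounding_one_one[OF f[unfolded nm] fd[unfolded nm] g[unfolded nm] gd[unfolded nm]] by simp
  qed
qed

end

section \<open>Arbitrary projective resolutions\<close>

context coord_algebra
begin

lemma hm_add:
  assumes "f \<in> hm M N" "g \<in> hm M N" "bimodule A N"
  shows "(\<lambda>x. f x \<oplus>\<^bsub>N\<^esub> g x) \<in> hm M N"
proof -
  interpret N: bimodule A N by fact
  show ?thesis
    unfolding hm_def
    by (simp add: hmD[OF assms(1)] hmD[OF assms(2)] N.l_distr_mod N.r_distr_mod N.a_ac)
qed

lemma hm_id: "(\<lambda>x. x) \<in> hm M M"
  by (simp add: hm_def)

lemma sub_add_cancel:
  assumes M: "bimodule A M" and "x \<in> carrier M" "y \<in> carrier M"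
  shows "x = (x \<oplus>\<^bsub>M\<^esub> sm M (-1) y) \<oplus>\<^bsub>M\<^esub> y"
proof -
  interpret M: bimodule A M by fact
  show ?thesis unfolding sm_minus[OF M assms(3)] using assms(2,3) by (simp add: M.a_assoc M.l_neg)
qed

lemma aug_cup_map:
  assumes m: "m > 0" and g: "g \<in> hm (bar m) (regular_bimodule A)" and c: "c \<in> carrier (bar m)"
  shows "aug (cup_map m g 0 c) = g c"
proof -
  have h: "cup_map m g 0 \<in> hm (bar m) (bar 0)" using cup_map_hm[OF m g, of 0] by simp
  show ?thesis
  proof (rule hm_bar_eqI[OF bimodule_regular hm_comp[OF h aug_hm] g _ c])
    fix t assume t: "t \<in> tuples m"
    have "aug (cup_map m g 0 (gen m t)) = aug (gen 0 []) \<otimes>\<^bsub>A\<^esub> g (gen m t)"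
      using cup_map_gen[OF m g, of t 0] t hmD(4)[OF aug_hm g_gen[OF m g] gen_carrier]
      by (simp add: cup_gen_def del: bar_simps)
    then show "aug (cup_map m g 0 (gen m t)) = g (gen m t)"
      using aug_gen bimodule.l_unit[OF bimodule_regular, of "g (gen m t)"] g_gen[OF m g] by simp
  qed
qed

end

context string_algebra
begin

section \<open>Transfer from the bar resolution to the given one\<close>

context
  fixes P :: "nat \<Rightarrow> ('a, 'p) bimod" and d :: "nat \<Rightarrow> 'p \<Rightarrow> 'p" and \<epsilon> :: "'p \<Rightarrow> 'a"
  assumes inf: "infinite (UNIV :: 'k set)" and res: "projective_resolution A reg P d \<epsilon>"
begin

lemma res_proj: "projective_bimodule A (P i)"
  using res by (simp add: projective_resolution_def)

lemma res_bimodule: "bimodule A (P i)"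
  using res_proj by (simp add: projective_bimodule_def)

lemma res_hm: "d i \<in> hm (P (Suc i)) (P i)" "\<epsilon> \<in> hm (P 0) reg"
  using res by (auto simp: projective_resolution_def intro: bimodule_hom_hm)

lemma res_exact:
  "x \<in> carrier (P 0) \<Longrightarrow> \<epsilon> x = \<zero>\<^bsub>reg\<^esub> \<Longrightarrow> x \<in> d 0 ` carrier (P (Suc 0))"
  "x \<in> carrier (P (Suc i)) \<Longrightarrow> d i x = \<zero>\<^bsub>P i\<^esub> \<Longrightarrow> x \<in> d (Suc i) ` carrier (P (Suc (Suc i)))"
  "x \<in> carrier (P (Suc 0)) \<Longrightarrow> \<epsilon> (d 0 x) = \<zero>\<^bsub>reg\<^esub>"
  "x \<in> carrier (P (Suc (Suc i))) \<Longrightarrow> d i (d (Suc i) x) = \<zero>\<^bsub>P i\<^esub>"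
  "\<epsilon> ` carrier (P 0) = carrier A"
proof -
  note r = res[unfolded projective_resolution_def]
  have e0: "d 0 ` carrier (P (Suc 0)) = {x \<in> carrier (P 0). \<epsilon> x = \<zero>\<^bsub>reg\<^esub>}" using r by simp
  have e: "d (Suc i) ` carrier (P (Suc (Suc i))) = {x \<in> carrier (P (Suc i)). d i x = \<zero>\<^bsub>P i\<^esub>}" for i using r by simp
  show "x \<in> carrier (P 0) \<Longrightarrow> \<epsilon> x = \<zero>\<^bsub>reg\<^esub> \<Longrightarrow> x \<in> d 0 ` carrier (P (Suc 0))"
    "x \<in> carrier (P (Suc i)) \<Longrightarrow> d i x = \<zero>\<^bsub>P i\<^esub> \<Longrightarrow> x \<in> d (Suc i) ` carrier (P (Suc (Suc i)))"
    unfolding e0 e by simp_all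
  show "x \<in> carrier (P (Suc 0)) \<Longrightarrow> \<epsilon> (d 0 x) = \<zero>\<^bsub>reg\<^esub>"
    "x \<in> carrier (P (Suc (Suc i))) \<Longrightarrow> d i (d (Suc i) x) = \<zero>\<^bsub>P i\<^esub>"
    using e0 e by blast+
  show "\<epsilon> ` carrier (P 0) = carrier A" using r by simp
qed

lemma lifts_res: "bimodule A N \<Longrightarrow> g \<in> hm (P j) N \<Longrightarrow> lifts (P i) (P j) N g"
  by (rule projective_lifts[OF res_proj res_bimodule, where \<iota> = "\<lambda>x. x"]) auto

text \<open>If \<open>X\<close> is empty, the bar terms vanish. Otherwise chosen preimages under
  \<epsilon> of the multiples of one basis path embed the field into \<open>'p\<close>, and finitely
  many coordinates can be packed into one field element.\<close>

lemma bar_embeds: "\<exists>\<iota> :: _ \<Rightarrow> 'p. inj_on \<iota> (carrier (bar i))"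
proof (cases "X = {}")
  case True
  have nb: "z \<notin> bar_basis i" for z by (cases z) (use bar_basis_X True in blast)
  have "\<forall>c\<in>carrier (bar i). c = (\<lambda>_. 0)"
  proof (intro ballI ext)
    fix c z assume "c \<in> carrier (bar i)"
    then show "c z = 0" using nb[of z] unfolding bar_simps(1) by blast
  qed
  then show ?thesis unfolding inj_on_def by (intro exI ballI impI) metis
next
  case False
  then obtain x where x: "x \<in> X" by blast
  define \<kappa> :: "'k \<Rightarrow> 'p" where "\<kappa> = (\<lambda>k. inv_into (carrier (P 0)) \<epsilon> (k \<odot>\<^bsub>A\<^esub> bas x))"
  have e: "\<epsilon> (\<kappa> k) = k \<odot>\<^bsub>A\<^esub> bas x" for k
    unfolding \<kappa>_def by (rule f_inv_into_f) (simp add: res_exact(5) A_closed bas x)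
  have inj: "inj \<kappa>"
  proof (rule injI)
    fix k l assume "\<kappa> k = \<kappa> l"
    then have "coef (k \<odot>\<^bsub>A\<^esub> bas x) x = coef (l \<odot>\<^bsub>A\<^esub> bas x) x" using e by metis
    then show "k = l" by (simp add: coef_ops bas x unit_at_def)
  qed
  have e: "carrier (bar i) = {c. \<forall>z. c z \<noteq> 0 \<longrightarrow> z \<in> bar_basis i}" by (simp add: bar_def)
  show ?thesis unfolding e by (rule finite_functions_inj[OF finite_bar_basis inf inj])
qed

lemma lifts_res_bar:
  assumes "bimodule A N" "g \<in> hm (bar j) N" shows "lifts (P i) (bar j) N g"
proof -
  obtain \<iota> :: "_ \<Rightarrow> 'p" where "inj_on \<iota> (carrier (bar j))" using bar_embeds by blast
  from projective_lifts[OF res_proj bimodule_bar assms this] show ?thesis .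
qed

lemma bar_to_res: "\<exists>\<theta>. (\<forall>i. \<theta> i \<in> hm (bar i) (P i)) \<and> (\<forall>c\<in>carrier (bar 0). \<epsilon> (\<theta> 0 c) = aug c) \<and>
    (\<forall>i. \<forall>c\<in>carrier (bar (Suc i)). d i (\<theta> (Suc i) c) = \<theta> i (dB i c))"
proof (rule comparison_map[where C = bar and D = P and Y = reg])
  show "lifts (bar 0) (P 0) reg \<epsilon>" by (rule lifts_bar[OF res_bimodule bimodule_regular res_hm(2)])
  show "lifts (bar (Suc i)) (P (Suc i)) (P i) (d i)" for i by (rule lifts_bar[OF res_bimodule res_bimodule res_hm(1)])
  show "aug ` carrier (bar 0) \<subseteq> \<epsilon> ` carrier (P 0)"
  proof
    fix a assume "a \<in> aug ` carrier (bar 0)"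
    then show "a \<in> \<epsilon> ` carrier (P 0)" using hmD(1)[OF aug_hm] unfolding res_exact(5) by (auto simp del: bar_simps)
  qed
qed (use bimodule_bar res_bimodule bimodule_regular dB_hm res_hm dB_dB res_exact aug_hm aug_dB in \<open>simp_all del: bar_simps(1) regular_simps(1)\<close>)

lemma res_to_bar: "\<exists>\<psi>. (\<forall>i. \<psi> i \<in> hm (P i) (bar i)) \<and> (\<forall>x\<in>carrier (P 0). aug (\<psi> 0 x) = \<epsilon> x) \<and>
    (\<forall>i. \<forall>x\<in>carrier (P (Suc i)). dB i (\<psi> (Suc i) x) = \<psi> i (d i x))"
proof (rule comparison_map[where C = P and D = bar and Y = reg])
  show "lifts (P 0) (bar 0) reg aug" by (rule lifts_res_bar[OF bimodule_regular aug_hm])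
  show "lifts (P (Suc i)) (bar (Suc i)) (bar i) (dB i)" for i by (rule lifts_res_bar[OF bimodule_bar dB_hm])
  show "\<epsilon> ` carrier (P 0) \<subseteq> aug ` carrier (bar 0)" unfolding res_exact(5) using aug_surj by blast
  show "c \<in> carrier (bar 0) \<Longrightarrow> aug c = \<zero>\<^bsub>reg\<^esub> \<Longrightarrow> c \<in> dB 0 ` carrier (bar (Suc 0))" for c
    using bar_exact_aug[of c] by (simp del: bar_simps)
  show "c \<in> carrier (bar (Suc i)) \<Longrightarrow> dB i c = \<zero>\<^bsub>bar i\<^esub> \<Longrightarrow> c \<in> dB (Suc i) ` carrier (bar (Suc (Suc i)))" for c i
    by (rule bar_exact)
qed (use bimodule_bar res_bimodule bimodule_regular dB_hm res_hm res_exact(3,4) aug_hm in \<open>simp_all del: bar_simps\<close>)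

lemma chain_lift_exists:
  assumes g: "g \<in> hm (P m) reg" and gd: "\<And>x. x \<in> carrier (P (Suc m)) \<Longrightarrow> g (d m x) = \<zero>\<^bsub>A\<^esub>"
  shows "\<exists>\<phi>. (\<forall>i. \<phi> i \<in> hm (P (m + i)) (P i)) \<and> (\<forall>x\<in>carrier (P m). \<epsilon> (\<phi> 0 x) = g x) \<and>
    (\<forall>i. \<forall>x\<in>carrier (P (Suc (m + i))). d i (\<phi> (Suc i) x) = \<phi> i (d (m + i) x))"
proof -
  have "\<exists>\<phi>. (\<forall>i. \<phi> i \<in> hm (P (m + i)) (P i)) \<and> (\<forall>x\<in>carrier (P (m + 0)). \<epsilon> (\<phi> 0 x) = g x) \<and>
    (\<forall>i. \<forall>x\<in>carrier (P (m + Suc i)). d i (\<phi> (Suc i) x) = \<phi> i (d (m + i) x))"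
  proof (rule comparison_map[where C = "\<lambda>i. P (m + i)" and D = P and Y = reg and dC = "\<lambda>i. d (m + i)"])
    show "lifts (P (m + 0)) (P 0) reg \<epsilon>" by (rule lifts_res[OF bimodule_regular res_hm(2)])
    show "lifts (P (m + Suc i)) (P (Suc i)) (P i) (d i)" for i by (rule lifts_res[OF res_bimodule res_hm(1)])
    show "g ` carrier (P (m + 0)) \<subseteq> \<epsilon> ` carrier (P 0)" using hmD(1)[OF g] unfolding res_exact(5) by auto
  qed (use res_bimodule bimodule_regular res_hm res_exact g gd in simp_all)
  then show ?thesis by simp
qed

text \<open>On the given resolution the identity is homotopic to \<theta> \<psi>, and on the bar
  resolution \<phi> \<theta> is homotopic to \<theta> after the explicit lift of g \<theta>, both
  being lifts of that cocycle. Up to coboundaries, f \<phi> is thus the bar product of f \<theta>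
  and g \<theta>, composed with \<psi>.\<close>

lemma product_bounding:
  assumes n: "n > 0" and m: "m > 0"
    and f: "f \<in> hm (P n) reg" and fd: "\<And>x. x \<in> carrier (P (Suc n)) \<Longrightarrow> f (d n x) = \<zero>\<^bsub>A\<^esub>"
    and g: "g \<in> hm (P m) reg" and gd: "\<And>x. x \<in> carrier (P (Suc m)) \<Longrightarrow> g (d m x) = \<zero>\<^bsub>A\<^esub>"
    and \<phi>: "\<And>i. \<phi> i \<in> hm (P (m + i)) (P i)" and \<phi>0: "\<And>x. x \<in> carrier (P m) \<Longrightarrow> \<epsilon> (\<phi> 0 x) = g x"
    and \<phi>d: "\<And>i x. x \<in> carrier (P (Suc (m + i))) \<Longrightarrow> d i (\<phi> (Suc i) x) = \<phi> i (d (m + i) x)"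
  shows "\<exists>H\<in>hm (P (m + n - 1)) reg. \<forall>x\<in>carrier (P (m + n)). f (\<phi> n x) = H (d (m + n - 1) x)"
proof -
  interpret R: bimodule A reg by (rule bimodule_regular)
  obtain \<theta> where \<theta>: "\<And>i. \<theta> i \<in> hm (bar i) (P i)" "\<And>c. c \<in> carrier (bar 0) \<Longrightarrow> \<epsilon> (\<theta> 0 c) = aug c"
    "\<And>i c. c \<in> carrier (bar (Suc i)) \<Longrightarrow> d i (\<theta> (Suc i) c) = \<theta> i (dB i c)" using bar_to_res by metis
  obtain \<psi> where \<psi>: "\<And>i. \<psi> i \<in> hm (P i) (bar i)" "\<And>x. x \<in> carrier (P 0) \<Longrightarrow> aug (\<psi> 0 x) = \<epsilon> x"
    "\<And>i x. x \<in> carrier (P (Suc i)) \<Longrightarrow> dB i (\<psi> (Suc i) x) = \<psi> i (d i x)" using res_to_bar by metis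
  define \<tau> where "\<tau> = (\<lambda>i x. x \<oplus>\<^bsub>P i\<^esub> sm (P i) (-1) (\<theta> i (\<psi> i x)))"
  have \<theta>\<psi>: "(\<lambda>x. \<theta> i (\<psi> i x)) \<in> hm (P i) (P i)" for i by (rule hm_comp[OF \<psi>(1) \<theta>(1)])
  have \<tau>: "\<tau> i \<in> hm (P i) (P i)" for i
    unfolding \<tau>_def by (rule hm_add_scaled[OF hm_id \<theta>\<psi> res_bimodule])
  have "\<exists>s. (\<forall>i. s i \<in> hm (P i) (P (Suc i))) \<and>
    (\<forall>i. \<forall>x\<in>carrier (P (Suc i)). \<tau> (Suc i) x = d (Suc i) (s (Suc i) x) \<oplus>\<^bsub>P (Suc i)\<^esub> s i (d i x))"
  proof (rule null_homotopy[where C = P and D = P and Y = reg and e = \<epsilon>])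
    show "lifts (P i) (P (Suc i)) (P i) (d i)" for i by (rule lifts_res[OF res_bimodule res_hm(1)])
    show "\<epsilon> (\<tau> 0 x) = \<zero>\<^bsub>reg\<^esub>" if x: "x \<in> carrier (P 0)" for x
    proof -
      note y = hmD(1)[OF \<theta>\<psi>[of 0] x]
      have "\<epsilon> (\<tau> 0 x) = \<epsilon> x \<oplus>\<^bsub>reg\<^esub> sm reg (-1) (\<epsilon> (\<theta> 0 (\<psi> 0 x)))"
        unfolding \<tau>_def hmD(2)[OF res_hm(2) x sm_closed[OF res_bimodule y]] hmD(5)[OF res_hm(2) y] ..
      also have "\<epsilon> (\<theta> 0 (\<psi> 0 x)) = \<epsilon> x" using \<theta>(2)[OF hmD(1)[OF \<psi>(1) x]] \<psi>(2)[OF x] by simp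
      finally show ?thesis
        unfolding sm_minus[OF bimodule_regular hmD(1)[OF res_hm(2) x]] R.r_neg[OF hmD(1)[OF res_hm(2) x]] .
    qed
    show "d i (\<tau> (Suc i) x) = \<tau> i (d i x)" if x: "x \<in> carrier (P (Suc i))" for i x
    proof -
      note y = hmD(1)[OF \<theta>\<psi> x]
      have "d i (\<tau> (Suc i) x) = d i x \<oplus>\<^bsub>P i\<^esub> sm (P i) (-1) (d i (\<theta> (Suc i) (\<psi> (Suc i) x)))"
        unfolding \<tau>_def hmD(2)[OF res_hm(1) x sm_closed[OF res_bimodule y]] hmD(5)[OF res_hm(1) y] ..
      then show ?thesis using \<theta>(3)[OF hmD(1)[OF \<psi>(1) x]] \<psi>(3)[OF x] by (simp add: \<tau>_def)
    qed
  qed (use res_bimodule bimodule_regular res_hm res_exact \<tau> in simp_all)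
  then obtain s where s: "\<And>i. s i \<in> hm (P i) (P (Suc i))"
    "\<And>i x. x \<in> carrier (P (Suc i)) \<Longrightarrow> \<tau> (Suc i) x = d (Suc i) (s (Suc i) x) \<oplus>\<^bsub>P (Suc i)\<^esub> s i (d i x)" by metis
  define g' where "g' = (\<lambda>c. g (\<theta> m c))"
  have g': "g' \<in> hm (bar m) reg" unfolding g'_def by (rule hm_comp[OF \<theta>(1) g])
  have gd': "g' (dB m c) = \<zero>\<^bsub>A\<^esub>" if "c \<in> carrier (bar (Suc m))" for c
    using \<theta>(3)[OF that] gd[OF hmD(1)[OF \<theta>(1) that]] by (simp add: g'_def)
  define f' where "f' = (\<lambda>c. f (\<theta> n c))"
  have f': "f' \<in> hm (bar n) reg" unfolding f'_def by (rule hm_comp[OF \<theta>(1) f])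
  have fd': "f' (dB n c) = \<zero>\<^bsub>A\<^esub>" if "c \<in> carrier (bar (Suc n))" for c
    using \<theta>(3)[OF that] fd[OF hmD(1)[OF \<theta>(1) that]] by (simp add: f'_def)
  define \<rho> where "\<rho> = (\<lambda>i c. \<phi> i (\<theta> (m + i) c) \<oplus>\<^bsub>P i\<^esub> sm (P i) (-1) (\<theta> i (cup_map m g' i c)))"
  note cm = cup_map_hm[OF m g']
  have \<phi>\<theta>: "(\<lambda>c. \<phi> i (\<theta> (m + i) c)) \<in> hm (bar (m + i)) (P i)" for i by (rule hm_comp[OF \<theta>(1) \<phi>])
  have \<theta>c: "(\<lambda>c. \<theta> i (cup_map m g' i c)) \<in> hm (bar (m + i)) (P i)" for i by (rule hm_comp[OF cm \<theta>(1)])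
  have \<rho>: "\<rho> i \<in> hm (bar (m + i)) (P i)" for i
    unfolding \<rho>_def by (rule hm_add_scaled[OF \<phi>\<theta> \<theta>c res_bimodule])
  have "\<exists>s. (\<forall>i. s i \<in> hm (bar (m + i)) (P (Suc i))) \<and>
    (\<forall>i. \<forall>c\<in>carrier (bar (m + Suc i)). \<rho> (Suc i) c = d (Suc i) (s (Suc i) c) \<oplus>\<^bsub>P (Suc i)\<^esub> s i (dB (m + i) c))"
  proof (rule null_homotopy[where C = "\<lambda>i. bar (m + i)" and D = P and Y = reg and e = \<epsilon>])
    show "lifts (bar (m + i)) (P (Suc i)) (P i) (d i)" for i by (rule lifts_bar[OF res_bimodule res_bimodule res_hm(1)])
    show "\<epsilon> (\<rho> 0 c) = \<zero>\<^bsub>reg\<^esub>" if "c \<in> carrier (bar (m + 0))" for c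
    proof -
      have c: "c \<in> carrier (bar m)" using that by (simp del: bar_simps)
      note y = hmD(1)[OF \<phi>\<theta> that] hmD(1)[OF \<theta>c that]
      have "\<epsilon> (\<rho> 0 c) = \<epsilon> (\<phi> 0 (\<theta> (m + 0) c)) \<oplus>\<^bsub>reg\<^esub> sm reg (-1) (\<epsilon> (\<theta> 0 (cup_map m g' 0 c)))"
        unfolding \<rho>_def hmD(2)[OF res_hm(2) y(1) sm_closed[OF res_bimodule y(2)]] hmD(5)[OF res_hm(2) y(2)] ..
      also have "\<epsilon> (\<phi> 0 (\<theta> (m + 0) c)) = g' c" using \<phi>0[OF hmD(1)[OF \<theta>(1) c]] by (simp add: g'_def)
      also have "\<epsilon> (\<theta> 0 (cup_map m g' 0 c)) = g' c"
        using \<theta>(2)[OF hmD(1)[OF cm that]] aug_cup_map[OF m g' c] by simp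
      finally show ?thesis
        unfolding sm_minus[OF bimodule_regular hmD(1)[OF g' c]] R.r_neg[OF hmD(1)[OF g' c]] .
    qed
    show "d i (\<rho> (Suc i) c) = \<rho> i (dB (m + i) c)" if c: "c \<in> carrier (bar (m + Suc i))" for i c
    proof -
      have c': "c \<in> carrier (bar (Suc (m + i)))" using c by (simp del: bar_simps)
      note y = hmD(1)[OF \<phi>\<theta> c] hmD(1)[OF \<theta>c c]
      have "d i (\<rho> (Suc i) c) = d i (\<phi> (Suc i) (\<theta> (m + Suc i) c)) \<oplus>\<^bsub>P i\<^esub> sm (P i) (-1) (d i (\<theta> (Suc i) (cup_map m g' (Suc i) c)))"
        unfolding \<rho>_def hmD(2)[OF res_hm(1) y(1) sm_closed[OF res_bimodule y(2)]] hmD(5)[OF res_hm(1) y(2)] ..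
      also have "d i (\<phi> (Suc i) (\<theta> (m + Suc i) c)) = \<phi> i (\<theta> (m + i) (dB (m + i) c))"
        using \<phi>d[OF hmD(1)[OF \<theta>(1) c']] \<theta>(3)[OF c'] by simp
      also have "d i (\<theta> (Suc i) (cup_map m g' (Suc i) c)) = \<theta> i (cup_map m g' i (dB (m + i) c))"
        using \<theta>(3)[OF hmD(1)[OF cm c]] cup_map_chain[OF m g' gd' c'] by simp
      finally show ?thesis by (simp add: \<rho>_def)
    qed
  qed (use res_bimodule bimodule_bar bimodule_regular res_hm res_exact \<rho> dB_hm dB_dB in \<open>simp_all del: bar_simps(1,3-5)\<close>)
  then obtain s' where s': "\<And>i. s' i \<in> hm (bar (m + i)) (P (Suc i))"
    "\<And>i c. c \<in> carrier (bar (m + Suc i)) \<Longrightarrow> \<rho> (Suc i) c = d (Suc i) (s' (Suc i) c) \<oplus>\<^bsub>P (Suc i)\<^esub> s' i (dB (m + i) c)" by metis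
  obtain n' where n': "n = Suc n'" using n by (cases n) auto
  define N where "N = m + n'"
  have N: "m + n - 1 = N" "m + n = Suc N" by (simp_all add: N_def n')
  obtain K where K: "K \<in> hm (bar N) reg" "\<And>c. c \<in> carrier (bar (Suc N)) \<Longrightarrow> f' (cup_map m g' n c) = K (dB N c)"
    using cup_bounding[OF n m f' fd' g' gd'] unfolding bounding_def N(1) by blast
  have F: "(\<lambda>x. f (\<phi> n x)) \<in> hm (P (Suc N)) reg" using hm_comp[OF \<phi>[of n] f] N by simp
  have fs': "(\<lambda>c. f (s' n' c)) \<in> hm (bar N) reg" using hm_comp[OF s'(1)[of n'] f[unfolded n']] by (simp add: N_def)
  \<comment> \<open>One summand for the homotopy \<open>s\<close>, one for the homotopy
    \<open>s'\<close>, and one for the bounding map \<open>K\<close> on the bar resolution.\<close>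
  define H where "H = (\<lambda>y. f (\<phi> n (s N y)) \<oplus>\<^bsub>reg\<^esub> (f (s' n' (\<psi> N y)) \<oplus>\<^bsub>reg\<^esub> K (\<psi> N y)))"
  have H: "H \<in> hm (P N) reg"
    unfolding H_def
    by (rule hm_add[OF hm_comp[OF s(1) F] hm_add[OF hm_comp[OF \<psi>(1) fs'] hm_comp[OF \<psi>(1) K(1)] bimodule_regular] bimodule_regular])
  have fin: "f (\<phi> n x) = H (d N x)" if x: "x \<in> carrier (P (Suc N))" for x
  proof -
    let ?c = "\<psi> (Suc N) x"
    have c: "?c \<in> carrier (bar (Suc N))" by (rule hmD(1)[OF \<psi>(1) x])
    have c': "?c \<in> carrier (bar (m + Suc n'))" using c by (simp add: N_def del: bar_simps)
    have dc: "dB N ?c = \<psi> N (d N x)" by (rule \<psi>(3)[OF x])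
    note y = hmD(1)[OF \<theta>(1) c]
    note sx = hmD(1)[OF s(1) x] hmD(1)[OF s(1) hmD(1)[OF res_hm(1) x]]
    note dsx = hmD(1)[OF res_hm(1) sx(1)]
    interpret PN: bimodule A "P (Suc N)" by (rule res_bimodule)
    interpret Pn: bimodule A "P (Suc n')" by (rule res_bimodule)
    have "x = (d (Suc N) (s (Suc N) x) \<oplus>\<^bsub>P (Suc N)\<^esub> s N (d N x)) \<oplus>\<^bsub>P (Suc N)\<^esub> \<theta> (Suc N) ?c"
      using sub_add_cancel[OF res_bimodule x y] s(2)[OF x] by (simp add: \<tau>_def)
    then have "f (\<phi> n x) = f (\<phi> n ((d (Suc N) (s (Suc N) x) \<oplus>\<^bsub>P (Suc N)\<^esub> s N (d N x)) \<oplus>\<^bsub>P (Suc N)\<^esub> \<theta> (Suc N) ?c))"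
      by simp
    also have "\<dots> = (f (\<phi> n (d (Suc N) (s (Suc N) x))) \<oplus>\<^bsub>reg\<^esub> f (\<phi> n (s N (d N x)))) \<oplus>\<^bsub>reg\<^esub> f (\<phi> n (\<theta> (Suc N) ?c))"
      unfolding hmD(2)[OF F PN.a_closed[OF dsx sx(2)] y] hmD(2)[OF F dsx sx(2)] ..
    \<comment> \<open>Here \<phi> moves past the differential and the cocycle \<open>f\<close> kills
      the result.\<close>
    also have "f (\<phi> n (d (Suc N) (s (Suc N) x))) = \<zero>\<^bsub>reg\<^esub>"
    proof -
      have z: "s (Suc N) x \<in> carrier (P (Suc (m + n)))" using sx(1) N by simp
      have "\<phi> (Suc n) (s (Suc N) x) \<in> carrier (P (Suc n))" using hmD(1)[OF \<phi>[of "Suc n"]] z by simp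
      from fd[OF this] show ?thesis unfolding \<phi>d[OF z] N(2) by simp
    qed
    also have "f (\<phi> n (\<theta> (Suc N) ?c)) = f (s' n' (dB N ?c)) \<oplus>\<^bsub>reg\<^esub> K (dB N ?c)"
    proof -
      note a = hmD(1)[OF \<phi>\<theta> c'] hmD(1)[OF \<theta>c c'] hmD(1)[OF s'(1) c']
      have b: "s' n' (dB (m + n') ?c) \<in> carrier (P (Suc n'))"
        using hmD(1)[OF s'(1) hmD(1)[OF dB_hm c[unfolded N_def]]] by (simp add: N_def)
      note da = hmD(1)[OF res_hm(1) a(3)]
      have "\<phi> (Suc n') (\<theta> (m + Suc n') ?c) = (d (Suc n') (s' (Suc n') ?c) \<oplus>\<^bsub>P (Suc n')\<^esub> s' n' (dB (m + n') ?c))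
          \<oplus>\<^bsub>P (Suc n')\<^esub> \<theta> (Suc n') (cup_map m g' (Suc n') ?c)"
        using sub_add_cancel[OF res_bimodule a(1,2)] s'(2)[OF c'] by (simp add: \<rho>_def)
      then have "f (\<phi> n (\<theta> (Suc N) ?c)) = (f (d n (s' n ?c)) \<oplus>\<^bsub>reg\<^esub> f (s' n' (dB N ?c))) \<oplus>\<^bsub>reg\<^esub> f' (cup_map m g' n ?c)"
        using hmD(2)[OF f[unfolded n'] Pn.a_closed[OF da b] a(2)] hmD(2)[OF f[unfolded n'] da b]
        by (simp add: n' N_def f'_def)
      moreover have "f (d n (s' n ?c)) = \<zero>\<^bsub>reg\<^esub>" using fd a(3) by (simp add: n')
      moreover have "f (s' n' (dB N ?c)) \<in> carrier reg" using hmD(1)[OF f[unfolded n'] b] by (simp add: N_def)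
      ultimately show ?thesis using K(2)[OF c] by (simp only: R.l_zero)
    qed
    finally have "f (\<phi> n x) = (\<zero>\<^bsub>reg\<^esub> \<oplus>\<^bsub>reg\<^esub> f (\<phi> n (s N (d N x)))) \<oplus>\<^bsub>reg\<^esub> (f (s' n' (dB N ?c)) \<oplus>\<^bsub>reg\<^esub> K (dB N ?c))" .
    then show ?thesis unfolding H_def dc using hmD(1)[OF F sx(2)] by (simp only: R.l_zero)
  qed
  show ?thesis unfolding N(1) unfolding N(2) by (intro bexI[OF _ H] ballI fin)
qed

section \<open>Cosets of cocycles and the cup product\<close>

lemma cocycle_iff:
  "f \<in> cocycles A P d reg n \<longleftrightarrow>
    f \<in> bimodule_hom A (P n) reg \<and> (\<forall>x\<in>carrier (P (Suc n)). f (d n x) = \<zero>\<^bsub>reg\<^esub>)"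
  by (auto simp: cocycles_def hom_group_def compose_def fun_eq_iff restrict_def)

lemma coboundaries_Suc:
  "c \<in> coboundaries A P d reg (Suc N) \<longleftrightarrow>
    (\<exists>H\<in>hm (P N) reg. c = (\<lambda>x\<in>carrier (P (Suc N)). H (d N x)))"
proof
  assume "c \<in> coboundaries A P d reg (Suc N)"
  then show "\<exists>H\<in>hm (P N) reg. c = (\<lambda>x\<in>carrier (P (Suc N)). H (d N x))"
    by (auto simp: compose_def intro: bimodule_hom_hm)
next
  assume "\<exists>H\<in>hm (P N) reg. c = (\<lambda>x\<in>carrier (P (Suc N)). H (d N x))"
  then obtain H where H: "H \<in> hm (P N) reg" "c = (\<lambda>x\<in>carrier (P (Suc N)). H (d N x))" by blast
  have "c = compose (carrier (P (Suc N))) (restrict H (carrier (P N))) (d N)"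
    using hmD(1)[OF res_hm(1)] by (auto simp: H(2) compose_def)
  then show "c \<in> coboundaries A P d reg (Suc N)"
    using hm_restrict[OF res_bimodule H(1)] by auto
qed

lemma coset_of_coboundary:
  assumes "c \<in> coboundaries A P d reg (Suc N)"
  shows "coboundaries A P d reg (Suc N) #>\<^bsub>hom_group A (P (Suc N)) reg\<^esub> c = coboundaries A P d reg (Suc N)"
    (is "?B #>\<^bsub>?G\<^esub> c = ?B")
proof -
  have mul: "b \<otimes>\<^bsub>?G\<^esub> c = (\<lambda>x\<in>carrier (P (Suc N)). b x \<oplus>\<^bsub>reg\<^esub> c x)" for b by (simp add: hom_group_def)
  obtain H where H: "H \<in> hm (P N) reg" "c = (\<lambda>x\<in>carrier (P (Suc N)). H (d N x))"
    using assms unfolding coboundaries_Suc by blast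
  note dc = hmD(1)[OF res_hm(1)]
  show ?thesis
  proof (intro equalityI subsetI)
    fix b assume "b \<in> ?B #>\<^bsub>?G\<^esub> c"
    then obtain b' where b': "b' \<in> ?B" "b = b' \<otimes>\<^bsub>?G\<^esub> c" by (auto simp: r_coset_def)
    obtain K where K: "K \<in> hm (P N) reg" "b' = (\<lambda>x\<in>carrier (P (Suc N)). K (d N x))"
      using b'(1) unfolding coboundaries_Suc by blast
    have "b = (\<lambda>x\<in>carrier (P (Suc N)). K (d N x) \<oplus>\<^bsub>reg\<^esub> H (d N x))"
      unfolding b'(2) mul unfolding K(2) H(2) by auto
    then show "b \<in> ?B" unfolding coboundaries_Suc
      by (intro bexI[OF _ hm_add[OF K(1) H(1) bimodule_regular]])
  next
    fix b assume "b \<in> ?B"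
    then obtain K where K: "K \<in> hm (P N) reg" "b = (\<lambda>x\<in>carrier (P (Suc N)). K (d N x))"
      unfolding coboundaries_Suc by blast
    let ?L = "\<lambda>x. K x \<oplus>\<^bsub>reg\<^esub> sm reg (-1) (H x)"
    let ?b = "\<lambda>x\<in>carrier (P (Suc N)). ?L (d N x)"
    have "?b \<in> ?B" unfolding coboundaries_Suc
      by (intro bexI[OF refl hm_add_scaled[OF K(1) H(1) bimodule_regular]])
    moreover have "b = ?b \<otimes>\<^bsub>?G\<^esub> c"
      unfolding mul unfolding K(2) H(2)
      using sub_add_cancel[OF bimodule_regular hmD(1)[OF K(1) dc] hmD(1)[OF H(1) dc]] by auto
    ultimately show "b \<in> ?B #>\<^bsub>?G\<^esub> c" unfolding r_coset_def by blast
  qed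
qed

text \<open>Every representative of a class is a cocycle, and there is one. The latter matters
  because \<open>cup\<close> is a union over representatives.\<close>

lemma HH_representatives:
  assumes n: "n > 0" and x: "x \<in> carrier (HH A P d n)"
  shows "x \<noteq> {}"
    and "f \<in> x \<Longrightarrow> f \<in> bimodule_hom A (P n) reg"
    and "f \<in> x \<Longrightarrow> y \<in> carrier (P (Suc n)) \<Longrightarrow> f (d n y) = \<zero>\<^bsub>reg\<^esub>"
proof -
  obtain N where N: "n = Suc N" using n by (cases n) auto
  let ?B = "coboundaries A P d reg (Suc N)"
  obtain a where a: "a \<in> cocycles A P d reg n" and xa: "x = (\<Union>h\<in>?B. {\<lambda>z\<in>carrier (P n). h z \<oplus>\<^bsub>reg\<^esub> a z})"
    using x by (auto simp: Ext_group_def FactGroup_def RCOSETS_def r_coset_def hom_group_def N simp del: coboundaries.simps)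
  note aa = a[unfolded cocycle_iff]
  note dc = hmD(1)[OF res_hm(1)]
  have rep: "\<exists>L\<in>hm (P n) reg. f = restrict L (carrier (P n)) \<and> (\<forall>y\<in>carrier (P (Suc n)). L (d n y) = \<zero>\<^bsub>reg\<^esub>)" if f: "f \<in> x"
  proof -
    obtain h where h: "h \<in> ?B" "f = (\<lambda>z\<in>carrier (P n). h z \<oplus>\<^bsub>reg\<^esub> a z)" using f xa by blast
    obtain K where K: "K \<in> hm (P N) reg" "h = (\<lambda>z\<in>carrier (P (Suc N)). K (d N z))"
      using h(1) unfolding coboundaries_Suc by blast
    have Kd: "(\<lambda>z. K (d N z)) \<in> hm (P n) reg" unfolding N by (rule hm_comp[OF res_hm(1) K(1)])
    show ?thesis
    proof (intro bexI[OF _ hm_add[OF Kd bimodule_hom_hm[OF conjunct1[OF aa]] bimodule_regular]] conjI ballI)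
      show "f = (\<lambda>z\<in>carrier (P n). K (d N z) \<oplus>\<^bsub>reg\<^esub> a z)" unfolding h(2) K(2) N by auto
      fix y assume y: "y \<in> carrier (P (Suc n))"
      interpret R: bimodule A reg by (rule bimodule_regular)
      have "d N (d n y) = \<zero>\<^bsub>P N\<^esub>" using res_exact(4) y unfolding N by blast
      moreover have "K \<zero>\<^bsub>P N\<^esub> = \<zero>\<^bsub>reg\<^esub>" by (rule hm_zero[OF K(1) res_bimodule bimodule_regular])
      moreover have "a (d n y) = \<zero>\<^bsub>reg\<^esub>" using aa y by blast
      ultimately show "K (d N (d n y)) \<oplus>\<^bsub>reg\<^esub> a (d n y) = \<zero>\<^bsub>reg\<^esub>" using R.l_zero[OF R.zero_closed] by simp
    qed
  qed
  show "f \<in> bimodule_hom A (P n) reg" if "f \<in> x"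
    using rep[OF that] hm_restrict[OF res_bimodule] by auto
  show "f (d n y) = \<zero>\<^bsub>reg\<^esub>" if "f \<in> x" "y \<in> carrier (P (Suc n))"
    using rep[OF that(1)] that(2) dc by auto
  have "?B \<noteq> {}" using hm_zero_map[OF bimodule_regular] coboundaries_Suc by blast
  then show "x \<noteq> {}" unfolding xa by blast
qed

lemma chain_lift_D:
  assumes "chain_lift A P d \<epsilon> m g \<phi>"
  shows "\<phi> i \<in> hm (P (m + i)) (P i)" "x \<in> carrier (P m) \<Longrightarrow> \<epsilon> (\<phi> 0 x) = g x"
    "x \<in> carrier (P (Suc (m + i))) \<Longrightarrow> d i (\<phi> (Suc i) x) = \<phi> i (d (m + i) x)"
proof -
  note l = assms[unfolded chain_lift_def]
  show "\<phi> i \<in> hm (P (m + i)) (P i)" using l by (auto intro: bimodule_hom_hm)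
  show "x \<in> carrier (P m) \<Longrightarrow> \<epsilon> (\<phi> 0 x) = g x"
    using fun_cong[OF conjunct1[OF conjunct2[OF l]], of x] by (simp add: compose_def)
  have "compose (carrier (P (m + Suc i))) (d i) (\<phi> (Suc i)) x = compose (carrier (P (m + Suc i))) (\<phi> i) (d (m + i)) x"
    using l by simp
  then show "x \<in> carrier (P (Suc (m + i))) \<Longrightarrow> d i (\<phi> (Suc i) x) = \<phi> i (d (m + i) x)"
    by (simp add: compose_def)
qed

text \<open>Without a lift the union in \<open>cup\<close> would be empty instead of a coset. The
  lifts are restricted to the carriers because \<open>chain_lift\<close> demands extensional
  maps.\<close>

lemma chain_lift_ex:
  assumes g: "g \<in> bimodule_hom A (P m) reg" and gd: "\<And>x. x \<in> carrier (P (Suc m)) \<Longrightarrow> g (d m x) = \<zero>\<^bsub>reg\<^esub>"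
  shows "\<exists>\<phi>. chain_lift A P d \<epsilon> m g \<phi>"
proof -
  have z: "\<zero>\<^bsub>reg\<^esub> = \<zero>\<^bsub>A\<^esub>" by (simp add: regular_bimodule_def)
  obtain \<phi> where \<phi>: "\<And>i. \<phi> i \<in> hm (P (m + i)) (P i)" "\<And>x. x \<in> carrier (P m) \<Longrightarrow> \<epsilon> (\<phi> 0 x) = g x"
    "\<And>i x. x \<in> carrier (P (Suc (m + i))) \<Longrightarrow> d i (\<phi> (Suc i) x) = \<phi> i (d (m + i) x)"
    using chain_lift_exists[OF bimodule_hom_hm[OF g] gd[unfolded z]] by metis
  note dc = hmD(1)[OF res_hm(1)]
  have "chain_lift A P d \<epsilon> m g (\<lambda>i. restrict (\<phi> i) (carrier (P (m + i))))"
    unfolding chain_lift_def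
  proof (intro conjI allI)
    show "restrict (\<phi> i) (carrier (P (m + i))) \<in> bimodule_hom A (P (m + i)) (P i)" for i
      by (rule hm_restrict[OF res_bimodule \<phi>(1)])
    show "compose (carrier (P m)) \<epsilon> (restrict (\<phi> 0) (carrier (P (m + 0)))) = g"
    proof
      fix x
      show "compose (carrier (P m)) \<epsilon> (restrict (\<phi> 0) (carrier (P (m + 0)))) x = g x"
        using \<phi>(2) g by (cases "x \<in> carrier (P m)") (auto simp: compose_def bimodule_hom_def PiE_def extensional_def)
    qed
    show "compose (carrier (P (m + Suc i))) (d i) (restrict (\<phi> (Suc i)) (carrier (P (m + Suc i))))
      = compose (carrier (P (m + Suc i))) (restrict (\<phi> i) (carrier (P (m + i)))) (d (m + i))" for i
      using \<phi>(3)[of _ i] dc[of _ "m + i"] by (auto simp: compose_def fun_eq_iff restrict_def)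
  qed
  then show ?thesis by blast
qed

text \<open>Each member of the union in \<open>cup\<close> is the coset of a coboundary, that is,
  the group of coboundaries itself, and there is at least one member.\<close>

theorem cup_eq_one:
  assumes n: "n > 0" and m: "m > 0" and x: "x \<in> carrier (HH A P d n)" and y: "y \<in> carrier (HH A P d m)"
  shows "cup A P d \<epsilon> n m x y = \<one>\<^bsub>HH A P d (n + m)\<^esub>"
proof -
  obtain N where N: "n + m = Suc N" using n by (cases n) auto
  then have N': "m + n - 1 = N" "m + n = Suc N" by simp_all
  let ?B = "coboundaries A P d reg (Suc N)"
  have z: "\<zero>\<^bsub>reg\<^esub> = \<zero>\<^bsub>A\<^esub>" by (simp add: regular_bimodule_def)
  note X = HH_representatives[OF n x] and Y = HH_representatives[OF m y]
  have coset: "?B #>\<^bsub>hom_group A (P (Suc N)) reg\<^esub> compose (carrier (P (Suc N))) f (\<phi> n) = ?B"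
    if f: "f \<in> x" and g: "g \<in> y" and \<phi>: "chain_lift A P d \<epsilon> m g \<phi>" for f g \<phi>
  proof (rule coset_of_coboundary)
    obtain H where H: "H \<in> hm (P N) reg" "\<And>x. x \<in> carrier (P (Suc N)) \<Longrightarrow> f (\<phi> n x) = H (d N x)"
      using product_bounding[OF n m bimodule_hom_hm[OF X(2)[OF f]] X(3)[OF f, unfolded z] bimodule_hom_hm[OF Y(2)[OF g]]
          Y(3)[OF g, unfolded z] chain_lift_D[OF \<phi>]] unfolding N'(1) unfolding N'(2) by blast
    then show "compose (carrier (P (Suc N))) f (\<phi> n) \<in> ?B"
      unfolding coboundaries_Suc by (intro bexI[OF _ H(1)]) (auto simp: compose_def)
  qed
  obtain f g where fg: "f \<in> x" "g \<in> y" using X(1) Y(1) by blast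
  obtain \<phi> where \<phi>: "chain_lift A P d \<epsilon> m g \<phi>" using chain_lift_ex[OF Y(2,3)[OF fg(2)]] by blast
  have "cup A P d \<epsilon> n m x y = ?B"
    unfolding cup_def N using coset fg \<phi> by (auto simp del: coboundaries.simps)
  then show ?thesis unfolding Ext_group_def FactGroup_def N by simp
qed

end

end

section \<open>Quotients of path algebras\<close>

text \<open>Over a finite field, 1 plus the product of all X - a is nonconstant and takes the value
  1 everywhere, so it has no root.\<close>

lemma infinite_alg_closed: "infinite (UNIV :: 'k::alg_closed_field set)"
proof
  assume fin: "finite (UNIV :: 'k set)"
  define p :: "'k poly" where "p = (\<Prod>a\<in>UNIV. [:- a, 1:])"
  have z: "poly p x = 0" for x
    unfolding p_def poly_prod by (rule prod_zero[OF fin]) (rule bexI[of _ x]; simp)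
  have "degree p = card (UNIV :: 'k set)"
    unfolding p_def by (subst degree_prod_eq_sum_degree) auto
  then have "degree p > 0" using fin by (simp add: card_gt_0_iff)
  then have "degree (p + 1) > 0" by (simp add: degree_add_eq_left)
  then obtain x where "poly (p + 1) x = 0" using alg_closed_imp_poly_has_root by blast
  then show False using z by simp
qed

locale quiver_quotient = fin_digraph Q for Q :: "('v,'e) pre_digraph" +
  fixes I :: "(('v,'e) qpath \<Rightarrow> 'k::field) set"
  assumes ideal_I: "ideal I (path_algebra Q)" and gen_I: "generated_by_paths Q I" and tri: "triangular Q"
begin

abbreviation "R \<equiv> path_algebra Q :: ('k, ('v,'e) qpath \<Rightarrow> 'k) module"

sublocale I: ideal I "path_algebra Q" by (rule ideal_I)

lemma R_simps:
  "carrier R = {x. finite {c. x c \<noteq> 0} \<and> {c. x c \<noteq> 0} \<subseteq> qpaths Q}"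
  "x \<otimes>\<^bsub>R\<^esub> y = (\<lambda>c. \<Sum>(a, b) | a \<in> qpaths Q \<and> b \<in> qpaths Q \<and> composes a b c. x a * y b)"
  "\<one>\<^bsub>R\<^esub> = (\<lambda>c. if c \<in> {(v, [], v) | v. v \<in> verts Q} then 1 else 0)"
  "\<zero>\<^bsub>R\<^esub> = (\<lambda>c. 0)" "x \<oplus>\<^bsub>R\<^esub> y = (\<lambda>c. x c + y c)" "r \<odot>\<^bsub>R\<^esub> x = (\<lambda>c. r * x c)"
  by (simp_all add: path_algebra_def)

text \<open>A walk that repeats a vertex contains an oriented cycle, so all walks are vertex-simple,
  and a finite quiver has finitely many of those.\<close>

lemma finite_qpaths: "finite (qpaths Q)"
proof (rule finite_subset[OF _ apaths_finite_triple])
  show "qpaths Q \<subseteq> {(u, p, v). apath u p v}"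
  proof
    fix a assume "a \<in> qpaths Q"
    then obtain u p v where a: "a = (u, p, v)" "awalk u p v" by (cases a) (auto simp: qpaths_def)
    have "distinct (awalk_verts u p)"
    proof (rule ccontr)
      assume "\<not> distinct (awalk_verts u p)"
      then obtain r w where "awalk w r w" "0 < length r" using awalk_not_distinct_decomp[OF a(2)] by blast
      then show False using tri by (auto simp: triangular_def)
    qed
    then show "a \<in> {(u, p, v). apath u p v}" using a by (simp add: apath_def)
  qed
qed

lemma composes_pmul: "composes a b c \<longleftrightarrow> ptgt a = psrc b \<and> c = pmul a b"
  by (cases a; cases b) (auto simp: composes_def pmul_def)

lemma path_elem_carrier: "a \<in> qpaths Q \<Longrightarrow> (\<lambda>d. k * path_elem a d) \<in> carrier R"
  by (auto simp: R_simps path_elem_def intro: finite_subset[of _ "{a}"])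

lemma path_elem_carrier1: "a \<in> qpaths Q \<Longrightarrow> path_elem a \<in> carrier R"
  using path_elem_carrier[of a 1] by simp

lemma path_elem_mult:
  assumes "a \<in> qpaths Q" "b \<in> qpaths Q" "ptgt a = psrc b"
  shows "(\<lambda>d. k * path_elem a d) \<otimes>\<^bsub>R\<^esub> (\<lambda>d. l * path_elem b d) = (\<lambda>d. k * l * path_elem (pmul a b) d)"
proof
  fix c
  let ?S = "{(a', b'). a' \<in> qpaths Q \<and> b' \<in> qpaths Q \<and> composes a' b' c}"
  have "(\<Sum>(a', b')\<in>?S. k * path_elem a a' * (l * path_elem b b')) = k * l * path_elem (pmul a b) c"
  proof (cases "c = pmul a b")
    case True
    have "(\<Sum>(a', b')\<in>?S. k * path_elem a a' * (l * path_elem b b'))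
      = (\<Sum>z\<in>?S. if z = (a, b) then k * l else 0)"
      by (rule sum.cong[OF refl]) (auto simp: path_elem_def split: if_splits)
    moreover have "finite ?S"
      by (rule finite_subset[OF _ finite_cartesian_product[OF finite_qpaths finite_qpaths]]) auto
    moreover have "(a, b) \<in> ?S" using assms True by (simp add: composes_pmul)
    ultimately show ?thesis using True by (simp add: path_elem_def sum.delta)
  next
    case False
    then have "(\<Sum>(a', b')\<in>?S. k * path_elem a a' * (l * path_elem b b')) = 0"
      by (intro sum.neutral) (auto simp: path_elem_def composes_pmul)
    then show ?thesis using False by (simp add: path_elem_def)
  qed
  then show "((\<lambda>d. k * path_elem a d) \<otimes>\<^bsub>R\<^esub> (\<lambda>d. l * path_elem b d)) c = k * l * path_elem (pmul a b) c"
    by (simp add: R_simps)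
qed

lemma path_elem_mult1:
  "a \<in> qpaths Q \<Longrightarrow> b \<in> qpaths Q \<Longrightarrow> ptgt a = psrc b \<Longrightarrow> path_elem a \<otimes>\<^bsub>R\<^esub> path_elem b = path_elem (pmul a b)"
  using path_elem_mult[of a b 1 1] by simp

lemma pid_qpath: "a \<in> qpaths Q \<Longrightarrow> pid (psrc a) \<in> qpaths Q"
  by (cases a) (auto simp: qpaths_def awalk_Nil_iff)

text \<open>An ideal of the ring is closed under multiplication by ring elements; a scalar multiple
  is obtained by multiplying with a scaled vertex.\<close>

lemma scaled_in_I:
  assumes "a \<in> qpaths Q" "path_elem a \<in> I" shows "(\<lambda>d. k * path_elem a d) \<in> I"
proof -
  have "(\<lambda>d. k * path_elem (pid (psrc a)) d) \<otimes>\<^bsub>R\<^esub> path_elem a \<in> I"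
    by (rule I.I_l_closed[OF assms(2) path_elem_carrier[OF pid_qpath[OF assms(1)]]])
  moreover have "pmul (pid (psrc a)) a = a" by (simp add: pmul_def)
  ultimately show ?thesis using path_elem_mult[OF pid_qpath[OF assms(1)] assms(1), of k 1] by simp
qed

lemma supp_mult:
  assumes "(x \<otimes>\<^bsub>R\<^esub> y) c \<noteq> 0"
  shows "\<exists>a\<in>qpaths Q. \<exists>b\<in>qpaths Q. ptgt a = psrc b \<and> c = pmul a b \<and> x a \<noteq> 0 \<and> y b \<noteq> 0"
proof -
  have "(\<Sum>(a, b) | a \<in> qpaths Q \<and> b \<in> qpaths Q \<and> composes a b c. x a * y b) \<noteq> 0"
    using assms by (simp add: R_simps)
  then obtain z where "z \<in> {(a, b). a \<in> qpaths Q \<and> b \<in> qpaths Q \<and> composes a b c}" "(case z of (a, b) \<Rightarrow> x a * y b) \<noteq> 0"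
    by (rule sum.not_neutral_contains_not_neutral)
  moreover obtain a b where "z = (a, b)" by (cases z)
  ultimately have "a \<in> qpaths Q" "b \<in> qpaths Q" "ptgt a = psrc b" "c = pmul a b" "x a \<noteq> 0" "y b \<noteq> 0"
    by (auto simp: composes_pmul)
  then show ?thesis by blast
qed

lemma a_inv_R: "x \<in> carrier R \<Longrightarrow> \<ominus>\<^bsub>R\<^esub> x = (\<lambda>c. - x c)"
  by (rule I.minus_equality) (auto simp: R_simps)

text \<open>The elements all of whose paths lie in \<open>I\<close> form an ideal, which contains the generating paths.\<close>

lemma mem_I: "x \<in> I \<longleftrightarrow> x \<in> carrier R \<and> (\<forall>p. x p \<noteq> 0 \<longrightarrow> path_elem p \<in> I)"
proof
  let ?J = "{x \<in> carrier R. \<forall>p. x p \<noteq> 0 \<longrightarrow> path_elem p \<in> I}"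
  obtain S where S: "S \<subseteq> qpaths Q" "I = Idl\<^bsub>R\<^esub> (path_elem ` S)" using gen_I by (auto simp: generated_by_paths_def)
  have "ideal ?J R"
  proof (rule idealI[OF I.ring_axioms])
    show "subgroup ?J (add_monoid R)"
    proof (rule group.subgroupI[OF I.a_group])
      show "?J \<noteq> {}" using I.zero_closed by (auto simp: R_simps)
      fix a assume a: "a \<in> ?J"
      have "inv\<^bsub>add_monoid R\<^esub> a = \<ominus>\<^bsub>R\<^esub> a" by (simp add: a_inv_def)
      moreover have "\<ominus>\<^bsub>R\<^esub> a \<in> carrier R" using a by simp
      ultimately show "inv\<^bsub>add_monoid R\<^esub> a \<in> ?J" using a by (auto simp: a_inv_R)
    next
      fix a b assume ab: "a \<in> ?J" "b \<in> ?J"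
      have "a \<oplus>\<^bsub>R\<^esub> b \<in> carrier R" using ab by simp
      moreover have "path_elem p \<in> I" if "(a \<oplus>\<^bsub>R\<^esub> b) p \<noteq> 0" for p
        using ab that by (cases "a p = 0") (auto simp: R_simps)
      ultimately show "a \<otimes>\<^bsub>add_monoid R\<^esub> b \<in> ?J" by simp
    qed auto
  next
    fix a x assume a: "a \<in> ?J" and x: "x \<in> carrier R"
    have "path_elem p \<in> I" if nz: "(x \<otimes>\<^bsub>R\<^esub> a) p \<noteq> 0" for p
    proof -
      obtain u v where uv: "u \<in> qpaths Q" "v \<in> qpaths Q" "ptgt u = psrc v" "p = pmul u v" "a v \<noteq> 0"
        using supp_mult[OF nz] by blast
      then have "path_elem u \<otimes>\<^bsub>R\<^esub> path_elem v \<in> I" using a I.I_l_closed path_elem_carrier1 by simp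
      then show ?thesis using path_elem_mult1 uv by simp
    qed
    then show "x \<otimes>\<^bsub>R\<^esub> a \<in> ?J" using a x by simp
    have "path_elem p \<in> I" if nz: "(a \<otimes>\<^bsub>R\<^esub> x) p \<noteq> 0" for p
    proof -
      obtain u v where uv: "u \<in> qpaths Q" "v \<in> qpaths Q" "ptgt u = psrc v" "p = pmul u v" "a u \<noteq> 0"
        using supp_mult[OF nz] by blast
      then have "path_elem u \<otimes>\<^bsub>R\<^esub> path_elem v \<in> I" using a I.I_r_closed path_elem_carrier1 by simp
      then show ?thesis using path_elem_mult1 uv by simp
    qed
    then show "a \<otimes>\<^bsub>R\<^esub> x \<in> ?J" using a x by simp
  qed
  moreover have "path_elem ` S \<subseteq> ?J"
  proof
    fix y :: "('v,'e) qpath \<Rightarrow> 'k" assume "y \<in> path_elem ` S"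
    then obtain s where s: "s \<in> S" "y = path_elem s" by blast
    have "path_elem ` S \<subseteq> carrier R" using S(1) path_elem_carrier1 by auto
    then have "path_elem s \<in> I" using I.genideal_self s S(2) by blast
    then show "y \<in> ?J" using s S(1) path_elem_carrier1 by (auto simp: path_elem_def split: if_splits)
  qed
  ultimately have "I \<subseteq> ?J" using I.genideal_minimal S(2) by simp
  then show "x \<in> I \<Longrightarrow> x \<in> carrier R \<and> (\<forall>p. x p \<noteq> 0 \<longrightarrow> path_elem p \<in> I)" by blast
next
  assume x: "x \<in> carrier R \<and> (\<forall>p. x p \<noteq> 0 \<longrightarrow> path_elem p \<in> I)"
  have "finite S \<Longrightarrow> S \<subseteq> qpaths Q \<Longrightarrow> (\<forall>p\<in>S. path_elem p \<in> I) \<Longrightarrow> (\<lambda>p. if p \<in> S then x p else 0) \<in> I" for S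
  proof (induction S rule: finite_induct)
    case empty
    then show ?case using additive_subgroup.zero_closed[OF I.additive_subgroup_axioms] by (simp add: R_simps)
  next
    case (insert q F)
    have "(\<lambda>d. x q * path_elem q d) \<oplus>\<^bsub>R\<^esub> (\<lambda>p. if p \<in> F then x p else 0) \<in> I"
      using insert scaled_in_I by (intro additive_subgroup.a_closed[OF I.additive_subgroup_axioms]) auto
    moreover have "(\<lambda>d. x q * path_elem q d) \<oplus>\<^bsub>R\<^esub> (\<lambda>p. if p \<in> F then x p else 0)
      = (\<lambda>p. if p \<in> insert q F then x p else 0)"
      using insert.hyps(2) by (auto simp: R_simps path_elem_def)
    ultimately show ?case by simp
  qed
  from this[of "{p. x p \<noteq> 0}"] have "(\<lambda>p. if p \<in> {p. x p \<noteq> 0} then x p else 0) \<in> I" using x by (simp add: R_simps)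
  moreover have "(\<lambda>p. if p \<in> {p. x p \<noteq> 0} then x p else 0) = x" by auto
  ultimately show "x \<in> I" by simp
qed

definition X :: "('v,'e) qpath set" where "X = {p \<in> qpaths Q. (path_elem p :: _ \<Rightarrow> 'k) \<notin> I}"

lemma path_basis_X: "path_basis Q X"
proof
  show "X \<subseteq> qpaths Q" by (auto simp: X_def)
  show "finite X" using finite_qpaths by (simp add: X_def)
  fix a b assume ab: "a \<in> qpaths Q" "b \<in> qpaths Q" "ptgt a = psrc b" "pmul a b \<in> X"
  have "(path_elem a :: _ \<Rightarrow> 'k) \<notin> I"
    using I.I_r_closed[OF _ path_elem_carrier1[OF ab(2)], of "path_elem a"] path_elem_mult1[OF ab(1-3)] ab(4) by (auto simp: X_def)
  moreover have "(path_elem b :: _ \<Rightarrow> 'k) \<notin> I"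
    using I.I_l_closed[OF _ path_elem_carrier1[OF ab(1)], of "path_elem b"] path_elem_mult1[OF ab(1-3)] ab(4) by (auto simp: X_def)
  ultimately show "a \<in> X \<and> b \<in> X" using ab by (simp add: X_def)
qed

sublocale path_basis Q X by (rule path_basis_X)

section \<open>Coordinates on the quotient algebra\<close>

abbreviation "A \<equiv> quiver_algebra Q I"

text \<open>The coordinates of a residue class are those of any representative at the nonzero paths.\<close>

definition coord :: "(('v,'e) qpath \<Rightarrow> 'k) set \<Rightarrow> ('v,'e) qpath \<Rightarrow> 'k" where
  "coord Y p = (if p \<in> X then (SOME x. x \<in> Y) p else 0)"

lemma coset_mem: "x \<in> carrier R \<Longrightarrow> y \<in> I +>\<^bsub>R\<^esub> x \<Longrightarrow> y \<in> carrier R \<and> (\<forall>p\<in>X. y p = x p)"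
proof -
  assume x: "x \<in> carrier R" and "y \<in> I +>\<^bsub>R\<^esub> x"
  then obtain i where i: "i \<in> I" "y = i \<oplus>\<^bsub>R\<^esub> x" by (auto simp: a_r_coset_def')
  have "i p = 0" if "p \<in> X" for p using i(1) that mem_I[of i] by (auto simp: X_def)
  moreover have "y \<in> carrier R" unfolding i(2) by (rule I.a_closed[OF I.Icarr[OF i(1)] x])
  ultimately show ?thesis unfolding i(2) by (simp add: R_simps(5))
qed

lemma coord_coset: "x \<in> carrier R \<Longrightarrow> coord (I +>\<^bsub>R\<^esub> x) p = (if p \<in> X then x p else 0)"
proof -
  assume x: "x \<in> carrier R"
  have "x \<in> I +>\<^bsub>R\<^esub> x" using I.a_rcos_self[OF x] .
  then have "(SOME y. y \<in> I +>\<^bsub>R\<^esub> x) \<in> I +>\<^bsub>R\<^esub> x" by (rule someI[of "\<lambda>y. y \<in> I +>\<^bsub>R\<^esub> x"])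
  from coset_mem[OF x this] show ?thesis by (simp add: coord_def)
qed

lemma coset_eq_iff:
  assumes "x \<in> carrier R" "y \<in> carrier R"
  shows "I +>\<^bsub>R\<^esub> x = I +>\<^bsub>R\<^esub> y \<longleftrightarrow> (\<forall>p\<in>X. x p = y p)"
proof -
  have d: "x \<ominus>\<^bsub>R\<^esub> y = (\<lambda>p. x p - y p)" using a_inv_R[OF assms(2)] by (simp add: a_minus_def R_simps)
  have "x \<ominus>\<^bsub>R\<^esub> y \<in> carrier R" using assms by simp
  then have "x \<ominus>\<^bsub>R\<^esub> y \<in> I \<longleftrightarrow> (\<forall>p. x p - y p \<noteq> 0 \<longrightarrow> path_elem p \<in> I)" using mem_I[of "x \<ominus>\<^bsub>R\<^esub> y"] d by simp
  also have "\<dots> \<longleftrightarrow> (\<forall>p\<in>X. x p = y p)"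
  proof -
    have "p \<in> qpaths Q" if "x p - y p \<noteq> 0" for p
    proof -
      have "x p \<noteq> 0 \<or> y p \<noteq> 0" using that by auto
      then show ?thesis using assms unfolding R_simps(1) by blast
    qed
    then have "x p - y p \<noteq> 0 \<Longrightarrow> path_elem p \<in> I \<longleftrightarrow> p \<notin> X" for p by (simp add: X_def)
    then show ?thesis by (metis eq_iff_diff_eq_0)
  qed
  finally show ?thesis using I.quotient_eq_iff_same_a_r_cos[OF ideal_I assms] by simp
qed

lemma A_simps:
  "carrier A = {I +>\<^bsub>R\<^esub> x | x. x \<in> carrier R}"
  "x \<in> carrier R \<Longrightarrow> y \<in> carrier R \<Longrightarrow> (I +>\<^bsub>R\<^esub> x) \<otimes>\<^bsub>A\<^esub> (I +>\<^bsub>R\<^esub> y) = I +>\<^bsub>R\<^esub> (x \<otimes>\<^bsub>R\<^esub> y)"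
  "x \<in> carrier R \<Longrightarrow> y \<in> carrier R \<Longrightarrow> (I +>\<^bsub>R\<^esub> x) \<oplus>\<^bsub>A\<^esub> (I +>\<^bsub>R\<^esub> y) = I +>\<^bsub>R\<^esub> (x \<oplus>\<^bsub>R\<^esub> y)"
  "\<one>\<^bsub>A\<^esub> = I +>\<^bsub>R\<^esub> \<one>\<^bsub>R\<^esub>"
  by (auto simp: quotient_algebra_def FactRing_def A_RCOSETS_def' I.rcoset_mult_add I.a_rcos_sum)

lemma A_zero: "\<zero>\<^bsub>A\<^esub> = I +>\<^bsub>R\<^esub> \<zero>\<^bsub>R\<^esub>"
  using I.a_rcos_zero[OF ideal_I additive_subgroup.zero_closed[OF I.additive_subgroup_axioms]] by (simp add: quotient_algebra_def FactRing_def)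

lemma R_smult_closed: "x \<in> carrier R \<Longrightarrow> k \<odot>\<^bsub>R\<^esub> x \<in> carrier R"
  by (auto simp: R_simps intro: finite_subset[of _ "{c. x c \<noteq> 0}"])

text \<open>Scaling respects agreement on \<open>X\<close>, so all cosets in the union that defines
  the scalar multiplication are equal.\<close>

lemma A_smult: "x \<in> carrier R \<Longrightarrow> k \<odot>\<^bsub>A\<^esub> (I +>\<^bsub>R\<^esub> x) = I +>\<^bsub>R\<^esub> (k \<odot>\<^bsub>R\<^esub> x)"
proof -
  assume x: "x \<in> carrier R"
  have "I +>\<^bsub>R\<^esub> (k \<odot>\<^bsub>R\<^esub> y) = I +>\<^bsub>R\<^esub> (k \<odot>\<^bsub>R\<^esub> x)" if "y \<in> I +>\<^bsub>R\<^esub> x" for y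
    using coset_mem[OF x that] coset_eq_iff[OF R_smult_closed R_smult_closed[OF x], of y k k] by (simp add: R_simps(6))
  then have "(\<Union>y\<in>I +>\<^bsub>R\<^esub> x. I +>\<^bsub>R\<^esub> (k \<odot>\<^bsub>R\<^esub> y)) = (\<Union>y\<in>I +>\<^bsub>R\<^esub> x. I +>\<^bsub>R\<^esub> (k \<odot>\<^bsub>R\<^esub> x))"
    by (intro SUP_cong refl)
  moreover have "I +>\<^bsub>R\<^esub> x \<noteq> {}" using I.a_rcos_self[OF x] by (metis empty_iff)
  moreover have "k \<odot>\<^bsub>A\<^esub> (I +>\<^bsub>R\<^esub> x) = (\<Union>y\<in>I +>\<^bsub>R\<^esub> x. I +>\<^bsub>R\<^esub> (k \<odot>\<^bsub>R\<^esub> y))"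
    unfolding quotient_algebra_def module.simps ..
  ultimately show ?thesis by (simp only: UN_constant if_False)
qed

lemma coord_algebra_A: "coord_algebra Q X A coord"
proof (intro coord_algebra.intro[OF path_basis_X] coord_algebra_axioms.intro)
  note one = I.one_closed and zero = I.zero_closed
  show "inj_on coord (carrier A)"
  proof (rule inj_onI)
    fix a b assume ab: "a \<in> carrier A" "b \<in> carrier A" "coord a = coord b"
    obtain x y where xy: "x \<in> carrier R" "y \<in> carrier R" "a = I +>\<^bsub>R\<^esub> x" "b = I +>\<^bsub>R\<^esub> y"
      using ab by (auto simp: A_simps(1))
    have "x p = y p" if "p \<in> X" for p
      using fun_cong[OF ab(3), of p] that xy by (simp add: coord_coset)
    then show "a = b" unfolding xy(3,4) coset_eq_iff[OF xy(1,2)] by blast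
  qed
  show "coord ` carrier A = {\<phi>. \<forall>p. \<phi> p \<noteq> 0 \<longrightarrow> p \<in> X}"
  proof (intro equalityI subsetI)
    fix \<phi> assume "\<phi> \<in> coord ` carrier A"
    then show "\<phi> \<in> {\<phi>. \<forall>p. \<phi> p \<noteq> 0 \<longrightarrow> p \<in> X}" by (auto simp: coord_def split: if_splits)
  next
    fix \<phi> :: "('v,'e) qpath \<Rightarrow> 'k" assume \<phi>: "\<phi> \<in> {\<phi>. \<forall>p. \<phi> p \<noteq> 0 \<longrightarrow> p \<in> X}"
    have c: "\<phi> \<in> carrier R"
      using \<phi> X_subset finite_subset[OF _ finite_X, of "{p. \<phi> p \<noteq> 0}"] by (auto simp: R_simps)
    have "coord (I +>\<^bsub>R\<^esub> \<phi>) = \<phi>" using \<phi> by (auto simp: coord_coset[OF c] fun_eq_iff)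
    then show "\<phi> \<in> coord ` carrier A" using c by (force simp: A_simps(1))
  qed
  show "a \<otimes>\<^bsub>A\<^esub> b \<in> carrier A" "a \<oplus>\<^bsub>A\<^esub> b \<in> carrier A" if a: "a \<in> carrier A" "b \<in> carrier A" for a b
    using that by (auto simp: A_simps(1)) (auto simp: A_simps(2,3) intro: I.m_closed I.a_closed)
  show "k \<odot>\<^bsub>A\<^esub> a \<in> carrier A" if a: "a \<in> carrier A" for a k
    using that by (auto simp: A_simps(1)) (auto simp: A_smult intro: R_smult_closed)
  show "\<one>\<^bsub>A\<^esub> \<in> carrier A" "\<zero>\<^bsub>A\<^esub> \<in> carrier A" unfolding A_simps(1,4) A_zero using one zero by auto
  show "coord \<one>\<^bsub>A\<^esub> = unit_coef"
    unfolding A_simps(4)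
  proof
    fix p
    have "p \<in> X \<Longrightarrow> p \<in> {(v, [], v) |v. v \<in> verts Q} \<longleftrightarrow> parcs p = []"
      using X_subset by (cases p) (auto simp: qpaths_def awalk_Nil_iff)
    then show "coord (I +>\<^bsub>R\<^esub> \<one>\<^bsub>R\<^esub>) p = unit_coef p" unfolding coord_coset[OF one] unfolding R_simps(3) unit_coef_def by (cases "p \<in> X") auto
  qed
  show "coord \<zero>\<^bsub>A\<^esub> = (\<lambda>_. 0)" unfolding A_zero by (rule ext) (unfold coord_coset[OF zero], simp add: R_simps(4))
  show "coord (k \<odot>\<^bsub>A\<^esub> a) = (\<lambda>p. k * coord a p)" if a: "a \<in> carrier A" for a k
  proof
    fix p
    obtain x where x: "x \<in> carrier R" "a = I +>\<^bsub>R\<^esub> x" using a by (auto simp: A_simps(1))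
    show "coord (k \<odot>\<^bsub>A\<^esub> a) p = k * coord a p"
      unfolding x(2) A_smult[OF x(1)] coord_coset[OF x(1)] coord_coset[OF R_smult_closed[OF x(1)]]
      by (simp add: R_simps(6))
  qed
  show "coord (a \<oplus>\<^bsub>A\<^esub> b) = (\<lambda>p. coord a p + coord b p)" if a: "a \<in> carrier A" "b \<in> carrier A" for a b
  proof -
    obtain x y where xy: "x \<in> carrier R" "y \<in> carrier R" "a = I +>\<^bsub>R\<^esub> x" "b = I +>\<^bsub>R\<^esub> y" using a by (auto simp: A_simps(1))
    show ?thesis
      unfolding xy(3,4) A_simps(3)[OF xy(1,2)]
    proof
      fix p
      show "coord (I +>\<^bsub>R\<^esub> (x \<oplus>\<^bsub>R\<^esub> y)) p = coord (I +>\<^bsub>R\<^esub> x) p + coord (I +>\<^bsub>R\<^esub> y) p"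
        unfolding coord_coset[OF xy(1)] coord_coset[OF xy(2)] coord_coset[OF I.a_closed[OF xy(1,2)]]
        by (simp add: R_simps(5))
    qed
  qed
  show "coord (a \<otimes>\<^bsub>A\<^esub> b) = conv (coord a) (coord b)" if a: "a \<in> carrier A" "b \<in> carrier A" for a b
  proof
    fix p
    obtain x y where xy: "x \<in> carrier R" "y \<in> carrier R" "a = I +>\<^bsub>R\<^esub> x" "b = I +>\<^bsub>R\<^esub> y" using a by (auto simp: A_simps(1))
    show "coord (a \<otimes>\<^bsub>A\<^esub> b) p = conv (coord a) (coord b) p"
    proof (cases "p \<in> X")
      case True
      \<comment> \<open>The product in the path algebra sums over all factorizations of
        \<open>p\<close>. As \<open>p\<close> lies in \<open>X\<close>, so do both factors, and the
        sum is the one in \<open>conv\<close>.\<close>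
      have S: "{(u, v). u \<in> qpaths Q \<and> v \<in> qpaths Q \<and> composes u v p} = {z \<in> X \<times> X. ptgt (fst z) = psrc (snd z) \<and> pmul (fst z) (snd z) = p}"
        using factor True X_subset by (auto simp: composes_pmul)
      have "coord (a \<otimes>\<^bsub>A\<^esub> b) p = (\<Sum>z\<in>{z \<in> X \<times> X. ptgt (fst z) = psrc (snd z) \<and> pmul (fst z) (snd z) = p}. x (fst z) * y (snd z))"
        unfolding xy(3,4) A_simps(2)[OF xy(1,2)] coord_coset[OF I.m_closed[OF xy(1,2)]]
        using True by (simp only: R_simps(2) S if_True) (auto intro!: sum.cong)
      also have "\<dots> = (\<Sum>z\<in>X \<times> X. if ptgt (fst z) = psrc (snd z) \<and> pmul (fst z) (snd z) = p then x (fst z) * y (snd z) else 0)"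
        using finite_X by (intro sum.inter_filter) auto
      also have "\<dots> = (\<Sum>u\<in>X. \<Sum>v\<in>X. if ptgt u = psrc v \<and> pmul u v = p then x u * y v else 0)"
        by (simp add: sum.cartesian_product case_prod_beta)
      also have "\<dots> = conv (coord a) (coord b) p"
        unfolding conv_def using True xy by (auto simp: coord_coset intro!: sum.cong)
      finally show ?thesis .
    next
      case False
      then show ?thesis by (simp add: coord_def conv_outside)
    qed
  qed
qed

end

lemma awalk_two_arcs:
  assumes "wf_digraph Q" "pre_digraph.awalk Q u [a, b] w"
  shows "a \<in> arcs Q" "b \<in> arcs Q" "u = tail Q a" "w = head Q b"
proof -
  interpret wf_digraph Q by fact
  show "a \<in> arcs Q" "b \<in> arcs Q" "u = tail Q a" "w = head Q b" using assms(2) by (auto simp: awalk_simps)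
qed

lemma string_algebra_quiver_algebra:
  fixes Q :: "('v,'e) pre_digraph" and I :: "(('v,'e) qpath \<Rightarrow> 'k::field) set"
  assumes s: "string_presentation Q I" and t: "triangular Q"
  shows "string_algebra Q (quiver_quotient.X Q I) (quiver_algebra Q I) (quiver_quotient.coord Q I)"
proof -
  interpret fin_digraph Q using s by (simp add: string_presentation_def)
  interpret quiver_quotient Q I
    using s t
    by (intro quiver_quotient.intro quiver_quotient_axioms.intro)
       (auto simp: string_presentation_def admissible_ideal_def)
  have pair: "nonzero_pair Q I a b \<and> a \<in> arcs Q \<and> b \<in> arcs Q" if "(u, [a, b], w) \<in> X" for u a b w
  proof -
    have q: "(u, [a, b], w) \<in> qpaths Q" "(path_elem (u, [a, b], w) :: _ \<Rightarrow> 'k) \<notin> I" using that by (simp_all add: X_def)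
    have "pre_digraph.awalk Q u [a, b] w" using q(1) by (simp add: qpaths_def)
    note a = awalk_two_arcs[OF wf_digraph_axioms this]
    show ?thesis using q a(1,2) unfolding nonzero_pair_def a(3,4) by blast
  qed
  have u: "\<exists>\<^sub>\<le>\<^sub>1\<beta>. nonzero_pair Q I \<alpha> \<beta>" "\<exists>\<^sub>\<le>\<^sub>1\<gamma>. nonzero_pair Q I \<gamma> \<alpha>" if "\<alpha> \<in> arcs Q" for \<alpha>
    using s that by (simp_all add: string_presentation_def)
  have "string_basis Q X"
  proof (intro string_basis.intro[OF path_basis_X] string_basis_axioms.intro)
    show "(u, p, u) \<in> qpaths Q \<Longrightarrow> p = []" for u p
      using t by (auto simp: qpaths_def triangular_def)
    show "b = b'" if "(u, [a, b], w) \<in> X" "(u', [a, b'], w') \<in> X" for u a b w u' b' w'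
      using u(1)[of a] pair[OF that(1)] pair[OF that(2)] by (auto dest: Uniq_D)
    show "b = b'" if "(u, [b, a], w) \<in> X" "(u', [b', a], w') \<in> X" for u a b w u' b' w'
      using u(2)[of a] pair[OF that(1)] pair[OF that(2)] by (auto dest: Uniq_D)
  qed
  then show ?thesis by (intro string_algebra.intro coord_algebra_A)
qed

theorem theorem5p2:
  fixes Q :: "('v,'e) pre_digraph"
    and I :: "(('v,'e) qpath \<Rightarrow> 'k::alg_closed_field) set"
    and P :: "nat \<Rightarrow> ((('v,'e) qpath \<Rightarrow> 'k) set, 'p) bimod"
    and d :: "nat \<Rightarrow> 'p \<Rightarrow> 'p"
    and \<epsilon> :: "'p \<Rightarrow> (('v,'e) qpath \<Rightarrow> 'k) set"
    and n m :: nat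
  assumes "string_presentation Q I"
    and "triangular Q"
    and "projective_resolution (quiver_algebra Q I) (regular_bimodule (quiver_algebra Q I)) P d \<epsilon>"
    and "n > 0" and "m > 0"
  shows "\<forall>x \<in> carrier (HH (quiver_algebra Q I) P d n). \<forall>y \<in> carrier (HH (quiver_algebra Q I) P d m).
    cup (quiver_algebra Q I) P d \<epsilon> n m x y = \<one>\<^bsub>HH (quiver_algebra Q I) P d (n + m)\<^esub>"
  using string_algebra.cup_eq_one[OF string_algebra_quiver_algebra[OF assms(1,2)] infinite_alg_closed assms(3-5)]
  by blast

end
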